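(* Let $R$ be a field, let $X$ be a precubical set in $Cub$ and let $X^1$, $X^2$ be two sub-precubical sets of $X$ such that $(X^1,X^2)$ is a good cover of $X$ and such that $(X,X^1)$ and $(X,X^2)$ are relative pairs. Then there is a long exact sequence of $R[X]$-bimodules $$\cdots\to {}^XHM_{i+1}[X^1]\oplus{}^XHM_{i+1}[X^2]\to HM_{i+1}[X]\xrightarrow{\partial_*}{}^XHM_i[X^1\cap X^2]\to{}^XHM_i[X^1]\oplus{}^XHM_i[X^2]\to HM_i[X]\xrightarrow{\partial_*}\cdots$$ $$\cdots\to{}^XHM_1[X^1]\oplus{}^XHM_1[X^2]\to HM_1[X]\to0 .$$
   Context: $R$ is a field. A precubical set $X$ is a graded set $(X_n)_{n\in\mathbb N}$ with maps $d^0_i,d^1_i:X_n\to X_{n-1}$ ($0\le i\le n-1$) such that $d^k_i d^l_j=d^l_{j-1}d^k_i$ for $i<j$, $k,l\in\{0,1\}$. For $I=\{i_1<\dots<i_k\}$ put $d^\epsilon_I=d^\epsilon_{i_1}\circ\dots\circ d^\epsilon_{i_k}$; for an $n$-cube $c$ put $d^\epsilon(c)=d^\epsilon_{\{0,\dots,n-1\}}(c)\in X_0$. A finite precubical set $X$ is in $Cub$ if its non-looping length covering $\tilde X$ ($\tilde X_n=X_n\times\mathbb Z$, $d^\epsilon_i(c,k)=(d^\epsilon_i(c),k+\epsilon)$) is proper, i.e. the map $c\mapsto\{d^0(c),d^1(c)\}$ on its cubes is injective. A cube chain from $v$ to $w$ is a sequence $c=(c_1,\dots,c_l)$, $l\ge0$,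 $c_k\in X_{n_k}$, $n_k>0$, with either $l=0$ and $v=w$, or $d^0(c_1)=v$, $d^1(c_l)=w$ and $d^1(c_k)=d^0(c_{k+1})$. Its dimension is $n_1+\dots+n_l-l$; an $m$-cube chain is a cube chain of dimension $m$, and $Ch^{=m}(X)$ is the set of $m$-cube chains. The path algebra $R[X]$ has as $R$-basis $Ch^{=0}(X)$ (directed paths, including constant paths $e_v$), with product the concatenation if defined and $0$ otherwise. For $i\ge1$, $R_i[X]$ is the $R$-vector space with basis $Ch^{=i-1}(X)$, an $R[X]$-bimodule via concatenation: $p\bullet r\bullet q$ is the concatenation if endpoints match, $0$ otherwise. The boundary $\partial:R_{i+1}[X]\to R_i[X]$ ($i\ge1$) is $$\partial c=\sum_{k=1}^l\sum_{r=1}^{n_k-1}\sum_{I\subseteq\{0,\dots,n_k-1\},|I|=r}(-1)^{n_1+\dots+n_{k-1}+k+r+1}\mathrm{sgn}(I)\,d_{k,I}(c),$$ with $d_{k,I}(c)=(c_1,\dots,c_{k-1},d^0_{\overline I}(c_k),d^1_I(c_k),c_{k+1},\dots,c_l)$, $\overline I=\{0,\dots,n_k-1\}\setminus I$, and $\mathrm{sgn}(I)=1$ if $\sum_{j\in I}(j+1)\equiv\sum_{j=1}^r j \bmod 2$, $-1$ otherwise; $\partial=0$ on $R_1[X]$. For $i\ge1$, $HM_i[X]=\mathrm{Ker}\,\partial_{|R_i[X]}/\mathrm{Im}\,\partial_{|R_{i+1}[X]}$, an $R[X]$-bimodule. Relative pair: for $X\in Cub$ and $Y$ a sub-precubical set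 of $X$, $(X,Y)$ is a relative pair if for all $c=(c_1,\dots,c_m)\in Ch^{=0}(X)$: if $d^0(c_1)\in Y_0$, there exists $k\in\{1,\dots,m\}$ such that $c_l\notin Y$ for all $l>k$ and $c_l\in Y$ for all $l<k$; and if $d^1(c_m)\in Y_0$, there exists $k\in\{1,\dots,m\}$ such that $c_l\in Y$ for all $l>k$ and $c_l\notin Y$ for all $l<k$. Good cover: a pair $(X^1,X^2)$ of sub-precubical sets with $X=X^1\cup X^2$ is a good cover of $X$ if for every $i$ and every $i$-cube chain $c=(c_1,\dots,c_k)$ of $X$ there exist indices $l<m$ ($0\le l$, $m\le k+1$) such that $c_1,\dots,c_l$ and $c_m,\dots,c_k$ are $1$-cells of $X$ and either $c_j\in X^1$ for all $l<j<m$, or $c_j\in X^2$ for all $l<j<m$. (Here $X_1$ denotes the set of $1$-cells, while $X^1,X^2$ are the sub-precubical sets.) Extension of scalars: for $Y\subseteq X$ and an $R[Y]$-bimodule $M$, ${}^XM=R[X]\otimes_{R[Y]}M\otimes_{R[Y]}R[X]$, with $R[X]$ an $R[Y]$-bimodule through the inclusion $R[Y]\to R[X]$, and with the evident $R[X]$-bimodule structure. *)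

theory Defs
  imports "HOL-Algebra.Module" "HOL-Algebra.AbelCoset" "HOL-Algebra.Generated_Groups"
    "HOL-Library.Poly_Mapping"
begin

section \<open>Precubical sets\<close>

text \<open>
  A superscript in \<open>{0, 1}\<close> is a Boolean (\<open>False\<close> for \<open>0\<close>). The
  face map carries the dimension \<open>n\<close> of its argument, \<open>face X \<epsilon> n i\<close> being
  the map from \<open>n\<close>-cubes to \<open>(n - 1)\<close>-cubes, so that the sets \<open>cells X n\<close> need not be disjoint;
  its values outside \<open>cells X n\<close> are irrelevant.
\<close>

record 'c precubical =
  cells :: "nat \<Rightarrow> 'c set"
  face :: "bool \<Rightarrow> nat \<Rightarrow> nat \<Rightarrow> 'c \<Rightarrow> 'c"

definition precubical :: "'c precubical \<Rightarrow> bool" where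
  "precubical X \<longleftrightarrow>
     (\<forall>\<epsilon> n i c. i < n \<and> c \<in> cells X n \<longrightarrow> face X \<epsilon> n i c \<in> cells X (n - 1)) \<and>
     (\<forall>k l n i j c. i < j \<and> j < n \<and> c \<in> cells X n \<longrightarrow>
        face X k (n - 1) i (face X l n j c) = face X l (n - 1) (j - 1) (face X k n i c))"

text \<open>For an increasing list \<open>[i\<^sub>1, \<dots>, i\<^sub>k]\<close>, the composite of the faces in
  directions \<open>i\<^sub>1, \<dots>, i\<^sub>k\<close> on an \<open>n\<close>-cube; the last direction is applied first.\<close>

primrec face_list :: "'c precubical \<Rightarrow> bool \<Rightarrow> nat \<Rightarrow> nat list \<Rightarrow> 'c \<Rightarrow> 'c" where
  "face_list X \<epsilon> n [] c = c"
| "face_list X \<epsilon> n (i # is) c = face X \<epsilon> (n - length is) i (face_list X \<epsilon> n is c)"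

definition face_set :: "'c precubical \<Rightarrow> bool \<Rightarrow> nat \<Rightarrow> nat set \<Rightarrow> 'c \<Rightarrow> 'c" where
  "face_set X \<epsilon> n I = face_list X \<epsilon> n (sorted_list_of_set I)"

text \<open>From here on a cube is a pair \<open>(n, c)\<close> of a dimension and an element of \<open>cells X n\<close>.\<close>

definition cubes :: "'c precubical \<Rightarrow> (nat \<times> 'c) set" where
  "cubes X = (SIGMA n:UNIV. cells X n)"

definition vertex :: "'c precubical \<Rightarrow> bool \<Rightarrow> nat \<times> 'c \<Rightarrow> 'c" where
  "vertex X \<epsilon> = (\<lambda>(n, c). face_set X \<epsilon> n {0..<n} c)"

definition length_covering :: "'c precubical \<Rightarrow> ('c \<times> int) precubical" where
  "length_covering X =
     \<lparr>cells = (\<lambda>n. cells X n \<times> UNIV),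
      face = (\<lambda>\<epsilon> n i (c, k). (face X \<epsilon> n i c, k + of_bool \<epsilon>))\<rparr>"

definition proper :: "'c precubical \<Rightarrow> bool" where
  "proper X \<longleftrightarrow> inj_on (\<lambda>c. {vertex X False c, vertex X True c}) (cubes X)"

definition in_Cub :: "'c precubical \<Rightarrow> bool" where
  "in_Cub X \<longleftrightarrow> precubical X \<and> finite (cubes X) \<and> proper (length_covering X)"

definition sub_precubical :: "'c precubical \<Rightarrow> 'c precubical \<Rightarrow> bool" where
  "sub_precubical Y X \<longleftrightarrow> precubical Y \<and> (\<forall>n. cells Y n \<subseteq> cells X n) \<and>
     (\<forall>\<epsilon> n i. \<forall>c\<in>cells Y n. i < n \<longrightarrow> face Y \<epsilon> n i c = face X \<epsilon> n i c)"

text \<open>Only meant for two sub-precubical sets of the same precubical set, where the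
  face maps agree on the intersection.\<close>

definition precubical_inter :: "'c precubical \<Rightarrow> 'c precubical \<Rightarrow> 'c precubical" where
  "precubical_inter Y Z = \<lparr>cells = (\<lambda>n. cells Y n \<inter> cells Z n), face = face Y\<rparr>"


section \<open>Cube chains\<close>

text \<open>A cube chain is stored together with its end points \<open>v\<close> and \<open>w\<close>;
  they are determined by the cubes unless the sequence of cubes is empty.\<close>

type_synonym 'c chain = "'c \<times> (nat \<times> 'c) list \<times> 'c"

definition cube_chain :: "'c precubical \<Rightarrow> 'c \<Rightarrow> (nat \<times> 'c) list \<Rightarrow> 'c \<Rightarrow> bool" where
  "cube_chain X v cs w \<longleftrightarrow>
     v \<in> cells X 0 \<and> w \<in> cells X 0 \<and>
     (\<forall>c\<in>set cs. c \<in> cubes X \<and> 0 < fst c) \<and>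
     (if cs = [] then v = w
      else vertex X False (hd cs) = v \<and> vertex X True (last cs) = w \<and>
        (\<forall>k. Suc k < length cs \<longrightarrow> vertex X True (cs ! k) = vertex X False (cs ! Suc k)))"

definition chain_dim :: "(nat \<times> 'c) list \<Rightarrow> nat" where
  "chain_dim cs = sum_list (map fst cs) - length cs"

definition Ch :: "'c precubical \<Rightarrow> nat \<Rightarrow> 'c chain set" where
  "Ch X m = {(v, cs, w). cube_chain X v cs w \<and> chain_dim cs = m}"

text \<open>In a nonempty directed path the cubes before (after) some position lie in \<open>Y\<close> and those
  after (before) it do not; positions are counted from \<open>0\<close>. The constant paths are excluded,
  since the conditions refer to the first and the last cube.\<close>

definition relative_pair :: "'c precubical \<Rightarrow> 'c precubical \<Rightarrow> bool" where
  "relative_pair X Y \<longleftrightarrow> in_Cub X \<and> sub_precubical Y X \<and>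
     (\<forall>(v, cs, w)\<in>Ch X 0. cs \<noteq> [] \<longrightarrow>
        (vertex X False (hd cs) \<in> cells Y 0 \<longrightarrow>
           (\<exists>k<length cs. \<forall>l<length cs.
              (l > k \<longrightarrow> cs ! l \<notin> cubes Y) \<and> (l < k \<longrightarrow> cs ! l \<in> cubes Y))) \<and>
        (vertex X True (last cs) \<in> cells Y 0 \<longrightarrow>
           (\<exists>k<length cs. \<forall>l<length cs.
              (l > k \<longrightarrow> cs ! l \<in> cubes Y) \<and> (l < k \<longrightarrow> cs ! l \<notin> cubes Y))))"

text \<open>Here \<open>j\<close> counts the cubes of a chain from \<open>1\<close>.\<close>

definition good_cover :: "'c precubical \<Rightarrow> 'c precubical \<Rightarrow> 'c precubical \<Rightarrow> bool" where
  "good_cover X X1 X2 \<longleftrightarrow>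
     sub_precubical X1 X \<and> sub_precubical X2 X \<and>
     (\<forall>n. cells X n = cells X1 n \<union> cells X2 n) \<and>
     (\<forall>i. \<forall>(v, cs, w)\<in>Ch X i. \<exists>l m. l < m \<and> m \<le> length cs + 1 \<and>
        (\<forall>j. (1 \<le> j \<and> j \<le> l) \<or> (m \<le> j \<and> j \<le> length cs) \<longrightarrow> fst (cs ! (j - 1)) = 1) \<and>
        ((\<forall>j. l < j \<and> j < m \<longrightarrow> cs ! (j - 1) \<in> cubes X1) \<or>
         (\<forall>j. l < j \<and> j < m \<longrightarrow> cs ! (j - 1) \<in> cubes X2)))"


section \<open>Bimodules\<close>

text \<open>As for \<^typ>\<open>('a, 'b) module\<close>, the multiplication and unit inherited from the record of
  rings play no role. The inherited scalar multiplication \<open>\<odot>\<close> is the left action.\<close>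

record ('a, 'b) bimodule = "('a, 'b) module" +
  rsmult :: "['b, 'a] \<Rightarrow> 'b" (infixl \<open>\<odot>\<^sub>r\<index>\<close> 70)

definition bimodule :: "('a, 'p) ring_scheme \<Rightarrow> ('a, 'q) ring_scheme
    \<Rightarrow> ('a, 'b, 'r) bimodule_scheme \<Rightarrow> bool" where
  "bimodule A B M \<longleftrightarrow> ring A \<and> ring B \<and> abelian_group M \<and>
     (\<forall>a\<in>carrier A. \<forall>x\<in>carrier M. a \<odot>\<^bsub>M\<^esub> x \<in> carrier M) \<and>
     (\<forall>x\<in>carrier M. \<forall>b\<in>carrier B. x \<odot>\<^sub>r\<^bsub>M\<^esub> b \<in> carrier M) \<and>
     (\<forall>a\<in>carrier A. \<forall>a'\<in>carrier A. \<forall>x\<in>carrier M.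
        (a \<oplus>\<^bsub>A\<^esub> a') \<odot>\<^bsub>M\<^esub> x = a \<odot>\<^bsub>M\<^esub> x \<oplus>\<^bsub>M\<^esub> a' \<odot>\<^bsub>M\<^esub> x \<and>
        (a \<otimes>\<^bsub>A\<^esub> a') \<odot>\<^bsub>M\<^esub> x = a \<odot>\<^bsub>M\<^esub> (a' \<odot>\<^bsub>M\<^esub> x)) \<and>
     (\<forall>b\<in>carrier B. \<forall>b'\<in>carrier B. \<forall>x\<in>carrier M.
        x \<odot>\<^sub>r\<^bsub>M\<^esub> (b \<oplus>\<^bsub>B\<^esub> b') = x \<odot>\<^sub>r\<^bsub>M\<^esub> b \<oplus>\<^bsub>M\<^esub> x \<odot>\<^sub>r\<^bsub>M\<^esub> b' \<and>
        x \<odot>\<^sub>r\<^bsub>M\<^esub> (b \<otimes>\<^bsub>B\<^esub> b') = (x \<odot>\<^sub>r\<^bsub>M\<^esub> b) \<odot>\<^sub>r\<^bsub>M\<^esub> b') \<and>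
     (\<forall>a\<in>carrier A. \<forall>x\<in>carrier M. \<forall>y\<in>carrier M.
        a \<odot>\<^bsub>M\<^esub> (x \<oplus>\<^bsub>M\<^esub> y) = a \<odot>\<^bsub>M\<^esub> x \<oplus>\<^bsub>M\<^esub> a \<odot>\<^bsub>M\<^esub> y) \<and>
     (\<forall>b\<in>carrier B. \<forall>x\<in>carrier M. \<forall>y\<in>carrier M.
        (x \<oplus>\<^bsub>M\<^esub> y) \<odot>\<^sub>r\<^bsub>M\<^esub> b = x \<odot>\<^sub>r\<^bsub>M\<^esub> b \<oplus>\<^bsub>M\<^esub> y \<odot>\<^sub>r\<^bsub>M\<^esub> b) \<and>
     (\<forall>a\<in>carrier A. \<forall>b\<in>carrier B. \<forall>x\<in>carrier M.
        (a \<odot>\<^bsub>M\<^esub> x) \<odot>\<^sub>r\<^bsub>M\<^esub> b = a \<odot>\<^bsub>M\<^esub> (x \<odot>\<^sub>r\<^bsub>M\<^esub> b)) \<and>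
     (\<forall>x\<in>carrier M. \<one>\<^bsub>A\<^esub> \<odot>\<^bsub>M\<^esub> x = x \<and> x \<odot>\<^sub>r\<^bsub>M\<^esub> \<one>\<^bsub>B\<^esub> = x)"

definition bimodule_hom :: "('a, 'p) ring_scheme \<Rightarrow> ('a, 'q) ring_scheme
    \<Rightarrow> ('a, 'b, 'r) bimodule_scheme \<Rightarrow> ('a, 'd, 's) bimodule_scheme \<Rightarrow> ('b \<Rightarrow> 'd) \<Rightarrow> bool" where
  "bimodule_hom A B M N f \<longleftrightarrow> bimodule A B M \<and> bimodule A B N \<and>
     f \<in> carrier M \<rightarrow> carrier N \<and>
     (\<forall>x\<in>carrier M. \<forall>y\<in>carrier M. f (x \<oplus>\<^bsub>M\<^esub> y) = f x \<oplus>\<^bsub>N\<^esub> f y) \<and>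
     (\<forall>a\<in>carrier A. \<forall>x\<in>carrier M. f (a \<odot>\<^bsub>M\<^esub> x) = a \<odot>\<^bsub>N\<^esub> f x) \<and>
     (\<forall>b\<in>carrier B. \<forall>x\<in>carrier M. f (x \<odot>\<^sub>r\<^bsub>M\<^esub> b) = f x \<odot>\<^sub>r\<^bsub>N\<^esub> b)"

definition bimodule_exact :: "('a, 'p) ring_scheme \<Rightarrow> ('a, 'q) ring_scheme
    \<Rightarrow> ('a, 'b, 'r) bimodule_scheme \<Rightarrow> ('b \<Rightarrow> 'd) \<Rightarrow> ('a, 'd, 's) bimodule_scheme
    \<Rightarrow> ('d \<Rightarrow> 'e) \<Rightarrow> ('a, 'e, 't) bimodule_scheme \<Rightarrow> bool" where
  "bimodule_exact A B L f M g N \<longleftrightarrow> bimodule_hom A B L M f \<and> bimodule_hom A B M N g \<and>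
     f ` carrier L = {x \<in> carrier M. g x = \<zero>\<^bsub>N\<^esub>}"

definition bimodule_sum ::
    "('a, 'b) bimodule \<Rightarrow> ('a, 'd) bimodule \<Rightarrow> ('a, 'b \<times> 'd) bimodule" where
  "bimodule_sum M N =
     \<lparr>carrier = carrier M \<times> carrier N, mult = undefined, one = undefined,
      zero = (\<zero>\<^bsub>M\<^esub>, \<zero>\<^bsub>N\<^esub>),
      add = (\<lambda>(x, y) (x', y'). (x \<oplus>\<^bsub>M\<^esub> x', y \<oplus>\<^bsub>N\<^esub> y')),
      smult = (\<lambda>a (x, y). (a \<odot>\<^bsub>M\<^esub> x, a \<odot>\<^bsub>N\<^esub> y)),
      rsmult = (\<lambda>(x, y) b. (x \<odot>\<^sub>r\<^bsub>M\<^esub> b, y \<odot>\<^sub>r\<^bsub>N\<^esub> b))\<rparr>"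

text \<open>The set \<open>M/N\<close> of additive cosets, with the structure induced from representatives.\<close>

definition bimodule_quotient :: "('a, 'b) bimodule \<Rightarrow> 'b set \<Rightarrow> ('a, 'b set) bimodule" where
  "bimodule_quotient M N =
     \<lparr>carrier = a_rcosets\<^bsub>M\<^esub> N, mult = undefined, one = undefined,
      zero = N, add = set_add M,
      smult = (\<lambda>a U. \<Union>x\<in>U. N +>\<^bsub>M\<^esub> (a \<odot>\<^bsub>M\<^esub> x)),
      rsmult = (\<lambda>U b. \<Union>x\<in>U. N +>\<^bsub>M\<^esub> (x \<odot>\<^sub>r\<^bsub>M\<^esub> b))\<rparr>"

definition regular_bimodule :: "('a, 'p) ring_scheme \<Rightarrow> ('a, 'a) bimodule" where
  "regular_bimodule A =
     \<lparr>carrier = carrier A, mult = mult A, one = one A, zero = zero A, add = add A,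
      smult = mult A, rsmult = mult A\<rparr>"


subsection \<open>Tensor products\<close>

text \<open>
  The tensor product over \<open>B\<close> of a right module \<open>M\<close> and a left module \<open>N\<close> is the free
  abelian group on \<open>carrier M \<times> carrier N\<close> modulo the additivity and balancing relations. The left
  action of \<open>M\<close> and the right action of \<open>N\<close> (possibly by other rings) induce the actions on it.
  The group \<open>tensor_free M N\<close> only satisfies the bimodule laws after passing to
  the quotient. Unitality of \<open>M\<close> and \<open>N\<close> is not required.
\<close>

definition tensor_free ::
    "('a, 'b) bimodule \<Rightarrow> ('a, 'd) bimodule \<Rightarrow> ('a, 'b \<times> 'd \<Rightarrow>\<^sub>0 int) bimodule" where
  "tensor_free M N =
     \<lparr>carrier = {z. Poly_Mapping.keys z \<subseteq> carrier M \<times> carrier N},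
      mult = undefined, one = undefined, zero = 0, add = (+),
      smult = (\<lambda>a. frag_extend (\<lambda>(x, y). frag_of (a \<odot>\<^bsub>M\<^esub> x, y))),
      rsmult = (\<lambda>z b. frag_extend (\<lambda>(x, y). frag_of (x, y \<odot>\<^sub>r\<^bsub>N\<^esub> b)) z)\<rparr>"

definition tensor_relations :: "('a, 'p) ring_scheme
    \<Rightarrow> ('a, 'b) bimodule \<Rightarrow> ('a, 'd) bimodule \<Rightarrow> ('b \<times> 'd \<Rightarrow>\<^sub>0 int) set" where
  "tensor_relations B M N =
     {frag_of (x \<oplus>\<^bsub>M\<^esub> x', y) - frag_of (x, y) - frag_of (x', y) | x x' y.
        x \<in> carrier M \<and> x' \<in> carrier M \<and> y \<in> carrier N} \<union>
     {frag_of (x, y \<oplus>\<^bsub>N\<^esub> y') - frag_of (x, y) - frag_of (x, y') | x y y'.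
        x \<in> carrier M \<and> y \<in> carrier N \<and> y' \<in> carrier N} \<union>
     {frag_of (x \<odot>\<^sub>r\<^bsub>M\<^esub> b, y) - frag_of (x, b \<odot>\<^bsub>N\<^esub> y) | x b y.
        x \<in> carrier M \<and> b \<in> carrier B \<and> y \<in> carrier N}"

definition tensor :: "('a, 'p) ring_scheme \<Rightarrow> ('a, 'b) bimodule \<Rightarrow> ('a, 'd) bimodule
    \<Rightarrow> ('a, ('b \<times> 'd \<Rightarrow>\<^sub>0 int) set) bimodule" where
  "tensor B M N = bimodule_quotient (tensor_free M N)
     (generate (add_monoid (tensor_free M N)) (tensor_relations B M N))"

type_synonym ('a, 'b) ext = "((('a \<times> 'b \<Rightarrow>\<^sub>0 int) set) \<times> 'a \<Rightarrow>\<^sub>0 int) set"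

text \<open>Extension of scalars from \<open>B\<close> to \<open>A\<close>, for \<open>B\<close> a (not necessarily unital)
  subring of \<open>A\<close> with the same multiplication.\<close>

definition ext_scalars :: "('a, 'p) ring_scheme \<Rightarrow> ('a, 'q) ring_scheme
    \<Rightarrow> ('a, 'b) bimodule \<Rightarrow> ('a, ('a, 'b) ext) bimodule" where
  "ext_scalars A B M = tensor B (tensor B (regular_bimodule A) M) (regular_bimodule A)"


section \<open>The path algebra and homology modules\<close>

text \<open>
  The vector space with basis a set \<open>S\<close> of chains over the field \<open>'r\<close> consists of the finitely
  supported maps \<open>'c chain \<Rightarrow>\<^sub>0 'r\<close> with support in \<open>S\<close>. Scalars are not recorded separately
  below: for finite \<open>X\<close> the path algebra is unital and contains them as the multiples of its unit.
\<close>

definition path_mult :: "('c chain \<Rightarrow>\<^sub>0 'r::field) \<Rightarrow> ('c chain \<Rightarrow>\<^sub>0 'r) \<Rightarrow> ('c chain \<Rightarrow>\<^sub>0 'r)" where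
  "path_mult f g = (\<Sum>(v, cs, w)\<in>Poly_Mapping.keys f. \<Sum>(v', ds, w')\<in>Poly_Mapping.keys g.
     if w = v'
     then Poly_Mapping.single (v, cs @ ds, w')
            (Poly_Mapping.lookup f (v, cs, w) * Poly_Mapping.lookup g (v', ds, w'))
     else 0)"

text \<open>The unit is the sum of the constant paths.\<close>

definition path_algebra :: "'r::field itself \<Rightarrow> 'c precubical \<Rightarrow> ('c chain \<Rightarrow>\<^sub>0 'r) ring" where
  "path_algebra _ X =
     \<lparr>carrier = {f. Poly_Mapping.keys f \<subseteq> Ch X 0}, mult = path_mult,
      one = (\<Sum>v\<in>cells X 0. Poly_Mapping.single (v, [], v) 1), zero = 0, add = (+)\<rparr>"

text \<open>\<open>R\<^sub>i[X]\<close>, for \<open>i \<ge> 1\<close>.\<close>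

definition chain_bimodule :: "'r::field itself \<Rightarrow> 'c precubical \<Rightarrow> nat
    \<Rightarrow> ('c chain \<Rightarrow>\<^sub>0 'r, 'c chain \<Rightarrow>\<^sub>0 'r) bimodule" where
  "chain_bimodule _ X i =
     \<lparr>carrier = {f. Poly_Mapping.keys f \<subseteq> Ch X (i - 1)}, mult = undefined, one = undefined,
      zero = 0, add = (+), smult = path_mult, rsmult = path_mult\<rparr>"

definition sgn_set :: "nat set \<Rightarrow> 'r::field" where
  "sgn_set I = (if (\<Sum>j\<in>I. j + 1) mod 2 = (\<Sum>j=1..card I. j) mod 2 then 1 else -1)"

definition split_cube :: "'c precubical \<Rightarrow> nat \<Rightarrow> nat set \<Rightarrow> (nat \<times> 'c) list \<Rightarrow> (nat \<times> 'c) list" where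
  "split_cube X k I cs = (let (n, c) = cs ! k; J = {0..<n} - I in
     take k cs @ [(card I, face_set X False n J c), (card J, face_set X True n I c)]
       @ drop (Suc k) cs)"

text \<open>The position \<open>k\<close> of a cube in a chain is counted from \<open>0\<close> here, which
  accounts for \<open>k + 1\<close> in the exponent. On \<open>0\<close>-chains the sum is empty.\<close>

definition boundary_chain :: "'c precubical \<Rightarrow> 'c chain \<Rightarrow> ('c chain \<Rightarrow>\<^sub>0 'r::field)" where
  "boundary_chain X = (\<lambda>(v, cs, w).
     \<Sum>k<length cs. let n = fst (cs ! k) in
       \<Sum>r\<in>{1..<n}. \<Sum>I\<in>{I. I \<subseteq> {0..<n} \<and> card I = r}.
         Poly_Mapping.single (v, split_cube X k I cs, w)
           ((-1) ^ (sum_list (map fst (take k cs)) + (k + 1) + r + 1) * sgn_set I))"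

definition boundary :: "'c precubical \<Rightarrow> ('c chain \<Rightarrow>\<^sub>0 'r::field) \<Rightarrow> ('c chain \<Rightarrow>\<^sub>0 'r)" where
  "boundary X f = (\<Sum>p\<in>Poly_Mapping.keys f.
     Poly_Mapping.map (\<lambda>s. Poly_Mapping.lookup f p * s) (boundary_chain X p))"

definition cycle_bimodule :: "'r::field itself \<Rightarrow> 'c precubical \<Rightarrow> nat
    \<Rightarrow> ('c chain \<Rightarrow>\<^sub>0 'r, 'c chain \<Rightarrow>\<^sub>0 'r) bimodule" where
  "cycle_bimodule R X i = (chain_bimodule R X i)
     \<lparr>carrier := {f \<in> carrier (chain_bimodule R X i). boundary X f = 0}\<rparr>"

definition HM :: "'r::field itself \<Rightarrow> 'c precubical \<Rightarrow> nat
    \<Rightarrow> ('c chain \<Rightarrow>\<^sub>0 'r, ('c chain \<Rightarrow>\<^sub>0 'r) set) bimodule" where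
  "HM R X i = bimodule_quotient (cycle_bimodule R X i)
     (boundary X ` carrier (chain_bimodule R X (i + 1)))"

definition extHM :: "'r::field itself \<Rightarrow> 'c precubical \<Rightarrow> 'c precubical \<Rightarrow> nat
    \<Rightarrow> ('c chain \<Rightarrow>\<^sub>0 'r, ('c chain \<Rightarrow>\<^sub>0 'r, ('c chain \<Rightarrow>\<^sub>0 'r) set) ext) bimodule" where
  "extHM R X Y i = ext_scalars (path_algebra R X) (path_algebra R Y) (HM R Y i)"

end

theory Submission
  imports Defs "HOL-Library.Product_Plus"
begin

text \<open>
  Let \<open>Y\<close> be one of \<open>X1\<close>, \<open>X2\<close> and their intersection. Since \<open>(X, Y)\<close> is a relative pair, a
  directed path ending in \<open>Y\<close> factors uniquely as a path without edges in \<open>Y\<close> followed by a path of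
  \<open>Y\<close>, and dually for paths starting in \<open>Y\<close>. (For the intersection: a path that meets it at one
  end lies entirely in \<open>X1\<close> or entirely in \<open>X2\<close>.) Hence the path algebra of \<open>X\<close> is
  projective over that of \<open>Y\<close> on both sides, extension of scalars commutes with homology, and the extended
  homology of \<open>Y\<close> is the homology of the complex of chains of \<open>X\<close> with a marked maximal part
  in \<open>Y\<close> outside of which there are only edges. The theorem becomes the long exact sequence of a short exact
  sequence of complexes whose first two terms are spanned by marked chains. Its exactness is checked on each chain
  \<open>d\<close> of \<open>X\<close> separately: for one of the two pieces \<open>d\<close> has exactly one marking, and for
  the other one the markings of \<open>d\<close> correspond bijectively to those for the intersection. For a
  \<open>d\<close> of positive dimension this is the good cover condition.
\<close>

section \<open>Linear and bilinear extension\<close>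

text \<open>The obstacle is that \<open>extHM\<close> has no evident basis: it is a quotient of a
  free group on pairs whose first entries are again cosets, namely tensors with homology classes. It
  is reached only through a surjection from the cycles of marked chains whose kernel has to be
  identified with the boundaries. Bounding that kernel requires a map in the opposite direction.
  This map depends on chosen representatives and is additive and balanced only modulo boundaries,
  which is why the universal property of the tensor product is stated modulo a subgroup. A second
  difficulty is that the inclusion of R[Y] into R[X] does not preserve units. The unit of R[Y] is an
  idempotent of R[X], and a tensor whose outer factors do not meet Y vanishes because this
  idempotent can be moved across the tensor sign. All terms of the long exact sequence are handled
  through such presentations by cycles, so bimodule laws and diagram chases take place among chains.
  The degree \<open>n\<close> of a complex is the dimension of its cube chains; hence
  \<open>HM\<close> and \<open>extHM\<close> occur with index \<open>Suc n\<close>.\<close>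

definition smul :: "'r::field \<Rightarrow> ('k \<Rightarrow>\<^sub>0 'r) \<Rightarrow> ('k \<Rightarrow>\<^sub>0 'r)" where
  "smul r = Poly_Mapping.map (\<lambda>s. r * s)"

lemma lookup_smul [simp]: "Poly_Mapping.lookup (smul r f) k = r * Poly_Mapping.lookup f k"
  unfolding smul_def by (simp add: Poly_Mapping.map.rep_eq when_def)

lemma smul_simps [simp]:
  "smul r 0 = 0" "smul 0 f = 0" "smul 1 f = f"
  "smul r (smul s f) = smul (r * s) f"
  "smul r (Poly_Mapping.single k s) = Poly_Mapping.single k (r * s)"
  by (rule poly_mapping_eqI; simp add: lookup_single when_def mult.assoc)+

lemma smul_add: "smul r (f + g) = smul r f + smul r g"
  by (rule poly_mapping_eqI) (simp add: lookup_add distrib_left)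

lemma smul_add_left: "smul (r + s) f = smul r f + smul s f"
  by (rule poly_mapping_eqI) (simp add: lookup_add distrib_right)

lemma smul_minus: "smul r (- f) = - smul r f"
  by (rule poly_mapping_eqI) simp

lemma smul_minus_one: "smul (-1) f = - f"
  by (rule poly_mapping_eqI) simp

lemma smul_sum: "smul r (sum f A) = (\<Sum>x\<in>A. smul r (f x))"
  by (induction A rule: infinite_finite_induct) (simp_all add: smul_add)

lemma keys_smul: "Poly_Mapping.keys (smul r f) \<subseteq> Poly_Mapping.keys f"
  by (auto simp: in_keys_iff)

text \<open>The coefficient map \<open>\<kappa>\<close> is the identity or \<^const>\<open>of_int\<close>.\<close>

definition ext_by :: "('s::zero \<Rightarrow> 'r::field) \<Rightarrow> ('k \<Rightarrow> 'm \<Rightarrow>\<^sub>0 'r) \<Rightarrow> ('k \<Rightarrow>\<^sub>0 's) \<Rightarrow> ('m \<Rightarrow>\<^sub>0 'r)" where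
  "ext_by \<kappa> h f = (\<Sum>k\<in>Poly_Mapping.keys f. smul (\<kappa> (Poly_Mapping.lookup f k)) (h k))"

abbreviation "lin \<equiv> ext_by (\<lambda>r. r)"
abbreviation "int_lin \<equiv> ext_by of_int"

lemma ext_by_superset:
  assumes "finite F" "Poly_Mapping.keys f \<subseteq> F" "\<kappa> 0 = 0"
  shows "ext_by \<kappa> h f = (\<Sum>k\<in>F. smul (\<kappa> (Poly_Mapping.lookup f k)) (h k))"
  unfolding ext_by_def
  by (rule sum.mono_neutral_left) (use assms in \<open>auto simp: in_keys_iff\<close>)

lemma ext_by_zero [simp]: "ext_by \<kappa> h 0 = 0"
  by (simp add: ext_by_def)

lemma ext_by_add:
  assumes "\<kappa> 0 = 0" "\<And>r s. \<kappa> (r + s) = \<kappa> r + \<kappa> s"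
  shows "ext_by \<kappa> h (f + g) = ext_by \<kappa> h f + ext_by \<kappa> h (g :: 'k \<Rightarrow>\<^sub>0 's::comm_monoid_add)"
proof -
  let ?F = "Poly_Mapping.keys f \<union> Poly_Mapping.keys g"
  have "ext_by \<kappa> h (f + g) = (\<Sum>k\<in>?F. smul (\<kappa> (Poly_Mapping.lookup (f + g) k)) (h k))"
    by (rule ext_by_superset) (use assms Poly_Mapping.keys_add[of f g] in auto)
  also have "\<dots> = (\<Sum>k\<in>?F. smul (\<kappa> (Poly_Mapping.lookup f k)) (h k))
      + (\<Sum>k\<in>?F. smul (\<kappa> (Poly_Mapping.lookup g k)) (h k))"
    by (simp add: lookup_add assms smul_add_left sum.distrib)
  also have "\<dots> = ext_by \<kappa> h f + ext_by \<kappa> h g"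
    using assms by (simp add: ext_by_superset[of ?F])
  finally show ?thesis .
qed

lemma ext_by_single:
  assumes "\<kappa> 0 = 0"
  shows "ext_by \<kappa> h (Poly_Mapping.single k s) = smul (\<kappa> s) (h k)"
  using assms by (simp add: ext_by_def)

lemmas lin_add = ext_by_add[of "\<lambda>r. r", simplified]
lemmas lin_single [simp] = ext_by_single[of "\<lambda>r. r", simplified]
lemmas int_lin_add = ext_by_add[of of_int, simplified]
lemmas int_lin_single [simp] = ext_by_single[of of_int, simplified]

lemma lin_smul: "lin h (smul r f) = smul r (lin h f)"
proof -
  have "lin h (smul r f) = (\<Sum>k\<in>Poly_Mapping.keys f. smul (Poly_Mapping.lookup (smul r f) k) (h k))"
    by (rule ext_by_superset) (use keys_smul[of r f] in auto)
  then show ?thesis by (simp add: ext_by_def smul_sum)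
qed

lemma lin_minus: "lin h (- f) = - lin h f"
  using lin_smul[of h "-1" f] by (simp add: smul_minus_one)

lemma lin_diff: "lin h (f - g) = lin h f - lin h g"
  using lin_add[of h f "- g"] by (simp add: lin_minus)

lemma lin_sum: "lin h (sum f A) = (\<Sum>x\<in>A. lin h (f x))"
  by (induction A rule: infinite_finite_induct) (simp_all add: lin_add)

lemma int_lin_minus: "int_lin h (- f) = - int_lin h f"
  using int_lin_add[of h f "- f"] by (simp add: eq_neg_iff_add_eq_0 add.commute)

lemma int_lin_diff: "int_lin h (f - g) = int_lin h f - int_lin h g"
  using int_lin_add[of h f "- g"] by (simp add: int_lin_minus)

lemma int_lin_sum: "int_lin h (sum f A) = (\<Sum>x\<in>A. int_lin h (f x))"
  by (induction A rule: infinite_finite_induct) (simp_all add: int_lin_add)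

lemma lin_cong:
  "(\<And>k. k \<in> Poly_Mapping.keys f \<Longrightarrow> g k = h k) \<Longrightarrow> lin g f = lin h f"
  by (simp add: ext_by_def)

lemma lin_single_id: "lin (\<lambda>k. Poly_Mapping.single k 1) f = f"
  by (rule poly_mapping_eqI)
    (simp add: ext_by_def lookup_sum lookup_single when_def in_keys_iff)

lemma lin_lin: "lin g (lin h f) = lin (\<lambda>k. lin g (h k)) f"
  by (simp add: ext_by_def[of _ h] ext_by_def[of _ "\<lambda>k. lin g (h k)"] lin_sum lin_smul)

lemma lin_fun_add: "lin (\<lambda>k. g k + h k) f = lin g f + lin h f"
  by (simp add: ext_by_def smul_add sum.distrib)

lemma lin_fun_smul: "lin (\<lambda>k. smul r (g k)) f = smul r (lin g f)"
  by (simp add: ext_by_def smul_sum mult.commute)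

lemma lin_fun_minus: "lin (\<lambda>k. - g k) f = - lin g f"
  by (simp add: ext_by_def smul_minus sum_negf)

lemma lin_fun_zero [simp]: "lin (\<lambda>k. 0) f = 0"
  by (simp add: ext_by_def)

text \<open>Fubini for finite sums; it allows either argument of \<open>bil\<close> to be expanded
  first.\<close>

lemma lin_swap: "lin (\<lambda>k. lin (\<lambda>l. h k l) g) f = lin (\<lambda>l. lin (\<lambda>k. h k l) f) g"
proof -
  have "lin (\<lambda>k. lin (\<lambda>l. h k l) g) f = (\<Sum>k\<in>Poly_Mapping.keys f. \<Sum>l\<in>Poly_Mapping.keys g.
      smul (Poly_Mapping.lookup f k * Poly_Mapping.lookup g l) (h k l))"
    by (simp add: ext_by_def smul_sum)
  also have "\<dots> = lin (\<lambda>l. lin (\<lambda>k. h k l) f) g"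
    by (subst sum.swap) (simp add: ext_by_def smul_sum mult.commute)
  finally show ?thesis .
qed

lemma keys_lin: "Poly_Mapping.keys (lin h f) \<subseteq> (\<Union>k\<in>Poly_Mapping.keys f. Poly_Mapping.keys (h k))"
  unfolding ext_by_def using keys_smul by (fastforce dest: subsetD[OF keys_sum])

lemma keys_lin_subset:
  "(\<And>k. k \<in> Poly_Mapping.keys f \<Longrightarrow> Poly_Mapping.keys (h k) \<subseteq> S) \<Longrightarrow> Poly_Mapping.keys (lin h f) \<subseteq> S"
  using keys_lin[of h f] by blast

text \<open>The supports stay in \<open>S\<close> throughout the induction, so closure properties
  that hold only on \<open>S\<close> are available in the addition step.\<close>

lemma single_induct [consumes 1, case_names zero single add]:
  fixes f :: "'k \<Rightarrow>\<^sub>0 'r::field"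
  assumes "Poly_Mapping.keys f \<subseteq> S" and "P 0"
    and "\<And>k r. k \<in> S \<Longrightarrow> P (Poly_Mapping.single k r)"
    and "\<And>f g. Poly_Mapping.keys f \<subseteq> S \<Longrightarrow> Poly_Mapping.keys g \<subseteq> S \<Longrightarrow> P f \<Longrightarrow> P g \<Longrightarrow> P (f + g)"
  shows "P f"
proof -
  have "Poly_Mapping.keys (\<Sum>k\<in>F. Poly_Mapping.single k (Poly_Mapping.lookup f k)) \<subseteq> S
      \<and> P (\<Sum>k\<in>F. Poly_Mapping.single k (Poly_Mapping.lookup f k))"
    if "finite F" "F \<subseteq> S" for F
    using that
  proof (induction F)
    case (insert k F)
    let ?s = "Poly_Mapping.single k (Poly_Mapping.lookup f k)"
    let ?t = "\<Sum>k\<in>F. Poly_Mapping.single k (Poly_Mapping.lookup f k)"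
    have s: "Poly_Mapping.keys ?s \<subseteq> S" and t: "Poly_Mapping.keys ?t \<subseteq> S" "P ?t"
      and k: "k \<in> S"
      using insert.prems insert.IH by auto
    have "Poly_Mapping.keys (?s + ?t) \<subseteq> S"
      using Poly_Mapping.keys_add[of ?s ?t] s t by blast
    then show ?case
      using insert.hyps assms(4)[OF s t(1) assms(3)[OF k] t(2)] by simp
  qed (use assms(2) in simp)
  from this[of "Poly_Mapping.keys f"] show ?thesis
    using assms(1) lin_single_id[of f] by (simp add: ext_by_def)
qed

section \<open>Bilinear extension\<close>

definition bil :: "('k \<Rightarrow> 'l \<Rightarrow> 'm \<Rightarrow>\<^sub>0 'r::field) \<Rightarrow> ('k \<Rightarrow>\<^sub>0 'r) \<Rightarrow> ('l \<Rightarrow>\<^sub>0 'r) \<Rightarrow> ('m \<Rightarrow>\<^sub>0 'r)" where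
  "bil m f g = lin (\<lambda>k. lin (m k) g) f"

lemma bil_add_left: "bil m (f + f') g = bil m f g + bil m f' g"
  by (simp add: bil_def lin_add)

lemma bil_add_right: "bil m f (g + g') = bil m f g + bil m f g'"
  by (simp add: bil_def lin_add lin_fun_add)

lemma bil_minus_left: "bil m (- f) g = - bil m f g"
  by (simp add: bil_def lin_minus)

lemma bil_minus_right: "bil m f (- g) = - bil m f g"
  by (simp add: bil_def lin_minus lin_fun_minus)

lemma bil_diff_left: "bil m (f - f') g = bil m f g - bil m f' g"
  by (simp add: bil_def lin_diff)

lemma bil_diff_right: "bil m f (g - g') = bil m f g - bil m f g'"
  using bil_add_right[of m f g "- g'"] by (simp add: bil_minus_right)

lemma bil_zero [simp]: "bil m 0 g = 0" "bil m f 0 = 0"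
  by (simp_all add: bil_def)

lemma bil_sum_left: "bil m (sum f A) g = (\<Sum>x\<in>A. bil m (f x) g)"
  by (simp add: bil_def lin_sum)

lemma bil_sum_right: "bil m f (sum g A) = (\<Sum>x\<in>A. bil m f (g x))"
  by (induction A rule: infinite_finite_induct) (simp_all add: bil_add_right)

lemma bil_single [simp]:
  "bil m (Poly_Mapping.single k r) (Poly_Mapping.single l s) = smul (r * s) (m k l)"
  by (simp add: bil_def)

lemma bil_single_left: "bil m (Poly_Mapping.single k r) g = smul r (lin (m k) g)"
  by (simp add: bil_def)

lemma bil_single_right: "bil m f (Poly_Mapping.single k r) = smul r (lin (\<lambda>l. m l k) f)"
  by (simp add: bil_def lin_fun_smul)

lemma keys_bil_subset:
  assumes "\<And>k l. k \<in> Poly_Mapping.keys f \<Longrightarrow> l \<in> Poly_Mapping.keys g \<Longrightarrow> Poly_Mapping.keys (m k l) \<subseteq> S"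
  shows "Poly_Mapping.keys (bil m f g) \<subseteq> S"
  unfolding bil_def by (intro keys_lin_subset assms)

text \<open>The equivariance statements below follow from this pattern: an identity between basis
  elements propagates through both arguments at once. Taking \<open>u\<close> or \<open>v\<close> to
  be the basis element with coefficient \<open>1\<close> leaves the corresponding argument
  unchanged.\<close>

lemma lin_bil:
  assumes "\<And>k l. k \<in> Poly_Mapping.keys f \<Longrightarrow> l \<in> Poly_Mapping.keys g \<Longrightarrow>
      lin h (m k l) = bil n (u k) (v l)"
  shows "lin h (bil m f g) = bil n (lin u f) (lin v g)"
proof -
  have "lin h (bil m f g) = lin (\<lambda>k. lin (\<lambda>l. bil n (u k) (v l)) g) f"
    unfolding bil_def lin_lin by (intro lin_cong) (use assms in \<open>simp add: bil_def\<close>)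
  also have "\<dots> = lin (\<lambda>k. lin (\<lambda>l. lin (\<lambda>x. lin (n x) (v l)) (u k)) g) f"
    by (simp add: bil_def)
  also have "\<dots> = lin (\<lambda>k. lin (\<lambda>x. lin (\<lambda>l. lin (n x) (v l)) g) (u k)) f"
    by (subst lin_swap) simp
  also have "\<dots> = bil n (lin u f) (lin v g)"
    by (simp add: bil_def lin_lin)
  finally show ?thesis .
qed

text \<open>Four different products are allowed, so that the same criterion gives associativity of
  the path product, the module laws of both actions and the compatibility of the left with the right
  action.\<close>

lemma bil_assoc:
  assumes "\<And>a b c. a \<in> Poly_Mapping.keys f \<Longrightarrow> b \<in> Poly_Mapping.keys g \<Longrightarrow> c \<in> Poly_Mapping.keys h \<Longrightarrow>
      lin (\<lambda>x. m1 x c) (m2 a b) = lin (m3 a) (m4 b c)"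
  shows "bil m1 (bil m2 f g) h = bil m3 f (bil m4 g h)"
proof -
  have "bil m1 (bil m2 f g) h = lin (\<lambda>a. lin (\<lambda>b. lin (\<lambda>x. lin (m1 x) h) (m2 a b)) g) f"
    by (simp add: bil_def lin_lin)
  also have "\<dots> = lin (\<lambda>a. lin (\<lambda>b. lin (\<lambda>c. lin (\<lambda>x. m1 x c) (m2 a b)) h) g) f"
    by (subst (3) lin_swap) simp
  also have "\<dots> = lin (\<lambda>a. lin (\<lambda>b. lin (\<lambda>c. lin (m3 a) (m4 b c)) h) g) f"
    by (intro lin_cong assms)
  also have "\<dots> = bil m3 f (bil m4 g h)"
    by (simp add: bil_def lin_lin)
  finally show ?thesis .
qed

section \<open>Complexes of bimodules and their homology\<close>

text \<open>Subgroups of the ambient type: the addition of every chain module is that of its type,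
  so only membership has to be tracked.\<close>

definition add_subgroup :: "'x::ab_group_add set \<Rightarrow> bool" where
  "add_subgroup I \<longleftrightarrow> 0 \<in> I \<and> (\<forall>x\<in>I. \<forall>y\<in>I. x + y \<in> I) \<and> (\<forall>x\<in>I. - x \<in> I)"

lemma add_subgroupD:
  assumes "add_subgroup I"
  shows "0 \<in> I" "x \<in> I \<Longrightarrow> y \<in> I \<Longrightarrow> x + y \<in> I" "x \<in> I \<Longrightarrow> - x \<in> I"
    "x \<in> I \<Longrightarrow> y \<in> I \<Longrightarrow> x - y \<in> I"
proof -
  show p: "0 \<in> I" "x \<in> I \<Longrightarrow> y \<in> I \<Longrightarrow> x + y \<in> I" "x \<in> I \<Longrightarrow> - x \<in> I" for x y
    using assms by (simp_all add: add_subgroup_def)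
  show "x \<in> I \<Longrightarrow> y \<in> I \<Longrightarrow> x - y \<in> I"
    using p(2)[of x "- y"] p(3)[of y] by simp
qed

lemma add_subgroup_sum:
  assumes "add_subgroup I" "\<And>x. x \<in> F \<Longrightarrow> f x \<in> I"
  shows "sum f F \<in> I"
  using assms(2) by (induction F rule: infinite_finite_induct) (auto intro: add_subgroupD[OF assms(1)])

lemma add_subgroup_keys: "add_subgroup {f :: 'k \<Rightarrow>\<^sub>0 'r::ab_group_add. Poly_Mapping.keys f \<subseteq> S}"
  unfolding add_subgroup_def
  by (auto dest!: subsetD[OF Poly_Mapping.keys_add])

text \<open>Additivity is required on the whole type because the maps are linear extensions; laws
  that rest on properties of basis chains, such as unitality and associativity, are restricted to
  \<open>C n\<close>. By \<open>d_0\<close> every element of degree \<open>0\<close> is a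
  cycle.\<close>

locale bimod_complex =
  fixes A :: "('a, 'p) ring_scheme" and C :: "nat \<Rightarrow> 'x::ab_group_add set"
    and d :: "'x \<Rightarrow> 'x" and l :: "'a \<Rightarrow> 'x \<Rightarrow> 'x" and r :: "'x \<Rightarrow> 'a \<Rightarrow> 'x"
  assumes ring_A: "ring A"
    and C_sub: "add_subgroup (C n)"
    and d_add: "d (x + y) = d x + d y"
    and d_closed: "x \<in> C (Suc n) \<Longrightarrow> d x \<in> C n"
    and d_d: "x \<in> C n \<Longrightarrow> d (d x) = 0"
    and d_0: "x \<in> C 0 \<Longrightarrow> d x = 0"
    and l_closed: "a \<in> carrier A \<Longrightarrow> x \<in> C n \<Longrightarrow> l a x \<in> C n"
    and r_closed: "a \<in> carrier A \<Longrightarrow> x \<in> C n \<Longrightarrow> r x a \<in> C n"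
    and l_add: "l a (x + y) = l a x + l a y"
    and r_add: "r (x + y) a = r x a + r y a"
    and l_add_left: "a \<in> carrier A \<Longrightarrow> a' \<in> carrier A \<Longrightarrow> l (a \<oplus>\<^bsub>A\<^esub> a') x = l a x + l a' x"
    and r_add_right: "a \<in> carrier A \<Longrightarrow> a' \<in> carrier A \<Longrightarrow> r x (a \<oplus>\<^bsub>A\<^esub> a') = r x a + r x a'"
    and l_mult: "a \<in> carrier A \<Longrightarrow> a' \<in> carrier A \<Longrightarrow> x \<in> C n \<Longrightarrow> l (a \<otimes>\<^bsub>A\<^esub> a') x = l a (l a' x)"
    and r_mult: "a \<in> carrier A \<Longrightarrow> a' \<in> carrier A \<Longrightarrow> x \<in> C n \<Longrightarrow> r x (a \<otimes>\<^bsub>A\<^esub> a') = r (r x a) a'"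
    and l_r: "a \<in> carrier A \<Longrightarrow> a' \<in> carrier A \<Longrightarrow> x \<in> C n \<Longrightarrow> r (l a x) a' = l a (r x a')"
    and l_one: "x \<in> C n \<Longrightarrow> l \<one>\<^bsub>A\<^esub> x = x"
    and r_one: "x \<in> C n \<Longrightarrow> r x \<one>\<^bsub>A\<^esub> = x"
    and d_l: "a \<in> carrier A \<Longrightarrow> x \<in> C n \<Longrightarrow> d (l a x) = l a (d x)"
    and d_r: "a \<in> carrier A \<Longrightarrow> x \<in> C n \<Longrightarrow> d (r x a) = r (d x) a"
begin

definition Z :: "nat \<Rightarrow> 'x set" where "Z n = {x \<in> C n. d x = 0}"
definition B :: "nat \<Rightarrow> 'x set" where "B n = d ` C (Suc n)"

lemma d_zero [simp]: "d 0 = 0"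
  using d_add[of 0 0] by simp

lemma l_zero [simp]: "l a 0 = 0"
  using l_add[of a 0 0] by simp

lemma r_zero [simp]: "r 0 a = 0"
  using r_add[of 0 0 a] by simp

lemma d_minus: "d (- x) = - d x"
  using d_add[of "- x" x] by (simp add: eq_neg_iff_add_eq_0)

lemma d_diff: "d (x - y) = d x - d y"
  using d_add[of x "- y"] by (simp add: d_minus)

lemma Z_sub: "add_subgroup (Z n)"
  using C_sub[of n] unfolding add_subgroup_def Z_def by (auto simp: d_add d_minus)

lemma B_sub: "add_subgroup (B n)"
proof -
  note C = add_subgroupD[OF C_sub[of "Suc n"]]
  have "0 \<in> B n" unfolding B_def using imageI[OF C(1), of d] by simp
  moreover have "x + y \<in> B n" if "x \<in> B n" "y \<in> B n" for x y
    using that C(2) unfolding B_def by (auto simp: d_add[symmetric])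
  moreover have "- x \<in> B n" if "x \<in> B n" for x
    using that C(3) unfolding B_def by (auto simp: d_minus[symmetric])
  ultimately show ?thesis by (simp add: add_subgroup_def)
qed

lemma B_Z: "x \<in> B n \<Longrightarrow> x \<in> Z n"
  unfolding B_def Z_def using d_closed d_d by auto

lemma Z_C: "x \<in> Z n \<Longrightarrow> x \<in> C n"
  by (simp add: Z_def)

lemma Z_d: "x \<in> Z n \<Longrightarrow> d x = 0"
  by (simp add: Z_def)

lemma Z_l: "a \<in> carrier A \<Longrightarrow> x \<in> Z n \<Longrightarrow> l a x \<in> Z n"
  unfolding Z_def using d_l[of a x n] by (simp add: l_closed)

lemma Z_r: "a \<in> carrier A \<Longrightarrow> x \<in> Z n \<Longrightarrow> r x a \<in> Z n"
  unfolding Z_def using d_r[of a x n] by (simp add: r_closed)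

lemma B_l: "a \<in> carrier A \<Longrightarrow> x \<in> B n \<Longrightarrow> l a x \<in> B n"
  unfolding B_def using d_l l_closed by (force simp: d_l[symmetric])

lemma B_r: "a \<in> carrier A \<Longrightarrow> x \<in> B n \<Longrightarrow> r x a \<in> B n"
  unfolding B_def using d_r r_closed by (force simp: d_r[symmetric])

end

text \<open>A bimodule \<open>E n\<close> is recognised as the \<open>n\<close>-th homology of a complex by a surjection \<open>S n\<close>
  from the cycles whose kernel consists of the boundaries; the bimodule laws of \<open>E n\<close> follow.\<close>

locale presented_homology = bimod_complex A C d l r
  for A :: "('a, 'p) ring_scheme" and C :: "nat \<Rightarrow> 'x::ab_group_add set"
    and d :: "'x \<Rightarrow> 'x" and l :: "'a \<Rightarrow> 'x \<Rightarrow> 'x" and r :: "'x \<Rightarrow> 'a \<Rightarrow> 'x" +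
  fixes E :: "nat \<Rightarrow> ('a, 'e, 's) bimodule_scheme" and S :: "nat \<Rightarrow> 'x \<Rightarrow> 'e"
  assumes S_add: "x \<in> Z n \<Longrightarrow> y \<in> Z n \<Longrightarrow> S n (x + y) = S n x \<oplus>\<^bsub>E n\<^esub> S n y"
    and S_l: "a \<in> carrier A \<Longrightarrow> x \<in> Z n \<Longrightarrow> S n (l a x) = a \<odot>\<^bsub>E n\<^esub> S n x"
    and S_r: "a \<in> carrier A \<Longrightarrow> x \<in> Z n \<Longrightarrow> S n (r x a) = S n x \<odot>\<^sub>r\<^bsub>E n\<^esub> a"
    and S_surj: "S n ` Z n = carrier (E n)"
    and S_ker: "x \<in> Z n \<Longrightarrow> S n x = \<zero>\<^bsub>E n\<^esub> \<longleftrightarrow> x \<in> B n"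
begin

lemma S_zero: "S n 0 = \<zero>\<^bsub>E n\<^esub>"
  using S_ker[of 0 n] add_subgroupD(1)[OF Z_sub] add_subgroupD(1)[OF B_sub] by blast

lemma S_closed: "x \<in> Z n \<Longrightarrow> S n x \<in> carrier (E n)"
  using S_surj by blast

lemma S_cases:
  assumes "e \<in> carrier (E n)"
  obtains x where "x \<in> Z n" "e = S n x"
  using assms S_surj by (metis imageE)

lemma abelian_group_E: "abelian_group (E n)"
proof (rule abelian_groupI)
  note Z = add_subgroupD[OF Z_sub[of n]]
  show "\<zero>\<^bsub>E n\<^esub> \<in> carrier (E n)"
    using S_closed[OF Z(1)] by (simp add: S_zero)
  fix x y assume "x \<in> carrier (E n)" "y \<in> carrier (E n)"
  then obtain u v where uv: "u \<in> Z n" "x = S n u" "v \<in> Z n" "y = S n v"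
    by (metis S_cases)
  then show "x \<oplus>\<^bsub>E n\<^esub> y \<in> carrier (E n)" "x \<oplus>\<^bsub>E n\<^esub> y = y \<oplus>\<^bsub>E n\<^esub> x" "\<zero>\<^bsub>E n\<^esub> \<oplus>\<^bsub>E n\<^esub> x = x"
    by (metis S_add S_closed Z(2), metis S_add add.commute, metis S_add S_zero Z(1) add_0)
  show "\<exists>y\<in>carrier (E n). y \<oplus>\<^bsub>E n\<^esub> x = \<zero>\<^bsub>E n\<^esub>"
    using uv Z(3)[of u] S_add[of "- u" n u] S_zero S_closed by (metis add.left_inverse)
  fix z assume "z \<in> carrier (E n)"
  then obtain w where w: "w \<in> Z n" "z = S n w" by (metis S_cases)
  have "S n (u + v + w) = (S n u \<oplus>\<^bsub>E n\<^esub> S n v) \<oplus>\<^bsub>E n\<^esub> S n w"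
    using uv w Z(2) by (simp add: S_add)
  moreover have "S n (u + (v + w)) = S n u \<oplus>\<^bsub>E n\<^esub> (S n v \<oplus>\<^bsub>E n\<^esub> S n w)"
    using uv w Z(2) by (simp add: S_add)
  ultimately show "x \<oplus>\<^bsub>E n\<^esub> y \<oplus>\<^bsub>E n\<^esub> z = x \<oplus>\<^bsub>E n\<^esub> (y \<oplus>\<^bsub>E n\<^esub> z)"
    using uv w by (simp add: add.assoc)
qed

text \<open>Every element of \<open>E n\<close> is the class of a cycle, so each law is the image
  under \<open>S n\<close> of the same law for chains.\<close>

lemma bimodule_E: "bimodule A A (E n)"
proof -
  interpret A: ring A by (rule ring_A)
  note Z = add_subgroupD[OF Z_sub[of n]]
  note S = S_add[symmetric] S_l[symmetric] S_r[symmetric]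
  have c: "a \<odot>\<^bsub>E n\<^esub> x \<in> carrier (E n)" "x \<odot>\<^sub>r\<^bsub>E n\<^esub> a \<in> carrier (E n)" "\<one>\<^bsub>A\<^esub> \<odot>\<^bsub>E n\<^esub> x = x" "x \<odot>\<^sub>r\<^bsub>E n\<^esub> \<one>\<^bsub>A\<^esub> = x"
    if *: "a \<in> carrier A" "x \<in> carrier (E n)" for a x
  proof -
    obtain u where u: "u \<in> Z n" "x = S n u" using S_cases[OF *(2)] .
    show "a \<odot>\<^bsub>E n\<^esub> x \<in> carrier (E n)" "x \<odot>\<^sub>r\<^bsub>E n\<^esub> a \<in> carrier (E n)" "\<one>\<^bsub>A\<^esub> \<odot>\<^bsub>E n\<^esub> x = x" "x \<odot>\<^sub>r\<^bsub>E n\<^esub> \<one>\<^bsub>A\<^esub> = x"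
      using u *(1) by (simp_all add: S Z_l Z_r S_closed l_one[OF Z_C] r_one[OF Z_C])
  qed
  have m: "(a \<oplus>\<^bsub>A\<^esub> a') \<odot>\<^bsub>E n\<^esub> x = a \<odot>\<^bsub>E n\<^esub> x \<oplus>\<^bsub>E n\<^esub> a' \<odot>\<^bsub>E n\<^esub> x"
    "(a \<otimes>\<^bsub>A\<^esub> a') \<odot>\<^bsub>E n\<^esub> x = a \<odot>\<^bsub>E n\<^esub> (a' \<odot>\<^bsub>E n\<^esub> x)"
    "x \<odot>\<^sub>r\<^bsub>E n\<^esub> (a \<oplus>\<^bsub>A\<^esub> a') = x \<odot>\<^sub>r\<^bsub>E n\<^esub> a \<oplus>\<^bsub>E n\<^esub> x \<odot>\<^sub>r\<^bsub>E n\<^esub> a'"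
    "x \<odot>\<^sub>r\<^bsub>E n\<^esub> (a \<otimes>\<^bsub>A\<^esub> a') = (x \<odot>\<^sub>r\<^bsub>E n\<^esub> a) \<odot>\<^sub>r\<^bsub>E n\<^esub> a'"
    "(a \<odot>\<^bsub>E n\<^esub> x) \<odot>\<^sub>r\<^bsub>E n\<^esub> a' = a \<odot>\<^bsub>E n\<^esub> (x \<odot>\<^sub>r\<^bsub>E n\<^esub> a')"
    if *: "a \<in> carrier A" "a' \<in> carrier A" "x \<in> carrier (E n)" for a a' x
  proof -
    obtain u where u: "u \<in> Z n" "x = S n u" using S_cases[OF *(3)] .
    show "(a \<oplus>\<^bsub>A\<^esub> a') \<odot>\<^bsub>E n\<^esub> x = a \<odot>\<^bsub>E n\<^esub> x \<oplus>\<^bsub>E n\<^esub> a' \<odot>\<^bsub>E n\<^esub> x"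
      "(a \<otimes>\<^bsub>A\<^esub> a') \<odot>\<^bsub>E n\<^esub> x = a \<odot>\<^bsub>E n\<^esub> (a' \<odot>\<^bsub>E n\<^esub> x)"
      "x \<odot>\<^sub>r\<^bsub>E n\<^esub> (a \<oplus>\<^bsub>A\<^esub> a') = x \<odot>\<^sub>r\<^bsub>E n\<^esub> a \<oplus>\<^bsub>E n\<^esub> x \<odot>\<^sub>r\<^bsub>E n\<^esub> a'"
      "x \<odot>\<^sub>r\<^bsub>E n\<^esub> (a \<otimes>\<^bsub>A\<^esub> a') = (x \<odot>\<^sub>r\<^bsub>E n\<^esub> a) \<odot>\<^sub>r\<^bsub>E n\<^esub> a'"
      "(a \<odot>\<^bsub>E n\<^esub> x) \<odot>\<^sub>r\<^bsub>E n\<^esub> a' = a \<odot>\<^bsub>E n\<^esub> (x \<odot>\<^sub>r\<^bsub>E n\<^esub> a')"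
      using u * by (simp_all add: S Z_l Z_r l_add_left r_add_right l_mult[OF _ _ Z_C]
          r_mult[OF _ _ Z_C] l_r[OF _ _ Z_C])
  qed
  have p: "a \<odot>\<^bsub>E n\<^esub> (x \<oplus>\<^bsub>E n\<^esub> y) = a \<odot>\<^bsub>E n\<^esub> x \<oplus>\<^bsub>E n\<^esub> a \<odot>\<^bsub>E n\<^esub> y"
    "(x \<oplus>\<^bsub>E n\<^esub> y) \<odot>\<^sub>r\<^bsub>E n\<^esub> a = x \<odot>\<^sub>r\<^bsub>E n\<^esub> a \<oplus>\<^bsub>E n\<^esub> y \<odot>\<^sub>r\<^bsub>E n\<^esub> a"
    if *: "a \<in> carrier A" "x \<in> carrier (E n)" "y \<in> carrier (E n)" for a x y
  proof -
    obtain u where u: "u \<in> Z n" "x = S n u" using S_cases[OF *(2)] .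
    obtain v where v: "v \<in> Z n" "y = S n v" using S_cases[OF *(3)] .
    with u show "a \<odot>\<^bsub>E n\<^esub> (x \<oplus>\<^bsub>E n\<^esub> y) = a \<odot>\<^bsub>E n\<^esub> x \<oplus>\<^bsub>E n\<^esub> a \<odot>\<^bsub>E n\<^esub> y"
      "(x \<oplus>\<^bsub>E n\<^esub> y) \<odot>\<^sub>r\<^bsub>E n\<^esub> a = x \<odot>\<^sub>r\<^bsub>E n\<^esub> a \<oplus>\<^bsub>E n\<^esub> y \<odot>\<^sub>r\<^bsub>E n\<^esub> a"
      using * by (simp_all add: S Z_l Z_r Z l_add r_add)
  qed
  show ?thesis
    unfolding bimodule_def
    by (intro conjI ballI ring_A abelian_group_E c(1,2) c(3,4)[OF A.one_closed] m p; assumption)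
qed

lemma S_eq: "x \<in> Z n \<Longrightarrow> y \<in> Z n \<Longrightarrow> S n x = S n y \<longleftrightarrow> x - y \<in> B n"
proof -
  assume xy: "x \<in> Z n" "y \<in> Z n"
  interpret E: abelian_group "E n" by (rule abelian_group_E)
  have "S n x = S n (x - y) \<oplus>\<^bsub>E n\<^esub> S n y"
    using xy S_add[of "x - y" n y] add_subgroupD(4)[OF Z_sub] by simp
  then have "S n x = S n y \<longleftrightarrow> S n (x - y) = \<zero>\<^bsub>E n\<^esub>"
    using xy S_closed add_subgroupD(4)[OF Z_sub]
    by (metis E.add.r_cancel_one)
  then show ?thesis
    using xy S_ker add_subgroupD(4)[OF Z_sub] by blast
qed

end

text \<open>A relation takes the place of a chain map because the connecting homomorphism involves
  the choice of a lift and is not a function on cycles. Totality and preservation of boundaries make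
  the class of a partner of \<open>x\<close> depend only on the class of \<open>x\<close>. The
  degrees \<open>m\<close> and \<open>n\<close> may differ, as they do for the connecting
  homomorphism.\<close>

lemma induced_hom:
  assumes "presented_homology A C1 d1 l1 r1 E1 S1" and "presented_homology A C2 d2 l2 r2 E2 S2"
    and Z1: "Z1 = bimod_complex.Z C1 d1 m" and Z2: "Z2 = bimod_complex.Z C2 d2 n"
    and rel: "rel \<subseteq> Z1 \<times> Z2"
    and total: "\<And>x. x \<in> Z1 \<Longrightarrow> \<exists>y. (x, y) \<in> rel"
    and add: "\<And>x y x' y'. (x, y) \<in> rel \<Longrightarrow> (x', y') \<in> rel \<Longrightarrow> (x + x', y + y') \<in> rel"
    and l: "\<And>a x y. a \<in> carrier A \<Longrightarrow> (x, y) \<in> rel \<Longrightarrow> (l1 a x, l2 a y) \<in> rel"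
    and r: "\<And>a x y. a \<in> carrier A \<Longrightarrow> (x, y) \<in> rel \<Longrightarrow> (r1 x a, r2 y a) \<in> rel"
    and B: "\<And>x y. (x, y) \<in> rel \<Longrightarrow> x \<in> bimod_complex.B C1 d1 m \<Longrightarrow> y \<in> bimod_complex.B C2 d2 n"
  shows "\<exists>\<phi>. bimodule_hom A A (E1 m) (E2 n) \<phi> \<and> (\<forall>(x, y)\<in>rel. \<phi> (S1 m x) = S2 n y)"
proof -
  interpret P1: presented_homology A C1 d1 l1 r1 E1 S1 by fact
  interpret P2: presented_homology A C2 d2 l2 r2 E2 S2 by fact
  note Z1 = Z1[folded P1.Z_def] and Z2 = Z2[folded P2.Z_def]
  define \<phi> where "\<phi> e = S2 n (SOME y. \<exists>x. (x, y) \<in> rel \<and> S1 m x = e)" for e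
  have \<phi>: "\<phi> (S1 m x) = S2 n y" if "(x, y) \<in> rel" for x y
  proof -
    have "\<exists>y x'. (x', y) \<in> rel \<and> S1 m x' = S1 m x" using that by blast
    from someI_ex[OF this] obtain x' where
      x': "(x', SOME y. \<exists>x'. (x', y) \<in> rel \<and> S1 m x' = S1 m x) \<in> rel" (is "(x', ?y) \<in> _") "S1 m x' = S1 m x"
      by blast
    have mem: "x \<in> P1.Z m" "x' \<in> P1.Z m" "y \<in> P2.Z n" "?y \<in> P2.Z n"
      using rel x' that Z1 Z2 by auto
    then have "- x \<in> Z1" using Z1 add_subgroupD(3)[OF P1.Z_sub] by blast
    \<comment> \<open>\<open>rel\<close> is only known to be closed under sums. Adding a partner of
      \<open>- x\<close> to both pairs turns their first components into boundaries, so the second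
      components agree up to a boundary.\<close>
    then obtain w where w: "(- x, w) \<in> rel" using total by blast
    then have wZ: "w \<in> P2.Z n" using rel Z2 by auto
    have "(x' + - x, ?y + w) \<in> rel" using add[OF x'(1) w] .
    moreover have "x' + - x \<in> P1.B m" using P1.S_eq mem x'(2) by simp
    ultimately have b1: "?y + w \<in> P2.B n" using B by blast
    have "(x + - x, y + w) \<in> rel" using add[OF that w] .
    moreover have "x + - x \<in> P1.B m" using add_subgroupD(1)[OF P1.B_sub] by simp
    ultimately have "y + w \<in> P2.B n" using B by blast
    with b1 have "(?y + w) - (y + w) \<in> P2.B n" using add_subgroupD(4)[OF P2.B_sub] by blast
    then have "S2 n ?y = S2 n y" using P2.S_eq mem by simp
    then show ?thesis by (simp add: \<phi>_def)
  qed
  have ex: "\<exists>x y. e = S1 m x \<and> (x, y) \<in> rel \<and> x \<in> P1.Z m \<and> y \<in> P2.Z n" if "e \<in> carrier (E1 m)" for e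
    using that total rel Z1 Z2 by (metis P1.S_cases mem_Sigma_iff subset_iff)
  have "bimodule_hom A A (E1 m) (E2 n) \<phi>"
    unfolding bimodule_hom_def
  proof (intro conjI ballI P1.bimodule_E P2.bimodule_E)
    show "\<phi> \<in> carrier (E1 m) \<rightarrow> carrier (E2 n)"
      using ex \<phi> P2.S_closed by (metis Pi_I)
  next
    fix e e' assume "e \<in> carrier (E1 m)" "e' \<in> carrier (E1 m)"
    then obtain x y x' y' where xy: "e = S1 m x" "(x, y) \<in> rel" "x \<in> P1.Z m" "y \<in> P2.Z n"
      "e' = S1 m x'" "(x', y') \<in> rel" "x' \<in> P1.Z m" "y' \<in> P2.Z n"
      using ex by meson
    then show "\<phi> (e \<oplus>\<^bsub>E1 m\<^esub> e') = \<phi> e \<oplus>\<^bsub>E2 n\<^esub> \<phi> e'"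
      using \<phi>[OF add[OF xy(2,6)]] by (simp add: P1.S_add P2.S_add \<phi>)
  next
    fix a e assume a: "a \<in> carrier A" and "e \<in> carrier (E1 m)"
    then obtain x y where xy: "e = S1 m x" "(x, y) \<in> rel" "x \<in> P1.Z m" "y \<in> P2.Z n"
      using ex by meson
    then show "\<phi> (a \<odot>\<^bsub>E1 m\<^esub> e) = a \<odot>\<^bsub>E2 n\<^esub> \<phi> e" "\<phi> (e \<odot>\<^sub>r\<^bsub>E1 m\<^esub> a) = \<phi> e \<odot>\<^sub>r\<^bsub>E2 n\<^esub> a"
      using \<phi>[OF l[OF a xy(2)]] \<phi>[OF r[OF a xy(2)]] a
      by (simp_all add: P1.S_l P2.S_l P1.S_r P2.S_r \<phi>)
  qed
  then show ?thesis using \<phi> by blast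
qed

text \<open>Exactness is a condition on the chains in each degree; homology enters only through the
  three presentations.\<close>

locale short_exact =
  P1: presented_homology A C1 d1 l1 r1 E1 S1 +
  P2: presented_homology A C2 d2 l2 r2 E2 S2 +
  P3: presented_homology A C3 d3 l3 r3 E3 S3
  for A :: "('a, 'p) ring_scheme"
    and C1 :: "nat \<Rightarrow> 'x::ab_group_add set" and d1 l1 r1 and E1 :: "nat \<Rightarrow> ('a, 'e, 's) bimodule_scheme" and S1
    and C2 :: "nat \<Rightarrow> 'y::ab_group_add set" and d2 l2 r2 and E2 :: "nat \<Rightarrow> ('a, 'f, 't) bimodule_scheme" and S2
    and C3 :: "nat \<Rightarrow> 'z::ab_group_add set" and d3 l3 r3 and E3 :: "nat \<Rightarrow> ('a, 'g, 'u) bimodule_scheme" and S3 +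
  fixes f :: "'x \<Rightarrow> 'y" and g :: "'y \<Rightarrow> 'z"
  assumes f_add: "f (x + x') = f x + f x'" and g_add: "g (y + y') = g y + g y'"
    and f_closed: "x \<in> C1 n \<Longrightarrow> f x \<in> C2 n" and g_closed: "y \<in> C2 n \<Longrightarrow> g y \<in> C3 n"
    and f_d: "x \<in> C1 n \<Longrightarrow> f (d1 x) = d2 (f x)" and g_d: "y \<in> C2 n \<Longrightarrow> g (d2 y) = d3 (g y)"
    and f_l: "a \<in> carrier A \<Longrightarrow> x \<in> C1 n \<Longrightarrow> f (l1 a x) = l2 a (f x)"
    and f_r: "a \<in> carrier A \<Longrightarrow> x \<in> C1 n \<Longrightarrow> f (r1 x a) = r2 (f x) a"
    and g_l: "a \<in> carrier A \<Longrightarrow> y \<in> C2 n \<Longrightarrow> g (l2 a y) = l3 a (g y)"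
    and g_r: "a \<in> carrier A \<Longrightarrow> y \<in> C2 n \<Longrightarrow> g (r2 y a) = r3 (g y) a"
    and f_inj: "x \<in> C1 n \<Longrightarrow> f x = 0 \<Longrightarrow> x = 0"
    and gf: "x \<in> C1 n \<Longrightarrow> g (f x) = 0"
    and ker_g: "y \<in> C2 n \<Longrightarrow> g y = 0 \<Longrightarrow> \<exists>x\<in>C1 n. y = f x"
    and g_surj: "z \<in> C3 n \<Longrightarrow> \<exists>y\<in>C2 n. z = g y"
begin

lemma f_zero: "f 0 = 0" using f_add[of 0 0] by simp
lemma g_zero: "g 0 = 0" using g_add[of 0 0] by simp
lemma f_diff: "f (x - y) = f x - f y"
  using f_add[of "x - y" y] by (simp add: algebra_simps)
lemma g_diff: "g (x - y) = g x - g y"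
  using g_add[of "x - y" y] by (simp add: algebra_simps)

lemma f_eq: "x \<in> C1 n \<Longrightarrow> x' \<in> C1 n \<Longrightarrow> f x = f x' \<Longrightarrow> x = x'"
  using f_inj[of "x - x'" n] add_subgroupD(4)[OF P1.C_sub] by (simp add: f_diff)

lemma f_Z: "x \<in> P1.Z n \<Longrightarrow> f x \<in> P2.Z n"
  using f_closed f_d f_zero unfolding P1.Z_def P2.Z_def by (metis (mono_tags, lifting) mem_Collect_eq)

text \<open>Injectivity of \<open>f\<close> one degree lower reflects cycles. Degree
  \<open>0\<close> is separate because there is no lower degree; everything is a cycle
  there.\<close>

lemma f_Z_iff: "x \<in> C1 n \<Longrightarrow> f x \<in> P2.Z n \<longleftrightarrow> x \<in> P1.Z n"
proof
  assume x: "x \<in> C1 n" and "f x \<in> P2.Z n"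
  then have e: "f (d1 x) = 0" using f_d[of x n] by (simp add: P2.Z_def)
  have "d1 x = 0"
  proof (cases n)
    case 0
    then show ?thesis using P1.d_0 x by blast
  next
    case (Suc k)
    then show ?thesis using f_inj[OF P1.d_closed e] x by blast
  qed
  with x show "x \<in> P1.Z n" by (simp add: P1.Z_def)
qed (rule f_Z)

lemma g_Z: "y \<in> P2.Z n \<Longrightarrow> g y \<in> P3.Z n"
  using g_closed g_d g_zero unfolding P2.Z_def P3.Z_def by (metis (mono_tags, lifting) mem_Collect_eq)

lemma f_B: "x \<in> P1.B n \<Longrightarrow> f x \<in> P2.B n"
  unfolding P1.B_def P2.B_def using f_d f_closed by (metis (no_types, lifting) image_iff)

lemma g_B: "y \<in> P2.B n \<Longrightarrow> g y \<in> P3.B n"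
  unfolding P2.B_def P3.B_def using g_d g_closed by (metis (no_types, lifting) image_iff)

text \<open>The relation underlying the connecting homomorphism.\<close>

definition conn :: "nat \<Rightarrow> ('z \<times> 'x) set" where
  "conn n = {(z, x). z \<in> P3.Z (Suc n) \<and> x \<in> C1 n \<and> (\<exists>y\<in>C2 (Suc n). g y = z \<and> f x = d2 y)}"

lemma conn_sub: "conn n \<subseteq> P3.Z (Suc n) \<times> P1.Z n"
proof -
  have "x \<in> P1.Z n" if "x \<in> C1 n" "y \<in> C2 (Suc n)" "f x = d2 y" for x y
    using that f_Z_iff[OF that(1)] P2.B_Z[of "d2 y" n] by (auto simp: P2.B_def)
  then show ?thesis by (auto simp: conn_def)
qed

lemma conn_ex: "y \<in> C2 (Suc n) \<Longrightarrow> g y \<in> P3.Z (Suc n) \<Longrightarrow> \<exists>x. (g y, x) \<in> conn n \<and> f x = d2 y"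
proof -
  assume y: "y \<in> C2 (Suc n)" "g y \<in> P3.Z (Suc n)"
  then have "g (d2 y) = 0" using g_d P3.Z_d by simp
  then obtain x where "x \<in> C1 n" "d2 y = f x" using ker_g P2.d_closed y(1) by blast
  then show ?thesis using y by (auto simp: conn_def intro!: exI[of _ x])
qed

text \<open>All three families of maps come from \<open>induced_hom\<close>: two from the graphs of
  \<open>f\<close> and \<open>g\<close>, the third from \<open>conn\<close>.\<close>

theorem long_exact_sequence:
  "\<exists>\<phi> \<psi> \<delta>. (\<forall>n. bimodule_exact A A (E1 n) (\<phi> n) (E2 n) (\<psi> n) (E3 n)) \<and>
    (\<forall>n. bimodule_exact A A (E2 (Suc n)) (\<psi> (Suc n)) (E3 (Suc n)) (\<delta> n) (E1 n)) \<and>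
    (\<forall>n. bimodule_exact A A (E3 (Suc n)) (\<delta> n) (E1 n) (\<phi> n) (E2 n)) \<and>
    \<psi> 0 ` carrier (E2 0) = carrier (E3 0)"
proof -
  have "\<exists>h. bimodule_hom A A (E1 n) (E2 n) h \<and> (\<forall>(x, y)\<in>{(x, y). x \<in> P1.Z n \<and> y = f x}. h (S1 n x) = S2 n y)" for n
  proof (rule induced_hom[OF P1.presented_homology_axioms P2.presented_homology_axioms refl refl])
    fix x y x' y' assume "(x, y) \<in> {(x, y). x \<in> P1.Z n \<and> y = f x}" "(x', y') \<in> {(x, y). x \<in> P1.Z n \<and> y = f x}"
    then show "(x + x', y + y') \<in> {(x, y). x \<in> P1.Z n \<and> y = f x}"
      using add_subgroupD(2)[OF P1.Z_sub] by (simp add: f_add)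
  qed (auto simp: P1.Z_l P1.Z_r f_l[OF _ P1.Z_C] f_r[OF _ P1.Z_C] intro: f_Z f_B)
  then have "\<forall>n. \<exists>h. bimodule_hom A A (E1 n) (E2 n) h \<and> (\<forall>x\<in>P1.Z n. h (S1 n x) = S2 n (f x))"
    by (simp add: Ball_def)
  from choice[OF this] obtain \<phi> where \<phi>: "\<And>n. bimodule_hom A A (E1 n) (E2 n) (\<phi> n)"
    "\<And>n x. x \<in> P1.Z n \<Longrightarrow> \<phi> n (S1 n x) = S2 n (f x)"
    by blast
  have "\<exists>h. bimodule_hom A A (E2 n) (E3 n) h \<and> (\<forall>(x, y)\<in>{(x, y). x \<in> P2.Z n \<and> y = g x}. h (S2 n x) = S3 n y)" for n
  proof (rule induced_hom[OF P2.presented_homology_axioms P3.presented_homology_axioms refl refl])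
    fix x y x' y' assume "(x, y) \<in> {(x, y). x \<in> P2.Z n \<and> y = g x}" "(x', y') \<in> {(x, y). x \<in> P2.Z n \<and> y = g x}"
    then show "(x + x', y + y') \<in> {(x, y). x \<in> P2.Z n \<and> y = g x}"
      using add_subgroupD(2)[OF P2.Z_sub] by (simp add: g_add)
  qed (auto simp: P2.Z_l P2.Z_r g_l[OF _ P2.Z_C] g_r[OF _ P2.Z_C] intro: g_Z g_B)
  then have "\<forall>n. \<exists>h. bimodule_hom A A (E2 n) (E3 n) h \<and> (\<forall>x\<in>P2.Z n. h (S2 n x) = S3 n (g x))"
    by (simp add: Ball_def)
  from choice[OF this] obtain \<psi> where \<psi>: "\<And>n. bimodule_hom A A (E2 n) (E3 n) (\<psi> n)"
    "\<And>n x. x \<in> P2.Z n \<Longrightarrow> \<psi> n (S2 n x) = S3 n (g x)"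
    by blast
  have "\<exists>h. bimodule_hom A A (E3 (Suc n)) (E1 n) h \<and> (\<forall>(x, y)\<in>conn n. h (S3 (Suc n) x) = S1 n y)" for n
  proof (rule induced_hom[OF P3.presented_homology_axioms P1.presented_homology_axioms refl refl conn_sub])
    fix z assume "z \<in> P3.Z (Suc n)"
    then show "\<exists>x. (z, x) \<in> conn n"
      using g_surj[OF P3.Z_C] conn_ex by metis
  next
    fix z x z' x' assume "(z, x) \<in> conn n" "(z', x') \<in> conn n"
    then show "(z + z', x + x') \<in> conn n"
      unfolding conn_def
      by (auto simp: add_subgroupD(2)[OF P3.Z_sub] add_subgroupD(2)[OF P1.C_sub]
          add_subgroupD(2)[OF P2.C_sub] f_add g_add P2.d_add intro!: bexI[of _ "_ + _"])
  next
    fix a z x assume a: "a \<in> carrier A" and "(z, x) \<in> conn n"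
    then obtain y where y: "z \<in> P3.Z (Suc n)" "x \<in> C1 n" "y \<in> C2 (Suc n)" "g y = z" "f x = d2 y"
      by (auto simp: conn_def)
    then have "g (l2 a y) = l3 a z" "f (l1 a x) = d2 (l2 a y)" "l2 a y \<in> C2 (Suc n)"
      "g (r2 y a) = r3 z a" "f (r1 x a) = d2 (r2 y a)" "r2 y a \<in> C2 (Suc n)"
      using a by (simp_all add: g_l g_r f_l f_r P2.d_l P2.d_r P2.l_closed P2.r_closed)
    then show "(l3 a z, l1 a x) \<in> conn n" "(r3 z a, r1 x a) \<in> conn n"
      using y a by (auto simp: conn_def P3.Z_l P3.Z_r P1.l_closed P1.r_closed)
  next
    fix z x assume "(z, x) \<in> conn n" and "z \<in> P3.B (Suc n)"
    then obtain y w where y: "x \<in> C1 n" "y \<in> C2 (Suc n)" "g y = z" "f x = d2 y"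
      and w: "w \<in> C3 (Suc (Suc n))" "z = d3 w"
      by (auto simp: conn_def P3.B_def)
    \<comment> \<open>The snake: \<open>w\<close> lifts to \<open>v\<close>, and
      \<open>y - d2 v\<close> comes from some \<open>u\<close>; applying \<open>d2\<close> shows
      that \<open>x\<close> is the boundary of \<open>u\<close>.\<close>
    obtain v where v: "v \<in> C2 (Suc (Suc n))" "w = g v" using g_surj w by blast
    have dv: "d2 v \<in> C2 (Suc n)" using v P2.d_closed by blast
    have "g (y - d2 v) = 0" using y v w by (simp add: g_diff g_d)
    moreover have "y - d2 v \<in> C2 (Suc n)" using y(2) dv add_subgroupD(4)[OF P2.C_sub] by blast
    ultimately obtain u where u: "u \<in> C1 (Suc n)" "y - d2 v = f u" using ker_g by blast
    have "f x = f (d1 u)"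
      using y v u(2)[symmetric] by (simp add: f_d[OF u(1)] P2.d_diff P2.d_d)
    then have "x = d1 u" using f_eq y(1) P1.d_closed u(1) by blast
    then show "x \<in> P1.B n" using u(1) by (simp add: P1.B_def)
  qed
  then have "\<forall>n. \<exists>h. bimodule_hom A A (E3 (Suc n)) (E1 n) h \<and> (\<forall>(z, x)\<in>conn n. h (S3 (Suc n) z) = S1 n x)"
    by blast
  from choice[OF this] obtain \<delta> where \<delta>: "\<And>n. bimodule_hom A A (E3 (Suc n)) (E1 n) (\<delta> n)"
    "\<And>n z x. (z, x) \<in> conn n \<Longrightarrow> \<delta> n (S3 (Suc n) z) = S1 n x"
    by blast
  have e1: "bimodule_exact A A (E1 n) (\<phi> n) (E2 n) (\<psi> n) (E3 n)" for n
    unfolding bimodule_exact_def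
  proof (intro conjI \<phi>(1) \<psi>(1), intro equalityI subsetI)
    fix e assume "e \<in> \<phi> n ` carrier (E1 n)"
    then obtain x where x: "x \<in> P1.Z n" "e = S2 n (f x)"
      by (auto elim!: P1.S_cases simp: \<phi>(2))
    have "\<psi> n e = S3 n 0" using x(2) \<psi>(2)[OF f_Z[OF x(1)]] gf[OF P1.Z_C[OF x(1)]] by simp
    then show "e \<in> {x \<in> carrier (E2 n). \<psi> n x = \<zero>\<^bsub>E3 n\<^esub>}"
      using x f_Z P2.S_closed P3.S_zero by simp
  next
    fix e assume "e \<in> {x \<in> carrier (E2 n). \<psi> n x = \<zero>\<^bsub>E3 n\<^esub>}"
    then obtain y where y: "y \<in> P2.Z n" "e = S2 n y" "\<psi> n e = \<zero>\<^bsub>E3 n\<^esub>"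
      by (auto elim: P2.S_cases)
    then have "g y \<in> P3.B n" using P3.S_ker[OF g_Z] \<psi>(2) by metis
    then obtain w where w: "w \<in> C3 (Suc n)" "g y = d3 w" by (auto simp: P3.B_def)
    obtain v where v: "v \<in> C2 (Suc n)" "w = g v" using g_surj w by blast
    \<comment> \<open>Correcting \<open>y\<close> by the boundary \<open>d2 v\<close> keeps its
      homology class and moves it into the kernel of \<open>g\<close>.\<close>
    have B: "d2 v \<in> P2.B n" using v by (simp add: P2.B_def)
    have Z: "y - d2 v \<in> P2.Z n" using P2.B_Z[OF B] y(1) add_subgroupD(4)[OF P2.Z_sub] by blast
    have "g (y - d2 v) = 0" using v w by (simp add: g_diff g_d)
    then obtain x where x: "x \<in> C1 n" "y - d2 v = f x" using ker_g P2.Z_C Z by blast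
    then have xZ: "x \<in> P1.Z n" using f_Z_iff Z by simp
    have "- (d2 v) \<in> P2.B n" using B add_subgroupD(3)[OF P2.B_sub] by blast
    then have "S2 n (f x) = S2 n y"
      using P2.S_eq[OF f_Z[OF xZ] y(1)] x(2)[symmetric] by simp
    then have "e = \<phi> n (S1 n x)" using y(2) \<phi>(2)[OF xZ] by simp
    then show "e \<in> \<phi> n ` carrier (E1 n)" using P1.S_closed[OF xZ] by blast
  qed
  have e2: "bimodule_exact A A (E2 (Suc n)) (\<psi> (Suc n)) (E3 (Suc n)) (\<delta> n) (E1 n)" for n
    unfolding bimodule_exact_def
  proof (intro conjI \<delta>(1) \<psi>(1), intro equalityI subsetI)
    fix e assume "e \<in> \<psi> (Suc n) ` carrier (E2 (Suc n))"
    then obtain y where y: "y \<in> P2.Z (Suc n)" "e = S3 (Suc n) (g y)"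
      by (auto elim!: P2.S_cases simp: \<psi>(2))
    obtain x where x: "(g y, x) \<in> conn n" "f x = d2 y"
      using conn_ex[OF P2.Z_C[OF y(1)] g_Z[OF y(1)]] by blast
    then have "x = 0" using f_inj[of x n] P2.Z_d[OF y(1)] by (auto simp: conn_def)
    then have "\<delta> n e = \<zero>\<^bsub>E1 n\<^esub>" using \<delta>(2)[OF x(1)] y(2) P1.S_zero by simp
    then show "e \<in> {x \<in> carrier (E3 (Suc n)). \<delta> n x = \<zero>\<^bsub>E1 n\<^esub>}"
      using y P3.S_closed[OF g_Z] by simp
  next
    fix e assume "e \<in> {x \<in> carrier (E3 (Suc n)). \<delta> n x = \<zero>\<^bsub>E1 n\<^esub>}"
    then obtain z where z: "z \<in> P3.Z (Suc n)" "e = S3 (Suc n) z" "\<delta> n e = \<zero>\<^bsub>E1 n\<^esub>"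
      by (auto elim: P3.S_cases)
    obtain y where y: "y \<in> C2 (Suc n)" "z = g y" using g_surj P3.Z_C z(1) by blast
    obtain x where x: "(z, x) \<in> conn n" "f x = d2 y" using conn_ex y z(1) by blast
    have "x \<in> P1.B n" using P1.S_ker[of x n] conn_sub x \<delta>(2)[OF x(1)] z by auto
    then obtain u where u: "u \<in> C1 (Suc n)" "x = d1 u" by (auto simp: P1.B_def)
    \<comment> \<open>The lift \<open>y\<close> need not be a cycle; subtracting \<open>f u\<close>
      makes it one and leaves its image under \<open>g\<close> unchanged.\<close>
    have Z: "y - f u \<in> P2.Z (Suc n)"
      using x(2) u y(1) f_closed[OF u(1)] add_subgroupD(4)[OF P2.C_sub]
      by (simp add: P2.Z_def P2.d_diff f_d[OF u(1), symmetric])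
    have "e = \<psi> (Suc n) (S2 (Suc n) (y - f u))"
      using \<psi>(2)[OF Z] z(2) y(2) by (simp add: g_diff gf[OF u(1)])
    then show "e \<in> \<psi> (Suc n) ` carrier (E2 (Suc n))" using P2.S_closed[OF Z] by blast
  qed
  have e3: "bimodule_exact A A (E3 (Suc n)) (\<delta> n) (E1 n) (\<phi> n) (E2 n)" for n
    unfolding bimodule_exact_def
  proof (intro conjI \<delta>(1) \<phi>(1), intro equalityI subsetI)
    fix e assume "e \<in> \<delta> n ` carrier (E3 (Suc n))"
    then obtain z where z: "z \<in> P3.Z (Suc n)" "e = \<delta> n (S3 (Suc n) z)"
      by (auto elim!: P3.S_cases)
    obtain y where y: "y \<in> C2 (Suc n)" "z = g y" using g_surj P3.Z_C z(1) by blast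
    obtain x where x: "(z, x) \<in> conn n" "f x = d2 y" using conn_ex y z(1) by blast
    then have xZ: "x \<in> P1.Z n" using conn_sub by auto
    have "f x \<in> P2.B n" using x(2) y(1) by (simp add: P2.B_def)
    then have "S2 n (f x) = \<zero>\<^bsub>E2 n\<^esub>" using P2.S_ker[OF f_Z[OF xZ]] by blast
    then show "e \<in> {x \<in> carrier (E1 n). \<phi> n x = \<zero>\<^bsub>E2 n\<^esub>}"
      using z \<delta>(2)[OF x(1)] \<phi>(2)[OF xZ] P1.S_closed[OF xZ] by simp
  next
    fix e assume "e \<in> {x \<in> carrier (E1 n). \<phi> n x = \<zero>\<^bsub>E2 n\<^esub>}"
    then obtain x where x: "x \<in> P1.Z n" "e = S1 n x" "\<phi> n e = \<zero>\<^bsub>E2 n\<^esub>"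
      by (auto elim: P1.S_cases)
    then have "f x \<in> P2.B n" using P2.S_ker[OF f_Z] \<phi>(2) by metis
    then obtain y where y: "y \<in> C2 (Suc n)" "f x = d2 y" by (auto simp: P2.B_def)
    have gf0: "g (f x) = 0" using x(1) gf P1.Z_C by blast
    have gZ: "g y \<in> P3.Z (Suc n)"
      using g_closed[OF y(1)] g_d[OF y(1)] gf0 y(2) by (simp add: P3.Z_def)
    have "(g y, x) \<in> conn n"
      using y x(1) P1.Z_C gZ by (auto simp: conn_def)
    then have "e = \<delta> n (S3 (Suc n) (g y))" using \<delta>(2) x(2) by simp
    then show "e \<in> \<delta> n ` carrier (E3 (Suc n))" using P3.S_closed[OF gZ] by blast
  qed
  have "\<psi> 0 ` carrier (E2 0) = carrier (E3 0)"
  proof (intro equalityI subsetI)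
    fix e assume "e \<in> carrier (E3 0)"
    then obtain z where z: "z \<in> P3.Z 0" "e = S3 0 z" using P3.S_cases by blast
    then obtain y where y: "y \<in> C2 0" "z = g y" using g_surj P3.Z_C by blast
    \<comment> \<open>In degree \<open>0\<close> everything is a cycle, so surjectivity on chains
      suffices.\<close>
    then have "y \<in> P2.Z 0" by (simp add: P2.Z_def P2.d_0)
    then show "e \<in> \<psi> 0 ` carrier (E2 0)" using z y \<psi>(2) P2.S_closed by (metis imageI)
  next
    fix e assume "e \<in> \<psi> 0 ` carrier (E2 0)"
    then show "e \<in> carrier (E3 0)" using \<psi>(1)[of 0] by (auto simp: bimodule_hom_def)
  qed
  with e1 e2 e3 show ?thesis by blast
qed

end

section \<open>Quotients and tensor products\<close>

text \<open>The coset as a set in the ambient type; \<open>coset_eq\<close> identifies it with the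
  coset formed in the record.\<close>

definition qt :: "'x::ab_group_add set \<Rightarrow> 'x \<Rightarrow> 'x set" where
  "qt I x = (\<lambda>i. i + x) ` I"

lemma qt_eq:
  assumes "add_subgroup I"
  shows "qt I x = qt I y \<longleftrightarrow> x - y \<in> I"
proof
  assume e: "qt I x = qt I y"
  have "0 + x \<in> qt I x" unfolding qt_def using add_subgroupD(1)[OF assms] by blast
  then obtain i where "i \<in> I" "x = i + y" using e by (auto simp: qt_def)
  then show "x - y \<in> I" by simp
next
  assume xy: "x - y \<in> I"
  have "\<exists>j\<in>I. i + x = j + y" if "i \<in> I" for i
    using add_subgroupD(2)[OF assms that xy] by (intro bexI[of _ "i + (x - y)"]) auto
  moreover have "\<exists>j\<in>I. i + y = j + x" if "i \<in> I" for i
    using add_subgroupD(4)[OF assms that xy] by (intro bexI[of _ "i - (x - y)"]) auto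
  ultimately show "qt I x = qt I y" by (auto simp: qt_def image_iff)
qed

text \<open>\<open>G\<close> is an arbitrary record with the addition of its type, since the free
  group of a tensor product becomes a bimodule only in the quotient.\<close>

locale additive_quotient =
  fixes G :: "('a, 'x::ab_group_add) bimodule" and I :: "'x set"
  assumes add_G: "add G = (+)" and I_sub: "add_subgroup I" and I_carrier: "I \<subseteq> carrier G"
begin

lemma coset_eq: "I +>\<^bsub>G\<^esub> x = qt I x"
  by (auto simp: a_r_coset_def' qt_def add_G)

lemma carrier_quotient: "carrier (bimodule_quotient G I) = qt I ` carrier G"
  by (auto simp: bimodule_quotient_def A_RCOSETS_def' coset_eq)

lemma zero_quotient: "\<zero>\<^bsub>bimodule_quotient G I\<^esub> = qt I 0"
  by (simp add: bimodule_quotient_def qt_def)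

lemma add_quotient: "qt I x \<oplus>\<^bsub>bimodule_quotient G I\<^esub> qt I y = qt I (x + y)"
proof -
  have "\<exists>k\<in>I. i + x + (j + y) = k + (x + y)" if "i \<in> I" "j \<in> I" for i j
    using add_subgroupD(2)[OF I_sub that] by (intro bexI[of _ "i + j"]) (auto simp: algebra_simps)
  moreover have "\<exists>j\<in>I. \<exists>k\<in>I. i + (x + y) = j + x + (k + y)" if "i \<in> I" for i
    using that add_subgroupD(1)[OF I_sub]
    by (intro bexI[of _ i] bexI[of _ 0]) (auto simp: algebra_simps)
  ultimately show ?thesis
    by (fastforce simp: bimodule_quotient_def set_add_def' qt_def add_G)
qed

text \<open>The action on a coset is a union over all elements of the coset. It is a single coset as
  soon as the action moves all of them into the same one.\<close>

lemma smult_quotient: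
  assumes "\<And>i. i \<in> I \<Longrightarrow> a \<odot>\<^bsub>G\<^esub> (i + x) - a \<odot>\<^bsub>G\<^esub> x \<in> I"
  shows "a \<odot>\<^bsub>bimodule_quotient G I\<^esub> qt I x = qt I (a \<odot>\<^bsub>G\<^esub> x)"
proof -
  have "qt I (a \<odot>\<^bsub>G\<^esub> (i + x)) = qt I (a \<odot>\<^bsub>G\<^esub> x)" if "i \<in> I" for i
    using assms[OF that] qt_eq[OF I_sub] by simp
  then show ?thesis
    using add_subgroupD(1)[OF I_sub]
    by (auto simp: bimodule_quotient_def coset_eq qt_def[of I x])
qed

lemma rsmult_quotient:
  assumes "\<And>i. i \<in> I \<Longrightarrow> (i + x) \<odot>\<^sub>r\<^bsub>G\<^esub> a - x \<odot>\<^sub>r\<^bsub>G\<^esub> a \<in> I"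
  shows "qt I x \<odot>\<^sub>r\<^bsub>bimodule_quotient G I\<^esub> a = qt I (x \<odot>\<^sub>r\<^bsub>G\<^esub> a)"
proof -
  have "qt I ((i + x) \<odot>\<^sub>r\<^bsub>G\<^esub> a) = qt I (x \<odot>\<^sub>r\<^bsub>G\<^esub> a)" if "i \<in> I" for i
    using assms[OF that] qt_eq[OF I_sub] by simp
  then show ?thesis
    using add_subgroupD(1)[OF I_sub]
    by (auto simp: bimodule_quotient_def coset_eq qt_def[of I x])
qed

end

section \<open>Tensor products as quotients of free abelian groups\<close>

definition tensor_kernel where
  "tensor_kernel B M N = generate (add_monoid (tensor_free M N)) (tensor_relations B M N)"

lemma tensor_eq: "tensor B M N = bimodule_quotient (tensor_free M N) (tensor_kernel B M N)"
  by (simp add: tensor_def tensor_kernel_def)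

text \<open>These closure conditions place the defining relations inside the free group, where the
  generated subgroup can be described by sums and negatives.\<close>

locale tensor_closed =
  fixes B :: "('a, 'p) ring_scheme" and M :: "('a, 'b) bimodule" and N :: "('a, 'd) bimodule"
  assumes M_add: "x \<in> carrier M \<Longrightarrow> x' \<in> carrier M \<Longrightarrow> x \<oplus>\<^bsub>M\<^esub> x' \<in> carrier M"
    and N_add: "y \<in> carrier N \<Longrightarrow> y' \<in> carrier N \<Longrightarrow> y \<oplus>\<^bsub>N\<^esub> y' \<in> carrier N"
    and M_rsmult: "x \<in> carrier M \<Longrightarrow> b \<in> carrier B \<Longrightarrow> x \<odot>\<^sub>r\<^bsub>M\<^esub> b \<in> carrier M"
    and N_smult: "y \<in> carrier N \<Longrightarrow> b \<in> carrier B \<Longrightarrow> b \<odot>\<^bsub>N\<^esub> y \<in> carrier N"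
begin

abbreviation "K \<equiv> tensor_kernel B M N"

lemma carrier_free: "carrier (tensor_free M N) = {z. Poly_Mapping.keys z \<subseteq> carrier M \<times> carrier N}"
  by (simp add: tensor_free_def)

lemma free_sub: "add_subgroup (carrier (tensor_free M N))"
  unfolding carrier_free by (rule add_subgroup_keys)

lemma group_free: "group (add_monoid (tensor_free M N))"
proof (rule groupI)
  fix x assume "x \<in> carrier (add_monoid (tensor_free M N))"
  then show "\<exists>y\<in>carrier (add_monoid (tensor_free M N)). y \<otimes>\<^bsub>add_monoid (tensor_free M N)\<^esub> x = \<one>\<^bsub>add_monoid (tensor_free M N)\<^esub>"
    using add_subgroupD(3)[OF free_sub] by (intro bexI[of _ "- x"]) (auto simp: tensor_free_def)
qed (use add_subgroupD[OF free_sub] in \<open>auto simp: tensor_free_def add.assoc\<close>)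

lemma free_inv: "z \<in> carrier (tensor_free M N) \<Longrightarrow> inv\<^bsub>add_monoid (tensor_free M N)\<^esub> z = - z"
  using add_subgroupD(3)[OF free_sub, of z]
  by (intro group.inv_equality[OF group_free]) (simp_all add: tensor_free_def)

lemma relations_free: "tensor_relations B M N \<subseteq> carrier (tensor_free M N)"
proof -
  have f: "frag_of (x, y) \<in> carrier (tensor_free M N)" if "x \<in> carrier M" "y \<in> carrier N" for x y
    using that by (simp add: carrier_free)
  show ?thesis
    unfolding tensor_relations_def
    by (auto intro!: add_subgroupD(4)[OF free_sub] f M_add N_add M_rsmult N_smult)
qed

text \<open>\<open>generate\<close> adjoins inverses of generators in the record; inside the free
  group these are the negatives of the type.\<close>

lemma kernel_induct [consumes 1, case_names zero rel minus add]:
  assumes "z \<in> K"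
    and "P 0" "\<And>z. z \<in> tensor_relations B M N \<Longrightarrow> P z"
    and "\<And>z. P z \<Longrightarrow> P (- z)" "\<And>z z'. P z \<Longrightarrow> P z' \<Longrightarrow> P (z + z')"
  shows "P z"
  using assms(1) unfolding tensor_kernel_def
proof (induction rule: generate.induct)
  case (inv h)
  then show ?case using assms(3,4) relations_free free_inv by auto
qed (use assms in \<open>auto simp: tensor_free_def\<close>)

lemma kernel_free: "K \<subseteq> carrier (tensor_free M N)"
  using group.generate_in_carrier[OF group_free] relations_free
  by (auto simp: tensor_kernel_def)

lemma kernel_sub: "add_subgroup K"
  unfolding add_subgroup_def
proof (intro conjI ballI)
  show "0 \<in> K" unfolding tensor_kernel_def
    using generate.one[of "add_monoid (tensor_free M N)"] by (simp add: tensor_free_def)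
next
  fix x y assume "x \<in> K" "y \<in> K"
  then show "x + y \<in> K" unfolding tensor_kernel_def
    using generate.eng[of x "add_monoid (tensor_free M N)" _ y] by (simp add: tensor_free_def)
next
  fix x assume x: "x \<in> K"
  then have "inv\<^bsub>add_monoid (tensor_free M N)\<^esub> x \<in> K" unfolding tensor_kernel_def
    using group.generate_m_inv_closed[OF group_free] relations_free by auto
  then show "- x \<in> K" using free_inv x kernel_free by auto
qed

lemma kernel_relations: "tensor_relations B M N \<subseteq> K"
  unfolding tensor_kernel_def by (auto intro: generate.incl)

lemma kernel_add_left: "x \<in> carrier M \<Longrightarrow> x' \<in> carrier M \<Longrightarrow> y \<in> carrier N \<Longrightarrow>
    frag_of (x \<oplus>\<^bsub>M\<^esub> x', y) - frag_of (x, y) - frag_of (x', y) \<in> K"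
  by (intro subsetD[OF kernel_relations]) (auto simp: tensor_relations_def)

lemma kernel_add_right: "x \<in> carrier M \<Longrightarrow> y \<in> carrier N \<Longrightarrow> y' \<in> carrier N \<Longrightarrow>
    frag_of (x, y \<oplus>\<^bsub>N\<^esub> y') - frag_of (x, y) - frag_of (x, y') \<in> K"
  by (intro subsetD[OF kernel_relations]) (auto simp: tensor_relations_def)

lemma kernel_balanced: "x \<in> carrier M \<Longrightarrow> b \<in> carrier B \<Longrightarrow> y \<in> carrier N \<Longrightarrow>
    frag_of (x \<odot>\<^sub>r\<^bsub>M\<^esub> b, y) - frag_of (x, b \<odot>\<^bsub>N\<^esub> y) \<in> K"
  by (intro subsetD[OF kernel_relations]) (auto simp: tensor_relations_def)

text \<open>The universal property, for maps that are balanced only modulo a subgroup \<open>J\<close>.\<close>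

lemma kernel_lift:
  fixes h :: "'b \<times> 'd \<Rightarrow> 'y::ab_group_add" and H :: "('b \<times> 'd \<Rightarrow>\<^sub>0 int) \<Rightarrow> 'y"
  assumes H: "\<And>z z'. H (z + z') = H z + H z'" "\<And>k. H (frag_of k) = h k"
    and J: "add_subgroup J"
    and "\<And>x x' y. x \<in> carrier M \<Longrightarrow> x' \<in> carrier M \<Longrightarrow> y \<in> carrier N \<Longrightarrow> h (x \<oplus>\<^bsub>M\<^esub> x', y) - h (x, y) - h (x', y) \<in> J"
    and "\<And>x y y'. x \<in> carrier M \<Longrightarrow> y \<in> carrier N \<Longrightarrow> y' \<in> carrier N \<Longrightarrow> h (x, y \<oplus>\<^bsub>N\<^esub> y') - h (x, y) - h (x, y') \<in> J"
    and "\<And>x b y. x \<in> carrier M \<Longrightarrow> b \<in> carrier B \<Longrightarrow> y \<in> carrier N \<Longrightarrow> h (x \<odot>\<^sub>r\<^bsub>M\<^esub> b, y) - h (x, b \<odot>\<^bsub>N\<^esub> y) \<in> J"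
    and "z \<in> K"
  shows "H z \<in> J"
proof -
  have H0: "H 0 = 0" using H(1)[of 0 0] by simp
  have Hm: "H (- z) = - H z" for z using H(1)[of "- z" z] H0 by (simp add: eq_neg_iff_add_eq_0)
  have Hd: "H (z - z') = H z - H z'" for z z' using H(1)[of z "- z'"] Hm by simp
  show ?thesis
    using assms(7)
  proof (induction rule: kernel_induct)
    case (rel z)
    then show ?case using assms(4-6) unfolding tensor_relations_def by (auto simp: Hd H(2))
  qed (auto simp: H0 Hm H(1) intro: add_subgroupD[OF J])
qed

text \<open>Applied to multiplication by a ring element, this makes the left action of
  \<open>M\<close> descend to the tensor product.\<close>

lemma kernel_left:
  assumes "\<And>x. x \<in> carrier M \<Longrightarrow> u x \<in> carrier M"
    and "\<And>x x'. x \<in> carrier M \<Longrightarrow> x' \<in> carrier M \<Longrightarrow> u (x \<oplus>\<^bsub>M\<^esub> x') = u x \<oplus>\<^bsub>M\<^esub> u x'"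
    and "\<And>x b. x \<in> carrier M \<Longrightarrow> b \<in> carrier B \<Longrightarrow> u (x \<odot>\<^sub>r\<^bsub>M\<^esub> b) = u x \<odot>\<^sub>r\<^bsub>M\<^esub> b"
    and "z \<in> K"
  shows "frag_extend (\<lambda>(x, y). frag_of (u x, y)) z \<in> K"
  by (rule kernel_lift[OF frag_extend_add frag_extend_of kernel_sub _ _ _ assms(4)])
    (auto simp: assms intro: kernel_add_left kernel_add_right kernel_balanced)

lemma kernel_right:
  assumes "\<And>y. y \<in> carrier N \<Longrightarrow> u y \<in> carrier N"
    and "\<And>y y'. y \<in> carrier N \<Longrightarrow> y' \<in> carrier N \<Longrightarrow> u (y \<oplus>\<^bsub>N\<^esub> y') = u y \<oplus>\<^bsub>N\<^esub> u y'"
    and "\<And>y b. y \<in> carrier N \<Longrightarrow> b \<in> carrier B \<Longrightarrow> u (b \<odot>\<^bsub>N\<^esub> y) = b \<odot>\<^bsub>N\<^esub> u y"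
    and "z \<in> K"
  shows "frag_extend (\<lambda>(x, y). frag_of (x, u y)) z \<in> K"
  by (rule kernel_lift[OF frag_extend_add frag_extend_of kernel_sub _ _ _ assms(4)])
    (auto simp: assms intro: kernel_add_left kernel_add_right kernel_balanced)

sublocale additive_quotient "tensor_free M N" K
  by unfold_locales (use kernel_sub kernel_free in \<open>auto simp: tensor_free_def\<close>)

lemma smult_tensor:
  assumes "\<And>x. x \<in> carrier M \<Longrightarrow> a \<odot>\<^bsub>M\<^esub> x \<in> carrier M"
    and "\<And>x x'. x \<in> carrier M \<Longrightarrow> x' \<in> carrier M \<Longrightarrow> a \<odot>\<^bsub>M\<^esub> (x \<oplus>\<^bsub>M\<^esub> x') = a \<odot>\<^bsub>M\<^esub> x \<oplus>\<^bsub>M\<^esub> a \<odot>\<^bsub>M\<^esub> x'"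
    and "\<And>x b. x \<in> carrier M \<Longrightarrow> b \<in> carrier B \<Longrightarrow> a \<odot>\<^bsub>M\<^esub> (x \<odot>\<^sub>r\<^bsub>M\<^esub> b) = (a \<odot>\<^bsub>M\<^esub> x) \<odot>\<^sub>r\<^bsub>M\<^esub> b"
  shows "a \<odot>\<^bsub>tensor B M N\<^esub> qt K z = qt K (a \<odot>\<^bsub>tensor_free M N\<^esub> z)"
  unfolding tensor_eq
  by (rule smult_quotient)
    (use kernel_left[of "\<lambda>x. a \<odot>\<^bsub>M\<^esub> x", OF assms] in \<open>simp add: tensor_free_def frag_extend_add\<close>)

lemma rsmult_tensor:
  assumes "\<And>y. y \<in> carrier N \<Longrightarrow> y \<odot>\<^sub>r\<^bsub>N\<^esub> a \<in> carrier N"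
    and "\<And>y y'. y \<in> carrier N \<Longrightarrow> y' \<in> carrier N \<Longrightarrow> (y \<oplus>\<^bsub>N\<^esub> y') \<odot>\<^sub>r\<^bsub>N\<^esub> a = y \<odot>\<^sub>r\<^bsub>N\<^esub> a \<oplus>\<^bsub>N\<^esub> y' \<odot>\<^sub>r\<^bsub>N\<^esub> a"
    and "\<And>y b. y \<in> carrier N \<Longrightarrow> b \<in> carrier B \<Longrightarrow> (b \<odot>\<^bsub>N\<^esub> y) \<odot>\<^sub>r\<^bsub>N\<^esub> a = b \<odot>\<^bsub>N\<^esub> (y \<odot>\<^sub>r\<^bsub>N\<^esub> a)"
  shows "qt K z \<odot>\<^sub>r\<^bsub>tensor B M N\<^esub> a = qt K (z \<odot>\<^sub>r\<^bsub>tensor_free M N\<^esub> a)"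
  unfolding tensor_eq
  by (rule rsmult_quotient)
    (use kernel_right[of "\<lambda>y. y \<odot>\<^sub>r\<^bsub>N\<^esub> a", OF assms] in \<open>simp add: tensor_free_def frag_extend_add\<close>)

lemma free_smult: "a \<odot>\<^bsub>tensor_free M N\<^esub> z = frag_extend (\<lambda>(x, y). frag_of (a \<odot>\<^bsub>M\<^esub> x, y)) z"
  and free_rsmult: "z \<odot>\<^sub>r\<^bsub>tensor_free M N\<^esub> a = frag_extend (\<lambda>(x, y). frag_of (x, y \<odot>\<^sub>r\<^bsub>N\<^esub> a)) z"
  by (simp_all add: tensor_free_def)

end

section \<open>Iterated faces\<close>

text \<open>Faces in the directions below \<open>n\<close> of an \<open>m\<close>-cube: direction \<open>j\<close> is left free
  if \<open>g j\<close> is \<^const>\<open>None\<close>.\<close>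

fun gface :: "'c precubical \<Rightarrow> (nat \<Rightarrow> bool option) \<Rightarrow> nat \<Rightarrow> nat \<Rightarrow> 'c \<Rightarrow> 'c" where
  "gface X g m 0 c = c"
| "gface X g m (Suc n) c = (case g n of None \<Rightarrow> gface X g m n c
     | Some \<epsilon> \<Rightarrow> gface X g (m - 1) n (face X \<epsilon> m n c))"

text \<open>This is also the new index of direction \<open>n\<close> once the faces that
  \<open>g\<close> prescribes below \<open>n\<close> have been taken.\<close>

definition free_dirs :: "(nat \<Rightarrow> bool option) \<Rightarrow> nat \<Rightarrow> nat" where
  "free_dirs g n = card {j. j < n \<and> g j = None}"

lemma card_less_Suc: "card {j. j < Suc n \<and> P j} = card {j. j < n \<and> P j} + of_bool (P n)"
proof -
  have "{j. j < Suc n \<and> P j} = {j. j < n \<and> P j} \<union> (if P n then {n} else {})"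
    by (auto simp: less_Suc_eq)
  then show ?thesis by simp
qed

lemma free_dirs_simps [simp]:
  "free_dirs g 0 = 0" "free_dirs g (Suc n) = free_dirs g n + of_bool (g n = None)"
  by (simp_all add: free_dirs_def card_less_Suc)

lemma gface_cong: "(\<And>j. j < n \<Longrightarrow> g j = h j) \<Longrightarrow> gface X g m n c = gface X h m n c"
  by (induction n arbitrary: m c) (auto split: option.split)

context
  fixes X :: "'c precubical"
  assumes X: "precubical X"
begin

lemma face_cells: "i < n \<Longrightarrow> c \<in> cells X n \<Longrightarrow> face X \<epsilon> n i c \<in> cells X (n - 1)"
  using X unfolding precubical_def by blast

lemma face_face: "i < j \<Longrightarrow> j < n \<Longrightarrow> c \<in> cells X n \<Longrightarrow>
    face X k (n - 1) i (face X l n j c) = face X l (n - 1) (j - 1) (face X k n i c)"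
  using X unfolding precubical_def by blast

lemma gface_cells:
  "n \<le> m \<Longrightarrow> c \<in> cells X m \<Longrightarrow> gface X g m n c \<in> cells X (m - n + free_dirs g n)"
proof (induction n arbitrary: m c)
  case (Suc n)
  show ?case
  proof (cases "g n")
    case None
    have "m - n = Suc (m - Suc n)" using Suc.prems by simp
    then show ?thesis using Suc.IH[of m c] Suc.prems None by simp
  next
    case (Some \<epsilon>)
    then show ?thesis
      using Suc.IH[of "m - 1" "face X \<epsilon> m n c"] Suc.prems face_cells[of n m c \<epsilon>] by simp
  qed
qed simp

text \<open>The precubical identity for one face against many: each face taken in a lower direction
  decreases the index \<open>t\<close> by one.\<close>

lemma gface_face:
  "n \<le> t \<Longrightarrow> t < m \<Longrightarrow> c \<in> cells X m \<Longrightarrow> gface X g (m - 1) n (face X \<epsilon> m t c) =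
     face X \<epsilon> (m - n + free_dirs g n) (t - n + free_dirs g n) (gface X g m n c)"
proof (induction n arbitrary: m t c)
  case (Suc n)
  show ?case
  proof (cases "g n")
    case None
    have "m - n = Suc (m - Suc n)" "t - n = Suc (t - Suc n)" using Suc.prems by simp_all
    then show ?thesis using Suc.IH[of t m c] Suc.prems None by simp
  next
    case (Some \<delta>)
    have "gface X g (m - 1) (Suc n) (face X \<epsilon> m t c)
        = gface X g (m - 1 - 1) n (face X \<delta> (m - 1) n (face X \<epsilon> m t c))"
      using Some by simp
    also have "\<dots> = gface X g (m - 1 - 1) n (face X \<epsilon> (m - 1) (t - 1) (face X \<delta> m n c))"
      using face_face[of n t m c \<delta> \<epsilon>] Suc.prems by simp
    also have "\<dots> = face X \<epsilon> (m - 1 - n + free_dirs g n) (t - 1 - n + free_dirs g n) (gface X g (m - 1) n (face X \<delta> m n c))"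
      by (rule Suc.IH) (use Suc.prems face_cells in auto)
    finally show ?thesis using Some by simp
  qed
qed simp

text \<open>A direction \<open>j\<close> left free by \<open>g\<close> has index
  \<open>free_dirs g j\<close> in the resulting cube, so two rounds of faces merge into one
  assignment. This serves as a normal form: identities between iterated faces become identities
  between assignments.\<close>

lemma gface_gface:
  "n \<le> m \<Longrightarrow> c \<in> cells X m \<Longrightarrow>
   gface X h (m - n + free_dirs g n) (free_dirs g n) (gface X g m n c) =
   gface X (\<lambda>j. case g j of Some \<epsilon> \<Rightarrow> Some \<epsilon> | None \<Rightarrow> h (free_dirs g j)) m n c"
proof (induction n arbitrary: m c)
  case (Suc n)
  have mn: "m - n = Suc (m - Suc n)" "n \<le> m - 1" "m - 1 - n = m - Suc n" using Suc.prems by simp_all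
  show ?case
  proof (cases "g n")
    case None
    show ?thesis
    proof (cases "h (free_dirs g n)")
      case None
      then show ?thesis using Suc.IH[of m c] Suc.prems \<open>g n = None\<close> mn by simp
    next
      case (Some \<epsilon>)
      have "face X \<epsilon> (Suc (m - Suc n + free_dirs g n)) (free_dirs g n) (gface X g m n c)
          = gface X g (m - 1) n (face X \<epsilon> m n c)"
        using gface_face[of n n m c g \<epsilon>] Suc.prems mn by simp
      moreover have "gface X h (m - 1 - n + free_dirs g n) (free_dirs g n) (gface X g (m - 1) n (face X \<epsilon> m n c))
          = gface X (\<lambda>j. case g j of Some \<epsilon> \<Rightarrow> Some \<epsilon> | None \<Rightarrow> h (free_dirs g j)) (m - 1) n (face X \<epsilon> m n c)"
        by (rule Suc.IH) (use Suc.prems face_cells in auto)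
      ultimately show ?thesis using Some \<open>g n = None\<close> by simp
    qed
  next
    case (Some \<epsilon>)
    then show ?thesis using Suc.IH[of "m - 1" "face X \<epsilon> m n c"] Suc.prems mn face_cells[of n m c \<epsilon>] by simp
  qed
qed simp

end

lemma face_list_snoc:
  "face_list X \<epsilon> m (is @ [i]) c = face_list X \<epsilon> (m - 1) is (face X \<epsilon> m i c)"
  by (induction "is") auto

definition mask :: "nat set \<Rightarrow> bool \<Rightarrow> nat \<Rightarrow> bool option" where
  "mask I \<epsilon> j = (if j \<in> I then Some \<epsilon> else None)"

text \<open>A list of directions is applied from its last entry on, so removing the largest
  direction matches the recursion of \<open>gface\<close>.\<close>

lemma face_list_gface:
  "I \<subseteq> {0..<n} \<Longrightarrow> face_list X \<epsilon> m (sorted_list_of_set I) c = gface X (mask I \<epsilon>) m n c"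
proof (induction n arbitrary: I m c)
  case (Suc n)
  have fin: "finite I" using Suc.prems finite_subset by blast
  show ?case
  proof (cases "n \<in> I")
    case True
    have sub: "I - {n} \<subseteq> {0..<n}" using Suc.prems by (auto simp: less_Suc_eq)
    have "sorted_list_of_set I = sorted_list_of_set (I - {n}) @ [n]"
      by (rule sorted_distinct_set_unique)
        (use fin sub True in \<open>auto simp: sorted_append subset_iff less_imp_le\<close>)
    then have "face_list X \<epsilon> m (sorted_list_of_set I) c
        = gface X (mask (I - {n}) \<epsilon>) (m - 1) n (face X \<epsilon> m n c)"
      using Suc.IH[OF sub] by (simp add: face_list_snoc)
    also have "\<dots> = gface X (mask I \<epsilon>) (m - 1) n (face X \<epsilon> m n c)"
      by (rule gface_cong) (auto simp: mask_def)
    finally show ?thesis using True by (simp add: mask_def[of I \<epsilon> n])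
  next
    case False
    then have "I \<subseteq> {0..<n}" using Suc.prems less_Suc_eq by fastforce
    then show ?thesis using Suc.IH False by (simp add: mask_def[of I \<epsilon> n])
  qed
qed simp

lemma face_set_gface: "I \<subseteq> {0..<n} \<Longrightarrow> face_set X \<epsilon> n I c = gface X (mask I \<epsilon>) n n c"
  by (simp add: face_set_def face_list_gface)

text \<open>On a finite \<open>D\<close> this is the increasing bijection onto an initial segment.
  It renumbers the directions that remain when those outside \<open>D\<close> are collapsed.\<close>

definition rk :: "nat set \<Rightarrow> nat \<Rightarrow> nat" where
  "rk D j = card {x. x < j \<and> x \<in> D}"

lemma rk_less: "i < j \<Longrightarrow> i \<in> D \<Longrightarrow> rk D i < rk D j"
  unfolding rk_def by (rule psubset_card_mono) auto

lemma inj_on_rk: "inj_on (rk D) D"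
  by (rule inj_onI) (metis linorder_neqE_nat nat_neq_iff rk_less)

lemma bij_betw_rk:
  assumes "finite D"
  shows "bij_betw (rk D) D {0..<card D}"
proof -
  have "rk D j < card D" if "j \<in> D" for j
    unfolding rk_def by (rule psubset_card_mono) (use that assms in auto)
  then have "rk D ` D \<subseteq> {0..<card D}" by auto
  then have "rk D ` D = {0..<card D}"
    by (rule card_subset_eq[rotated]) (simp_all add: card_image[OF inj_on_rk])
  then show ?thesis using inj_on_rk by (simp add: bij_betw_def)
qed

lemma free_dirs_mask: "S \<subseteq> {0..<n} \<Longrightarrow> j \<le> n \<Longrightarrow> free_dirs (mask S \<epsilon>) j = rk ({0..<n} - S) j"
  unfolding free_dirs_def rk_def mask_def by (rule arg_cong[of _ _ card]) auto

lemma rk_all: "rk D n = card D" if "D \<subseteq> {0..<n}"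
  unfolding rk_def by (rule arg_cong[of _ _ card]) (use that in auto)

lemma face_set_cells:
  assumes "precubical X" "c \<in> cells X n" "I \<subseteq> {0..<n}"
  shows "face_set X \<epsilon> n I c \<in> cells X (card ({0..<n} - I))"
  using gface_cells[OF assms(1) order_refl assms(2), of "mask I \<epsilon>"] assms(3)
  by (simp add: face_set_gface free_dirs_mask rk_all)

text \<open>A direction of the intermediate cube is the rank in \<open>D\<close> of an original
  direction, so the set \<open>J\<close> of directions is traded for the set \<open>A\<close> of
  original ones.\<close>

lemma face_set_face_set:
  assumes X: "precubical X" and c: "c \<in> cells X n" and S: "S \<subseteq> {0..<n}" and D: "D = {0..<n} - S"
    and A: "A \<subseteq> D" and J: "J = rk D ` A"
  shows "face_set X \<epsilon> (card D) J (face_set X \<delta> n S c) =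
    gface X (\<lambda>j. if j \<in> S then Some \<delta> else if j \<in> A then Some \<epsilon> else None) n n c"
proof -
  have fD: "finite D" using D by simp
  have "J \<subseteq> {0..<card D}" using bij_betw_rk[OF fD] A J by (auto simp: bij_betw_def)
  then have "face_set X \<epsilon> (card D) J (face_set X \<delta> n S c)
      = gface X (mask J \<epsilon>) (card D) (card D) (gface X (mask S \<delta>) n n c)"
    using S by (simp add: face_set_gface)
  also have "\<dots> = gface X (\<lambda>j. case mask S \<delta> j of Some \<epsilon> \<Rightarrow> Some \<epsilon> | None \<Rightarrow> mask J \<epsilon> (free_dirs (mask S \<delta>) j)) n n c"
    using gface_gface[OF X order_refl c, of "mask J \<epsilon>" "mask S \<delta>"] S D rk_all[of D n]
    by (simp add: free_dirs_mask)
  also have "\<dots> = gface X (\<lambda>j. if j \<in> S then Some \<delta> else if j \<in> A then Some \<epsilon> else None) n n c"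
  proof (rule gface_cong)
    fix j assume j: "j < n"
    have "rk D j \<in> J \<longleftrightarrow> j \<in> A" if "j \<in> D"
      using inj_on_rk[of D] that A J by (meson inj_on_image_mem_iff)
    then show "(case mask S \<delta> j of Some \<epsilon> \<Rightarrow> Some \<epsilon> | None \<Rightarrow> mask J \<epsilon> (free_dirs (mask S \<delta>) j))
        = (if j \<in> S then Some \<delta> else if j \<in> A then Some \<epsilon> else None)"
      using j S D free_dirs_mask[OF S, of j \<delta>] by (auto simp: mask_def)
  qed
  finally show ?thesis .
qed

lemma rk_image_all: "finite D \<Longrightarrow> rk D ` D = {0..<card D}"
  using bij_betw_rk by (simp add: bij_betw_def)

lemma rk_image_diff: "finite D \<Longrightarrow> A \<subseteq> D \<Longrightarrow> {0..<card D} - rk D ` A = rk D ` (D - A)"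
  using inj_on_image_set_diff[OF inj_on_rk[of D], of D A] by (simp add: rk_image_all)

section \<open>Signs\<close>

definition proper_subsets :: "nat set \<Rightarrow> nat set set" where
  "proper_subsets D = {A. A \<subseteq> D \<and> A \<noteq> {} \<and> A \<noteq> D}"

lemma finite_proper_subsets: "finite D \<Longrightarrow> finite (proper_subsets D)"
  unfolding proper_subsets_def by (rule finite_subset[of _ "Pow D"]) auto

lemma bij_betw_proper_subsets:
  assumes "bij_betw f D E"
  shows "bij_betw ((`) f) (proper_subsets D) (proper_subsets E)"
proof -
  have "bij_betw ((`) f) (Pow D - {{}, D}) (Pow E - {{}, E})"
    using bij_betw_Pow[OF assms] assms
    by (intro bij_betw_DiffI) (auto simp: bij_betw_def inj_on_def)
  moreover have "proper_subsets D = Pow D - {{}, D}" "proper_subsets E = Pow E - {{}, E}"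
    by (auto simp: proper_subsets_def)
  ultimately show ?thesis by simp
qed

lemma sgn_set_eq: "(sgn_set I :: 'r::field) = (-1) ^ ((\<Sum>j\<in>I. j + 1) + (\<Sum>j=1..card I. j))"
proof -
  have "(a mod 2 = b mod 2) = even (a + b)" for a b :: nat by presburger
  then show ?thesis by (simp add: sgn_set_def minus_one_power_iff)
qed

lemma sum_triangle: "(\<Sum>j=1..a + b. j) = (\<Sum>j=1..a. j) + (\<Sum>j=1..b. j) + a * (b::nat)"
  by (induction b) (auto simp: algebra_simps)

lemma sum_rk: "finite A \<Longrightarrow> (\<Sum>a\<in>A. rk A a + 1) = (\<Sum>j=1..card A. j)"
proof -
  assume "finite A"
  then have "(\<Sum>a\<in>A. rk A a + 1) = (\<Sum>j\<in>{0..<card A}. j + 1)"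
    by (intro sum.reindex_bij_betw bij_betw_rk)
  also have "\<dots> = (\<Sum>j=1..card A. j)"
    by (rule sum.reindex_bij_witness[of _ "\<lambda>j. j - 1" "\<lambda>j. j + 1"]) auto
  finally show ?thesis .
qed

lemma rk_sum: "finite B \<Longrightarrow> rk B a = (\<Sum>b\<in>B. of_bool (b < a))"
proof -
  assume "finite B"
  then have "(\<Sum>b\<in>B. of_bool (b < a)) = card (B \<inter> {b. b < a})"
    by simp
  also have "B \<inter> {b. b < a} = {x. x < a \<and> x \<in> B}" by auto
  finally show ?thesis by (simp add: rk_def)
qed

text \<open>Every pair from \<open>A\<close> and \<open>B\<close> is counted exactly once, according
  to which member is smaller.\<close>

lemma sum_rk_swap:
  assumes "finite A" "finite B" "A \<inter> B = {}"
  shows "(\<Sum>a\<in>A. rk B a) + (\<Sum>b\<in>B. rk A b) = card A * card B"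
proof -
  have "(\<Sum>a\<in>A. rk B a) + (\<Sum>b\<in>B. rk A b) = (\<Sum>a\<in>A. \<Sum>b\<in>B. of_bool (b < a) + of_bool (a < b))"
    unfolding rk_sum[OF assms(1)] rk_sum[OF assms(2)] sum.distrib
    by (rule arg_cong[OF sum.swap])
  also have "\<dots> = (\<Sum>a\<in>A. \<Sum>b\<in>B. 1)"
    by (intro sum.cong refl) (use assms(3) in \<open>auto simp: not_less\<close>)
  finally show ?thesis by simp
qed

text \<open>The sign identity behind the vanishing of the double boundary. Nested sets arise by
  choosing \<open>D\<close> and then \<open>A\<close> inside it, or \<open>A\<close> and then
  \<open>D - A\<close> inside the complement of \<open>A\<close>. Both products are the sign of the
  shuffle that sorts the directions into \<open>A\<close>, \<open>D - A\<close> and the complement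
  of \<open>D\<close>.\<close>

lemma sgn_set_nested:
  assumes "A \<subseteq> D" "D \<subseteq> {0..<n}"
  shows "(sgn_set D * sgn_set (rk D ` A) :: 'r::field)
    = sgn_set A * sgn_set (rk ({0..<n} - A) ` (D - A))"
proof -
  define B where "B = D - A"
  define A' where "A' = {0..<n} - A"
  have "finite D" using assms(2) by (rule finite_subset) simp
  moreover from this have "finite A" using assms(1) by (rule finite_subset[rotated])
  ultimately have fin: "finite A" "finite B" "finite D" by (simp_all add: B_def)
  have DAB: "D = A \<union> B" "A \<inter> B = {}" "B \<subseteq> A'" using assms by (auto simp: B_def A'_def)
  have D: "card D = card A + card B" "(\<Sum>j\<in>D. j + 1) = (\<Sum>j\<in>A. j + 1) + (\<Sum>j\<in>B. j + 1)"
    using DAB fin by (simp_all add: card_Un_disjoint sum.union_disjoint)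
  have "rk D a = rk A a + rk B a" for a
  proof -
    have "{x. x < a \<and> x \<in> D} = {x. x < a \<and> x \<in> A} \<union> {x. x < a \<and> x \<in> B}" using DAB by auto
    then show ?thesis unfolding rk_def using DAB by (simp add: card_Un_disjoint disjoint_iff)
  qed
  then have "(\<Sum>a\<in>A. rk D a + 1) = (\<Sum>a\<in>A. rk A a + 1) + (\<Sum>a\<in>A. rk B a)"
    unfolding sum.distrib[symmetric] by (intro sum.cong) auto
  then have J: "(\<Sum>j\<in>rk D ` A. j + 1) = (\<Sum>j=1..card A. j) + (\<Sum>a\<in>A. rk B a)"
    using sum.reindex[OF inj_on_subset[OF inj_on_rk assms(1)], of "\<lambda>j. j + 1"] sum_rk[OF fin(1)]
    by (simp add: o_def)
  have cJ: "card (rk D ` A) = card A" using inj_on_subset[OF inj_on_rk assms(1)] by (rule card_image)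
  have "rk A' b + 1 + rk A b = b + 1" if b: "b \<in> B" for b
  proof -
    have "b < n" using b assms(2) by (auto simp: B_def)
    then have "{x. x < b \<and> x \<in> A'} \<union> {x. x < b \<and> x \<in> A} = {x. x < b}"
      by (auto simp: A'_def)
    moreover have "card ({x. x < b \<and> x \<in> A'} \<union> {x. x < b \<and> x \<in> A}) = rk A' b + rk A b"
      unfolding rk_def by (rule card_Un_disjoint) (auto simp: A'_def)
    ultimately have "b = rk A' b + rk A b" by (simp only: card_Collect_less_nat)
    then show ?thesis by linarith
  qed
  then have "(\<Sum>b\<in>B. rk A' b + 1) + (\<Sum>b\<in>B. rk A b) = (\<Sum>b\<in>B. b + 1)"
    unfolding sum.distrib[symmetric] by (rule sum.cong[OF refl])
  then have J': "(\<Sum>j\<in>rk A' ` B. j + 1) + (\<Sum>b\<in>B. rk A b) = (\<Sum>b\<in>B. b + 1)"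
    unfolding sum.reindex[OF inj_on_subset[OF inj_on_rk DAB(3)], of "\<lambda>j. j + 1"] o_def .
  have cJ': "card (rk A' ` B) = card B" using inj_on_subset[OF inj_on_rk DAB(3)] by (rule card_image)
  define e where "e = (\<Sum>j\<in>D. j + 1) + (\<Sum>j=1..card D. j)
    + ((\<Sum>j\<in>rk D ` A. j + 1) + (\<Sum>j=1..card (rk D ` A). j))"
  define e' where "e' = (\<Sum>j\<in>A. j + 1) + (\<Sum>j=1..card A. j)
    + ((\<Sum>j\<in>rk A' ` B. j + 1) + (\<Sum>j=1..card (rk A' ` B). j))"
  \<comment> \<open>Renumbering contributes the rank sums of \<open>A\<close> and \<open>B\<close>
    against each other, and the product \<open>card A * card B\<close> coming from the triangular
    numbers is the sum of both. Whatever the two exponents do not share therefore occurs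
    twice.\<close>
  have "e = e' + 2 * ((\<Sum>j=1..card A. j) + (\<Sum>a\<in>A. rk B a) + (\<Sum>b\<in>B. rk A b))"
    unfolding e_def e'_def D J cJ cJ' sum_triangle J'[symmetric]
      sum_rk_swap[OF fin(1,2) DAB(2), symmetric]
    by (simp only: mult_2 add_ac)
  then have "(-1) ^ e = ((-1) ^ e' :: 'r)" by (simp add: power_add power_mult)
  then show ?thesis unfolding sgn_set_eq power_add[symmetric] e_def e'_def A'_def B_def .
qed

section \<open>The boundary of a sequence of cubes\<close>

text \<open>\<open>I\<close> is the set of directions that are traversed in the first piece; the
  second piece starts where they are completed.\<close>

definition split_fst :: "'c precubical \<Rightarrow> nat \<times> 'c \<Rightarrow> nat set \<Rightarrow> nat \<times> 'c" where
  "split_fst X x I = (card I, face_set X False (fst x) ({0..<fst x} - I) (snd x))"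

definition split_snd :: "'c precubical \<Rightarrow> nat \<times> 'c \<Rightarrow> nat set \<Rightarrow> nat \<times> 'c" where
  "split_snd X x I = (card ({0..<fst x} - I), face_set X True (fst x) I (snd x))"

text \<open>For a chain with a single cube the exponent in the boundary is
  \<open>card I + 2\<close>, whence the sign \<open>(-1) ^ card I\<close>.\<close>

definition cube_bd :: "'c precubical \<Rightarrow> nat \<times> 'c \<Rightarrow> (nat \<times> 'c) list \<Rightarrow>\<^sub>0 'r::field" where
  "cube_bd X x = (\<Sum>I\<in>proper_subsets {0..<fst x}.
     Poly_Mapping.single [split_fst X x I, split_snd X x I] ((-1) ^ card I * sgn_set I))"

text \<open>The boundary as a graded derivation for concatenation. Passing \<open>x\<close> adds
  \<open>fst x\<close> and one position to the exponent, which for a cube of positive dimension has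
  the parity of \<open>fst x - 1\<close>, its dimension as a chain.\<close>

primrec list_bd :: "'c precubical \<Rightarrow> (nat \<times> 'c) list \<Rightarrow> (nat \<times> 'c) list \<Rightarrow>\<^sub>0 'r::field" where
  "list_bd X [] = 0"
| "list_bd X (x # cs) = lin (\<lambda>es. Poly_Mapping.single (es @ cs) 1) (cube_bd X x)
     + smul ((-1) ^ (fst x + 1)) (lin (\<lambda>es. Poly_Mapping.single (x # es) 1) (list_bd X cs))"

text \<open>The parity sign of the dimension of a chain; adding the length instead of subtracting it
  avoids truncation.\<close>

definition list_sgn :: "(nat \<times> 'c) list \<Rightarrow> 'r::field" where
  "list_sgn cs = (-1) ^ (sum_list (map fst cs) + length cs)"

lemma list_sgn_Cons: "list_sgn (x # cs) = (-1) ^ (fst x + 1) * list_sgn cs"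
  by (simp add: list_sgn_def power_add)

lemma list_bd_append:
  "list_bd X (cs @ ds) = lin (\<lambda>es. Poly_Mapping.single (es @ ds) 1) (list_bd X cs)
     + smul (list_sgn cs) (lin (\<lambda>es. Poly_Mapping.single (cs @ es) (1 :: 'r::field)) (list_bd X ds))"
proof (induction cs)
  case Nil
  then show ?case by (simp add: list_sgn_def lin_single_id)
next
  case (Cons x cs)
  show ?case
    by (simp add: Cons.IH lin_add lin_smul lin_lin smul_add list_sgn_Cons)
qed

lemma keys_cube_bd:
  "es \<in> Poly_Mapping.keys (cube_bd X x :: _ \<Rightarrow>\<^sub>0 'r::field) \<Longrightarrow>
    \<exists>I\<in>proper_subsets {0..<fst x}. es = [split_fst X x I, split_snd X x I]"
  unfolding cube_bd_def by (auto dest!: subsetD[OF keys_sum] split: if_splits)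

lemma keys_list_bd:
  "es \<in> Poly_Mapping.keys (list_bd X cs :: _ \<Rightarrow>\<^sub>0 'r::field) \<Longrightarrow>
    \<exists>us x vs. \<exists>I\<in>proper_subsets {0..<fst x}. cs = us @ x # vs \<and>
      es = us @ [split_fst X x I, split_snd X x I] @ vs"
proof (induction cs arbitrary: es)
  case (Cons x cs)
  have "es \<in> Poly_Mapping.keys (lin (\<lambda>es. Poly_Mapping.single (es @ cs) (1::'r)) (cube_bd X x))
    \<union> Poly_Mapping.keys (lin (\<lambda>es. Poly_Mapping.single (x # es) (1::'r)) (list_bd X cs))"
    using Cons.prems keys_smul[of "(-1) ^ (fst x + 1)"] Poly_Mapping.keys_add by fastforce
  then consider (1) es' where "es' \<in> Poly_Mapping.keys (cube_bd X x :: _ \<Rightarrow>\<^sub>0 'r)" "es = es' @ cs"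
    | (2) es' where "es' \<in> Poly_Mapping.keys (list_bd X cs :: _ \<Rightarrow>\<^sub>0 'r)" "es = x # es'"
    by (fastforce dest!: subsetD[OF keys_lin] split: if_splits)
  then show ?case
  proof cases
    case 1
    then show ?thesis using keys_cube_bd[OF 1(1)]
      by (intro exI[of _ "[]"] exI[of _ x] exI[of _ cs]) auto
  next
    case 2
    obtain us y vs I where "I \<in> proper_subsets {0..<fst y}" "cs = us @ y # vs"
      "es' = us @ [split_fst X y I, split_snd X y I] @ vs"
      using Cons.IH[OF 2(1)] by blast
    then show ?thesis using 2(2)
      by (intro exI[of _ "x # us"] exI[of _ y] exI[of _ vs]) auto
  qed
qed simp

lemma card_proper_subset:
  assumes "I \<in> proper_subsets {0..<n}"
  shows "card I + card ({0..<n} - I) = n" "0 < card I" "card I < n" "finite I" "I \<subseteq> {0..<n}"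
    "0 < card ({0..<n} - I)" "card ({0..<n} - I) = n - card I"
proof -
  have I: "I \<subseteq> {0..<n}" "I \<noteq> {}" "I \<noteq> {0..<n}" using assms by (auto simp: proper_subsets_def)
  show fin: "finite I" using I(1) by (rule finite_subset) simp
  show "I \<subseteq> {0..<n}" by fact
  show "0 < card I" using I fin by (simp add: card_gt_0_iff)
  have "card I < card {0..<n}" by (rule psubset_card_mono) (use I in auto)
  then show c: "card I < n" by simp
  show d: "card ({0..<n} - I) = n - card I" using card_Diff_subset[OF fin I(1)] by simp
  show "card I + card ({0..<n} - I) = n" "0 < card ({0..<n} - I)" using c d by simp_all
qed

text \<open>A split keeps the total dimension and adds one cube.\<close>

lemma list_sgn_keys:
  assumes "es \<in> Poly_Mapping.keys (list_bd X cs :: _ \<Rightarrow>\<^sub>0 'r::field)"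
  shows "list_sgn es = - (list_sgn cs :: 'r)"
proof -
  obtain us x vs I where I: "I \<in> proper_subsets {0..<fst x}" and "cs = us @ x # vs"
    "es = us @ [split_fst X x I, split_snd X x I] @ vs"
    using keys_list_bd[OF assms] by blast
  then have "sum_list (map fst es) + length es = Suc (sum_list (map fst cs) + length cs)"
    using card_proper_subset(1)[OF I] by (simp add: split_fst_def split_snd_def)
  then show ?thesis by (simp add: list_sgn_def)
qed

text \<open>The graded Leibniz rule is applied twice. The two cross terms, in which both
  \<open>cs\<close> and \<open>ds\<close> are split, carry opposite signs because splitting
  \<open>cs\<close> reverses its \<open>list_sgn\<close>.\<close>

lemma list_bd_bd_append:
  assumes "lin (list_bd X) (list_bd X cs) = (0 :: _ \<Rightarrow>\<^sub>0 'r::field)"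
    and "lin (list_bd X) (list_bd X ds) = (0 :: _ \<Rightarrow>\<^sub>0 'r)"
  shows "lin (list_bd X) (list_bd X (cs @ ds)) = (0 :: _ \<Rightarrow>\<^sub>0 'r)"
proof -
  let ?post = "\<lambda>ds es. Poly_Mapping.single (es @ ds) (1::'r)"
  let ?pre = "\<lambda>cs es. Poly_Mapping.single (cs @ es) (1::'r)"
  let ?F = "list_bd X cs :: _ \<Rightarrow>\<^sub>0 'r" and ?G = "list_bd X ds :: _ \<Rightarrow>\<^sub>0 'r"
  let ?cross = "lin (\<lambda>es. lin (?pre es) ?G) ?F"
  have "lin (list_bd X) (lin (?post ds) ?F) = lin (\<lambda>es. list_bd X (es @ ds)) ?F"
    by (simp add: lin_lin)
  also have "\<dots> = lin (\<lambda>es. lin (?post ds) (list_bd X es) + smul (- list_sgn cs) (lin (?pre es) ?G)) ?F"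
    by (rule lin_cong) (simp add: list_bd_append list_sgn_keys)
  also have "\<dots> = lin (?post ds) (lin (list_bd X) ?F) + smul (- list_sgn cs) ?cross"
    by (simp add: lin_fun_add lin_fun_smul lin_lin)
  finally have 1: "lin (list_bd X) (lin (?post ds) ?F) = smul (- list_sgn cs) ?cross"
    using assms(1) by simp
  have "lin (list_bd X) (lin (?pre cs) ?G) = lin (\<lambda>es. list_bd X (cs @ es)) ?G"
    by (simp add: lin_lin)
  also have "\<dots> = lin (\<lambda>es. lin (?post es) ?F + smul (list_sgn cs) (lin (?pre cs) (list_bd X es))) ?G"
    by (simp add: list_bd_append)
  also have "\<dots> = lin (\<lambda>es. lin (?post es) ?F) ?G + smul (list_sgn cs) (lin (?pre cs) (lin (list_bd X) ?G))"
    by (simp add: lin_fun_add lin_fun_smul lin_lin)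
  also have "lin (\<lambda>es. lin (?post es) ?F) ?G = ?cross"
    by (subst lin_swap) simp
  finally have 2: "lin (list_bd X) (lin (?pre cs) ?G) = ?cross"
    using assms(2) by simp
  have "smul (- list_sgn cs) ?cross + smul (list_sgn cs) ?cross = 0"
    by (simp add: smul_add_left[symmetric])
  then show ?thesis
    by (simp only: list_bd_append lin_add lin_smul 1 2)
qed

text \<open>Subsets of the renumbered directions are traded for subsets of the original
  ones.\<close>

lemma cube_bd_reindex:
  assumes "finite D"
  shows "(\<Sum>J\<in>proper_subsets {0..<card D}. f J) = (\<Sum>A\<in>proper_subsets D. f (rk D ` A))"
  using sum.reindex_bij_betw[OF bij_betw_proper_subsets[OF bij_betw_rk[OF assms]], of f] by simp

text \<open>Both ways of splitting an \<open>n\<close>-cube twice are indexed by a chain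
  \<open>A \<subset> D\<close> of sets of directions; the three pieces have the free directions \<open>A\<close>, \<open>D - A\<close> and
  the complement of \<open>D\<close>.\<close>

lemma list_bd_cube_bd:
  assumes X: "precubical X" and c: "c \<in> cells X n"
  shows "lin (list_bd X) (cube_bd X (n, c)) = (0 :: _ \<Rightarrow>\<^sub>0 'r::field)"
proof -
  let ?N = "{0..<n}" and ?x = "(n, c)"
  define piece where "piece A D = [(card A, gface X (\<lambda>j. if j \<in> A then None else Some False) n n c),
      (card (D - A), gface X (\<lambda>j. if j \<in> A then Some True else if j \<in> D then None else Some False) n n c),
      (card (?N - D), gface X (\<lambda>j. if j \<in> D then Some True else None) n n c)]" for A D
  \<comment> \<open>The factors \<open>(-1) ^ card D\<close> and \<open>(-1) ^ card A\<close> of the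
    two splittings combine to \<open>(-1) ^ card (D - A)\<close>.\<close>
  define co where "co A D = ((-1) ^ card (D - A) * (sgn_set D * sgn_set (rk D ` A)) :: 'r)" for A D
  have fst_part: "lin (\<lambda>es. Poly_Mapping.single (es @ [split_snd X ?x D]) 1) (cube_bd X (split_fst X ?x D))
      = (\<Sum>A\<in>proper_subsets D. Poly_Mapping.single (piece A D) ((-1) ^ card A * (sgn_set (rk D ` A) :: 'r)))"
    if D: "D \<in> proper_subsets ?N" for D
  proof -
    note D' = card_proper_subset[OF D]
    let ?S = "?N - D"
    have DS: "D = ?N - ?S" using D' by auto
    have pc: "Poly_Mapping.single ([split_fst X (split_fst X ?x D) (rk D ` A), split_snd X (split_fst X ?x D) (rk D ` A)]
          @ [split_snd X ?x D]) ((-1) ^ card (rk D ` A) * (sgn_set (rk D ` A) :: 'r))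
        = Poly_Mapping.single (piece A D) ((-1) ^ card A * sgn_set (rk D ` A))"
      if "A \<in> proper_subsets D" for A
    proof -
      have A: "A \<subseteq> D" using that by (simp add: proper_subsets_def)
      have cA: "card (rk D ` A) = card A" using inj_on_subset[OF inj_on_rk A] by (rule card_image)
      have cB: "card ({0..<card D} - rk D ` A) = card (D - A)"
        unfolding rk_image_diff[OF D'(4) A] using inj_on_subset[OF inj_on_rk, of "D - A" D]
        by (intro card_image) auto
      \<comment> \<open>All three cubes are brought to the normal form \<open>gface\<close> on the
        original cube, where the two orders of splitting become comparable.\<close>
      have f1: "face_set X False (card D) ({0..<card D} - rk D ` A) (face_set X False n ?S c)
          = gface X (\<lambda>j. if j \<in> A then None else Some False) n n c"
        by (subst face_set_face_set[OF X c, of ?S D "D - A"])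
          (use DS A rk_image_diff[OF D'(4) A] in \<open>auto intro!: gface_cong\<close>)
      have f2: "face_set X True (card D) (rk D ` A) (face_set X False n ?S c)
          = gface X (\<lambda>j. if j \<in> A then Some True else if j \<in> D then None else Some False) n n c"
        by (subst face_set_face_set[OF X c, of ?S D A]) (use DS A in \<open>auto intro!: gface_cong\<close>)
      have f3: "face_set X True n D c = gface X (\<lambda>j. if j \<in> D then Some True else None) n n c"
        unfolding face_set_gface[OF D'(5)] by (rule gface_cong) (simp add: mask_def)
      show ?thesis using f1 f2 f3 cA cB by (simp add: split_fst_def split_snd_def piece_def)
    qed
    have "cube_bd X (split_fst X ?x D) = (\<Sum>A\<in>proper_subsets D.
        Poly_Mapping.single [split_fst X (split_fst X ?x D) (rk D ` A), split_snd X (split_fst X ?x D) (rk D ` A)]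
          ((-1) ^ card (rk D ` A) * (sgn_set (rk D ` A) :: 'r)))"
      unfolding cube_bd_def by (simp add: split_fst_def[of X ?x] cube_bd_reindex[OF D'(4)])
    then show ?thesis using pc by (simp add: lin_sum)
  qed
  have snd_part: "lin (\<lambda>es. Poly_Mapping.single (split_fst X ?x A # es) 1) (cube_bd X (split_snd X ?x A))
      = (\<Sum>B\<in>proper_subsets (?N - A). Poly_Mapping.single (piece A (A \<union> B)) ((-1) ^ card B * (sgn_set (rk (?N - A) ` B) :: 'r)))"
    if A: "A \<in> proper_subsets ?N" for A
  proof -
    note A' = card_proper_subset[OF A]
    let ?D = "?N - A"
    have pc: "Poly_Mapping.single (split_fst X ?x A # [split_fst X (split_snd X ?x A) (rk ?D ` B), split_snd X (split_snd X ?x A) (rk ?D ` B)])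
          ((-1) ^ card (rk ?D ` B) * (sgn_set (rk ?D ` B) :: 'r))
        = Poly_Mapping.single (piece A (A \<union> B)) ((-1) ^ card B * sgn_set (rk ?D ` B))"
      if "B \<in> proper_subsets ?D" for B
    proof -
      have B: "B \<subseteq> ?D" using that by (simp add: proper_subsets_def)
      have cB: "card (rk ?D ` B) = card B" using inj_on_subset[OF inj_on_rk B] by (rule card_image)
      have cC: "card ({0..<card ?D} - rk ?D ` B) = card (?N - (A \<union> B))"
      proof -
        have "?D - B = ?N - (A \<union> B)" by blast
        moreover have "card (rk ?D ` (?D - B)) = card (?D - B)"
          using inj_on_subset[OF inj_on_rk, of "?D - B" ?D] by (intro card_image) auto
        ultimately show ?thesis
          unfolding rk_image_diff[OF finite_Diff[OF finite_atLeastLessThan] B] by (simp only:)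
      qed
      have BA: "A \<union> B - A = B" using B by auto
      have f1: "face_set X False n (?N - A) c = gface X (\<lambda>j. if j \<in> A then None else Some False) n n c"
        by (subst face_set_gface) (auto intro!: gface_cong simp: mask_def)
      have f2: "face_set X False (card ?D) ({0..<card ?D} - rk ?D ` B) (face_set X True n A c)
          = gface X (\<lambda>j. if j \<in> A then Some True else if j \<in> A \<union> B then None else Some False) n n c"
        by (subst face_set_face_set[OF X c, of A ?D "?D - B"])
          (use A' B rk_image_diff[OF finite_Diff[OF finite_atLeastLessThan] B] in \<open>auto intro!: gface_cong\<close>)
      have f3: "face_set X True (card ?D) (rk ?D ` B) (face_set X True n A c)
          = gface X (\<lambda>j. if j \<in> A \<union> B then Some True else None) n n c"
        by (subst face_set_face_set[OF X c, of A ?D B]) (use A' B in \<open>auto intro!: gface_cong\<close>)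
      show ?thesis using f1 f2 f3 cB cC by (simp add: split_fst_def split_snd_def piece_def BA)
    qed
    have "cube_bd X (split_snd X ?x A) = (\<Sum>B\<in>proper_subsets ?D.
        Poly_Mapping.single [split_fst X (split_snd X ?x A) (rk ?D ` B), split_snd X (split_snd X ?x A) (rk ?D ` B)]
          ((-1) ^ card (rk ?D ` B) * (sgn_set (rk ?D ` B) :: 'r)))"
      unfolding cube_bd_def
      by (simp add: split_snd_def[of X ?x] cube_bd_reindex[OF finite_Diff[OF finite_atLeastLessThan]])
    then show ?thesis using pc by (simp add: lin_sum)
  qed
  have "lin (list_bd X) (cube_bd X ?x) = (\<Sum>D\<in>proper_subsets ?N. smul ((-1) ^ card D * sgn_set D)
      (list_bd X [split_fst X ?x D, split_snd X ?x D]) :: _ \<Rightarrow>\<^sub>0 'r)"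
    by (simp add: cube_bd_def lin_sum)
  also have "\<dots> = (\<Sum>D\<in>proper_subsets ?N. \<Sum>A\<in>proper_subsets D. Poly_Mapping.single (piece A D) (co A D))
      + (\<Sum>A\<in>proper_subsets ?N. \<Sum>B\<in>proper_subsets (?N - A). Poly_Mapping.single (piece A (A \<union> B)) (- co A (A \<union> B)))"
    unfolding sum.distrib[symmetric]
  proof (rule sum.cong[OF refl])
    fix D assume D: "D \<in> proper_subsets ?N"
    have "smul ((-1) ^ card D * sgn_set D) (list_bd X [split_fst X ?x D, split_snd X ?x D])
      = smul ((-1) ^ card D * sgn_set D) (lin (\<lambda>es. Poly_Mapping.single (es @ [split_snd X ?x D]) 1) (cube_bd X (split_fst X ?x D)))
      + smul ((-1) ^ card D * sgn_set D * (-1) ^ (card D + 1)) (lin (\<lambda>es. Poly_Mapping.single (split_fst X ?x D # es) (1::'r)) (cube_bd X (split_snd X ?x D)))"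
      by (simp add: smul_add lin_single_id split_fst_def[of X ?x D])
    also have "smul ((-1) ^ card D * sgn_set D) (lin (\<lambda>es. Poly_Mapping.single (es @ [split_snd X ?x D]) 1) (cube_bd X (split_fst X ?x D)))
      = (\<Sum>A\<in>proper_subsets D. Poly_Mapping.single (piece A D) (co A D))"
      unfolding fst_part[OF D] smul_sum
    proof (rule sum.cong[OF refl])
      fix A assume "A \<in> proper_subsets D"
      then have A: "A \<subseteq> D" by (simp add: proper_subsets_def)
      then have "card D = card (D - A) + card A"
        using card_Diff_subset[of A D] card_mono[of D A] card_proper_subset(4)[OF D] finite_subset by fastforce
      then have "((-1) ^ card D * (-1) ^ card A :: 'r) = (-1) ^ card (D - A)"
        by (simp add: power_add power_mult_distrib[symmetric])
      then show "smul ((-1) ^ card D * sgn_set D) (Poly_Mapping.single (piece A D) ((-1) ^ card A * sgn_set (rk D ` A)))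
        = Poly_Mapping.single (piece A D) (co A D)"
        by (simp add: co_def ac_simps)
    qed
    also have "smul ((-1) ^ card D * sgn_set D * (-1) ^ (card D + 1)) (lin (\<lambda>es. Poly_Mapping.single (split_fst X ?x D # es) (1::'r)) (cube_bd X (split_snd X ?x D)))
      = (\<Sum>B\<in>proper_subsets (?N - D). Poly_Mapping.single (piece D (D \<union> B)) (- co D (D \<union> B)))"
      unfolding snd_part[OF D] smul_sum
    proof (rule sum.cong[OF refl])
      fix B assume "B \<in> proper_subsets (?N - D)"
      then have B: "B \<subseteq> ?N - D" by (simp add: proper_subsets_def)
      then have BD: "D \<union> B - D = B" "D \<subseteq> D \<union> B" "D \<union> B \<subseteq> ?N"
        using card_proper_subset(5)[OF D] by auto
      \<comment> \<open>Passing the first piece contributes the exponent \<open>card D + 1\<close>;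
        against the sign of the outer split this leaves a minus, the source of the
        cancellation.\<close>
      have "((-1) ^ card D * (-1) ^ (card D + 1) :: 'r) = -1"
        by (simp add: power_mult_distrib[symmetric])
      moreover have "co D (D \<union> B) = (-1) ^ card B * (sgn_set D * sgn_set (rk (?N - D) ` B))"
        using sgn_set_nested[OF BD(2,3), where 'r = 'r] by (simp only: co_def BD(1))
      ultimately show "smul ((-1) ^ card D * sgn_set D * (-1) ^ (card D + 1)) (Poly_Mapping.single (piece D (D \<union> B)) ((-1) ^ card B * sgn_set (rk (?N - D) ` B)))
        = Poly_Mapping.single (piece D (D \<union> B)) (- co D (D \<union> B))"
        by (simp add: mult_ac)
    qed
    finally show "smul ((-1) ^ card D * sgn_set D) (list_bd X [split_fst X ?x D, split_snd X ?x D])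
      = (\<Sum>A\<in>proper_subsets D. Poly_Mapping.single (piece A D) (co A D))
      + (\<Sum>B\<in>proper_subsets (?N - D). Poly_Mapping.single (piece D (D \<union> B)) (- co D (D \<union> B)))" .
  qed
  also have "(\<Sum>A\<in>proper_subsets ?N. \<Sum>B\<in>proper_subsets (?N - A). Poly_Mapping.single (piece A (A \<union> B)) (- co A (A \<union> B)))
      = (\<Sum>D\<in>proper_subsets ?N. \<Sum>A\<in>proper_subsets D. Poly_Mapping.single (piece A D) (- co A D))"
  proof -
    have fin: "finite (proper_subsets (?N - A))" "A \<in> proper_subsets ?N \<Longrightarrow> finite (proper_subsets A)" for A
      by (simp_all add: finite_proper_subsets card_proper_subset(4))
    \<comment> \<open>With \<open>D = A \<union> B\<close> both sums run over the same pairs of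
      nested sets, since \<open>B\<close> is recovered as \<open>D - A\<close>.\<close>
    have "(\<Sum>(A, B)\<in>(SIGMA A:proper_subsets ?N. proper_subsets (?N - A)). Poly_Mapping.single (piece A (A \<union> B)) (- co A (A \<union> B)))
      = (\<Sum>(D, A)\<in>(SIGMA D:proper_subsets ?N. proper_subsets D). Poly_Mapping.single (piece A D) (- co A D))"
      by (rule sum.reindex_bij_witness[of _ "\<lambda>(D, A). (A, D - A)" "\<lambda>(A, B). (A \<union> B, A)"])
        (auto simp: proper_subsets_def Un_absorb1 subset_iff)
    then show ?thesis
      using fin by (simp add: sum.Sigma finite_proper_subsets)
  qed
  also have "(\<Sum>D\<in>proper_subsets ?N. \<Sum>A\<in>proper_subsets D. Poly_Mapping.single (piece A D) (co A D))
      + (\<Sum>D\<in>proper_subsets ?N. \<Sum>A\<in>proper_subsets D. Poly_Mapping.single (piece A D) (- co A D)) = 0"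
    by (simp add: sum.distrib[symmetric] single_add[symmetric])
  finally show ?thesis .
qed

lemma list_bd_list_bd:
  assumes "precubical X" "set cs \<subseteq> cubes X"
  shows "lin (list_bd X) (list_bd X cs) = (0 :: _ \<Rightarrow>\<^sub>0 'r::field)"
  using assms(2)
proof (induction cs)
  case (Cons x cs)
  have "lin (list_bd X) (cube_bd X x) = (0 :: _ \<Rightarrow>\<^sub>0 'r)"
    using list_bd_cube_bd[OF assms(1), of "snd x" "fst x"] Cons.prems by (auto simp: cubes_def)
  then have "lin (list_bd X) (list_bd X [x]) = (0 :: _ \<Rightarrow>\<^sub>0 'r)"
    by (simp add: lin_single_id)
  then show ?case
    using list_bd_bd_append[of X "[x]" cs] Cons by simp
qed simp

text \<open>Identifies the explicit signed sum with the recursive derivation, so that later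
  computations with the boundary need no indices.\<close>

lemma boundary_chain_eq:
  "boundary_chain X (v, cs, w) = lin (\<lambda>es. Poly_Mapping.single (v, es, w) (1 :: 'r::field)) (list_bd X cs)"
proof -
  have split: "split_cube X k I cs = take k cs @ [split_fst X (cs ! k) I, split_snd X (cs ! k) I] @ drop (Suc k) cs" for k I cs
    by (simp add: split_cube_def split_fst_def split_snd_def split_beta Let_def)
  \<comment> \<open>Cardinalities from \<open>1\<close> to \<open>n - 1\<close> are exactly those of
    the nonempty proper subsets.\<close>
  have PI: "(\<Sum>r\<in>{1..<n}. \<Sum>I\<in>{I. I \<subseteq> {0..<n} \<and> card I = r}. g r I) = (\<Sum>I\<in>proper_subsets {0..<n}. g (card I) I)"
    for n :: nat and g :: "nat \<Rightarrow> nat set \<Rightarrow> 'c chain \<Rightarrow>\<^sub>0 'r"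
  proof -
    have "(\<Sum>r\<in>{1..<n}. \<Sum>I\<in>{I. I \<subseteq> {0..<n} \<and> card I = r}. g r I)
      = (\<Sum>(r, I)\<in>(SIGMA r:{1..<n}. {I. I \<subseteq> {0..<n} \<and> card I = r}). g r I)"
      by (rule sum.Sigma) auto
    also have "\<dots> = (\<Sum>I\<in>proper_subsets {0..<n}. g (card I) I)"
    proof (rule sum.reindex_bij_witness[of _ "\<lambda>I. (card I, I)" snd])
      fix I assume I: "I \<in> proper_subsets {0..<n}"
      then show "(card I, I) \<in> (SIGMA r:{1..<n}. {I. I \<subseteq> {0..<n} \<and> card I = r})"
        using card_proper_subset[OF I] by simp
    next
      fix z assume "z \<in> (SIGMA r:{1..<n}. {I. I \<subseteq> {0..<n} \<and> card I = r})"
      then show "snd z \<in> proper_subsets {0..<n}"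
        by (auto simp: proper_subsets_def)
    qed auto
    finally show ?thesis .
  qed
  have "(\<Sum>k<length cs. \<Sum>I\<in>proper_subsets {0..<fst (cs ! k)}. Poly_Mapping.single (v, split_cube X k I cs, w)
      ((-1) ^ (sum_list (map fst (take k cs)) + (k + 1) + card I + 1) * sgn_set I))
    = lin (\<lambda>es. Poly_Mapping.single (v, es, w) (1::'r)) (list_bd X cs)"
  proof (induction cs)
    case (Cons x cs)
    have 0: "(\<Sum>I\<in>proper_subsets {0..<fst ((x # cs) ! 0)}. Poly_Mapping.single (v, split_cube X 0 I (x # cs), w)
        ((-1) ^ (sum_list (map fst (take 0 (x # cs))) + (0 + 1) + card I + 1) * sgn_set I))
      = lin (\<lambda>es. Poly_Mapping.single (v, es, w) (1::'r)) (lin (\<lambda>es. Poly_Mapping.single (es @ cs) 1) (cube_bd X x))"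
      by (simp add: split cube_bd_def lin_sum)
    \<comment> \<open>Prepending \<open>x\<close> puts it into the prefix of every later position
      and adds \<open>fst x + 1\<close> to the exponent.\<close>
    have "(\<Sum>I\<in>proper_subsets {0..<fst ((x # cs) ! Suc k)}. Poly_Mapping.single (v, split_cube X (Suc k) I (x # cs), w)
        ((-1) ^ (sum_list (map fst (take (Suc k) (x # cs))) + (Suc k + 1) + card I + 1) * sgn_set I))
      = smul ((-1) ^ (fst x + 1)) (lin (\<lambda>(v, es, w). Poly_Mapping.single (v, x # es, w) (1::'r))
         (\<Sum>I\<in>proper_subsets {0..<fst (cs ! k)}. Poly_Mapping.single (v, split_cube X k I cs, w)
        ((-1) ^ (sum_list (map fst (take k cs)) + (k + 1) + card I + 1) * sgn_set I)))" for k
      by (simp add: split lin_sum smul_sum power_add mult.assoc)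
    then have "(\<Sum>k<length (x # cs). \<Sum>I\<in>proper_subsets {0..<fst ((x # cs) ! k)}. Poly_Mapping.single (v, split_cube X k I (x # cs), w)
      ((-1) ^ (sum_list (map fst (take k (x # cs))) + (k + 1) + card I + 1) * sgn_set I))
      = lin (\<lambda>es. Poly_Mapping.single (v, es, w) (1::'r)) (lin (\<lambda>es. Poly_Mapping.single (es @ cs) 1) (cube_bd X x))
      + smul ((-1) ^ (fst x + 1)) (lin (\<lambda>(v, es, w). Poly_Mapping.single (v, x # es, w) (1::'r))
         (\<Sum>k<length cs. \<Sum>I\<in>proper_subsets {0..<fst (cs ! k)}. Poly_Mapping.single (v, split_cube X k I cs, w)
        ((-1) ^ (sum_list (map fst (take k cs)) + (k + 1) + card I + 1) * sgn_set I)))"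
      using 0 unfolding length_Cons sum.lessThan_Suc_shift by (simp only: lin_sum smul_sum)
    then show ?case
      by (simp only: Cons.IH) (simp add: lin_add lin_smul lin_lin)
  qed simp
  then show ?thesis
    unfolding boundary_chain_def prod.case Let_def PI .
qed

lemma boundary_eq: "boundary X f = lin (boundary_chain X) f"
  by (simp add: boundary_def ext_by_def smul_def)

section \<open>Cube chains\<close>

lemma mem_cubes: "x \<in> cubes X \<longleftrightarrow> snd x \<in> cells X (fst x)"
  by (cases x) (simp add: cubes_def)

lemma vertex_gface: "vertex X \<epsilon> x = gface X (\<lambda>j. Some \<epsilon>) (fst x) (fst x) (snd x)"
  unfolding vertex_def split_beta face_set_gface[OF order_refl]
  by (rule gface_cong) (simp add: mask_def)

lemma vertex_cells:
  assumes "precubical X" "x \<in> cubes X"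
  shows "vertex X \<epsilon> x \<in> cells X 0"
  using gface_cells[OF assms(1) order_refl, of "snd x" "fst x" "\<lambda>j. Some \<epsilon>"] assms(2)
  by (simp add: vertex_gface mem_cubes free_dirs_def)

lemma cube_chain_Nil [simp]: "cube_chain X v [] w \<longleftrightarrow> v = w \<and> v \<in> cells X 0"
  by (auto simp: cube_chain_def)

text \<open>Replaces the indexed matching conditions by a recursion that carries the current vertex
  along.\<close>

lemma cube_chain_Cons:
  assumes "precubical X"
  shows "cube_chain X v (c # cs) w \<longleftrightarrow>
    c \<in> cubes X \<and> 0 < fst c \<and> vertex X False c = v \<and> cube_chain X (vertex X True c) cs w"
proof (cases cs)
  case Nil
  then show ?thesis
    using vertex_cells[OF assms, of c] by (auto simp: cube_chain_def)
next
  case (Cons d ds)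
  have "(\<forall>k. Suc k < length (c # cs) \<longrightarrow> vertex X True ((c # cs) ! k) = vertex X False ((c # cs) ! Suc k)) \<longleftrightarrow>
    vertex X True c = vertex X False (hd cs) \<and>
    (\<forall>k. Suc k < length cs \<longrightarrow> vertex X True (cs ! k) = vertex X False (cs ! Suc k))"
    unfolding Cons by (auto simp: less_Suc_eq_0_disj nth_Cons split: nat.splits)
  then show ?thesis
    using vertex_cells[OF assms, of c] Cons unfolding cube_chain_def by auto
qed

lemma cube_chain_append:
  assumes "precubical X"
  shows "cube_chain X v (cs @ ds) w \<longleftrightarrow> (\<exists>x. cube_chain X v cs x \<and> cube_chain X x ds w)"
proof (induction cs arbitrary: v)
  case Nil
  have "cube_chain X v ds w \<Longrightarrow> v \<in> cells X 0" by (simp add: cube_chain_def)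
  then show ?case by auto
qed (auto simp: cube_chain_Cons[OF assms])

lemma cube_chain_end_unique:
  assumes "precubical X" "cube_chain X v cs w" "cube_chain X v cs w'"
  shows "w = w'"
  using assms(2,3) by (induction cs arbitrary: v) (auto simp: cube_chain_Cons[OF assms(1)])

lemma cube_chain_start_unique:
  assumes "precubical X" "cube_chain X v cs w" "cube_chain X v' cs w"
  shows "v = v'"
  using assms(2,3) by (cases cs) (auto simp: cube_chain_Cons[OF assms(1)])

lemma cube_chainD:
  assumes "cube_chain X v cs w"
  shows "v \<in> cells X 0" "w \<in> cells X 0" "set cs \<subseteq> cubes X" "\<And>c. c \<in> set cs \<Longrightarrow> 0 < fst c"
  using assms by (auto simp: cube_chain_def)

text \<open>\<open>chain_dim\<close> is a truncated difference; for cubes of positive dimension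
  nothing is truncated.\<close>

lemma chain_dim_sum:
  assumes "\<And>c. c \<in> set cs \<Longrightarrow> 0 < fst c"
  shows "chain_dim cs + length cs = sum_list (map fst cs)"
proof -
  have "length cs \<le> sum_list (map fst cs)"
    using assms by (induction cs) (auto simp: Suc_le_eq add_mono dest: less_imp_Suc_add, force)
  then show ?thesis by (simp add: chain_dim_def)
qed

lemma chain_dim_append:
  assumes "\<And>c. c \<in> set (cs @ ds) \<Longrightarrow> 0 < fst c"
  shows "chain_dim (cs @ ds) = chain_dim cs + chain_dim ds"
  using chain_dim_sum[of cs] chain_dim_sum[of ds] chain_dim_sum[of "cs @ ds"] assms by auto

lemma chain_dim_Cons: "(\<And>c. c \<in> set (x # cs) \<Longrightarrow> 0 < fst c) \<Longrightarrow> chain_dim (x # cs) = fst x - 1 + chain_dim cs"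
  using chain_dim_append[of "[x]" cs] by (auto simp: chain_dim_def)

lemma chain_dim_0_iff:
  "(\<And>c. c \<in> set cs \<Longrightarrow> 0 < fst c) \<Longrightarrow> chain_dim cs = 0 \<longleftrightarrow> (\<forall>c\<in>set cs. fst c = 1)"
proof (induction cs)
  case (Cons x cs)
  have "0 < fst x" using Cons.prems by simp
  then have "fst x - 1 = 0 \<longleftrightarrow> fst x = 1" by arith
  moreover have "chain_dim cs = 0 \<longleftrightarrow> (\<forall>c\<in>set cs. fst c = 1)" using Cons by simp
  moreover have "chain_dim (x # cs) = fst x - 1 + chain_dim cs"
    by (rule chain_dim_Cons) (rule Cons.prems)
  ultimately show ?case by simp
qed (simp add: chain_dim_def)

lemma Ch_iff: "(v, cs, w) \<in> Ch X m \<longleftrightarrow> cube_chain X v cs w \<and> chain_dim cs = m"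
  by (simp add: Ch_def)

lemma Ch_append:
  assumes "precubical X" "(v, cs, x) \<in> Ch X m" "(x, ds, w) \<in> Ch X n"
  shows "(v, cs @ ds, w) \<in> Ch X (m + n)"
proof -
  have "chain_dim (cs @ ds) = chain_dim cs + chain_dim ds"
    using assms(2,3) by (intro chain_dim_append) (auto simp: Ch_iff dest: cube_chainD(4))
  then show ?thesis using assms by (auto simp: Ch_iff cube_chain_append)
qed

lemma Ch_0_iff: "(v, cs, w) \<in> Ch X 0 \<longleftrightarrow> cube_chain X v cs w \<and> (\<forall>c\<in>set cs. fst c = 1)"
  unfolding Ch_iff using chain_dim_0_iff[of cs] cube_chainD(4) by metis

lemma Ch_appendE:
  assumes "precubical X" "(v, cs @ ds, w) \<in> Ch X m"
  obtains x i j where "(v, cs, x) \<in> Ch X i" "(x, ds, w) \<in> Ch X j" "m = i + j"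
proof -
  from assms obtain x where x: "cube_chain X v cs x" "cube_chain X x ds w"
    by (auto simp: Ch_iff cube_chain_append)
  have "chain_dim (cs @ ds) = chain_dim cs + chain_dim ds"
    using x by (intro chain_dim_append) (auto dest: cube_chainD(4))
  then show ?thesis using that x assms(2) by (auto simp: Ch_iff)
qed

text \<open>Vertices are faces with every direction prescribed, so each equation compares two
  assignments of end values to the directions.\<close>

lemma split_cubes:
  assumes X: "precubical X" and x: "x \<in> cubes X" and I: "I \<in> proper_subsets {0..<fst x}"
  shows "split_fst X x I \<in> cubes X" "split_snd X x I \<in> cubes X"
    "vertex X False (split_fst X x I) = vertex X False x"
    "vertex X True (split_snd X x I) = vertex X True x"
    "vertex X True (split_fst X x I) = vertex X False (split_snd X x I)"
proof -
  define n where "n = fst x"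
  define c where "c = snd x"
  note I = card_proper_subset[OF I, folded n_def]
  have c: "c \<in> cells X n" using x by (simp add: mem_cubes n_def c_def)
  have II: "{0..<n} - ({0..<n} - I) = I" using I(5) by blast
  show "split_fst X x I \<in> cubes X" "split_snd X x I \<in> cubes X"
    using face_set_cells[OF X c, of "{0..<n} - I"] face_set_cells[OF X c I(5)] II
    by (auto simp: mem_cubes split_fst_def split_snd_def n_def c_def)
  have v: "vertex X \<epsilon> (card D, face_set X \<delta> n S c) = gface X (\<lambda>j. if j \<in> S then Some \<delta> else Some \<epsilon>) n n c"
    if "S \<subseteq> {0..<n}" "D = {0..<n} - S" for S D \<epsilon> \<delta>
  proof -
    have "vertex X \<epsilon> (card D, face_set X \<delta> n S c) = face_set X \<epsilon> (card D) (rk D ` D) (face_set X \<delta> n S c)"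
      using that by (simp add: vertex_def rk_image_all)
    also have "\<dots> = gface X (\<lambda>j. if j \<in> S then Some \<delta> else Some \<epsilon>) n n c"
      by (subst face_set_face_set[OF X c that order_refl refl])
        (use that in \<open>auto intro!: gface_cong\<close>)
    finally show ?thesis .
  qed
  have 1: "vertex X \<epsilon> (split_fst X x I) = gface X (\<lambda>j. if j \<in> {0..<n} - I then Some False else Some \<epsilon>) n n c" for \<epsilon>
    using v[of "{0..<n} - I" I \<epsilon> False] II by (simp add: split_fst_def n_def c_def)
  have 2: "vertex X \<epsilon> (split_snd X x I) = gface X (\<lambda>j. if j \<in> I then Some True else Some \<epsilon>) n n c" for \<epsilon>
    using v[OF I(5) refl, of \<epsilon> True] by (simp add: split_snd_def n_def c_def)
  show "vertex X False (split_fst X x I) = vertex X False x"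
    "vertex X True (split_snd X x I) = vertex X True x"
    "vertex X True (split_fst X x I) = vertex X False (split_snd X x I)"
    unfolding 1 2 vertex_gface[of X _ x] n_def[symmetric] c_def[symmetric]
    by (auto intro!: gface_cong)
qed

text \<open>The pieces of a split cube meet in a common vertex and keep its two extreme vertices, so
  the chain stays connected. The total dimension is preserved while the length grows by one.\<close>

lemma cube_chain_list_bd:
  assumes X: "precubical X" and cs: "cube_chain X v cs w"
    and es: "es \<in> Poly_Mapping.keys (list_bd X cs :: _ \<Rightarrow>\<^sub>0 'r::field)"
  shows "cube_chain X v es w" "Suc (chain_dim es) = chain_dim cs"
proof -
  obtain us x vs I where I: "I \<in> proper_subsets {0..<fst x}" and e: "cs = us @ x # vs"
    "es = us @ [split_fst X x I, split_snd X x I] @ vs"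
    using keys_list_bd[OF es] by blast
  have x: "x \<in> cubes X" using cs e cube_chainD(3) by fastforce
  note s = split_cubes[OF X x I] and I' = card_proper_subset[OF I]
  have pos: "0 < fst (split_fst X x I)" "0 < fst (split_snd X x I)"
    using I' by (simp_all add: split_fst_def split_snd_def)
  show es': "cube_chain X v es w"
    using cs s pos unfolding e by (auto simp: cube_chain_append[OF X] cube_chain_Cons[OF X])
  have "chain_dim es + length es = sum_list (map fst es)" "chain_dim cs + length cs = sum_list (map fst cs)"
    using chain_dim_sum cube_chainD(4)[OF es'] cube_chainD(4)[OF cs] by blast+
  moreover have "sum_list (map fst es) = sum_list (map fst cs)"
    using I'(1) by (simp add: e split_fst_def split_snd_def)
  ultimately have "chain_dim es + length es = chain_dim cs + length cs" by simp
  then show "Suc (chain_dim es) = chain_dim cs" by (simp add: e)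
qed

text \<open>An edge has no nonempty proper set of directions, so there is nothing to split.\<close>

lemma list_bd_path:
  assumes "\<And>c. c \<in> set cs \<Longrightarrow> fst c = 1"
  shows "list_bd X cs = (0 :: _ \<Rightarrow>\<^sub>0 'r::field)"
proof -
  have "es \<notin> Poly_Mapping.keys (list_bd X cs :: _ \<Rightarrow>\<^sub>0 'r)" for es
  proof
    assume "es \<in> Poly_Mapping.keys (list_bd X cs :: _ \<Rightarrow>\<^sub>0 'r)"
    from keys_list_bd[OF this] obtain us x vs I where "I \<in> proper_subsets {0..<fst x}" "cs = us @ x # vs"
      by blast
    then show False using card_proper_subset(2,3)[of I "fst x"] assms[of x] by simp
  qed
  then show ?thesis by (metis all_not_in_conv keys_eq_empty)
qed

lemma list_sgn_path: "(\<And>c. c \<in> set cs \<Longrightarrow> fst c = 1) \<Longrightarrow> list_sgn cs = (1 :: 'r::field)"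
proof -
  assume "\<And>c. c \<in> set cs \<Longrightarrow> fst c = 1"
  then have "sum_list (map fst cs) = length cs" by (induction cs) auto
  then show ?thesis by (simp add: list_sgn_def mult_2[symmetric] power_mult)
qed

section \<open>Sub-precubical sets\<close>

locale sub_cub =
  fixes Y X :: "'c precubical"
  assumes X: "precubical X" and sub: "sub_precubical Y X"
begin

lemma Y: "precubical Y"
  using sub by (simp add: sub_precubical_def)

lemma cells_sub: "c \<in> cells Y n \<Longrightarrow> c \<in> cells X n"
  using sub by (auto simp: sub_precubical_def)

lemma cubes_sub: "c \<in> cubes Y \<Longrightarrow> c \<in> cubes X"
  using cells_sub by (auto simp: mem_cubes)

lemma gface_sub: "n \<le> m \<Longrightarrow> c \<in> cells Y m \<Longrightarrow> gface Y g m n c = gface X g m n c"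
proof (induction n arbitrary: m c)
  case (Suc n)
  have "face Y \<epsilon> m n c = face X \<epsilon> m n c" "face Y \<epsilon> m n c \<in> cells Y (m - 1)" for \<epsilon>
    using sub Suc.prems face_cells[OF Y, of n m c] by (auto simp: sub_precubical_def)
  then show ?case using Suc by (auto split: option.split)
qed simp

lemma face_set_sub: "I \<subseteq> {0..<n} \<Longrightarrow> c \<in> cells Y n \<Longrightarrow> face_set Y \<epsilon> n I c = face_set X \<epsilon> n I c"
  by (simp add: face_set_gface gface_sub)

lemma vertex_sub: "c \<in> cubes Y \<Longrightarrow> vertex Y \<epsilon> c = vertex X \<epsilon> c"
  by (simp add: vertex_gface gface_sub mem_cubes)

lemma split_sub:
  assumes "x \<in> cubes Y" "I \<subseteq> {0..<fst x}"
  shows "split_fst Y x I = split_fst X x I" "split_snd Y x I = split_snd X x I"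
  using assms by (simp_all add: split_fst_def split_snd_def face_set_sub mem_cubes)

lemma cube_bd_sub: "x \<in> cubes Y \<Longrightarrow> cube_bd Y x = cube_bd X x"
  unfolding cube_bd_def
  by (intro sum.cong refl) (simp add: split_sub proper_subsets_def)

lemma list_bd_sub: "set cs \<subseteq> cubes Y \<Longrightarrow> list_bd Y cs = list_bd X cs"
  by (induction cs) (simp_all add: cube_bd_sub)

text \<open>The condition on the initial vertex concerns the constant path, which contains no cube
  that could place it in \<open>Y\<close>.\<close>

lemma cube_chain_sub:
  "cube_chain Y v cs w \<longleftrightarrow> cube_chain X v cs w \<and> set cs \<subseteq> cubes Y \<and> v \<in> cells Y 0"
proof (induction cs arbitrary: v)
  case Nil
  then show ?case using cells_sub by auto
next
  case (Cons c cs)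
  show ?case
    using vertex_cells[OF Y, of c] cubes_sub[of c]
    by (auto simp: cube_chain_Cons[OF X] cube_chain_Cons[OF Y] Cons.IH vertex_sub)
qed

lemma cube_chain_sub_end: "cube_chain X v cs w \<Longrightarrow> set cs \<subseteq> cubes Y \<Longrightarrow> w \<in> cells Y 0 \<Longrightarrow> v \<in> cells Y 0"
proof (cases cs)
  case (Cons c cs')
  assume "cube_chain X v cs w" "set cs \<subseteq> cubes Y"
  then show ?thesis using vertex_cells[OF Y, of c False] Cons
    by (auto simp: cube_chain_Cons[OF X] vertex_sub)
qed simp

lemma Ch_sub: "(v, cs, w) \<in> Ch Y m \<longleftrightarrow> (v, cs, w) \<in> Ch X m \<and> set cs \<subseteq> cubes Y \<and> v \<in> cells Y 0"
  by (auto simp: Ch_iff cube_chain_sub)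

lemma boundary_chain_sub: "d \<in> Ch Y m \<Longrightarrow> boundary_chain Y d = boundary_chain X d"
  by (cases d) (auto simp: Ch_sub boundary_chain_eq list_bd_sub)

end

section \<open>The path algebra and its chain bimodules\<close>

definition cat :: "'c chain \<Rightarrow> 'c chain \<Rightarrow> 'c chain \<Rightarrow>\<^sub>0 'r::field" where
  "cat = (\<lambda>(v, cs, w) (v', ds, w'). if w = v' then Poly_Mapping.single (v, cs @ ds, w') 1 else 0)"

lemma cat_simp [simp]:
  "cat (v, cs, w) (v', ds, w') = (if w = v' then Poly_Mapping.single (v, cs @ ds, w') 1 else 0)"
  by (simp add: cat_def)

lemma path_mult_bil: "path_mult f g = bil cat f g"
  unfolding path_mult_def bil_def ext_by_def smul_sum cat_def
  by (intro sum.cong refl) (auto intro!: sum.cong)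

lemma path_mult_assoc: "path_mult (path_mult f g) h = path_mult f (path_mult g h)"
  unfolding path_mult_bil by (rule bil_assoc) (auto simp: cat_def split: prod.splits)

definition span :: "'k set \<Rightarrow> ('k \<Rightarrow>\<^sub>0 'r::field) set" where
  "span S = {f. Poly_Mapping.keys f \<subseteq> S}"

lemma span_sub: "add_subgroup (span S)"
  unfolding span_def by (rule add_subgroup_keys)

lemma span_mono: "S \<subseteq> T \<Longrightarrow> f \<in> span S \<Longrightarrow> f \<in> span T"
  by (auto simp: span_def)

lemma span_smul: "f \<in> span S \<Longrightarrow> smul r f \<in> span S"
  using keys_smul[of r f] by (auto simp: span_def)

lemma span_single: "k \<in> S \<Longrightarrow> Poly_Mapping.single k r \<in> span S"
  by (simp add: span_def)

lemma lin_span: "f \<in> span S \<Longrightarrow> (\<And>k. k \<in> S \<Longrightarrow> h k \<in> span T) \<Longrightarrow> lin h f \<in> span T"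
  unfolding span_def mem_Collect_eq by (rule keys_lin_subset) blast

lemma bil_span: "f \<in> span S \<Longrightarrow> g \<in> span T \<Longrightarrow> (\<And>k l. k \<in> S \<Longrightarrow> l \<in> T \<Longrightarrow> m k l \<in> span U) \<Longrightarrow> bil m f g \<in> span U"
  unfolding span_def mem_Collect_eq by (rule keys_bil_subset) blast

lemma span_induct [consumes 1, case_names zero single add]:
  assumes "f \<in> span S" and "P 0" "\<And>k r. k \<in> S \<Longrightarrow> P (Poly_Mapping.single k r)"
    and "\<And>f g. f \<in> span S \<Longrightarrow> g \<in> span S \<Longrightarrow> P f \<Longrightarrow> P g \<Longrightarrow> P (f + g)"
  shows "P f"
  using assms unfolding span_def mem_Collect_eq by (rule single_induct)

lemma path_mult_unit_left:
  assumes "finite V" "f \<in> span {(v, cs, w). v \<in> V}"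
  shows "path_mult (\<Sum>v\<in>V. Poly_Mapping.single (v, [], v) 1) f = f"
  using assms(2)
proof (induction rule: span_induct)
  case (single k r)
  then obtain v cs w where k: "k = (v, cs, w)" "v \<in> V" by auto
  have "path_mult (\<Sum>v\<in>V. Poly_Mapping.single (v, [], v) 1) (Poly_Mapping.single k r)
    = (\<Sum>u\<in>V. if u = v then Poly_Mapping.single k r else 0)"
    unfolding path_mult_bil bil_sum_left by (intro sum.cong) (auto simp: k)
  then show ?case using assms(1) k(2) by simp
qed (simp_all add: path_mult_bil bil_add_right)

lemma path_mult_unit_right:
  assumes "finite V" "f \<in> span {(v, cs, w). w \<in> V}"
  shows "path_mult f (\<Sum>v\<in>V. Poly_Mapping.single (v, [], v) 1) = f"
  using assms(2)
proof (induction rule: span_induct)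
  case (single k r)
  then obtain v cs w where k: "k = (v, cs, w)" "w \<in> V" by auto
  have "path_mult (Poly_Mapping.single k r) (\<Sum>v\<in>V. Poly_Mapping.single (v, [], v) 1)
    = (\<Sum>u\<in>V. if u = w then Poly_Mapping.single k r else 0)"
    unfolding path_mult_bil bil_sum_right by (intro sum.cong) (auto simp: k)
  then show ?case using assms(1) k(2) by simp
qed (simp_all add: path_mult_bil bil_add_left)

lemma path_mult_span:
  assumes "precubical X" "f \<in> span (Ch X m)" "g \<in> span (Ch X n)"
  shows "path_mult f g \<in> span (Ch X (m + n))"
  unfolding path_mult_bil
  by (rule bil_span[OF assms(2,3)])
    (auto simp: cat_def span_def split: prod.splits intro: Ch_append[OF assms(1)])

lemma Ch_cells: "Ch X n \<subseteq> {(v, cs, w). v \<in> cells X 0}" "Ch X n \<subseteq> {(v, cs, w). w \<in> cells X 0}"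
  by (auto simp: Ch_def dest: cube_chainD)

lemma boundary_chain_span:
  assumes "precubical X" "d \<in> Ch X (Suc n)"
  shows "boundary_chain X d \<in> span (Ch X n)"
proof -
  obtain v cs w where d: "d = (v, cs, w)" by (cases d)
  show ?thesis
    unfolding d boundary_chain_eq span_def mem_Collect_eq
    by (rule keys_lin_subset)
      (use assms d cube_chain_list_bd[OF assms(1), of v cs w] in \<open>auto simp: Ch_iff\<close>)
qed

lemma boundary_chain_boundary:
  assumes "precubical X" "d \<in> Ch X n"
  shows "boundary X (boundary_chain X d) = 0"
proof -
  obtain v cs w where d: "d = (v, cs, w)" by (cases d)
  then have "set cs \<subseteq> cubes X" using assms(2) by (auto simp: Ch_iff dest: cube_chainD)
  then have "lin (list_bd X) (list_bd X cs) = (0 :: _ \<Rightarrow>\<^sub>0 'b)"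
    by (rule list_bd_list_bd[OF assms(1)])
  then show ?thesis
    by (simp add: d boundary_eq boundary_chain_eq lin_lin flip: lin_lin[of "\<lambda>es. Poly_Mapping.single (v, es, w) 1"])
qed

lemma boundary_chain_0: "d \<in> Ch X 0 \<Longrightarrow> boundary_chain X d = 0"
  by (cases d) (simp add: boundary_chain_eq Ch_0_iff list_bd_path)

text \<open>Directed paths have boundary zero and sign one, so the graded Leibniz rule reduces to
  linearity over the path algebra.\<close>

lemma boundary_chain_cat:
  assumes "p \<in> Ch X 0"
  shows "lin (boundary_chain X) (cat p d) = lin (cat p) (boundary_chain X d :: _ \<Rightarrow>\<^sub>0 'r::field)"
    and "lin (boundary_chain X) (cat d p) = lin (\<lambda>x. cat x p) (boundary_chain X d :: _ \<Rightarrow>\<^sub>0 'r)"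
proof -
  obtain v cs w v' ps w' where d: "d = (v, cs, w)" "p = (v', ps, w')" by (cases d, cases p)
  then have "\<And>c. c \<in> set ps \<Longrightarrow> fst c = 1" using assms by (simp add: Ch_0_iff)
  then have "list_bd X ps = (0 :: _ \<Rightarrow>\<^sub>0 'r)" "list_sgn ps = (1 :: 'r)"
    by (simp_all add: list_bd_path list_sgn_path)
  then show "lin (boundary_chain X) (cat p d) = lin (cat p) (boundary_chain X d :: _ \<Rightarrow>\<^sub>0 'r)"
    and "lin (boundary_chain X) (cat d p) = lin (\<lambda>x. cat x p) (boundary_chain X d :: _ \<Rightarrow>\<^sub>0 'r)"
    by (auto simp: d boundary_chain_eq list_bd_append lin_lin)
qed

lemma boundary_path_mult:
  assumes "a \<in> span (Ch X 0)"
  shows "boundary X (path_mult a x) = path_mult a (boundary X x)"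
    and "boundary X (path_mult x a) = path_mult (boundary X x) a"
proof -
  have a: "k \<in> Poly_Mapping.keys a \<Longrightarrow> k \<in> Ch X 0" for k using assms by (auto simp: span_def)
  have "lin (boundary_chain X) (bil cat a x) = bil cat (lin (\<lambda>k. Poly_Mapping.single k 1) a) (lin (boundary_chain X) x)"
    by (rule lin_bil) (simp add: a boundary_chain_cat(1) bil_single_left)
  then show "boundary X (path_mult a x) = path_mult a (boundary X x)"
    by (simp add: boundary_eq path_mult_bil lin_single_id)
  have "lin (boundary_chain X) (bil cat x a) = bil cat (lin (boundary_chain X) x) (lin (\<lambda>k. Poly_Mapping.single k 1) a)"
    by (rule lin_bil) (simp add: a boundary_chain_cat(2) bil_single_right)
  then show "boundary X (path_mult x a) = path_mult (boundary X x) a"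
    by (simp add: boundary_eq path_mult_bil lin_single_id)
qed

text \<open>Finiteness of the vertex set makes the sum of the constant paths a unit of the path
  algebra.\<close>

locale fin_cub =
  fixes X :: "'c precubical"
  assumes X: "precubical X" and fin: "finite (cells X 0)"
begin

lemma carrier_path_algebra: "carrier (path_algebra (R :: 'r::field itself) X) = span (Ch X 0)"
  by (simp add: path_algebra_def span_def)

lemma path_one: "(\<Sum>v\<in>cells X 0. Poly_Mapping.single (v, [], v) 1) \<in> span (Ch X 0)"
  by (intro add_subgroup_sum span_sub span_single) (simp add: Ch_iff chain_dim_def)

lemma unit_left: "f \<in> span (Ch X n) \<Longrightarrow> path_mult \<one>\<^bsub>path_algebra R X\<^esub> f = f"
  using path_mult_unit_left[OF fin, of f] span_mono[OF Ch_cells(1), of f X n] by (simp add: path_algebra_def)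

lemma unit_right: "f \<in> span (Ch X n) \<Longrightarrow> path_mult f \<one>\<^bsub>path_algebra R X\<^esub> = f"
  using path_mult_unit_right[OF fin, of f] span_mono[OF Ch_cells(2), of f X n] by (simp add: path_algebra_def)

lemma ring_path_algebra: "ring (path_algebra (R :: 'r::field itself) X)"
proof (rule ringI)
  note sub = add_subgroupD[OF span_sub[of "Ch X 0", where 'b = 'r]]
  show "abelian_group (path_algebra R X)"
  proof (rule abelian_groupI)
    fix x assume "x \<in> carrier (path_algebra R X)"
    then show "\<exists>y\<in>carrier (path_algebra R X). y \<oplus>\<^bsub>path_algebra R X\<^esub> x = \<zero>\<^bsub>path_algebra R X\<^esub>"
      using sub(3) by (intro bexI[of _ "- x"]) (auto simp: path_algebra_def span_def)
  qed (use sub in \<open>auto simp: path_algebra_def span_def[symmetric] add_ac\<close>)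
  show "monoid (path_algebra R X)"
    by (rule monoidI)
      (use path_one path_mult_span[OF X, of _ 0 _ 0] unit_left unit_right in
        \<open>auto simp: path_mult_assoc path_algebra_def span_def[symmetric]\<close>)
qed (simp_all add: path_algebra_def path_mult_bil bil_add_left bil_add_right)

sublocale chains: bimod_complex "path_algebra (R :: 'r::field itself) X" "\<lambda>n. span (Ch X n)" "boundary X"
  path_mult path_mult
proof (rule bimod_complex.intro)
  fix a x :: "'c chain \<Rightarrow>\<^sub>0 'r" and n :: nat assume a: "a \<in> carrier (path_algebra R X)" and x: "x \<in> span (Ch X n)"
  then have a': "a \<in> span (Ch X 0)" by (simp add: carrier_path_algebra)
  show "path_mult a x \<in> span (Ch X n)" "path_mult x a \<in> span (Ch X n)"
    using path_mult_span[OF X a' x] path_mult_span[OF X x a'] by simp_all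
  show "boundary X (path_mult a x) = path_mult a (boundary X x)"
    "boundary X (path_mult x a) = path_mult (boundary X x) a"
    using boundary_path_mult[OF a'] by blast+
next
  fix x :: "'c chain \<Rightarrow>\<^sub>0 'r" and n assume x: "x \<in> span (Ch X n)"
  have "lin (boundary X \<circ> boundary_chain X) x = lin (\<lambda>_. 0) x"
    by (rule lin_cong) (use x in \<open>auto simp: span_def intro!: boundary_chain_boundary[OF X, of _ n]\<close>)
  then show "boundary X (boundary X x) = 0"
    by (simp add: boundary_eq[of X x] boundary_eq[of X "lin _ _"] lin_lin o_def boundary_eq[of X "boundary_chain X _"])
next
  fix x :: "'c chain \<Rightarrow>\<^sub>0 'r" and n assume "x \<in> span (Ch X (Suc n))"
  then show "boundary X x \<in> span (Ch X n)"
    unfolding boundary_eq by (rule lin_span) (rule boundary_chain_span[OF X])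
next
  fix x :: "'c chain \<Rightarrow>\<^sub>0 'r" assume x: "x \<in> span (Ch X 0)"
  have "lin (boundary_chain X) x = lin (\<lambda>_. 0) x"
    by (rule lin_cong) (use x in \<open>auto simp: span_def intro!: boundary_chain_0[of _ X]\<close>)
  then show "boundary X x = 0" by (simp add: boundary_eq)
qed (simp_all add: ring_path_algebra span_sub boundary_eq lin_add unit_left unit_right
  path_mult_assoc, simp_all add: path_algebra_def path_mult_bil bil_add_left bil_add_right path_mult_assoc[unfolded path_mult_bil])

end

section \<open>The homology modules\<close>

context fin_cub
begin

text \<open>The module with index \<open>Suc n\<close> is spanned by the \<open>n\<close>-cube
  chains, hence the shift between \<open>HM\<close> and the degree of the complex.\<close>

lemma HM_quotient:
  "additive_quotient (cycle_bimodule R X (Suc n)) (chains.B n)"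
  "HM R X (Suc n) = bimodule_quotient (cycle_bimodule R X (Suc n)) (chains.B n)"
  "carrier (cycle_bimodule R X (Suc n)) = chains.Z n"
proof -
  show "HM R X (Suc n) = bimodule_quotient (cycle_bimodule R X (Suc n)) (chains.B n)"
  proof -
    have "boundary X ` carrier (chain_bimodule R X (Suc n + 1)) = chains.B n"
      unfolding chains.B_def by (simp add: chain_bimodule_def span_def)
    then show ?thesis by (simp add: HM_def)
  qed
  show c: "carrier (cycle_bimodule R X (Suc n)) = chains.Z n"
    unfolding chains.Z_def by (simp add: cycle_bimodule_def chain_bimodule_def span_def)
  show "additive_quotient (cycle_bimodule R X (Suc n)) (chains.B n)"
  proof
    show "add (cycle_bimodule R X (Suc n)) = (+)"
      by (simp add: cycle_bimodule_def chain_bimodule_def)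
    show "chains.B n \<subseteq> carrier (cycle_bimodule R X (Suc n))"
      unfolding c using chains.B_Z by blast
  qed (rule chains.B_sub)
qed

lemma carrier_HM: "carrier (HM R X (Suc n)) = qt (chains.B n) ` chains.Z n"
  using additive_quotient.carrier_quotient[OF HM_quotient(1)] by (simp add: HM_quotient(2,3))

lemma zero_HM: "\<zero>\<^bsub>HM R X (Suc n)\<^esub> = qt (chains.B n) 0"
  using additive_quotient.zero_quotient[OF HM_quotient(1)] by (simp add: HM_quotient(2))

lemma add_HM: "qt (chains.B n) x \<oplus>\<^bsub>HM R X (Suc n)\<^esub> qt (chains.B n) y = qt (chains.B n) (x + y)"
  using additive_quotient.add_quotient[OF HM_quotient(1)] by (simp add: HM_quotient(2))

lemma smult_HM:
  assumes "a \<in> span (Ch X 0)"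
  shows "a \<odot>\<^bsub>HM R X (Suc n)\<^esub> qt (chains.B n) x = qt (chains.B n) (path_mult a x)"
proof -
  have "a \<odot>\<^bsub>HM R X (Suc n)\<^esub> qt (chains.B n) x = qt (chains.B n) (a \<odot>\<^bsub>cycle_bimodule R X (Suc n)\<^esub> x)"
    unfolding HM_quotient(2)
    by (rule additive_quotient.smult_quotient[OF HM_quotient(1)])
      (use assms chains.B_l[of a R] in \<open>simp add: cycle_bimodule_def chain_bimodule_def carrier_path_algebra chains.l_add\<close>)
  then show ?thesis by (simp add: cycle_bimodule_def chain_bimodule_def)
qed

lemma rsmult_HM:
  assumes "a \<in> span (Ch X 0)"
  shows "qt (chains.B n) x \<odot>\<^sub>r\<^bsub>HM R X (Suc n)\<^esub> a = qt (chains.B n) (path_mult x a)"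
proof -
  have "qt (chains.B n) x \<odot>\<^sub>r\<^bsub>HM R X (Suc n)\<^esub> a = qt (chains.B n) (x \<odot>\<^sub>r\<^bsub>cycle_bimodule R X (Suc n)\<^esub> a)"
    unfolding HM_quotient(2)
    by (rule additive_quotient.rsmult_quotient[OF HM_quotient(1)])
      (use assms chains.B_r[of a R] in \<open>simp add: cycle_bimodule_def chain_bimodule_def carrier_path_algebra chains.r_add\<close>)
  then show ?thesis by (simp add: cycle_bimodule_def chain_bimodule_def)
qed

lemma presented_HM:
  "presented_homology (path_algebra (R :: 'r::field itself) X) (\<lambda>n. span (Ch X n)) (boundary X) path_mult path_mult
    (\<lambda>n. HM R X (Suc n)) (\<lambda>n. qt (chains.B n))"
proof (rule presented_homology.intro[OF chains.bimod_complex_axioms presented_homology_axioms.intro])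
  fix x :: "'c chain \<Rightarrow>\<^sub>0 'r" and n
  show "(qt (chains.B n) x = \<zero>\<^bsub>HM R X (Suc n)\<^esub>) = (x \<in> chains.B n)"
    by (simp add: zero_HM qt_eq[OF chains.B_sub])
qed (simp_all add: add_HM smult_HM rsmult_HM carrier_path_algebra carrier_HM)

end

section \<open>Marked chains\<close>

text \<open>
  A basis of \<open>R[X] \<otimes> R\<^sub>m\<^sub>+\<^sub>1[Y] \<otimes> R[X]\<close> over \<open>R[Y]\<close> consists of the triples \<open>(q, c, r)\<close> of composable chains
  where \<open>c\<close> is an \<open>m\<close>-cube chain of \<open>Y\<close> and \<open>q\<close>, \<open>r\<close> are directed paths of \<open>X\<close> without edges in
  \<open>Y\<close>. Such a triple is encoded as the pair of the concatenated chain \<open>q c r\<close> and the length of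
  \<open>q\<close>, because the boundary does not change that length. The left action makes \<open>c\<close> absorb
  the edges of \<open>Y\<close> at the end of the left factor, which accounts for \<open>strip\<close>.
\<close>

definition strip :: "'a set \<Rightarrow> 'a list \<Rightarrow> nat" where
  "strip P us = length (dropWhile (\<lambda>c. c \<in> P) (rev us))"

lemma strip_append: "set s \<subseteq> P \<Longrightarrow> strip P (us @ s) = strip P us"
  unfolding strip_def by (subst rev_append, subst dropWhile_append2) auto

lemma strip_id: "us = [] \<or> last us \<notin> P \<Longrightarrow> strip P us = length us"
  by (cases us rule: rev_cases) (auto simp: strip_def)

lemma strip_disjoint: "set q \<inter> P = {} \<Longrightarrow> set s \<subseteq> P \<Longrightarrow> strip P (q @ s) = length q"
  using strip_append[of s P q] strip_id[of q P] by (metis disjoint_iff last_in_set)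

lemma stripE:
  obtains r s where "us = r @ s" "set s \<subseteq> P" "length r = strip P us"
proof
  let ?s = "rev (takeWhile (\<lambda>c. c \<in> P) (rev us))" and ?r = "rev (dropWhile (\<lambda>c. c \<in> P) (rev us))"
  show "us = ?r @ ?s" by (metis rev_append rev_rev_ident takeWhile_dropWhile_id)
  show "set ?s \<subseteq> P" by (auto dest: set_takeWhileD)
  show "length ?r = strip P us" by (simp add: strip_def)
qed

lemma strip_le: "strip P us \<le> length us"
  by (rule stripE[of us P]) (metis le_add1 length_append)

text \<open>Stripping a smaller set first and a larger one afterwards amounts to stripping the
  larger one at once. The case \<open>P = P'\<close> gives the module law of \<open>lact\<close>; a
  larger \<open>P'\<close> occurs when markings for the intersection become markings for a
  piece.\<close>

lemma strip_strip:
  assumes "P \<subseteq> P'"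
  shows "strip P' (ps @ take (strip P us) us) = strip P' (ps @ us)"
proof -
  obtain r s where rs: "us = r @ s" "set s \<subseteq> P" "length r = strip P us" by (rule stripE)
  then have "take (strip P us) us = r" by simp
  then show ?thesis using strip_append[of s P' "ps @ r"] rs assms by auto
qed

text \<open>\<open>take a cs\<close> is the left path of the marking. If it is nonempty its last
  edge is not in \<open>Y\<close>, so edges of \<open>ps\<close> are absorbed only when it is
  empty.\<close>

definition lact :: "'c precubical \<Rightarrow> 'c chain \<Rightarrow> 'c chain \<times> nat \<Rightarrow> 'c chain \<times> nat \<Rightarrow>\<^sub>0 'r::field" where
  "lact Y = (\<lambda>(v, ps, w) ((v', cs, w'), a). if w = v'
     then Poly_Mapping.single ((v, ps @ cs, w'), strip (cubes Y) (ps @ take a cs)) 1 else 0)"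

text \<open>Only the start of the middle chain is recorded, because its end is determined as the end
  of the maximal run in \<open>Y\<close>; hence extending on the right leaves the mark
  unchanged.\<close>

definition ract :: "'c chain \<times> nat \<Rightarrow> 'c chain \<Rightarrow> 'c chain \<times> nat \<Rightarrow>\<^sub>0 'r::field" where
  "ract = (\<lambda>((v, cs, w), a) (v', ps, w'). if w = v'
     then Poly_Mapping.single ((v, cs @ ps, w'), a) 1 else 0)"

definition mark_bd :: "'c precubical \<Rightarrow> 'c chain \<times> nat \<Rightarrow> 'c chain \<times> nat \<Rightarrow>\<^sub>0 'r::field" where
  "mark_bd X = (\<lambda>(d, a). lin (\<lambda>d'. Poly_Mapping.single (d', a) 1) (boundary_chain X d))"

lemma lact_simp [simp]: "lact Y (v, ps, w) ((v', cs, w'), a) = (if w = v'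
     then Poly_Mapping.single ((v, ps @ cs, w'), strip (cubes Y) (ps @ take a cs)) 1 else 0)"
  and ract_simp [simp]: "ract ((v, cs, w), a) (v', ps, w') = (if w = v'
     then Poly_Mapping.single ((v, cs @ ps, w'), a) 1 else 0)"
  and mark_bd_simp [simp]: "mark_bd X (d, a) = lin (\<lambda>d'. Poly_Mapping.single (d', a) 1) (boundary_chain X d)"
  by (simp_all add: lact_def ract_def mark_bd_def)

fun join :: "'c chain \<Rightarrow> 'c chain \<Rightarrow> 'c chain \<Rightarrow> 'c chain \<times> nat" where
  "join (v, qs, _) (_, cs, _) (_, rs, w) = ((v, qs @ cs @ rs, w), length qs)"

text \<open>Relative pairs enter only through these two factorizations of paths. They are isolated
  here because the intersection of the two pieces has to satisfy them as well.\<close>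

locale rel_cub = sub_cub Y X + fin_cub X for Y X :: "'c precubical" +
  assumes rel_start: "(v, cs, w) \<in> Ch X 0 \<Longrightarrow> v \<in> cells Y 0 \<Longrightarrow>
      \<exists>s q. cs = s @ q \<and> set s \<subseteq> cubes Y \<and> set q \<inter> cubes Y = {}"
    and rel_end: "(v, cs, w) \<in> Ch X 0 \<Longrightarrow> w \<in> cells Y 0 \<Longrightarrow>
      \<exists>q s. cs = q @ s \<and> set q \<inter> cubes Y = {} \<and> set s \<subseteq> cubes Y"
begin

definition lpaths :: "'c chain set" where
  "lpaths = {(v, qs, x). (v, qs, x) \<in> Ch X 0 \<and> x \<in> cells Y 0 \<and> set qs \<inter> cubes Y = {}}"

definition rpaths :: "'c chain set" where
  "rpaths = {(y, rs, w). (y, rs, w) \<in> Ch X 0 \<and> y \<in> cells Y 0 \<and> set rs \<inter> cubes Y = {}}"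

definition mid :: "nat \<Rightarrow> 'c chain \<Rightarrow> 'c chain \<Rightarrow> 'c chain set" where
  "mid m q r = {c \<in> Ch Y m. fst c = snd (snd q) \<and> snd (snd c) = fst r}"

definition marks :: "nat \<Rightarrow> ('c chain \<times> nat) set" where
  "marks m = {join q c r |q c r. q \<in> lpaths \<and> c \<in> mid m q r \<and> r \<in> rpaths}"

lemma marksI: "q \<in> lpaths \<Longrightarrow> c \<in> mid m q r \<Longrightarrow> r \<in> rpaths \<Longrightarrow> join q c r \<in> marks m"
  unfolding marks_def by blast

lemma marksE:
  assumes "k \<in> marks m"
  obtains v qs x cs y rs w where "k = ((v, qs @ cs @ rs, w), length qs)"
    "(v, qs, x) \<in> lpaths" "(x, cs, y) \<in> Ch Y m" "(y, rs, w) \<in> rpaths"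
proof -
  obtain q c r where k: "k = join q c r" "q \<in> lpaths" "c \<in> mid m q r" "r \<in> rpaths"
    using assms unfolding marks_def by blast
  then show ?thesis
    using that by (cases q, cases c, cases r) (auto simp: mid_def)
qed

text \<open>The outer paths may contain edges of \<open>Y\<close> next to the middle chain. These
  are moved into it, so any factorization with a middle chain in \<open>Y\<close> determines a
  marking.\<close>

lemma marks_split:
  assumes "(v, us, x) \<in> Ch X 0" "(x, cs, y) \<in> Ch Y m" "(y, vs, w) \<in> Ch X 0"
  shows "((v, us @ cs @ vs, w), strip (cubes Y) us) \<in> marks m"
proof -
  have xy: "x \<in> cells Y 0" "y \<in> cells Y 0" using assms(2) by (auto simp: Ch_def dest: cube_chainD)
  obtain qs s where qs: "us = qs @ s" "set qs \<inter> cubes Y = {}" "set s \<subseteq> cubes Y"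
    using rel_end[OF assms(1) xy(1)] by blast
  obtain s' rs where rs: "vs = s' @ rs" "set s' \<subseteq> cubes Y" "set rs \<inter> cubes Y = {}"
    using rel_start[OF assms(3) xy(2)] by blast
  obtain x' where x': "(v, qs, x') \<in> Ch X 0" "(x', s, x) \<in> Ch X 0"
    using assms(1) unfolding qs by (auto elim: Ch_appendE[OF X])
  obtain y' where y': "(y, s', y') \<in> Ch X 0" "(y', rs, w) \<in> Ch X 0"
    using assms(3) unfolding rs by (auto elim: Ch_appendE[OF X])
  have x'Y: "x' \<in> cells Y 0"
    using x'(2) qs(3) xy(1) cube_chain_sub_end by (auto simp: Ch_iff)
  have s: "(x', s, x) \<in> Ch Y 0" "(y, s', y') \<in> Ch Y 0"
    using x' y' qs rs xy x'Y by (auto simp: Ch_sub)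
  have y'Y: "y' \<in> cells Y 0" using s(2) by (auto simp: Ch_def dest: cube_chainD)
  have "(x', s @ cs @ s', y') \<in> Ch Y m"
    using Ch_append[OF Y s(1) Ch_append[OF Y assms(2) s(2)]] by simp
  then have "join (v, qs, x') (x', s @ cs @ s', y') (y', rs, w) \<in> marks m"
    using x' y' x'Y y'Y qs rs by (intro marksI) (auto simp: lpaths_def rpaths_def mid_def)
  then show ?thesis using qs rs by (simp add: strip_disjoint)
qed

text \<open>The mark gives the length of the first path, the middle chain is the maximal prefix of
  the rest inside \<open>Y\<close>, and the joining vertices are the end of the first and the start
  of the last path.\<close>

lemma join_inj:
  assumes "q \<in> lpaths" "c \<in> mid m q r" "r \<in> rpaths" "q' \<in> lpaths" "c' \<in> mid m' q' r'" "r' \<in> rpaths"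
    and "join q c r = join q' c' r'"
  shows "q = q' \<and> c = c' \<and> r = r'"
proof -
  obtain v qs x cs y rs w where e: "q = (v, qs, x)" "c = (x, cs, y)" "r = (y, rs, w)"
    using assms(2) by (cases q, cases c, cases r) (auto simp: mid_def)
  obtain v' qs' x' cs' y' rs' w' where e': "q' = (v', qs', x')" "c' = (x', cs', y')" "r' = (y', rs', w')"
    using assms(5) by (cases q', cases c', cases r') (auto simp: mid_def)
  have j: "v = v'" "qs = qs'" "cs @ rs = cs' @ rs'" "w = w'" using assms(7) by (auto simp: e e')
  have Ys: "set cs \<subseteq> cubes Y" "set cs' \<subseteq> cubes Y" "set rs \<inter> cubes Y = {}" "set rs' \<inter> cubes Y = {}"
    using assms by (auto simp: e e' mid_def Ch_sub rpaths_def)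
  have t: "cs = takeWhile (\<lambda>c. c \<in> cubes Y) (cs @ rs)" if "set cs \<subseteq> cubes Y" "set rs \<inter> cubes Y = {}" for cs rs
    using that by (subst takeWhile_append2) (cases rs; auto)+
  have "cs = cs'" using t[OF Ys(1,3)] t[OF Ys(2,4)] j(3) by simp
  then have "rs = rs'" using j(3) by simp
  moreover have "x = x'"
    using assms(1,4) j by (intro cube_chain_end_unique[OF X, of v qs]) (auto simp: e e' lpaths_def Ch_iff)
  moreover have "y = y'"
    using assms(3,6) j calculation(1)
    by (intro cube_chain_start_unique[OF X, of _ rs w]) (auto simp: e e' rpaths_def Ch_iff)
  ultimately show ?thesis using j \<open>cs = cs'\<close> by (simp add: e e')
qed

lemma marks_length: "(d, a) \<in> marks m \<Longrightarrow> a \<le> length (fst (snd d)) \<and> strip (cubes Y) (take a (fst (snd d))) = a"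
proof -
  assume "(d, a) \<in> marks m"
  then obtain v qs x cs y rs w where k: "(d, a) = ((v, qs @ cs @ rs, w), length qs)" "(v, qs, x) \<in> lpaths"
    by (rule marksE)
  then show ?thesis using strip_disjoint[of qs "cubes Y" "[]"] by (auto simp: lpaths_def)
qed

lemma marks_Ch: "k \<in> marks m \<Longrightarrow> fst k \<in> Ch X m"
proof -
  assume "k \<in> marks m"
  then obtain v qs x cs y rs w where "k = ((v, qs @ cs @ rs, w), length qs)"
    "(v, qs, x) \<in> lpaths" "(x, cs, y) \<in> Ch Y m" "(y, rs, w) \<in> rpaths" by (rule marksE)
  moreover from this have "(v, qs, x) \<in> Ch X 0" "(x, cs, y) \<in> Ch X m" "(y, rs, w) \<in> Ch X 0"
    by (auto simp: lpaths_def rpaths_def Ch_sub)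
  ultimately show ?thesis
    using Ch_append[OF X, of v qs x 0 "cs @ rs" w m] Ch_append[OF X, of x cs y m rs w 0] by simp
qed

lemma lact_marks: "p \<in> Ch X 0 \<Longrightarrow> k \<in> marks m \<Longrightarrow> lact Y p k \<in> span (marks m)"
proof -
  assume p: "p \<in> Ch X 0" and km: "k \<in> marks m"
  obtain v qs x cs y rs w where k: "k = ((v, qs @ cs @ rs, w), length qs)"
    "(v, qs, x) \<in> lpaths" "(x, cs, y) \<in> Ch Y m" "(y, rs, w) \<in> rpaths" using marksE[OF km] .
  obtain u ps v' where p': "p = (u, ps, v')" by (cases p)
  show ?thesis
  proof (cases "v' = v")
    case True
    have "(u, ps @ qs, x) \<in> Ch X 0"
      using Ch_append[OF X, of u ps v 0 qs x 0] p k(2) by (simp add: p' True lpaths_def)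
    then have "((u, (ps @ qs) @ cs @ rs, w), strip (cubes Y) (ps @ qs)) \<in> marks m"
      using k by (intro marks_split) (auto simp: rpaths_def)
    then show ?thesis by (simp add: p' k True span_single)
  qed (simp add: p' k add_subgroupD(1)[OF span_sub])
qed

lemma ract_marks: "p \<in> Ch X 0 \<Longrightarrow> k \<in> marks m \<Longrightarrow> ract k p \<in> span (marks m)"
proof -
  assume p: "p \<in> Ch X 0" and km: "k \<in> marks m"
  obtain v qs x cs y rs w where k: "k = ((v, qs @ cs @ rs, w), length qs)"
    "(v, qs, x) \<in> lpaths" "(x, cs, y) \<in> Ch Y m" "(y, rs, w) \<in> rpaths" using marksE[OF km] .
  obtain u ps v' where p': "p = (u, ps, v')" by (cases p)
  show ?thesis
  proof (cases "u = w")
    case True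
    have "(y, rs @ ps, v') \<in> Ch X 0"
      using Ch_append[OF X, of y rs w 0 ps v' 0] p k(4) by (simp add: p' True rpaths_def)
    then have "((v, qs @ cs @ rs @ ps, v'), strip (cubes Y) qs) \<in> marks m"
      using k by (intro marks_split) (auto simp: lpaths_def)
    moreover have "strip (cubes Y) qs = length qs"
      using k(2) strip_disjoint[of qs "cubes Y" "[]"] by (simp add: lpaths_def)
    ultimately show ?thesis by (simp add: p' k True span_single)
  qed (simp add: p' k add_subgroupD(1)[OF span_sub])
qed

text \<open>The outer paths consist of edges, with zero boundary and sign one, so only the middle
  chain is split.\<close>

lemma mark_bd_join:
  assumes "q \<in> lpaths" "c \<in> mid m q r" "r \<in> rpaths"
  shows "mark_bd X (join q c r) = lin (\<lambda>c'. Poly_Mapping.single (join q c' r) 1) (boundary_chain X c :: _ \<Rightarrow>\<^sub>0 'r::field)"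
proof -
  obtain v qs x cs y rs w where e: "q = (v, qs, x)" "c = (x, cs, y)" "r = (y, rs, w)"
    using assms(2) by (cases q, cases c, cases r) (auto simp: mid_def)
  have "\<And>c. c \<in> set qs \<Longrightarrow> fst c = 1" "\<And>c. c \<in> set rs \<Longrightarrow> fst c = 1"
    using assms by (auto simp: e lpaths_def rpaths_def Ch_0_iff)
  then have "list_bd X qs = (0 :: _ \<Rightarrow>\<^sub>0 'r)" "list_bd X rs = (0 :: _ \<Rightarrow>\<^sub>0 'r)" "list_sgn qs = (1 :: 'r)"
    by (simp_all add: list_bd_path list_sgn_path)
  then show ?thesis by (simp add: e boundary_chain_eq list_bd_append lin_lin)
qed

lemma boundary_mid:
  assumes "c \<in> mid (Suc m) q r"
  shows "(boundary_chain X c :: _ \<Rightarrow>\<^sub>0 'r::field) \<in> span (mid m q r)"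
proof -
  obtain v cs w where c: "c = (v, cs, w)" by (cases c)
  have cY: "c \<in> Ch Y (Suc m)" using assms by (simp add: mid_def)
  have "(boundary_chain Y c :: _ \<Rightarrow>\<^sub>0 'r) \<in> span (mid m q r)"
    unfolding c boundary_chain_eq span_def mem_Collect_eq
    by (rule keys_lin_subset)
      (use assms cY c cube_chain_list_bd[OF Y, of v cs w] in \<open>auto simp: Ch_iff mid_def\<close>)
  moreover have "boundary_chain Y c = (boundary_chain X c :: _ \<Rightarrow>\<^sub>0 'r)"
    by (rule boundary_chain_sub[OF cY])
  ultimately show ?thesis by simp
qed

lemma mark_bd_span: "k \<in> marks (Suc m) \<Longrightarrow> mark_bd X k \<in> span (marks m)"
proof -
  assume "k \<in> marks (Suc m)"
  then obtain q c r where k: "k = join q c r" "q \<in> lpaths" "c \<in> mid (Suc m) q r" "r \<in> rpaths"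
    unfolding marks_def by blast
  show ?thesis
    unfolding k(1) mark_bd_join[OF k(2-4)]
    by (rule lin_span[OF boundary_mid[OF k(3)]]) (auto intro!: span_single marksI k)
qed

text \<open>The boundary changes only the middle chain, whereas the mark computed by
  \<open>lact\<close> depends only on what precedes it.\<close>

lemma mark_bd_lact:
  assumes "p \<in> Ch X 0" "k \<in> marks m"
  shows "lin (mark_bd X) (lact Y p k) = lin (lact Y p) (mark_bd X k :: _ \<Rightarrow>\<^sub>0 'r::field)"
proof -
  obtain u ps v' where p: "p = (u, ps, v')" by (cases p)
  obtain q c r where k: "k = join q c r" "q \<in> lpaths" "c \<in> mid m q r" "r \<in> rpaths"
    using assms(2) unfolding marks_def by blast
  obtain v qs x cs y rs w where e: "q = (v, qs, x)" "c = (x, cs, y)" "r = (y, rs, w)"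
    using k(3) by (cases q, cases c, cases r) (auto simp: mid_def)
  have "\<And>c. c \<in> set ps \<Longrightarrow> fst c = 1" "\<And>c. c \<in> set qs \<Longrightarrow> fst c = 1" "\<And>c. c \<in> set rs \<Longrightarrow> fst c = 1"
    using assms(1) k by (auto simp: p e lpaths_def rpaths_def Ch_0_iff)
  then have "list_bd X qs = (0 :: _ \<Rightarrow>\<^sub>0 'r)" "list_bd X rs = (0 :: _ \<Rightarrow>\<^sub>0 'r)" "list_sgn qs = (1 :: 'r)"
    "list_bd X ps = (0 :: _ \<Rightarrow>\<^sub>0 'r)" "list_sgn ps = (1 :: 'r)"
    by (simp_all add: list_bd_path list_sgn_path)
  then show ?thesis
    by (simp add: p k(1) e boundary_chain_eq list_bd_append lin_lin)
qed

lemma mark_bd_ract: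
  assumes "p \<in> Ch X 0"
  shows "lin (mark_bd X) (ract k p) = lin (\<lambda>k'. ract k' p) (mark_bd X k :: _ \<Rightarrow>\<^sub>0 'r::field)"
proof -
  obtain u ps v' v cs w a where p: "p = (u, ps, v')" "k = ((v, cs, w), a)" by (cases p, cases k) auto
  have "\<And>c. c \<in> set ps \<Longrightarrow> fst c = 1" using assms(1) by (simp add: p Ch_0_iff)
  then have "list_bd X ps = (0 :: _ \<Rightarrow>\<^sub>0 'r)" by (simp add: list_bd_path)
  then show ?thesis by (auto simp: p boundary_chain_eq list_bd_append lin_lin)
qed

lemma mark_bd_mark_bd:
  assumes "k \<in> marks m"
  shows "lin (mark_bd X) (mark_bd X k) = (0 :: _ \<Rightarrow>\<^sub>0 'r::field)"
proof -
  obtain d a where k: "k = (d, a)" by (cases k)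
  have "lin (mark_bd X) (mark_bd X k) = lin (\<lambda>d'. Poly_Mapping.single (d', a) (1::'r)) (boundary X (boundary_chain X d))"
    by (simp add: k lin_lin boundary_eq)
  moreover have "boundary X (boundary_chain X d) = (0 :: _ \<Rightarrow>\<^sub>0 'r)"
    by (rule boundary_chain_boundary[OF X]) (use marks_Ch[OF assms] in \<open>simp add: k\<close>)
  ultimately show ?thesis by simp
qed

lemma mark_bd_0: "k \<in> marks 0 \<Longrightarrow> mark_bd X k = 0"
  using marks_Ch[of k 0] by (cases k) (simp add: boundary_chain_0)

lemma lact_lact:
  assumes "k \<in> marks m"
  shows "lin (\<lambda>x. lact Y x k) (cat p p') = lin (lact Y p) (lact Y p' k)"
proof -
  obtain v cs w a where k: "k = ((v, cs, w), a)" by (cases k) auto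
  obtain u ps x u' ps' x' where p: "p = (u, ps, x)" "p' = (u', ps', x')" by (cases p, cases p')
  have a: "a \<le> length cs" using marks_length[of "(v, cs, w)" a m] assms k by simp
  \<comment> \<open>The new mark falls inside \<open>ps' @ take a cs\<close>, so the second left
    action strips a prefix of that list and \<open>strip_strip\<close> applies.\<close>
  have "strip (cubes Y) (ps' @ take a cs) - length ps' \<le> a"
    using strip_le[of "cubes Y" "ps' @ take a cs"] a by simp
  then have "take (strip (cubes Y) (ps' @ take a cs)) (ps' @ cs) = take (strip (cubes Y) (ps' @ take a cs)) (ps' @ take a cs)"
    by (simp add: min_absorb1)
  then show ?thesis using strip_strip[of "cubes Y" "cubes Y" ps "ps' @ take a cs"] by (auto simp: k p)
qed

lemma ract_ract: "lin (\<lambda>x. ract x p') (ract k p) = lin (ract k) (cat p p')"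
  by (cases k, cases p, cases p') (auto simp: ract_def)

lemma ract_lact:
  assumes "k \<in> marks m"
  shows "lin (\<lambda>x. ract x p') (lact Y p k) = lin (lact Y p) (ract k p')"
proof -
  obtain v cs w a where k: "k = ((v, cs, w), a)" by (cases k) auto
  have "a \<le> length cs" using marks_length[of "(v, cs, w)" a m] assms k by simp
  then show ?thesis by (cases p, cases p') (auto simp: k)
qed

lemma lact_unit:
  assumes "f \<in> span (marks m)"
  shows "bil (lact Y) (\<Sum>v\<in>cells X 0. Poly_Mapping.single (v, [], v) 1) f = f"
    and "bil ract f (\<Sum>v\<in>cells X 0. Poly_Mapping.single (v, [], v) 1) = f"
  using assms
proof (induction rule: span_induct)
  case (single k r)
  obtain v cs w a where k: "k = ((v, cs, w), a)" by (cases k) auto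
  have d: "(v, cs, w) \<in> Ch X m" "strip (cubes Y) (take a cs) = a" using marks_Ch[OF single] marks_length[of "(v,cs,w)" a m] single k by auto
  then have vw: "v \<in> cells X 0" "w \<in> cells X 0" by (auto simp: Ch_iff dest: cube_chainD)
  have "bil (lact Y) (\<Sum>v\<in>cells X 0. Poly_Mapping.single (v, [], v) 1) (Poly_Mapping.single k r)
    = (\<Sum>u\<in>cells X 0. if u = v then Poly_Mapping.single k r else 0)"
    unfolding bil_sum_left by (intro sum.cong) (auto simp: k d)
  then show "bil (lact Y) (\<Sum>v\<in>cells X 0. Poly_Mapping.single (v, [], v) 1) (Poly_Mapping.single k r) = Poly_Mapping.single k r"
    using fin vw by simp
  have "bil ract (Poly_Mapping.single k r) (\<Sum>v\<in>cells X 0. Poly_Mapping.single (v, [], v) 1)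
    = (\<Sum>u\<in>cells X 0. if u = w then Poly_Mapping.single k r else 0)"
    unfolding bil_sum_right by (intro sum.cong) (auto simp: k)
  then show "bil ract (Poly_Mapping.single k r) (\<Sum>v\<in>cells X 0. Poly_Mapping.single (v, [], v) 1) = Poly_Mapping.single k r"
    using fin vw by simp
qed (simp_all add: bil_add_right bil_add_left)

sublocale marked: bimod_complex "path_algebra (R :: 'r::field itself) X" "\<lambda>n. span (marks n)" "lin (mark_bd X)"
  "bil (lact Y)" "bil ract"
proof (rule bimod_complex.intro)
  fix a :: "'c chain \<Rightarrow>\<^sub>0 'r" and x :: "'c chain \<times> nat \<Rightarrow>\<^sub>0 'r" and n
  assume a: "a \<in> carrier (path_algebra R X)" and x: "x \<in> span (marks n)"
  then have a': "a \<in> span (Ch X 0)" by (simp add: carrier_path_algebra)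
  have keys: "k \<in> Poly_Mapping.keys a \<Longrightarrow> k \<in> Ch X 0" "l \<in> Poly_Mapping.keys x \<Longrightarrow> l \<in> marks n" for k l
    using a' x by (auto simp: span_def)
  show "bil (lact Y) a x \<in> span (marks n)" by (rule bil_span[OF a' x lact_marks])
  show "bil ract x a \<in> span (marks n)" by (rule bil_span[OF x a' ract_marks])
  have "lin (mark_bd X) (bil (lact Y) a x) = bil (lact Y) (lin (\<lambda>k. Poly_Mapping.single k 1) a) (lin (mark_bd X) x)"
    by (rule lin_bil) (simp add: bil_single_left mark_bd_lact[OF keys(1,2)])
  then show "lin (mark_bd X) (bil (lact Y) a x) = bil (lact Y) a (lin (mark_bd X) x)"
    by (simp add: lin_single_id)
  have "lin (mark_bd X) (bil ract x a) = bil ract (lin (mark_bd X) x) (lin (\<lambda>k. Poly_Mapping.single k 1) a)"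
    by (rule lin_bil) (simp add: bil_single_right mark_bd_ract[OF keys(1)])
  then show "lin (mark_bd X) (bil ract x a) = bil ract (lin (mark_bd X) x) a"
    by (simp add: lin_single_id)
  fix a' :: "'c chain \<Rightarrow>\<^sub>0 'r"
  have "bil (lact Y) (bil cat a a') x = bil (lact Y) a (bil (lact Y) a' x)"
    by (rule bil_assoc) (rule lact_lact[of _ n], use x in \<open>auto simp: span_def\<close>)
  then show "bil (lact Y) (a \<otimes>\<^bsub>path_algebra R X\<^esub> a') x = bil (lact Y) a (bil (lact Y) a' x)"
    by (simp add: path_algebra_def path_mult_bil)
  have "bil ract (bil ract x a) a' = bil ract x (bil cat a a')"
    by (rule bil_assoc) (rule ract_ract)
  then show "bil ract x (a \<otimes>\<^bsub>path_algebra R X\<^esub> a') = bil ract (bil ract x a) a'"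
    by (simp add: path_algebra_def path_mult_bil)
  show "bil ract (bil (lact Y) a x) a' = bil (lact Y) a (bil ract x a')"
    by (rule bil_assoc) (rule ract_lact[of _ n], use x in \<open>auto simp: span_def\<close>)
next
  fix x :: "'c chain \<times> nat \<Rightarrow>\<^sub>0 'r" and n assume x: "x \<in> span (marks n)"
  show "bil (lact Y) \<one>\<^bsub>path_algebra R X\<^esub> x = x" "bil ract x \<one>\<^bsub>path_algebra R X\<^esub> = x"
    using lact_unit[OF x] by (simp_all add: path_algebra_def)
  have "lin (\<lambda>k. lin (mark_bd X) (mark_bd X k)) x = lin (\<lambda>_. 0) x"
    by (rule lin_cong, rule mark_bd_mark_bd[of _ n]) (use x in \<open>auto simp: span_def\<close>)
  then show "lin (mark_bd X) (lin (mark_bd X) x) = 0" by (simp add: lin_lin)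
next
  fix x :: "'c chain \<times> nat \<Rightarrow>\<^sub>0 'r" and n assume "x \<in> span (marks (Suc n))"
  then show "lin (mark_bd X) x \<in> span (marks n)" by (rule lin_span) (rule mark_bd_span)
next
  fix x :: "'c chain \<times> nat \<Rightarrow>\<^sub>0 'r" assume x: "x \<in> span (marks 0)"
  have "lin (mark_bd X) x = lin (\<lambda>_. 0) x"
    by (rule lin_cong, rule mark_bd_0) (use x in \<open>auto simp: span_def\<close>)
  then show "lin (mark_bd X) x = 0" by simp
qed (simp_all add: ring_path_algebra span_sub lin_add bil_add_right bil_add_left,
    simp_all add: path_algebra_def bil_add_right bil_add_left)

end

section \<open>Extension of scalars of the homology modules\<close>

lemma lin_fun_sum: "lin (\<lambda>k. \<Sum>x\<in>F. h x k) f = (\<Sum>x\<in>F. lin (h x) f)"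
  by (induction F rule: infinite_finite_induct) (simp_all add: lin_fun_add)

context rel_cub
begin

sublocale Y: fin_cub Y
proof
  show "finite (cells Y 0)" using fin cells_sub by (meson finite_subset subsetI)
qed (rule Y)

lemma span_Y: "f \<in> span (Ch Y m) \<Longrightarrow> f \<in> span (Ch X m)"
  by (rule span_mono[rotated]) (auto simp: Ch_sub)

section \<open>Decomposition of marked chains by their outer paths\<close>

definition emb :: "'c chain \<Rightarrow> 'c chain \<Rightarrow> ('c chain \<Rightarrow>\<^sub>0 'r::field) \<Rightarrow> ('c chain \<times> nat \<Rightarrow>\<^sub>0 'r)" where
  "emb q r = lin (\<lambda>c. Poly_Mapping.single (join q c r) 1)"

text \<open>A coefficient map: the middle chain if the outer paths are \<open>q\<close> and
  \<open>r\<close>, and zero otherwise. The dimension of the middle chain is left open, so one map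
  serves all degrees.\<close>

definition inner :: "'c chain \<Rightarrow> 'c chain \<Rightarrow> 'c chain \<times> nat \<Rightarrow> 'c chain \<Rightarrow>\<^sub>0 'r::field" where
  "inner q r k = (if \<exists>c m. c \<in> mid m q r \<and> k = join q c r
     then Poly_Mapping.single (THE c. \<exists>m. c \<in> mid m q r \<and> k = join q c r) 1 else 0)"

definition proj :: "'c chain \<Rightarrow> 'c chain \<Rightarrow> ('c chain \<times> nat \<Rightarrow>\<^sub>0 'r::field) \<Rightarrow> ('c chain \<Rightarrow>\<^sub>0 'r)" where
  "proj q r = lin (inner q r)"

definition ends :: "'c chain \<times> nat \<Rightarrow> 'c chain \<times> 'c chain" where
  "ends k = (THE (q, r). q \<in> lpaths \<and> r \<in> rpaths \<and> (\<exists>c m. c \<in> mid m q r \<and> k = join q c r))"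

lemma inner_join:
  assumes "q \<in> lpaths" "r \<in> rpaths" "q' \<in> lpaths" "r' \<in> rpaths" "c \<in> mid m q' r'"
  shows "inner q r (join q' c r') = (if q = q' \<and> r = r' then Poly_Mapping.single c 1 else 0)"
proof (cases "q = q' \<and> r = r'")
  case True
  then have "(THE c'. \<exists>m. c' \<in> mid m q r \<and> join q' c r' = join q c' r) = c"
    using assms join_inj[of q _ _ r q c m r] by (intro the_equality) metis+
  moreover have "\<exists>c' m. c' \<in> mid m q r \<and> join q' c r' = join q c' r"
    using True assms by blast
  ultimately show ?thesis using True unfolding inner_def by (simp only: if_True simp_thms)
next
  case False
  then have "\<not> (\<exists>c' m. c' \<in> mid m q r \<and> join q' c r' = join q c' r)"
    using assms join_inj[of q' c m r' q] by metis
  then show ?thesis using False unfolding inner_def by (simp only: if_False simp_thms)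
qed

lemma ends_join:
  assumes "q \<in> lpaths" "r \<in> rpaths" "c \<in> mid m q r"
  shows "ends (join q c r) = (q, r)"
  unfolding ends_def
proof (rule the_equality)
  show "case (q, r) of (q', r') \<Rightarrow> q' \<in> lpaths \<and> r' \<in> rpaths \<and> (\<exists>c' m. c' \<in> mid m q' r' \<and> join q c r = join q' c' r')"
    using assms by (simp only: prod.case) blast
next
  fix x assume "case x of (q', r') \<Rightarrow> q' \<in> lpaths \<and> r' \<in> rpaths \<and> (\<exists>c' m. c' \<in> mid m q' r' \<and> join q c r = join q' c' r')"
  then obtain q' r' c' m' where "x = (q', r')" "q' \<in> lpaths" "r' \<in> rpaths" "c' \<in> mid m' q' r'" "join q c r = join q' c' r'"
    by (cases x) (simp only: prod.case, blast)
  then show "x = (q, r)" using join_inj[OF assms(1,3,2)] by blast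
qed

lemma marks_joinE:
  assumes "k \<in> marks m"
  obtains q c r where "k = join q c r" "q \<in> lpaths" "c \<in> mid m q r" "r \<in> rpaths"
  using assms unfolding marks_def by blast

lemma inner_span:
  assumes "q \<in> lpaths" "r \<in> rpaths" "k \<in> marks m"
  shows "inner q r k \<in> span (mid m q r)"
  using assms(3)
proof (rule marks_joinE)
  fix q' c r' assume e: "k = join q' c r'" "q' \<in> lpaths" "c \<in> mid m q' r'" "r' \<in> rpaths"
  show ?thesis
    unfolding e(1) inner_join[OF assms(1,2) e(2,4,3)]
    using e(3) by (cases "q = q' \<and> r = r'") (simp_all add: span_single add_subgroupD(1)[OF span_sub])
qed

lemma proj_span: "q \<in> lpaths \<Longrightarrow> r \<in> rpaths \<Longrightarrow> z \<in> span (marks m) \<Longrightarrow> proj q r z \<in> span (mid m q r)"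
  unfolding proj_def by (erule lin_span) (rule inner_span)

lemma mid_sub: "mid m q r \<subseteq> Ch Y m"
  by (auto simp: mid_def)

lemma proj_span_Ch: "q \<in> lpaths \<Longrightarrow> r \<in> rpaths \<Longrightarrow> z \<in> span (marks m) \<Longrightarrow> proj q r z \<in> span (Ch Y m)"
  using span_mono[OF mid_sub proj_span] .

text \<open>Each marking lies in exactly one component, the one indexed by its \<open>ends\<close>,
  so a single summand survives.\<close>

lemma decompose:
  fixes z :: "'c chain \<times> nat \<Rightarrow>\<^sub>0 'r::field"
  assumes "z \<in> span (marks m)" "finite F" "F \<subseteq> lpaths \<times> rpaths" "ends ` Poly_Mapping.keys z \<subseteq> F"
  shows "(\<Sum>(q, r)\<in>F. emb q r (proj q r z)) = z"
proof -
  have "(\<Sum>(q, r)\<in>F. emb q r (proj q r z)) = lin (\<lambda>k. \<Sum>(q, r)\<in>F. emb q r (inner q r k)) z"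
    by (simp add: split_beta lin_fun_sum emb_def proj_def lin_lin)
  also have "\<dots> = lin (\<lambda>k. Poly_Mapping.single k 1) z"
  proof (rule lin_cong)
    fix k assume k: "k \<in> Poly_Mapping.keys z"
    then have "k \<in> marks m" using assms(1) by (auto simp: span_def)
    then obtain q c r where e: "k = join q c r" "q \<in> lpaths" "c \<in> mid m q r" "r \<in> rpaths"
      by (rule marks_joinE)
    have qr: "(q, r) \<in> F" using k assms(4) ends_join[OF e(2,4,3)] e(1) by auto
    have "(\<Sum>(q', r')\<in>F. emb q' r' (inner q' r' k)) = (\<Sum>x\<in>F. if x = (q, r) then Poly_Mapping.single k (1::'r) else 0)"
    proof (rule sum.cong[OF refl])
      fix x assume "x \<in> F"
      then obtain q' r' where x: "x = (q', r')" "q' \<in> lpaths" "r' \<in> rpaths" using assms(3) by auto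
      show "(case x of (q', r') \<Rightarrow> emb q' r' (inner q' r' k)) = (if x = (q, r) then Poly_Mapping.single k (1::'r) else 0)"
        unfolding x(1) e(1) prod.case inner_join[OF x(2,3) e(2,4,3)] by (auto simp: emb_def)
    qed
    then show "(\<Sum>(q', r')\<in>F. emb q' r' (inner q' r' k)) = Poly_Mapping.single k (1::'r)"
      using qr assms(2) by simp
  qed
  finally show ?thesis by (simp add: lin_single_id)
qed

lemma proj_emb:
  assumes "q \<in> lpaths" "r \<in> rpaths" "q' \<in> lpaths" "r' \<in> rpaths" "z \<in> span (mid m q' r')"
  shows "proj q r (emb q' r' z) = (if q = q' \<and> r = r' then z else 0)"
proof -
  have "proj q r (emb q' r' z) = lin (\<lambda>c. inner q r (join q' c r')) z"
    by (simp add: proj_def emb_def lin_lin)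
  also have "\<dots> = lin (\<lambda>c. if q = q' \<and> r = r' then Poly_Mapping.single c 1 else 0) z"
    by (rule lin_cong, rule inner_join[OF assms(1-4)]) (use assms(5) in \<open>auto simp: span_def\<close>)
  finally show ?thesis by (cases "q = q'"; cases "r = r'") (simp_all add: lin_single_id)
qed

text \<open>The component projections are chain maps. The marked complex is thereby a direct sum of
  complexes of chains of \<open>Y\<close> with prescribed end points, which is the form in which
  projectivity is used.\<close>

lemma proj_mark_bd:
  assumes "q \<in> lpaths" "r \<in> rpaths" "z \<in> span (marks m)"
  shows "proj q r (lin (mark_bd X) z) = boundary X (proj q r z :: _ \<Rightarrow>\<^sub>0 'r::field)"
proof -
  have "lin (inner q r) (mark_bd X k) = lin (boundary_chain X) (inner q r k :: _ \<Rightarrow>\<^sub>0 'r)"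
    if "k \<in> marks m" for k
    using that
  proof (rule marks_joinE)
    fix q' c r' assume e: "k = join q' c r'" "q' \<in> lpaths" "c \<in> mid m q' r'" "r' \<in> rpaths"
    \<comment> \<open>\<open>boundary_mid\<close> only covers degrees of the form
      \<open>Suc m\<close>; in degree \<open>0\<close> the boundary is zero.\<close>
    have c0: "boundary_chain X c = (0 :: _ \<Rightarrow>\<^sub>0 'r)" if "m = 0"
      using e(3) that boundary_chain_0[of c X] by (cases c) (auto simp: mid_def Ch_sub)
    have "lin (inner q r) (mark_bd X k) = lin (\<lambda>c'. inner q r (join q' c' r')) (boundary_chain X c :: _ \<Rightarrow>\<^sub>0 'r)"
      by (simp add: e(1) mark_bd_join[OF e(2-4)] lin_lin)
    also have "\<dots> = lin (\<lambda>c'. if q = q' \<and> r = r' then Poly_Mapping.single c' 1 else 0) (boundary_chain X c)"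
    proof (rule lin_cong)
      fix c' assume c': "c' \<in> Poly_Mapping.keys (boundary_chain X c :: _ \<Rightarrow>\<^sub>0 'r)"
      then obtain n where n: "m = Suc n" using c0 by (cases m) auto
      then have "c' \<in> mid n q' r'" using boundary_mid[of c n q' r', where 'r = 'r] e(3) c' by (auto simp: span_def)
      then show "inner q r (join q' c' r') = (if q = q' \<and> r = r' then Poly_Mapping.single c' 1 else 0)"
        by (rule inner_join[OF assms(1,2) e(2,4)])
    qed
    also have "\<dots> = lin (boundary_chain X) (inner q r k)"
      unfolding e(1) inner_join[OF assms(1,2) e(2,4,3)]
      by (cases "q = q'"; cases "r = r'") (simp_all add: lin_single_id)
    finally show ?thesis .
  qed
  then have "lin (\<lambda>k. lin (inner q r) (mark_bd X k)) z = lin (\<lambda>k. lin (boundary_chain X) (inner q r k)) z"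
    using assms(3) by (intro lin_cong) (auto simp: span_def)
  then show ?thesis by (simp add: proj_def boundary_eq lin_lin)
qed

text \<open>The image of \<open>1 \<otimes> c \<otimes> 1\<close>: both outer paths are
  empty.\<close>

definition at_start :: "('c chain \<Rightarrow>\<^sub>0 'r::field) \<Rightarrow> ('c chain \<times> nat \<Rightarrow>\<^sub>0 'r)" where
  "at_start = lin (\<lambda>c. Poly_Mapping.single (c, 0) 1)"

lemma at_start_add: "at_start (x + y) = at_start x + at_start y" and at_start_diff: "at_start (x - y) = at_start x - at_start y"
  by (simp_all add: at_start_def lin_add lin_diff)

lemma at_start_span: "z \<in> span (Ch Y m) \<Longrightarrow> at_start z \<in> span (marks m)"
  unfolding at_start_def
proof (erule lin_span)
  fix c assume c: "c \<in> Ch Y m"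
  obtain x cs y where e: "c = (x, cs, y)" by (cases c)
  have "x \<in> cells X 0" "y \<in> cells X 0" using c e cells_sub by (auto simp: Ch_iff dest: cube_chainD)
  then show "Poly_Mapping.single (c, 0) (1::'a) \<in> span (marks m)"
    using marks_split[of x "[]" x cs y m "[]" y] c by (simp add: e Ch_iff chain_dim_def strip_def span_single)
qed

lemma boundary_sub: "z \<in> span (Ch Y m) \<Longrightarrow> boundary Y z = boundary X z"
  unfolding boundary_eq by (rule lin_cong, rule boundary_chain_sub[of _ m]) (auto simp: span_def)

lemma at_start_boundary: "lin (mark_bd X) (at_start z) = at_start (boundary X z)"
  by (simp add: at_start_def boundary_eq lin_lin)

text \<open>The edges of \<open>a\<close> lie in \<open>Y\<close>, so all of them are absorbed and
  the mark stays \<open>0\<close>. This lets scalars from R[Y] cross the left tensor sign.\<close>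

lemma at_start_lact:
  assumes "a \<in> span (Ch Y 0)"
  shows "bil (lact Y) a (at_start z) = at_start (path_mult a z)"
proof -
  have "at_start (bil cat a z) = bil (lact Y) (lin (\<lambda>k. Poly_Mapping.single k 1) a) (at_start z)"
    unfolding at_start_def
  proof (rule lin_bil)
    fix k l assume "k \<in> Poly_Mapping.keys a"
    then have "k \<in> Ch Y 0" using assms by (auto simp: span_def)
    then show "lin (\<lambda>c. Poly_Mapping.single (c, 0) 1) (cat k l) = bil (lact Y) (Poly_Mapping.single k 1) (Poly_Mapping.single (l, 0) 1)"
      using strip_append[of _ "cubes Y" "[]"] by (cases k, cases l) (auto simp: Ch_sub strip_def[of _ "[]"])
  qed
  then show ?thesis by (simp add: path_mult_bil lin_single_id)
qed

lemma at_start_ract: "bil ract (at_start z) a = at_start (path_mult z a)"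
proof -
  have "at_start (bil cat z a) = bil ract (at_start z) (lin (\<lambda>k. Poly_Mapping.single k 1) a)"
    unfolding at_start_def by (rule lin_bil) (auto simp: cat_def split: prod.splits)
  then show ?thesis by (simp add: path_mult_bil lin_single_id)
qed

text \<open>The combination of marked chains that corresponds to the tensor of \<open>a\<close>,
  \<open>z\<close> and \<open>b\<close>.\<close>

definition two_sided :: "('c chain \<Rightarrow>\<^sub>0 'r::field) \<Rightarrow> ('c chain \<Rightarrow>\<^sub>0 'r) \<Rightarrow> ('c chain \<Rightarrow>\<^sub>0 'r) \<Rightarrow> ('c chain \<times> nat \<Rightarrow>\<^sub>0 'r)" where
  "two_sided a z b = bil ract (bil (lact Y) a (at_start z)) b"

lemma emb_two_sided:
  assumes "q \<in> lpaths" "z \<in> span (mid m q r)"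
  shows "emb q r z = two_sided (Poly_Mapping.single q 1) z (Poly_Mapping.single r 1)"
proof -
  have "two_sided (Poly_Mapping.single q 1) z (Poly_Mapping.single r 1)
    = lin (\<lambda>c. lin (\<lambda>k. ract k r) (lact Y q (c, 0))) z"
    by (simp add: two_sided_def at_start_def bil_single_left bil_single_right lin_lin)
  also have "\<dots> = lin (\<lambda>c. Poly_Mapping.single (join q c r) 1) z"
  proof (rule lin_cong)
    fix c assume "c \<in> Poly_Mapping.keys z"
    then have c: "c \<in> mid m q r" using assms by (auto simp: span_def)
    obtain v qs x cs y rs w where e: "q = (v, qs, x)" "c = (x, cs, y)" "r = (y, rs, w)"
      using c by (cases q, cases c, cases r) (auto simp: mid_def)
    show "lin (\<lambda>k. ract k r) (lact Y q (c, 0)) = Poly_Mapping.single (join q c r) 1"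
      using c assms(1) strip_disjoint[of qs "cubes Y" "[]"] by (simp add: e mid_def lpaths_def)
  qed
  finally show ?thesis by (simp add: emb_def)
qed

end

text \<open>Congruence modulo \<open>I\<close>, kept as a relation so that computations in the
  nested quotients can be chained.\<close>

definition eqv :: "'x::ab_group_add set \<Rightarrow> 'x \<Rightarrow> 'x \<Rightarrow> bool" where
  "eqv I x y \<longleftrightarrow> x - y \<in> I"

lemma eqvD:
  assumes "add_subgroup I"
  shows "eqv I x x" "eqv I x y \<Longrightarrow> eqv I y x" "eqv I x y \<Longrightarrow> eqv I y z \<Longrightarrow> eqv I x z"
    "eqv I x y \<Longrightarrow> eqv I x' y' \<Longrightarrow> eqv I (x + x') (y + y')"
    "eqv I x y \<Longrightarrow> eqv I x' y' \<Longrightarrow> eqv I (x - x') (y - y')"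
proof -
  note I = add_subgroupD[OF assms]
  show "eqv I x x" using I(1) by (simp add: eqv_def)
  show "eqv I x y \<Longrightarrow> eqv I y x" using I(3)[of "x - y"] by (simp add: eqv_def)
  show "eqv I x y \<Longrightarrow> eqv I y z \<Longrightarrow> eqv I x z" using I(2)[of "x - y" "y - z"] by (simp add: eqv_def)
  show "eqv I x y \<Longrightarrow> eqv I x' y' \<Longrightarrow> eqv I (x + x') (y + y')"
    using I(2)[of "x - y" "x' - y'"] by (simp add: eqv_def algebra_simps)
  show "eqv I x y \<Longrightarrow> eqv I x' y' \<Longrightarrow> eqv I (x - x') (y - y')"
    using I(4)[of "x - y" "x' - y'"] by (simp add: eqv_def algebra_simps)
qed

lemma eqv_sum: "add_subgroup I \<Longrightarrow> (\<And>x. x \<in> F \<Longrightarrow> eqv I (f x) (g x)) \<Longrightarrow> eqv I (sum f F) (sum g F)"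
  unfolding eqv_def sum_subtractf[symmetric] by (rule add_subgroup_sum)

lemma qt_cong: "add_subgroup I \<Longrightarrow> x - y \<in> I \<Longrightarrow> qt I x = qt I y"
  by (simp add: qt_eq)

context rel_cub
begin

lemma span_simps:
  "carrier (regular_bimodule (path_algebra R X)) = span (Ch X 0)"
  "a \<oplus>\<^bsub>regular_bimodule (path_algebra R X)\<^esub> b = a + b"
  "a \<odot>\<^bsub>regular_bimodule (path_algebra R X)\<^esub> b = path_mult a b"
  "a \<odot>\<^sub>r\<^bsub>regular_bimodule (path_algebra R X)\<^esub> b = path_mult a b"
  "carrier (path_algebra R X) = span (Ch X 0)" "carrier (path_algebra R Y) = span (Ch Y 0)"
  by (simp_all add: regular_bimodule_def carrier_path_algebra Y.carrier_path_algebra)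
    (simp_all add: path_algebra_def)

lemma path_mult_X: "a \<in> span (Ch X 0) \<Longrightarrow> b \<in> span (Ch X 0) \<Longrightarrow> path_mult a b \<in> span (Ch X 0)"
  using path_mult_span[OF X, of a 0 b 0] by simp

lemma path_mult_add_left: "path_mult (a + b) x = path_mult a x + path_mult b x"
  by (simp add: path_mult_bil bil_add_left)

lemma path_mult_add_right: "path_mult x (a + b) = path_mult x a + path_mult x b"
  by (simp add: path_mult_bil bil_add_right)

lemma Y_Z_l: "a \<in> span (Ch Y 0) \<Longrightarrow> z \<in> Y.chains.Z n \<Longrightarrow> path_mult a z \<in> Y.chains.Z n"
  by (rule Y.chains.Z_l) (simp_all add: span_simps)

lemma Y_Z_r: "a \<in> span (Ch Y 0) \<Longrightarrow> z \<in> Y.chains.Z n \<Longrightarrow> path_mult z a \<in> Y.chains.Z n"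
  by (rule Y.chains.Z_r) (simp_all add: span_simps)

lemma Z_l: "a \<in> span (Ch X 0) \<Longrightarrow> z \<in> marked.Z n \<Longrightarrow> bil (lact Y) a z \<in> marked.Z n"
  by (rule marked.Z_l) (simp_all add: span_simps)

lemma Z_r: "a \<in> span (Ch X 0) \<Longrightarrow> z \<in> marked.Z n \<Longrightarrow> bil ract z a \<in> marked.Z n"
  by (rule marked.Z_r) (simp_all add: span_simps)

lemma B_l: "a \<in> span (Ch X 0) \<Longrightarrow> z \<in> marked.B n \<Longrightarrow> bil (lact Y) a z \<in> marked.B n"
  by (rule marked.B_l) (simp_all add: span_simps)

lemma B_r: "a \<in> span (Ch X 0) \<Longrightarrow> z \<in> marked.B n \<Longrightarrow> bil ract z a \<in> marked.B n"
  by (rule marked.B_r) (simp_all add: span_simps)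

lemma at_start_Z: "z \<in> Y.chains.Z n \<Longrightarrow> at_start z \<in> marked.Z n"
  using at_start_span[of z n] at_start_boundary[of z] boundary_sub[of z n]
  by (simp add: Y.chains.Z_def marked.Z_def) (simp add: at_start_def)

lemma at_start_B: "z \<in> Y.chains.B n \<Longrightarrow> at_start z \<in> marked.B n"
proof -
  assume "z \<in> Y.chains.B n"
  then obtain y where y: "y \<in> span (Ch Y (Suc n))" "z = boundary Y y" by (auto simp: Y.chains.B_def)
  then have "at_start z = lin (mark_bd X) (at_start y)" by (simp add: at_start_boundary boundary_sub)
  then show ?thesis using at_start_span[OF y(1)] by (simp add: marked.B_def)
qed

lemma two_sided_Z: "a \<in> span (Ch X 0) \<Longrightarrow> b \<in> span (Ch X 0) \<Longrightarrow> z \<in> Y.chains.Z n \<Longrightarrow> two_sided a z b \<in> marked.Z n"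
  unfolding two_sided_def by (intro Z_l Z_r at_start_Z)

lemma two_sided_add:
  "two_sided (a + a') z b = two_sided a z b + two_sided a' z b"
  "two_sided a (z + z') b = two_sided a z b + two_sided a z' b"
  "two_sided a z (b + b') = two_sided a z b + two_sided a z b'"
  by (simp_all add: two_sided_def at_start_add bil_add_left bil_add_right)

lemma lact_mult: "(x :: _ \<Rightarrow>\<^sub>0 'r::field) \<in> span (marks n) \<Longrightarrow> a \<in> span (Ch X 0) \<Longrightarrow> b \<in> span (Ch X 0) \<Longrightarrow>
    bil (lact Y) (path_mult a b) x = bil (lact Y) a (bil (lact Y) b x)"
  using marked.l_mult[where R = "TYPE('r)", of a b x n] by (simp add: span_simps) (simp add: path_algebra_def)

lemma ract_mult: "(x :: _ \<Rightarrow>\<^sub>0 'r::field) \<in> span (marks n) \<Longrightarrow> a \<in> span (Ch X 0) \<Longrightarrow> b \<in> span (Ch X 0) \<Longrightarrow>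
    bil ract x (path_mult a b) = bil ract (bil ract x a) b"
  using marked.r_mult[where R = "TYPE('r)", of a b x n] by (simp add: span_simps) (simp add: path_algebra_def)

lemma lact_ract: "(x :: _ \<Rightarrow>\<^sub>0 'r::field) \<in> span (marks n) \<Longrightarrow> a \<in> span (Ch X 0) \<Longrightarrow> b \<in> span (Ch X 0) \<Longrightarrow>
    bil ract (bil (lact Y) a x) b = bil (lact Y) a (bil ract x b)"
  using marked.l_r[where R = "TYPE('r)", of a b x n] by (simp add: span_simps)

lemma lact_span: "x \<in> span (marks n) \<Longrightarrow> a \<in> span (Ch X 0) \<Longrightarrow> bil (lact Y) a x \<in> span (marks n)"
  by (rule marked.l_closed) (simp_all add: span_simps)

lemma two_sided_lact:
  assumes "a' \<in> span (Ch X 0)" "a \<in> span (Ch X 0)" "b \<in> span (Ch X 0)" "z \<in> span (Ch Y n)"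
  shows "bil (lact Y) a' (two_sided a z b) = two_sided (path_mult a' a) z b"
  using assms at_start_span[OF assms(4)]
  by (simp add: two_sided_def lact_mult[of _ n] lact_ract[of _ n] lact_span)

lemma two_sided_ract:
  assumes "b' \<in> span (Ch X 0)" "a \<in> span (Ch X 0)" "b \<in> span (Ch X 0)" "z \<in> span (Ch Y n)"
  shows "bil ract (two_sided a z b) b' = two_sided a z (path_mult b b')"
  using assms at_start_span[OF assms(4)] by (simp add: two_sided_def ract_mult[of _ n] lact_span)

text \<open>Among marked chains the balancing relations are equalities, not merely congruences
  modulo boundaries.\<close>

lemma two_sided_bal:
  assumes "s \<in> span (Ch Y 0)" "a \<in> span (Ch X 0)" "b \<in> span (Ch X 0)" "z \<in> span (Ch Y n)"
  shows "two_sided (path_mult a s) z b = two_sided a (path_mult s z) b"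
    and "two_sided a (path_mult z s) b = two_sided a z (path_mult s b)"
proof -
  note s = span_Y[OF assms(1)] and at_start = at_start_span[OF assms(4)]
  show "two_sided (path_mult a s) z b = two_sided a (path_mult s z) b"
    using assms s at_start by (simp add: two_sided_def lact_mult[of _ n] at_start_lact)
  show "two_sided a (path_mult z s) b = two_sided a z (path_mult s b)"
    using assms s at_start by (simp add: two_sided_def at_start_ract[symmetric] lact_ract[of _ n, symmetric] ract_mult[of _ n] lact_span)
qed

context
  fixes R :: "'r::field itself" and n :: nat
begin

section \<open>The two nested tensor products\<close>

abbreviation "AX \<equiv> path_algebra R X"
abbreviation "AY \<equiv> path_algebra R Y"
abbreviation "RX \<equiv> regular_bimodule AX"
abbreviation "HY \<equiv> HM R Y (Suc n)"
abbreviation "T1 \<equiv> tensor AY RX HY"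
abbreviation "I1 \<equiv> tensor_kernel AY RX HY"
abbreviation "I2 \<equiv> tensor_kernel AY T1 RX"
abbreviation "Zy \<equiv> Y.chains.Z n :: ('c chain \<Rightarrow>\<^sub>0 'r) set"
abbreviation "By \<equiv> Y.chains.B n :: ('c chain \<Rightarrow>\<^sub>0 'r) set"
abbreviation "Zk \<equiv> marked.Z n :: ('c chain \<times> nat \<Rightarrow>\<^sub>0 'r) set"
abbreviation "Bk \<equiv> marked.B n :: ('c chain \<times> nat \<Rightarrow>\<^sub>0 'r) set"
abbreviation "cl \<equiv> qt By"

lemma HYE:
  assumes "m \<in> carrier HY"
  obtains z where "z \<in> Zy" "m = cl z"
  using assms by (auto simp: Y.carrier_HM)

lemma cl_HY: "z \<in> Zy \<Longrightarrow> cl z \<in> carrier HY"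
  by (simp add: Y.carrier_HM)

interpretation t1: tensor_closed AY RX HY
proof
  fix y y' assume "y \<in> carrier HY" "y' \<in> carrier HY"
  then show "y \<oplus>\<^bsub>HY\<^esub> y' \<in> carrier HY"
    by (auto elim!: HYE simp: Y.add_HM intro!: cl_HY add_subgroupD(2)[OF Y.chains.Z_sub])
next
  fix y b assume "y \<in> carrier HY" "b \<in> carrier AY"
  then show "b \<odot>\<^bsub>HY\<^esub> y \<in> carrier HY"
    by (auto elim!: HYE simp: Y.smult_HM span_simps cl_HY Y_Z_l)
qed (auto simp: span_simps path_mult_X span_Y intro: add_subgroupD(2)[OF span_sub])

lemma I1: "add_subgroup I1"
  by (rule t1.kernel_sub)

lemma carrier_T1: "carrier T1 = qt I1 ` carrier (tensor_free RX HY)"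
  unfolding tensor_eq by (rule t1.carrier_quotient)

lemma add_T1: "qt I1 u \<oplus>\<^bsub>T1\<^esub> qt I1 u' = qt I1 (u + u')"
  unfolding tensor_eq by (rule t1.add_quotient)

lemma rsmult_T1:
  "b \<in> span (Ch Y 0) \<Longrightarrow> qt I1 u \<odot>\<^sub>r\<^bsub>T1\<^esub> b = qt I1 (frag_extend (\<lambda>(x, y). frag_of (x, y \<odot>\<^sub>r\<^bsub>HY\<^esub> b)) u)"
  unfolding t1.free_rsmult[symmetric]
  by (rule t1.rsmult_tensor)
    (auto elim!: HYE simp: Y.rsmult_HM Y.smult_HM Y.add_HM span_simps cl_HY Y_Z_r path_mult_assoc path_mult_add_left)

lemma smult_T1:
  "a \<in> span (Ch X 0) \<Longrightarrow> a \<odot>\<^bsub>T1\<^esub> qt I1 u = qt I1 (frag_extend (\<lambda>(x, y). frag_of (path_mult a x, y)) u)"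
  using t1.smult_tensor[of a u]
  by (simp add: t1.free_smult span_simps path_mult_X path_mult_add_right path_mult_assoc)

lemma free_rsmult_closed:
  assumes "b \<in> span (Ch Y 0)" "u \<in> carrier (tensor_free RX HY)"
  shows "frag_extend (\<lambda>(x, y). frag_of (x, y \<odot>\<^sub>r\<^bsub>HY\<^esub> b)) u \<in> carrier (tensor_free RX HY)"
proof -
  have "y \<odot>\<^sub>r\<^bsub>HY\<^esub> b \<in> carrier HY" if "y \<in> carrier HY" for y
    using that assms(1) by (auto elim!: HYE simp: Y.rsmult_HM cl_HY Y_Z_r)
  then show ?thesis
    using assms(2) keys_frag_extend[of "\<lambda>(x, y). frag_of (x, y \<odot>\<^sub>r\<^bsub>HY\<^esub> b)" u]
    by (fastforce simp: t1.carrier_free)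
qed

lemma free_smult_closed:
  assumes "a \<in> span (Ch X 0)" "u \<in> carrier (tensor_free RX HY)"
  shows "frag_extend (\<lambda>(x, y). frag_of (path_mult a x, y)) u \<in> carrier (tensor_free RX HY)"
  using assms keys_frag_extend[of "\<lambda>(x, y). frag_of (path_mult a x, y)" u]
  by (fastforce simp: t1.carrier_free span_simps path_mult_X)

interpretation t2: tensor_closed AY T1 RX
proof
  fix x x' assume "x \<in> carrier T1" "x' \<in> carrier T1"
  then show "x \<oplus>\<^bsub>T1\<^esub> x' \<in> carrier T1"
    using add_subgroupD(2)[OF t1.free_sub] by (auto simp: carrier_T1 add_T1)
next
  fix x b assume "x \<in> carrier T1" "b \<in> carrier AY"
  then show "x \<odot>\<^sub>r\<^bsub>T1\<^esub> b \<in> carrier T1"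
    by (auto simp: carrier_T1 span_simps rsmult_T1 free_rsmult_closed)
qed (auto simp: span_simps path_mult_X span_Y intro: add_subgroupD(2)[OF span_sub])

lemma I2: "add_subgroup I2"
  by (rule t2.kernel_sub)

section \<open>From the extension to marked cycles modulo boundaries\<close>

definition rep :: "('c chain \<Rightarrow>\<^sub>0 'r) set \<Rightarrow> ('c chain \<Rightarrow>\<^sub>0 'r)" where
  "rep m = (SOME z. z \<in> Zy \<and> m = cl z)"

lemma rep: "m \<in> carrier HY \<Longrightarrow> rep m \<in> Zy \<and> cl (rep m) = m"
proof -
  assume "m \<in> carrier HY"
  then have "\<exists>z. z \<in> Zy \<and> m = cl z" by (metis HYE)
  from someI_ex[OF this] show ?thesis unfolding rep_def by simp
qed

lemma rep_cl: "z \<in> Zy \<Longrightarrow> m = cl z \<Longrightarrow> rep m - z \<in> By"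
  using rep[OF cl_HY] qt_eq[OF Y.chains.B_sub] by blast

text \<open>Additive in \<open>a\<close>, but defined through a chosen cycle, so in the class
  \<open>m\<close> it is additive and balanced only up to boundaries.\<close>

definition lift1 :: "('c chain \<Rightarrow>\<^sub>0 'r) \<times> ('c chain \<Rightarrow>\<^sub>0 'r) set \<Rightarrow> 'c chain \<times> nat \<Rightarrow>\<^sub>0 'r" where
  "lift1 = (\<lambda>(a, m). bil (lact Y) a (at_start (rep m)))"

lemma lift1_cong: "a \<in> span (Ch X 0) \<Longrightarrow> z \<in> Zy \<Longrightarrow> m = cl z \<Longrightarrow> lift1 (a, m) - bil (lact Y) a (at_start z) \<in> Bk"
  unfolding lift1_def prod.case bil_diff_right[symmetric] at_start_diff[symmetric]
  by (intro B_l at_start_B rep_cl)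

lemma lift1_kernel: "u \<in> I1 \<Longrightarrow> int_lin lift1 u \<in> Bk"
proof (rule t1.kernel_lift[where H = "int_lin lift1" and h = lift1])
  fix x y y' assume x: "x \<in> carrier RX" and "y \<in> carrier HY" "y' \<in> carrier HY"
  then obtain z z' where z: "z \<in> Zy" "y = cl z" "z' \<in> Zy" "y' = cl z'" by (metis HYE)
  have e: "y \<oplus>\<^bsub>HY\<^esub> y' = cl (z + z')" by (simp add: z Y.add_HM)
  have x': "x \<in> span (Ch X 0)" using x by (simp add: span_simps)
  have "lift1 (x, y \<oplus>\<^bsub>HY\<^esub> y') - bil (lact Y) x (at_start (z + z')) \<in> Bk"
    by (rule lift1_cong[OF x' add_subgroupD(2)[OF Y.chains.Z_sub z(1,3)] e])
  moreover have "lift1 (x, y) - bil (lact Y) x (at_start z) \<in> Bk" "lift1 (x, y') - bil (lact Y) x (at_start z') \<in> Bk"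
    by (rule lift1_cong[OF x' z(1,2)], rule lift1_cong[OF x' z(3,4)])
  note this = calculation this
  from add_subgroupD(4)[OF marked.B_sub add_subgroupD(4)[OF marked.B_sub this(1,2)] this(3)]
  show "lift1 (x, y \<oplus>\<^bsub>HY\<^esub> y') - lift1 (x, y) - lift1 (x, y') \<in> Bk"
    by (simp add: at_start_add bil_add_right algebra_simps)
next
  fix x b y assume x: "x \<in> carrier RX" and b: "b \<in> carrier AY" and "y \<in> carrier HY"
  then obtain z where z: "z \<in> Zy" "y = cl z" by (metis HYE)
  have b': "b \<in> span (Ch Y 0)" using b by (simp add: span_simps)
  have 1: "lift1 (path_mult x b, y) - bil (lact Y) (path_mult x b) (at_start z) \<in> Bk"
    using x b' z by (intro lift1_cong) (auto simp: span_simps intro: path_mult_X span_Y)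
  have "b \<odot>\<^bsub>HY\<^esub> y = cl (path_mult b z)" by (simp add: z Y.smult_HM[OF b'])
  then have 2: "lift1 (x, b \<odot>\<^bsub>HY\<^esub> y) - bil (lact Y) x (at_start (path_mult b z)) \<in> Bk"
    using x b' z by (intro lift1_cong) (auto simp: span_simps intro: Y_Z_l)
  have "bil (lact Y) (path_mult x b) (at_start z) = bil (lact Y) x (at_start (path_mult b z))"
    using x b' at_start_Z[OF z(1)] by (simp add: span_simps lact_mult[of _ n] marked.Z_C span_Y at_start_lact)
  with add_subgroupD(4)[OF marked.B_sub 1 2]
  show "lift1 (x \<odot>\<^sub>r\<^bsub>RX\<^esub> b, y) - lift1 (x, b \<odot>\<^bsub>HY\<^esub> y) \<in> Bk"
    by (simp add: span_simps)
qed (auto simp: int_lin_add marked.B_sub span_simps lift1_def bil_add_left add_subgroupD(1)[OF marked.B_sub])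

lemma lift1_Z: "u \<in> carrier (tensor_free RX HY) \<Longrightarrow> int_lin lift1 u \<in> Zk"
proof -
  assume "u \<in> carrier (tensor_free RX HY)"
  then have "Poly_Mapping.keys u \<subseteq> span (Ch X 0) \<times> carrier HY" by (simp add: t1.carrier_free span_simps)
  then show ?thesis
  proof (induction u rule: frag_induction)
    case (one x)
    then show ?case using rep by (auto simp: lift1_def intro!: Z_l at_start_Z)
  qed (auto simp: int_lin_diff intro: add_subgroupD[OF marked.Z_sub])
qed

text \<open>The first factor is a coset, again evaluated at a chosen representative. Another choice
  changes the value by a boundary, because \<open>lift1\<close> sends the inner relations to
  boundaries.\<close>

definition lift2 :: "(('c chain \<Rightarrow>\<^sub>0 'r) \<times> ('c chain \<Rightarrow>\<^sub>0 'r) set \<Rightarrow>\<^sub>0 int) set \<times> ('c chain \<Rightarrow>\<^sub>0 'r) \<Rightarrow> 'c chain \<times> nat \<Rightarrow>\<^sub>0 'r" where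
  "lift2 = (\<lambda>(U, b). bil ract (int_lin lift1 (SOME u. u \<in> carrier (tensor_free RX HY) \<and> U = qt I1 u)) b)"

lemma lift2_cong:
  assumes "u \<in> carrier (tensor_free RX HY)" "b \<in> span (Ch X 0)" "U = qt I1 u"
  shows "lift2 (U, b) - bil ract (int_lin lift1 u) b \<in> Bk"
proof -
  have "\<exists>u'. u' \<in> carrier (tensor_free RX HY) \<and> U = qt I1 u'" using assms by blast
  from someI_ex[OF this] have some: "U = qt I1 (SOME u. u \<in> carrier (tensor_free RX HY) \<and> U = qt I1 u)"
    by blast
  define u' where "u' = (SOME u. u \<in> carrier (tensor_free RX HY) \<and> U = qt I1 u)"
  have u': "U = qt I1 u'" "lift2 (U, b) = bil ract (int_lin lift1 u') b"
    using some by (simp_all add: lift2_def u'_def)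
  then have "u' - u \<in> I1" using assms(3) qt_eq[OF I1] by blast
  then show ?thesis
    unfolding u'(2) bil_diff_left[symmetric] int_lin_diff[symmetric]
    using assms(2) by (intro B_r lift1_kernel)
qed

lemma lift2_kernel: "w \<in> I2 \<Longrightarrow> int_lin lift2 w \<in> Bk"
proof (rule t2.kernel_lift[where H = "int_lin lift2" and h = lift2])
  fix x x' y assume "x \<in> carrier T1" "x' \<in> carrier T1" and y: "y \<in> carrier RX"
  then obtain u u' where u: "u \<in> carrier (tensor_free RX HY)" "x = qt I1 u"
    "u' \<in> carrier (tensor_free RX HY)" "x' = qt I1 u'" by (auto simp: carrier_T1)
  have "lift2 (x \<oplus>\<^bsub>T1\<^esub> x', y) - bil ract (int_lin lift1 (u + u')) y \<in> Bk"
    "lift2 (x, y) - bil ract (int_lin lift1 u) y \<in> Bk" "lift2 (x', y) - bil ract (int_lin lift1 u') y \<in> Bk"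
    using u y add_subgroupD(2)[OF t1.free_sub] by (auto simp: span_simps add_T1 intro!: lift2_cong)
  from add_subgroupD(4)[OF marked.B_sub add_subgroupD(4)[OF marked.B_sub this(1,2)] this(3)]
  show "lift2 (x \<oplus>\<^bsub>T1\<^esub> x', y) - lift2 (x, y) - lift2 (x', y) \<in> Bk"
    by (simp add: int_lin_add bil_add_left algebra_simps)
next
  fix x b y assume "x \<in> carrier T1" and b: "b \<in> carrier AY" and y: "y \<in> carrier RX"
  then obtain u where u: "u \<in> carrier (tensor_free RX HY)" "x = qt I1 u" by (auto simp: carrier_T1)
  have b': "b \<in> span (Ch Y 0)" and y': "y \<in> span (Ch X 0)" using b y by (simp_all add: span_simps)
  define ub where "ub = frag_extend (\<lambda>(x, y). frag_of (x, y \<odot>\<^sub>r\<^bsub>HY\<^esub> b)) u"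
  have 1: "lift2 (x \<odot>\<^sub>r\<^bsub>T1\<^esub> b, y) - bil ract (int_lin lift1 ub) y \<in> Bk"
    using u b' y' by (intro lift2_cong) (auto simp: ub_def rsmult_T1 free_rsmult_closed)
  have 2: "lift2 (x, path_mult b y) - bil ract (int_lin lift1 u) (path_mult b y) \<in> Bk"
    using u b' y' by (intro lift2_cong) (auto intro: path_mult_X span_Y)
  have "Poly_Mapping.keys u \<subseteq> span (Ch X 0) \<times> carrier HY" using u by (simp add: t1.carrier_free span_simps)
  \<comment> \<open>Acting by \<open>b\<close> on homology classes and acting on marked chains agree
    up to a boundary; it suffices to check this on generators of the free group.\<close>
  then have "int_lin lift1 ub - bil ract (int_lin lift1 u) b \<in> Bk"
    unfolding ub_def
  proof (induction u rule: frag_induction)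
    case zero
    then show ?case by (simp add: add_subgroupD(1)[OF marked.B_sub])
  next
    case (one x)
    then obtain a z where z: "x = (a, cl z)" "a \<in> span (Ch X 0)" "z \<in> Zy" by (auto elim!: HYE)
    have 1: "lift1 (a, cl z) - bil (lact Y) a (at_start z) \<in> Bk" using z by (intro lift1_cong) auto
    have 2: "lift1 (a, cl (path_mult z b)) - bil (lact Y) a (at_start (path_mult z b)) \<in> Bk"
      using z b' by (intro lift1_cong) (auto intro: Y_Z_r)
    have "bil (lact Y) a (at_start (path_mult z b)) = bil ract (bil (lact Y) a (at_start z)) b"
      using z b' marked.Z_C[OF at_start_Z[OF z(3)]] by (simp add: at_start_ract[symmetric] lact_ract[of _ n] span_Y)
    with add_subgroupD(4)[OF marked.B_sub 2 B_r[OF span_Y[OF b'] 1]]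
    show ?case by (simp add: z Y.rsmult_HM[OF b'] bil_diff_left)
  next
    case (diff c d)
    from add_subgroupD(4)[OF marked.B_sub diff]
    show ?case by (simp add: frag_extend_diff int_lin_diff bil_diff_left algebra_simps)
  qed
  then have 3: "bil ract (int_lin lift1 ub - bil ract (int_lin lift1 u) b) y \<in> Bk" by (rule B_r[OF y'])
  have "bil ract (int_lin lift1 u) (path_mult b y) = bil ract (bil ract (int_lin lift1 u) b) y"
    using ract_mult[of "int_lin lift1 u" n b y] marked.Z_C[OF lift1_Z[OF u(1)]] b' y' span_Y by blast
  with add_subgroupD(2)[OF marked.B_sub add_subgroupD(4)[OF marked.B_sub 1 2] 3]
  show "lift2 (x \<odot>\<^sub>r\<^bsub>T1\<^esub> b, y) - lift2 (x, b \<odot>\<^bsub>RX\<^esub> y) \<in> Bk"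
    by (simp add: span_simps bil_diff_left)
qed (auto simp: int_lin_add marked.B_sub span_simps lift2_def bil_add_right add_subgroupD(1)[OF marked.B_sub])

text \<open>A representative in the outer free group: the inner tensor is already a coset, the outer
  one is not. Hence balancing in the inner product is an equality and balancing in the outer one a
  congruence modulo \<open>I2\<close>.\<close>

definition pure_tensor where "pure_tensor a z b = frag_of (qt I1 (frag_of (a, cl z)), b)"

lemma lift2_pure_tensor:
  assumes "a \<in> span (Ch X 0)" "b \<in> span (Ch X 0)" "z \<in> Zy"
  shows "int_lin lift2 (pure_tensor a z b) - two_sided a z b \<in> Bk"
proof -
  have "lift2 (qt I1 (frag_of (a, cl z)), b) - bil ract (int_lin lift1 (frag_of (a, cl z))) b \<in> Bk"
    by (rule lift2_cong) (use assms cl_HY in \<open>auto simp: t1.carrier_free span_simps\<close>)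
  moreover have "bil ract (lift1 (a, cl z) - bil (lact Y) a (at_start z)) b \<in> Bk"
    using assms by (intro B_r lift1_cong) auto
  ultimately have "lift2 (qt I1 (frag_of (a, cl z)), b) - bil ract (int_lin lift1 (frag_of (a, cl z))) b
      + bil ract (lift1 (a, cl z) - bil (lact Y) a (at_start z)) b \<in> Bk"
    by (rule add_subgroupD(2)[OF marked.B_sub])
  then show ?thesis by (simp add: pure_tensor_def two_sided_def bil_diff_left)
qed

lemma frag_T1: "a \<in> span (Ch X 0) \<Longrightarrow> z \<in> Zy \<Longrightarrow> qt I1 (frag_of (a, cl z)) \<in> carrier T1"
  unfolding carrier_T1 by (rule imageI) (simp add: t1.carrier_free span_simps cl_HY)

text \<open>Additivity in an inner factor uses both products: the inner relations give a sum of
  cosets, which the outer relation distributes.\<close>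

lemma pure_tensor_add1:
  assumes "a \<in> span (Ch X 0)" "a' \<in> span (Ch X 0)" "b \<in> span (Ch X 0)" "z \<in> Zy"
  shows "eqv I2 (pure_tensor (a + a') z b) (pure_tensor a z b + pure_tensor a' z b)"
proof -
  have "qt I1 (frag_of (a + a', cl z)) = qt I1 (frag_of (a, cl z) + frag_of (a', cl z))"
    using t1.kernel_add_left[of a a' "cl z"] assms cl_HY
    by (intro qt_cong[OF I1]) (simp add: span_simps diff_diff_eq)
  then have "pure_tensor (a + a') z b = frag_of (qt I1 (frag_of (a, cl z)) \<oplus>\<^bsub>T1\<^esub> qt I1 (frag_of (a', cl z)), b)"
    by (simp add: pure_tensor_def add_T1)
  then show ?thesis
    using t2.kernel_add_left[OF frag_T1[OF assms(1,4)] frag_T1[OF assms(2,4)], of b] assms(3)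
    by (simp add: eqv_def pure_tensor_def span_simps diff_diff_eq)
qed

lemma pure_tensor_add2:
  assumes "a \<in> span (Ch X 0)" "b \<in> span (Ch X 0)" "z \<in> Zy" "z' \<in> Zy"
  shows "eqv I2 (pure_tensor a (z + z') b) (pure_tensor a z b + pure_tensor a z' b)"
proof -
  have "qt I1 (frag_of (a, cl (z + z'))) = qt I1 (frag_of (a, cl z) + frag_of (a, cl z'))"
    using t1.kernel_add_right[of a "cl z" "cl z'"] assms cl_HY
    by (intro qt_cong[OF I1]) (simp add: span_simps diff_diff_eq Y.add_HM)
  then have "pure_tensor a (z + z') b = frag_of (qt I1 (frag_of (a, cl z)) \<oplus>\<^bsub>T1\<^esub> qt I1 (frag_of (a, cl z')), b)"
    by (simp add: pure_tensor_def add_T1)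
  then show ?thesis
    using t2.kernel_add_left[OF frag_T1[OF assms(1,3)] frag_T1[OF assms(1,4)], of b] assms(2)
    by (simp add: eqv_def pure_tensor_def span_simps diff_diff_eq)
qed

lemma pure_tensor_add3:
  assumes "a \<in> span (Ch X 0)" "b \<in> span (Ch X 0)" "b' \<in> span (Ch X 0)" "z \<in> Zy"
  shows "eqv I2 (pure_tensor a z (b + b')) (pure_tensor a z b + pure_tensor a z b')"
  using t2.kernel_add_right[OF frag_T1[OF assms(1,4)], of b b'] assms(2,3)
  by (simp add: eqv_def pure_tensor_def span_simps diff_diff_eq)

lemma pure_tensor_bal1:
  assumes "a \<in> span (Ch X 0)" "s \<in> span (Ch Y 0)" "z \<in> Zy"
  shows "pure_tensor (path_mult a s) z b = pure_tensor a (path_mult s z) b"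
proof -
  have "qt I1 (frag_of (path_mult a s, cl z)) = qt I1 (frag_of (a, cl (path_mult s z)))"
    using t1.kernel_balanced[of a s "cl z"] assms cl_HY
    by (intro qt_cong[OF I1]) (simp add: span_simps Y.smult_HM)
  then show ?thesis by (simp add: pure_tensor_def)
qed

lemma pure_tensor_bal2:
  assumes "a \<in> span (Ch X 0)" "s \<in> span (Ch Y 0)" "b \<in> span (Ch X 0)" "z \<in> Zy"
  shows "eqv I2 (pure_tensor a (path_mult z s) b) (pure_tensor a z (path_mult s b))"
  using t2.kernel_balanced[OF frag_T1[OF assms(1,4)], of s b] assms(2,3)
  by (simp add: eqv_def pure_tensor_def span_simps rsmult_T1 Y.rsmult_HM)

text \<open>Additivity applied to \<open>0 + 0\<close> makes the tensor congruent to twice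
  itself.\<close>

lemma pure_tensor_zero:
  assumes "b \<in> span (Ch X 0)" "z \<in> Zy"
  shows "pure_tensor 0 z b \<in> I2" "pure_tensor b z 0 \<in> I2"
proof -
  have 0: "(0 :: 'c chain \<Rightarrow>\<^sub>0 'r) \<in> span (Ch X 0)" by (rule add_subgroupD(1)[OF span_sub])
  show "pure_tensor 0 z b \<in> I2"
    using pure_tensor_add1[OF 0 0 assms] add_subgroupD(3)[OF I2, of "- pure_tensor 0 z b"] by (simp add: eqv_def)
  show "pure_tensor b z 0 \<in> I2"
    using pure_tensor_add3[OF assms(1) 0 0 assms(2)] add_subgroupD(3)[OF I2, of "- pure_tensor b z 0"] by (simp add: eqv_def)
qed

text \<open>A boundary has the same class as \<open>0\<close>, and additivity at
  \<open>0 + 0\<close> applies again.\<close>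

lemma pure_tensor_B:
  assumes "a \<in> span (Ch X 0)" "b \<in> span (Ch X 0)" "z \<in> By"
  shows "pure_tensor a z b \<in> I2"
proof -
  have 0: "0 \<in> Zy" by (rule add_subgroupD(1)[OF Y.chains.Z_sub])
  have "cl z = cl 0" using assms(3) by (intro qt_cong[OF Y.chains.B_sub]) simp
  then have "pure_tensor a z b = pure_tensor a 0 b" by (simp add: pure_tensor_def)
  moreover have "pure_tensor a 0 b \<in> I2"
    using pure_tensor_add2[OF assms(1,2) 0 0] add_subgroupD(3)[OF I2, of "- pure_tensor a 0 b"] by (simp add: eqv_def)
  ultimately show ?thesis by simp
qed

abbreviation "sg k \<equiv> Poly_Mapping.single k (1::'r)"

text \<open>Every element of the extension has a normal form indexed by the pairs \<open>(q, r)\<close> of paths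
  without edges in \<open>Y\<close>; this is the sum of pure tensors attached to a cycle of marked chains.\<close>

definition ext_rep :: "('c chain \<times> nat \<Rightarrow>\<^sub>0 'r) \<Rightarrow> _" where
  "ext_rep z = (\<Sum>(q, r)\<in>ends ` Poly_Mapping.keys z. pure_tensor (sg q) (proj q r z) (sg r))"

lemma lpaths_span: "q \<in> lpaths \<Longrightarrow> sg q \<in> span (Ch X 0)"
  and rpaths_span: "r \<in> rpaths \<Longrightarrow> sg r \<in> span (Ch X 0)"
  by (auto simp: lpaths_def rpaths_def span_single)

lemma proj_Z:
  assumes "q \<in> lpaths" "r \<in> rpaths" "z \<in> Zk"
  shows "proj q r z \<in> Zy"
proof -
  have "proj q r z \<in> span (Ch Y n)" using proj_span_Ch assms marked.Z_C by blast
  moreover from this have "boundary Y (proj q r z) = proj q r (lin (mark_bd X) z)"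
    using proj_mark_bd[OF assms(1,2) marked.Z_C[OF assms(3)]] boundary_sub by metis
  ultimately show ?thesis
    using marked.Z_d[OF assms(3)] by (simp add: Y.chains.Z_def) (simp add: proj_def)
qed

lemma proj_B:
  assumes "q \<in> lpaths" "r \<in> rpaths" "z \<in> Bk"
  shows "proj q r z \<in> By"
proof -
  obtain y where y: "y \<in> span (marks (Suc n))" "z = lin (mark_bd X) y" using assms(3) by (auto simp: marked.B_def)
  have "proj q r y \<in> span (Ch Y (Suc n))" using proj_span_Ch assms y by blast
  moreover from this have "proj q r z = boundary Y (proj q r y)"
    using proj_mark_bd[OF assms(1,2) y(1)] y(2) boundary_sub by metis
  ultimately show ?thesis by (simp add: Y.chains.B_def)
qed

lemma ends_keys: "z \<in> span (marks n) \<Longrightarrow> ends ` Poly_Mapping.keys z \<subseteq> lpaths \<times> rpaths"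
proof
  fix x assume z: "z \<in> span (marks n)" and "x \<in> ends ` Poly_Mapping.keys z"
  then obtain k where k: "k \<in> marks n" "x = ends k" by (auto simp: span_def)
  from k(1) show "x \<in> lpaths \<times> rpaths"
    by (rule marks_joinE) (simp add: k(2) ends_join)
qed

lemma proj_zero:
  assumes "z \<in> span (marks n)" "q \<in> lpaths" "r \<in> rpaths" "(q, r) \<notin> ends ` Poly_Mapping.keys z"
  shows "proj q r z = 0"
proof -
  have "lin (inner q r) z = lin (\<lambda>_. 0) z"
  proof (rule lin_cong)
    fix k assume k: "k \<in> Poly_Mapping.keys z"
    then have "k \<in> marks n" using assms(1) by (auto simp: span_def)
    then obtain q' c r' where e: "k = join q' c r'" "q' \<in> lpaths" "c \<in> mid n q' r'" "r' \<in> rpaths"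
      by (rule marks_joinE)
    then have "(q, r) \<noteq> (q', r')" using ends_join[OF e(2,4,3)] k assms(4) by force
    then show "inner q r k = 0" unfolding e(1) inner_join[OF assms(2,3) e(2,4,3)] by auto
  qed
  then show ?thesis by (simp add: proj_def)
qed

text \<open>Components outside \<open>ends\<close> are zero, so the index set may be enlarged. This
  lets the normal forms of several cycles be compared over one common set.\<close>

lemma ext_rep_cong:
  assumes "z \<in> Zk" "finite F" "ends ` Poly_Mapping.keys z \<subseteq> F" "F \<subseteq> lpaths \<times> rpaths"
  shows "eqv I2 (ext_rep z) (\<Sum>(q, r)\<in>F. pure_tensor (sg q) (proj q r z) (sg r))"
proof -
  let ?E = "ends ` Poly_Mapping.keys z" and ?t = "\<lambda>(q, r). pure_tensor (sg q) (proj q r z) (sg r)"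
  have "sum ?t (F - ?E) \<in> I2"
  proof (rule add_subgroup_sum[OF I2])
    fix x assume x': "x \<in> F - ?E"
    obtain q r where x: "x = (q, r)" by (cases x)
    have qr: "q \<in> lpaths" "r \<in> rpaths" "(q, r) \<notin> ?E"
      using x' assms(4) unfolding x by blast+
    have "proj q r z = 0" by (rule proj_zero[OF marked.Z_C[OF assms(1)] qr])
    then show "?t x \<in> I2"
      using pure_tensor_B[OF lpaths_span[OF qr(1)] rpaths_span[OF qr(2)] add_subgroupD(1)[OF Y.chains.B_sub]]
      by (simp add: x)
  qed
  then have "- sum ?t (F - ?E) \<in> I2" by (rule add_subgroupD(3)[OF I2])
  moreover have "sum ?t F = sum ?t (F - ?E) + sum ?t ?E" by (rule sum.subset_diff[OF assms(3,2)])
  ultimately show ?thesis unfolding eqv_def ext_rep_def by simp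
qed

text \<open>The supports of two cycles and of their sum differ, so all three normal forms are
  rewritten over the union of the index sets.\<close>

lemma ext_rep_add:
  assumes "z \<in> Zk" "z' \<in> Zk"
  shows "eqv I2 (ext_rep (z + z')) (ext_rep z + ext_rep z')"
proof -
  let ?F = "ends ` Poly_Mapping.keys z \<union> ends ` Poly_Mapping.keys z'"
  let ?t = "\<lambda>z (q, r). pure_tensor (sg q) (proj q r z) (sg r)"
  have F: "finite ?F" "?F \<subseteq> lpaths \<times> rpaths"
    by simp (intro Un_least ends_keys[OF marked.Z_C[OF assms(1)]] ends_keys[OF marked.Z_C[OF assms(2)]])
  have zz: "z + z' \<in> Zk" using add_subgroupD(2)[OF marked.Z_sub assms] .
  have c: "eqv I2 (ext_rep (z + z')) (sum (?t (z + z')) ?F)" "eqv I2 (ext_rep z) (sum (?t z) ?F)"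
    "eqv I2 (ext_rep z') (sum (?t z') ?F)"
    by (rule ext_rep_cong[OF zz F(1) _ F(2)], use Poly_Mapping.keys_add[of z z'] in blast)
      (rule ext_rep_cong[OF assms(1) F(1) _ F(2)], blast, rule ext_rep_cong[OF assms(2) F(1) _ F(2)], blast)
  have m: "eqv I2 (sum (?t (z + z')) ?F) (\<Sum>x\<in>?F. ?t z x + ?t z' x)"
  proof (rule eqv_sum[OF I2])
    fix x assume "x \<in> ?F"
    then obtain q r where x: "x = (q, r)" "q \<in> lpaths" "r \<in> rpaths" using F(2) by blast
    have "proj q r (z + z') = proj q r z + proj q r z'" by (simp add: proj_def lin_add)
    then show "eqv I2 (?t (z + z') x) (?t z x + ?t z' x)"
      using pure_tensor_add2[OF lpaths_span[OF x(2)] rpaths_span[OF x(3)] proj_Z[OF x(2,3) assms(1)] proj_Z[OF x(2,3) assms(2)]]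
      by (simp add: x(1))
  qed
  show ?thesis
    using eqvD(3)[OF I2 c(1) eqvD(3)[OF I2 m[unfolded sum.distrib] eqvD(2)[OF I2 eqvD(4)[OF I2 c(2,3)]]]] .
qed

lemma ext_rep_zero: "ext_rep 0 = 0"
  by (simp add: ext_rep_def)

lemma ext_rep_diff:
  assumes "z \<in> Zk" "z' \<in> Zk"
  shows "eqv I2 (ext_rep (z - z')) (ext_rep z - ext_rep z')"
proof -
  have "eqv I2 (ext_rep z) (ext_rep (z - z') + ext_rep z')"
    using ext_rep_add[OF add_subgroupD(4)[OF marked.Z_sub assms] assms(2)] by simp
  from eqvD(5)[OF I2 this eqvD(1)[OF I2, of "ext_rep z'"]] have "eqv I2 (ext_rep z - ext_rep z') (ext_rep (z - z'))"
    by simp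
  then show ?thesis by (rule eqvD(2)[OF I2])
qed

lemma ext_rep_sum:
  assumes "finite F" "\<And>x. x \<in> F \<Longrightarrow> f x \<in> Zk"
  shows "eqv I2 (ext_rep (sum f F)) (\<Sum>x\<in>F. ext_rep (f x))"
  using assms
proof (induction F)
  case empty
  then show ?case by (simp add: ext_rep_zero eqvD(1)[OF I2])
next
  case (insert x F)
  have "sum f F \<in> Zk" using insert.prems by (intro add_subgroup_sum[OF marked.Z_sub]) auto
  then have "eqv I2 (ext_rep (f x + sum f F)) (ext_rep (f x) + ext_rep (sum f F))"
    using insert.prems by (intro ext_rep_add) auto
  also have "eqv I2 \<dots> (ext_rep (f x) + (\<Sum>x\<in>F. ext_rep (f x)))"
    using insert by (intro eqvD(1,4)[OF I2]) auto
  finally (eqvD(3)[OF I2]) show ?case using insert.hyps by simp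
qed

lemma ext_rep_emb:
  assumes "q \<in> lpaths" "r \<in> rpaths" "z \<in> span (mid n q r)" "z \<in> Zy"
  shows "eqv I2 (ext_rep (emb q r z)) (pure_tensor (sg q) z (sg r))"
proof -
  have "Poly_Mapping.keys (emb q r z) \<subseteq> (\<lambda>c. join q c r) ` mid n q r"
    unfolding emb_def by (rule keys_lin_subset) (use assms(3) in \<open>auto simp: span_def\<close>)
  then have "ends ` Poly_Mapping.keys (emb q r z) \<subseteq> {(q, r)}"
    using ends_join[OF assms(1,2)] by blast
  moreover have "emb q r z \<in> Zk"
    unfolding emb_two_sided[OF assms(1,3)] using assms by (intro two_sided_Z lpaths_span rpaths_span)
  ultimately have "eqv I2 (ext_rep (emb q r z)) (\<Sum>(q', r')\<in>{(q, r)}. pure_tensor (sg q') (proj q' r' (emb q r z)) (sg r'))"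
    using assms by (intro ext_rep_cong[where z = "emb q r z"]) auto
  then show ?thesis using proj_emb[OF assms(1,2,1,2,3)] by simp
qed

lemma path_end_split:
  assumes "(v, ps, w) \<in> Ch X 0" "w \<in> cells Y 0"
  obtains qs s x where "ps = qs @ s" "(v, qs, x) \<in> lpaths" "(x, s, w) \<in> Ch Y 0"
proof -
  obtain qs s where qs: "ps = qs @ s" "set qs \<inter> cubes Y = {}" "set s \<subseteq> cubes Y"
    using rel_end[OF assms] by blast
  obtain x where x: "(v, qs, x) \<in> Ch X 0" "(x, s, w) \<in> Ch X 0"
    using assms(1) unfolding qs by (auto elim: Ch_appendE[OF X])
  have "x \<in> cells Y 0" using x(2) qs(3) assms(2) cube_chain_sub_end by (auto simp: Ch_iff)
  then show ?thesis using that[of qs s x] qs x by (simp add: lpaths_def Ch_sub)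
qed

lemma path_start_split:
  assumes "(v, ps, w) \<in> Ch X 0" "v \<in> cells Y 0"
  obtains s rs y where "ps = s @ rs" "(y, rs, w) \<in> rpaths" "(v, s, y) \<in> Ch Y 0"
proof -
  obtain s rs where rs: "ps = s @ rs" "set s \<subseteq> cubes Y" "set rs \<inter> cubes Y = {}"
    using rel_start[OF assms] by blast
  obtain y where y: "(v, s, y) \<in> Ch X 0" "(y, rs, w) \<in> Ch X 0"
    using assms(1) unfolding rs by (auto elim: Ch_appendE[OF X])
  have s: "(v, s, y) \<in> Ch Y 0" using y rs assms(2) by (simp add: Ch_sub)
  then have "y \<in> cells Y 0" by (auto simp: Ch_def dest: cube_chainD)
  then show ?thesis using that[of s rs y] rs y s by (simp add: rpaths_def)
qed

text \<open>It fixes the cycles of \<open>Y\<close> on both sides. Multiplied to a path of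
  \<open>X\<close>, it keeps the path or kills it according to whether the end point on that side
  lies in \<open>Y\<close>.\<close>

definition unitY :: "'c chain \<Rightarrow>\<^sub>0 'r" where
  "unitY = (\<Sum>v\<in>cells Y 0. Poly_Mapping.single (v, [], v) 1)"

lemma unitY: "unitY \<in> span (Ch Y 0)" "z \<in> Zy \<Longrightarrow> path_mult unitY z = z" "z \<in> Zy \<Longrightarrow> path_mult z unitY = z"
  using Y.path_one Y.unit_left[of z n R] Y.unit_right[of z n R] Y.chains.Z_C
  by (auto simp: unitY_def path_algebra_def)

text \<open>If an inner end point is outside \<open>Y\<close>, moving \<open>unitY\<close> across
  the tensor sign shows that both sides vanish up to \<open>I2\<close>. Otherwise both paths are
  factored and their parts in \<open>Y\<close> are absorbed into the cycle; what remains is a single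
  component of the normal form.\<close>

lemma ext_rep_single:
  assumes p: "p \<in> Ch X 0" "p' \<in> Ch X 0" and z: "z \<in> Zy"
  shows "eqv I2 (ext_rep (two_sided (Poly_Mapping.single p \<alpha>) z (Poly_Mapping.single p' \<beta>)))
    (pure_tensor (Poly_Mapping.single p \<alpha>) z (Poly_Mapping.single p' \<beta>))"
proof -
  let ?a = "Poly_Mapping.single p \<alpha>" and ?b = "Poly_Mapping.single p' \<beta>"
  note ab = span_single[OF p(1), of \<alpha>] span_single[OF p(2), of \<beta>]
  note zC = Y.chains.Z_C[OF z]
  obtain v ps w w' ps' u where e: "p = (v, ps, w)" "p' = (w', ps', u)" by (cases p, cases p')
  consider (1) "w \<notin> cells Y 0" | (2) "w' \<notin> cells Y 0" | (3) "w \<in> cells Y 0" "w' \<in> cells Y 0" by blast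
  then show ?thesis
  proof cases
    case 1
    \<comment> \<open>The path \<open>p\<close> ends outside \<open>Y\<close>, so no constant path
      in \<open>unitY\<close> can be appended to it.\<close>
    have 0: "path_mult ?a unitY = 0"
      unfolding path_mult_bil unitY_def bil_sum_right by (rule sum.neutral) (use 1 in \<open>auto simp: e\<close>)
    have "two_sided ?a z ?b = 0"
      using two_sided_bal(1)[OF unitY(1) ab(1,2) zC] unitY(2)[OF z] by (simp add: 0) (simp add: two_sided_def)
    moreover have "pure_tensor ?a z ?b = pure_tensor 0 z ?b"
      using pure_tensor_bal1[OF ab(1) unitY(1) z, of ?b] unitY(2)[OF z] by (simp add: 0)
    ultimately show ?thesis
      using add_subgroupD(3)[OF I2 pure_tensor_zero(1)[OF ab(2) z]] by (simp add: ext_rep_zero eqv_def)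
  next
    case 2
    have 0: "path_mult unitY ?b = 0"
      unfolding path_mult_bil unitY_def bil_sum_left by (rule sum.neutral) (use 2 in \<open>auto simp: e\<close>)
    have "two_sided ?a z ?b = 0"
      using two_sided_bal(2)[OF unitY(1) ab(1,2) zC] unitY(3)[OF z] by (simp add: 0) (simp add: two_sided_def)
    moreover have t1: "eqv I2 (pure_tensor ?a z ?b) (pure_tensor ?a z 0)"
      using pure_tensor_bal2[OF ab(1) unitY(1) ab(2) z] unitY(3)[OF z] by (simp add: 0)
    have t2: "eqv I2 (pure_tensor ?a z 0) 0" using pure_tensor_zero(2)[OF ab(1) z] by (simp add: eqv_def)
    note eqvD(2)[OF I2 eqvD(3)[OF I2 t1 t2]]
    ultimately show ?thesis by (simp add: ext_rep_zero)
  next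
    case 3
    obtain qs s x where q: "ps = qs @ s" "(v, qs, x) \<in> lpaths" "(x, s, w) \<in> Ch Y 0"
      using path_end_split[OF p(1)[unfolded e] 3(1)] .
    obtain s' rs y where r: "ps' = s' @ rs" "(y, rs, u) \<in> rpaths" "(w', s', y) \<in> Ch Y 0"
      using path_start_split[OF p(2)[unfolded e] 3(2)] .
    let ?q = "(v, qs, x)" and ?r = "(y, rs, u)"
    let ?s = "Poly_Mapping.single (x, s, w) \<alpha>" and ?s' = "Poly_Mapping.single (w', s', y) \<beta>"
    note s = span_single[OF q(3), of \<alpha>] span_single[OF r(3), of \<beta>]
    note qr = lpaths_span[OF q(2)] rpaths_span[OF r(2)]
    have a: "?a = path_mult (sg ?q) ?s" and b: "?b = path_mult ?s' (sg ?r)"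
      by (simp_all add: path_mult_bil e q(1) r(1))
    have sz: "path_mult ?s z \<in> Zy" by (rule Y_Z_l[OF s(1) z])
    \<comment> \<open>The factors \<open>?s\<close> and \<open>?s'\<close> fix the end points of
      \<open>z'\<close>, which places it in the component of \<open>?q\<close> and
      \<open>?r\<close>.\<close>
    define z' where "z' = path_mult (path_mult ?s z) ?s'"
    have z': "z' \<in> Zy" unfolding z'_def by (rule Y_Z_r[OF s(2) sz])
    have "z' \<in> span {c. snd (snd c) = y}"
      unfolding z'_def path_mult_bil bil_single_right[of _ "bil _ _ _"]
      by (intro span_smul lin_span[where S = UNIV]) (auto simp: cat_def span_def split: prod.splits)
    moreover have "z' \<in> span {c. fst c = x}"
      unfolding z'_def path_mult_assoc unfolding path_mult_bil bil_single_left[of _ _ _ "bil _ _ _"]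
      by (intro span_smul lin_span[where S = UNIV]) (auto simp: cat_def span_def split: prod.splits)
    ultimately have mid: "z' \<in> span (mid n ?q ?r)"
      using Y.chains.Z_C[OF z'] by (auto simp: span_def mid_def)
    have "two_sided ?a z ?b = two_sided (sg ?q) (path_mult ?s z) (path_mult ?s' (sg ?r))"
      unfolding a using two_sided_bal(1)[OF s(1) qr(1) ab(2) zC] b by simp
    also have "\<dots> = two_sided (sg ?q) z' (sg ?r)"
      unfolding z'_def using two_sided_bal(2)[OF s(2) qr Y.chains.Z_C[OF sz]] by simp
    finally have "ext_rep (two_sided ?a z ?b) = ext_rep (emb ?q ?r z')"
      using emb_two_sided[OF q(2) mid] by simp
    then have e1: "eqv I2 (ext_rep (two_sided ?a z ?b)) (pure_tensor (sg ?q) z' (sg ?r))"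
      using ext_rep_emb[OF q(2) r(2) mid z'] by simp
    have e2: "eqv I2 (pure_tensor (sg ?q) z' (sg ?r)) (pure_tensor (sg ?q) (path_mult ?s z) ?b)"
      unfolding z'_def b by (rule pure_tensor_bal2[OF qr(1) s(2) qr(2) sz])
    have "pure_tensor (sg ?q) (path_mult ?s z) ?b = pure_tensor ?a z ?b"
      unfolding a by (rule pure_tensor_bal1[OF qr(1) s(1) z, symmetric])
    with eqvD(3)[OF I2 e1 e2] show ?thesis by simp
  qed
qed

text \<open>Both sides are additive in \<open>a\<close> and in \<open>b\<close> up to
  \<open>I2\<close>, which reduces the claim to basis paths.\<close>

lemma ext_rep_tri:
  assumes a: "a \<in> span (Ch X 0)" and b: "b \<in> span (Ch X 0)" and z: "z \<in> Zy"
  shows "eqv I2 (ext_rep (two_sided a z b)) (pure_tensor a z b)"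
  using a
proof (induction a rule: span_induct)
  case zero
  have "eqv I2 (pure_tensor 0 z b) 0" using pure_tensor_zero(1)[OF b z] by (simp add: eqv_def)
  from eqvD(2)[OF I2 this] show ?case by (simp add: two_sided_def ext_rep_zero)
next
  case (single p \<alpha>)
  show ?case
    using b
  proof (induction b rule: span_induct)
    case zero
    have "eqv I2 (pure_tensor (Poly_Mapping.single p \<alpha>) z 0) 0"
      using pure_tensor_zero(2)[OF span_single[OF single] z] by (simp add: eqv_def)
    from eqvD(2)[OF I2 this] show ?case by (simp add: two_sided_def ext_rep_zero)
  next
    case (single p' \<beta>)
    then show ?case using ext_rep_single[OF \<open>p \<in> Ch X 0\<close> _ z] by blast
  next
    case (add f g)
    note p = span_single[OF single, of \<alpha>]
    have "eqv I2 (ext_rep (two_sided (Poly_Mapping.single p \<alpha>) z (f + g)))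
      (ext_rep (two_sided (Poly_Mapping.single p \<alpha>) z f) + ext_rep (two_sided (Poly_Mapping.single p \<alpha>) z g))"
      unfolding two_sided_add by (intro ext_rep_add two_sided_Z p add.hyps z)
    also have "eqv I2 \<dots> (pure_tensor (Poly_Mapping.single p \<alpha>) z f + pure_tensor (Poly_Mapping.single p \<alpha>) z g)"
      by (intro eqvD(4)[OF I2] add.IH)
    also (eqvD(3)[OF I2]) have "eqv I2 \<dots> (pure_tensor (Poly_Mapping.single p \<alpha>) z (f + g))"
      by (rule eqvD(2)[OF I2 pure_tensor_add3[OF p add.hyps(1,2) z]])
    finally (eqvD(3)[OF I2]) show ?case .
  qed
next
  case (add f g)
  have "eqv I2 (ext_rep (two_sided (f + g) z b)) (ext_rep (two_sided f z b) + ext_rep (two_sided g z b))"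
    unfolding two_sided_add by (intro ext_rep_add two_sided_Z b add.hyps z)
  also have "eqv I2 \<dots> (pure_tensor f z b + pure_tensor g z b)"
    by (intro eqvD(4)[OF I2] add.IH)
  also (eqvD(3)[OF I2]) have "eqv I2 \<dots> (pure_tensor (f + g) z b)"
    by (rule eqvD(2)[OF I2 pure_tensor_add1[OF add.hyps(1,2) b z]])
  finally (eqvD(3)[OF I2]) show ?case .
qed

text \<open>\<open>lift2\<close> undoes \<open>ext_rep\<close> up to boundaries; this keeps the
  kernel of the presentation from exceeding the boundaries.\<close>

lemma lift2_ext_rep:
  assumes "z \<in> Zk"
  shows "int_lin lift2 (ext_rep z) - z \<in> Bk"
proof -
  let ?E = "ends ` Poly_Mapping.keys z"
  have E: "?E \<subseteq> lpaths \<times> rpaths" by (rule ends_keys[OF marked.Z_C[OF assms]])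
  have "(\<Sum>x\<in>?E. int_lin lift2 (case x of (q, r) \<Rightarrow> pure_tensor (sg q) (proj q r z) (sg r))
      - (case x of (q, r) \<Rightarrow> emb q r (proj q r z))) \<in> Bk"
  proof (rule add_subgroup_sum[OF marked.B_sub])
    fix x assume x': "x \<in> ?E"
    obtain q r where x: "x = (q, r)" by (cases x)
    have qr: "q \<in> lpaths" "r \<in> rpaths" using x' E unfolding x by blast+
    have "int_lin lift2 (pure_tensor (sg q) (proj q r z) (sg r)) - two_sided (sg q) (proj q r z) (sg r) \<in> Bk"
      by (rule lift2_pure_tensor[OF lpaths_span[OF qr(1)] rpaths_span[OF qr(2)] proj_Z[OF qr assms]])
    then show "int_lin lift2 (case x of (q, r) \<Rightarrow> pure_tensor (sg q) (proj q r z) (sg r))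
      - (case x of (q, r) \<Rightarrow> emb q r (proj q r z)) \<in> Bk"
      by (simp add: x emb_two_sided[OF qr(1) proj_span[OF qr marked.Z_C[OF assms]]])
  qed
  moreover have "(\<Sum>(q, r)\<in>?E. emb q r (proj q r z)) = z"
    by (rule decompose[OF marked.Z_C[OF assms] _ E order_refl]) simp
  ultimately show ?thesis
    unfolding sum_subtractf ext_rep_def int_lin_sum by (simp only:)
qed

section \<open>The extended homology as the homology of marked chains\<close>

lemma ext_eq: "extHM R X Y (Suc n) = tensor AY T1 RX"
  by (simp add: extHM_def ext_scalars_def)

lemma carrier_ext: "carrier (extHM R X Y (Suc n)) = qt I2 ` carrier (tensor_free T1 RX)"
  unfolding ext_eq tensor_eq[of AY T1 RX] by (rule t2.carrier_quotient)

lemma zero_ext: "\<zero>\<^bsub>extHM R X Y (Suc n)\<^esub> = qt I2 0"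
  unfolding ext_eq tensor_eq[of AY T1 RX] by (rule t2.zero_quotient)

lemma add_ext: "qt I2 u \<oplus>\<^bsub>extHM R X Y (Suc n)\<^esub> qt I2 u' = qt I2 (u + u')"
  unfolding ext_eq tensor_eq[of AY T1 RX] by (rule t2.add_quotient)

lemma smult_ext:
  assumes a: "a \<in> span (Ch X 0)"
  shows "a \<odot>\<^bsub>extHM R X Y (Suc n)\<^esub> qt I2 w = qt I2 (frag_extend (\<lambda>(U, b). frag_of (a \<odot>\<^bsub>T1\<^esub> U, b)) w)"
  unfolding ext_eq t2.free_smult[symmetric]
proof (rule t2.smult_tensor)
  fix x x' assume "x \<in> carrier T1" "x' \<in> carrier T1"
  then show "a \<odot>\<^bsub>T1\<^esub> (x \<oplus>\<^bsub>T1\<^esub> x') = a \<odot>\<^bsub>T1\<^esub> x \<oplus>\<^bsub>T1\<^esub> a \<odot>\<^bsub>T1\<^esub> x'"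
    by (auto simp: carrier_T1 add_T1 smult_T1[OF a] frag_extend_add)
next
  fix x assume "x \<in> carrier T1"
  then show "a \<odot>\<^bsub>T1\<^esub> x \<in> carrier T1"
    by (auto simp: carrier_T1 smult_T1[OF a] free_smult_closed[OF a])
next
  fix x b assume "x \<in> carrier T1" "b \<in> carrier AY"
  then obtain u where u: "x = qt I1 u" and b: "b \<in> span (Ch Y 0)"
    by (auto simp: carrier_T1 span_simps)
  have "frag_extend (\<lambda>(x, y). frag_of (path_mult a x, y)) (frag_extend (\<lambda>(x, y). frag_of (x, y \<odot>\<^sub>r\<^bsub>HY\<^esub> b)) u)
    = frag_extend (\<lambda>(x, y). frag_of (x, y \<odot>\<^sub>r\<^bsub>HY\<^esub> b)) (frag_extend (\<lambda>(x, y). frag_of (path_mult a x, y)) u)"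
    using subset_UNIV[of "Poly_Mapping.keys u"]
    by (induction u rule: frag_induction) (auto simp: frag_extend_diff)
  then show "a \<odot>\<^bsub>T1\<^esub> (x \<odot>\<^sub>r\<^bsub>T1\<^esub> b) = (a \<odot>\<^bsub>T1\<^esub> x) \<odot>\<^sub>r\<^bsub>T1\<^esub> b"
    by (simp add: u smult_T1[OF a] rsmult_T1[OF b])
qed

lemma rsmult_ext:
  assumes a: "a \<in> span (Ch X 0)"
  shows "qt I2 w \<odot>\<^sub>r\<^bsub>extHM R X Y (Suc n)\<^esub> a = qt I2 (frag_extend (\<lambda>(U, b). frag_of (U, path_mult b a)) w)"
  using t2.rsmult_tensor[of a w] a
  by (simp add: ext_eq t2.free_rsmult span_simps path_mult_X path_mult_add_left path_mult_assoc span_Y)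

definition ext_class :: "('c chain \<times> nat \<Rightarrow>\<^sub>0 'r) \<Rightarrow> _" where
  "ext_class z = qt I2 (ext_rep z)"

lemma ext_class_eqI: "eqv I2 (ext_rep z) w \<Longrightarrow> ext_class z = qt I2 w"
  unfolding ext_class_def eqv_def by (rule qt_cong[OF I2])

text \<open>Treats both actions at once: \<open>f\<close> is the action on marked chains,
  \<open>g\<close> and \<open>h\<close> its effect on the outer factors. The elements
  \<open>g q\<close> and \<open>h r\<close> are arbitrary elements of the path algebra, so
  \<open>ext_rep_tri\<close> is what leads back to pure tensors.\<close>

lemma act_decompose:
  assumes z: "z \<in> Zk" and f: "\<And>z z'. f (z + z') = f z + f z'"
    and fz: "\<And>q r z. q \<in> lpaths \<Longrightarrow> r \<in> rpaths \<Longrightarrow> z \<in> Zy \<Longrightarrow> f (two_sided (sg q) z (sg r)) = two_sided (g q) z (h r)"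
    and g: "\<And>q. q \<in> lpaths \<Longrightarrow> g q \<in> span (Ch X 0)" and h: "\<And>r. r \<in> rpaths \<Longrightarrow> h r \<in> span (Ch X 0)"
  shows "eqv I2 (ext_rep (f z)) (\<Sum>(q, r)\<in>ends ` Poly_Mapping.keys z. pure_tensor (g q) (proj q r z) (h r))"
proof -
  let ?E = "ends ` Poly_Mapping.keys z"
  have E: "?E \<subseteq> lpaths \<times> rpaths" by (rule ends_keys[OF marked.Z_C[OF z]])
  have f0: "f 0 = 0" using f[of 0 0] by simp
  have f_sum: "f (sum t F) = (\<Sum>x\<in>F. f (t x))" for t and F :: "('c chain \<times> 'c chain) set"
    by (induction F rule: infinite_finite_induct) (simp_all add: f f0)
  have "f z = f (\<Sum>(q, r)\<in>?E. emb q r (proj q r z))"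
    by (subst decompose[OF marked.Z_C[OF z] _ E order_refl]) simp_all
  also have "\<dots> = (\<Sum>(q, r)\<in>?E. two_sided (g q) (proj q r z) (h r))"
    unfolding f_sum
  proof (rule sum.cong[OF refl])
    fix x assume x': "x \<in> ?E"
    obtain q r where x: "x = (q, r)" by (cases x)
    have qr: "q \<in> lpaths" "r \<in> rpaths" using x' E unfolding x by blast+
    show "f (case x of (q, r) \<Rightarrow> emb q r (proj q r z)) = (case x of (q, r) \<Rightarrow> two_sided (g q) (proj q r z) (h r))"
      by (simp add: x emb_two_sided[OF qr(1) proj_span[OF qr marked.Z_C[OF z]]] fz[OF qr proj_Z[OF qr z]])
  qed
  finally have fz': "f z = (\<Sum>(q, r)\<in>?E. two_sided (g q) (proj q r z) (h r))" .
  have mem: "(case x of (q, r) \<Rightarrow> two_sided (g q) (proj q r z) (h r)) \<in> Zk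
    \<and> eqv I2 (ext_rep (case x of (q, r) \<Rightarrow> two_sided (g q) (proj q r z) (h r))) (case x of (q, r) \<Rightarrow> pure_tensor (g q) (proj q r z) (h r))"
    if x': "x \<in> ?E" for x
  proof -
    obtain q r where x: "x = (q, r)" by (cases x)
    have qr: "q \<in> lpaths" "r \<in> rpaths" using x' E unfolding x by blast+
    show ?thesis unfolding x prod.case
      using two_sided_Z[OF g[OF qr(1)] h[OF qr(2)] proj_Z[OF qr z]] ext_rep_tri[OF g[OF qr(1)] h[OF qr(2)] proj_Z[OF qr z]] by blast
  qed
  have "eqv I2 (ext_rep (f z)) (\<Sum>x\<in>?E. ext_rep (case x of (q, r) \<Rightarrow> two_sided (g q) (proj q r z) (h r)))"
    unfolding fz' by (rule ext_rep_sum) (simp, use mem in blast)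
  moreover have "eqv I2 (\<Sum>x\<in>?E. ext_rep (case x of (q, r) \<Rightarrow> two_sided (g q) (proj q r z) (h r)))
    (\<Sum>(q, r)\<in>?E. pure_tensor (g q) (proj q r z) (h r))"
    by (rule eqv_sum[OF I2]) (use mem in blast)
  ultimately show ?thesis by (rule eqvD(3)[OF I2])
qed

lemma ext_class_add: "z \<in> Zk \<Longrightarrow> z' \<in> Zk \<Longrightarrow> ext_class (z + z') = ext_class z \<oplus>\<^bsub>extHM R X Y (Suc n)\<^esub> ext_class z'"
  unfolding ext_class_eqI[OF ext_rep_add] by (simp add: ext_class_def add_ext)

lemma ext_class_l:
  assumes a: "a \<in> span (Ch X 0)" and z: "z \<in> Zk"
  shows "ext_class (bil (lact Y) a z) = a \<odot>\<^bsub>extHM R X Y (Suc n)\<^esub> ext_class z"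
proof -
  have "eqv I2 (ext_rep (bil (lact Y) a z)) (\<Sum>(q, r)\<in>ends ` Poly_Mapping.keys z. pure_tensor (path_mult a (sg q)) (proj q r z) (sg r))"
    by (rule act_decompose[OF z])
      (auto simp: bil_add_right a lpaths_span rpaths_span path_mult_X intro!: two_sided_lact[of _ _ _ _ n] Y.chains.Z_C)
  moreover have "frag_extend (\<lambda>(U, b). frag_of (a \<odot>\<^bsub>T1\<^esub> U, b)) (pure_tensor (sg q) y (sg r)) = pure_tensor (path_mult a (sg q)) y (sg r)" for q r y
    by (simp add: pure_tensor_def smult_T1[OF a])
  then have "frag_extend (\<lambda>(U, b). frag_of (a \<odot>\<^bsub>T1\<^esub> U, b)) (ext_rep z) = (\<Sum>(q, r)\<in>ends ` Poly_Mapping.keys z. pure_tensor (path_mult a (sg q)) (proj q r z) (sg r))"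
    unfolding ext_rep_def by (subst frag_extend_sum) (auto intro!: sum.cong)
  ultimately show ?thesis
    by (simp add: ext_class_eqI ext_class_def[of z] smult_ext[OF a])
qed

lemma ext_class_r:
  assumes a: "a \<in> span (Ch X 0)" and z: "z \<in> Zk"
  shows "ext_class (bil ract z a) = ext_class z \<odot>\<^sub>r\<^bsub>extHM R X Y (Suc n)\<^esub> a"
proof -
  have "eqv I2 (ext_rep (bil ract z a)) (\<Sum>(q, r)\<in>ends ` Poly_Mapping.keys z. pure_tensor (sg q) (proj q r z) (path_mult (sg r) a))"
    by (rule act_decompose[OF z, where f = "\<lambda>z. bil ract z a"])
      (auto simp: bil_add_left a lpaths_span rpaths_span path_mult_X intro!: two_sided_ract[of _ _ _ _ n] Y.chains.Z_C)
  moreover have "frag_extend (\<lambda>(U, b). frag_of (U, path_mult b a)) (pure_tensor (sg q) y (sg r)) = pure_tensor (sg q) y (path_mult (sg r) a)" for q r y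
    by (simp add: pure_tensor_def)
  then have "frag_extend (\<lambda>(U, b). frag_of (U, path_mult b a)) (ext_rep z) = (\<Sum>(q, r)\<in>ends ` Poly_Mapping.keys z. pure_tensor (sg q) (proj q r z) (path_mult (sg r) a))"
    unfolding ext_rep_def by (subst frag_extend_sum) (auto intro!: sum.cong)
  ultimately show ?thesis
    by (simp add: ext_class_eqI ext_class_def[of z] rsmult_ext[OF a])
qed

text \<open>One direction applies \<open>lift2\<close>, which sends relations to boundaries. The
  other projects a boundary to its components, each of which is a boundary in \<open>Y\<close> and
  has class zero.\<close>

lemma ext_class_ker:
  assumes z: "z \<in> Zk"
  shows "ext_class z = \<zero>\<^bsub>extHM R X Y (Suc n)\<^esub> \<longleftrightarrow> z \<in> Bk"
proof -
  have "ext_class z = \<zero>\<^bsub>extHM R X Y (Suc n)\<^esub> \<longleftrightarrow> ext_rep z \<in> I2"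
    by (simp add: ext_class_def zero_ext qt_eq[OF I2])
  also have "\<dots> \<longleftrightarrow> z \<in> Bk"
  proof
    assume "ext_rep z \<in> I2"
    from add_subgroupD(4)[OF marked.B_sub lift2_kernel[OF this] lift2_ext_rep[OF z]] show "z \<in> Bk" by simp
  next
    assume B: "z \<in> Bk"
    show "ext_rep z \<in> I2"
      unfolding ext_rep_def
    proof (rule add_subgroup_sum[OF I2])
      fix x assume x': "x \<in> ends ` Poly_Mapping.keys z"
      obtain q r where x: "x = (q, r)" by (cases x)
      have qr: "q \<in> lpaths" "r \<in> rpaths"
        using x' ends_keys[OF marked.Z_C[OF z]] unfolding x by blast+
      show "(case x of (q, r) \<Rightarrow> pure_tensor (sg q) (proj q r z) (sg r)) \<in> I2"
        unfolding x prod.case by (rule pure_tensor_B[OF lpaths_span[OF qr(1)] rpaths_span[OF qr(2)] proj_B[OF qr B]])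
    qed
  qed
  finally show ?thesis .
qed

lemma frag_kernel2:
  assumes "u \<in> carrier (tensor_free RX HY)" "u' \<in> carrier (tensor_free RX HY)" "b \<in> span (Ch X 0)"
  shows "eqv I2 (frag_of (qt I1 (u + u'), b)) (frag_of (qt I1 u, b) + frag_of (qt I1 u', b))"
  using t2.kernel_add_left[of "qt I1 u" "qt I1 u'" b] assms
  by (simp add: eqv_def carrier_T1 add_T1 span_simps diff_diff_eq)

text \<open>Pure tensors are reached by \<open>ext_rep_tri\<close> and differences by
  \<open>ext_rep_diff\<close>; together these exhaust the inner free group.\<close>

lemma ext_rep_surj_inner:
  assumes b: "b \<in> span (Ch X 0)" and u: "u \<in> carrier (tensor_free RX HY)"
  shows "\<exists>z\<in>Zk. eqv I2 (ext_rep z) (frag_of (qt I1 u, b))"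
proof -
  have "Poly_Mapping.keys u \<subseteq> span (Ch X 0) \<times> carrier HY" using u by (simp add: t1.carrier_free span_simps)
  \<comment> \<open>Membership in the free group is part of the induction because the difference
    step has to apply \<open>frag_kernel2\<close>.\<close>
  then have "u \<in> carrier (tensor_free RX HY) \<and> (\<exists>z\<in>Zk. eqv I2 (ext_rep z) (frag_of (qt I1 u, b)))"
  proof (induction u rule: frag_induction)
    case zero
    note 0 = add_subgroupD(1)[OF t1.free_sub] and Z0 = add_subgroupD(1)[OF marked.Z_sub]
    have "eqv I2 0 (frag_of (qt I1 0, b))"
      using frag_kernel2[OF 0 0 b] by (simp add: eqv_def)
    then show ?case using 0 by (intro conjI bexI[of _ 0] Z0) (simp_all add: ext_rep_zero)
  next
    case (one x)
    then obtain a z where x: "x = (a, cl z)" "a \<in> span (Ch X 0)" "z \<in> Zy" by (auto elim!: HYE)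
    have "frag_of x \<in> carrier (tensor_free RX HY)" using one by (simp add: t1.carrier_free span_simps)
    moreover have "eqv I2 (ext_rep (two_sided a z b)) (frag_of (qt I1 (frag_of x), b))"
      using ext_rep_tri[OF x(2) b x(3)] by (simp add: pure_tensor_def x(1))
    ultimately show ?case using two_sided_Z[OF x(2) b x(3)] by blast
  next
    case (diff u u')
    then obtain z z' where z: "z \<in> Zk" "eqv I2 (ext_rep z) (frag_of (qt I1 u, b))"
      "z' \<in> Zk" "eqv I2 (ext_rep z') (frag_of (qt I1 u', b))" by blast
    have c: "u - u' \<in> carrier (tensor_free RX HY)" using diff add_subgroupD(4)[OF t1.free_sub] by blast
    have "eqv I2 (frag_of (qt I1 u, b)) (frag_of (qt I1 (u - u'), b) + frag_of (qt I1 u', b))"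
      using frag_kernel2[OF c _ b, of u'] diff by simp
    from eqvD(5)[OF I2 this eqvD(1)[OF I2]]
    have "eqv I2 (frag_of (qt I1 u, b) - frag_of (qt I1 u', b)) (frag_of (qt I1 (u - u'), b))"
      by (simp add: eqv_def algebra_simps)
    from eqvD(3)[OF I2 ext_rep_diff[OF z(1,3)] eqvD(3)[OF I2 eqvD(5)[OF I2 z(2,4)] this]]
    show ?case using c add_subgroupD(4)[OF marked.Z_sub z(1,3)] by blast
  qed
  then show ?thesis by blast
qed

lemma ext_rep_surj: "w \<in> carrier (tensor_free T1 RX) \<Longrightarrow> \<exists>z\<in>Zk. eqv I2 (ext_rep z) w"
proof -
  assume "w \<in> carrier (tensor_free T1 RX)"
  then have "Poly_Mapping.keys w \<subseteq> carrier T1 \<times> span (Ch X 0)" by (simp add: t2.carrier_free span_simps)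
  then show ?thesis
  proof (induction w rule: frag_induction)
    case zero
    show ?case using add_subgroupD(1)[OF marked.Z_sub]
      by (intro bexI[of _ 0]) (simp_all add: ext_rep_zero eqvD(1)[OF I2])
  next
    case (one x)
    then obtain u b where x: "x = (qt I1 u, b)" "u \<in> carrier (tensor_free RX HY)" "b \<in> span (Ch X 0)"
      by (auto simp: carrier_T1)
    then show ?case using ext_rep_surj_inner by simp
  next
    case (diff w w')
    then obtain z z' where z: "z \<in> Zk" "eqv I2 (ext_rep z) w" "z' \<in> Zk" "eqv I2 (ext_rep z') w'" by blast
    from eqvD(3)[OF I2 ext_rep_diff[OF z(1,3)] eqvD(5)[OF I2 z(2,4)]]
    show ?case using add_subgroupD(4)[OF marked.Z_sub z(1,3)] by blast
  qed
qed

lemma ext_rep_carrier: "z \<in> Zk \<Longrightarrow> ext_rep z \<in> carrier (tensor_free T1 RX)"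
  unfolding ext_rep_def
proof (rule add_subgroup_sum[OF t2.free_sub])
  fix x assume z: "z \<in> Zk" and x': "x \<in> ends ` Poly_Mapping.keys z"
  obtain q r where x: "x = (q, r)" by (cases x)
  have qr: "q \<in> lpaths" "r \<in> rpaths"
    using x' ends_keys[OF marked.Z_C[OF z]] unfolding x by blast+
  show "(case x of (q, r) \<Rightarrow> pure_tensor (sg q) (proj q r z) (sg r)) \<in> carrier (tensor_free T1 RX)"
    using frag_T1[OF lpaths_span[OF qr(1)] proj_Z[OF qr z]] rpaths_span[OF qr(2)]
    by (simp add: x pure_tensor_def t2.carrier_free span_simps)
qed

lemma ext_class_surj: "ext_class ` Zk = carrier (extHM R X Y (Suc n))"
proof (intro equalityI subsetI)
  fix e assume "e \<in> ext_class ` Zk"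
  then show "e \<in> carrier (extHM R X Y (Suc n))"
    using ext_rep_carrier by (auto simp: carrier_ext ext_class_def)
next
  fix e assume "e \<in> carrier (extHM R X Y (Suc n))"
  then obtain w where w: "w \<in> carrier (tensor_free T1 RX)" "e = qt I2 w" by (auto simp: carrier_ext)
  then obtain z where "z \<in> Zk" "eqv I2 (ext_rep z) w" using ext_rep_surj by blast
  then show "e \<in> ext_class ` Zk" using ext_class_eqI w(2) by blast
qed

end

text \<open>The interface to the rest of the argument: from here on \<open>extHM\<close> is accessed
  through this presentation, and no tensors occur.\<close>

theorem presented_extHM:
  "presented_homology (path_algebra (R :: 'r::field itself) X) (\<lambda>n. span (marks n)) (lin (mark_bd X))
    (bil (lact Y)) (bil ract) (\<lambda>n. extHM R X Y (Suc n)) (ext_class R)"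
  by (rule presented_homology.intro[OF marked.bimod_complex_axioms presented_homology_axioms.intro])
    (simp_all add: ext_class_add ext_class_l ext_class_r ext_class_surj ext_class_ker carrier_path_algebra)

end

section \<open>The short exact sequence of a good cover\<close>

context rel_cub
begin

section \<open>The markings of a fixed chain\<close>

text \<open>In dimension \<open>0\<close> the middle chain may be shrunk to a vertex: a marking
  amounts to a vertex of the path in \<open>Y\<close>, where vertices joined by edges of
  \<open>Y\<close> count as one.\<close>

lemma marks_path:
  assumes "(v, cs, w) \<in> Ch X 0"
  shows "((v, cs, w), a) \<in> marks 0 \<longleftrightarrow> (\<exists>us vs x. cs = us @ vs \<and> (v, us, x) \<in> Ch X 0 \<and> (x, vs, w) \<in> Ch X 0
    \<and> x \<in> cells Y 0 \<and> a = strip (cubes Y) us)"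
proof
  assume "((v, cs, w), a) \<in> marks 0"
  then obtain v' qs x c y rs w' where e: "((v, cs, w), a) = ((v', qs @ c @ rs, w'), length qs)"
    "(v', qs, x) \<in> lpaths" "(x, c, y) \<in> Ch Y 0" "(y, rs, w') \<in> rpaths" by (rule marksE)
  then have "(v, qs, x) \<in> Ch X 0" "x \<in> cells Y 0" "set qs \<inter> cubes Y = {}" "(x, c, y) \<in> Ch X 0" "(y, rs, w) \<in> Ch X 0"
    by (auto simp: lpaths_def rpaths_def Ch_sub)
  moreover have "(x, c @ rs, w) \<in> Ch X 0"
    using Ch_append[OF X calculation(4,5)] by simp
  ultimately show "\<exists>us vs x. cs = us @ vs \<and> (v, us, x) \<in> Ch X 0 \<and> (x, vs, w) \<in> Ch X 0
    \<and> x \<in> cells Y 0 \<and> a = strip (cubes Y) us"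
    using e(1) strip_disjoint[of qs "cubes Y" "[]"] by (intro exI[of _ qs] exI[of _ "c @ rs"] exI[of _ x]) auto
next
  assume "\<exists>us vs x. cs = us @ vs \<and> (v, us, x) \<in> Ch X 0 \<and> (x, vs, w) \<in> Ch X 0
    \<and> x \<in> cells Y 0 \<and> a = strip (cubes Y) us"
  then obtain us vs x where e: "cs = us @ vs" "(v, us, x) \<in> Ch X 0" "(x, vs, w) \<in> Ch X 0"
    "x \<in> cells Y 0" "a = strip (cubes Y) us" by blast
  then have "(x, [], x) \<in> Ch Y 0" by (simp add: Ch_iff chain_dim_def)
  from marks_split[OF e(2) this e(3)] show "((v, cs, w), a) \<in> marks 0" by (simp add: e)
qed

lemma start_Y: "cube_chain X v cs w \<Longrightarrow> set cs \<subseteq> cubes Y \<Longrightarrow> cs \<noteq> [] \<Longrightarrow> v \<in> cells Y 0"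
proof (cases cs)
  case (Cons c cs')
  assume "cube_chain X v cs w" "set cs \<subseteq> cubes Y"
  then show ?thesis using vertex_cells[OF Y, of c False] Cons
    by (auto simp: cube_chain_Cons[OF X] vertex_sub)
qed simp

text \<open>A nonempty window of positions \<open>i \<le> k < j\<close> inside \<open>Y\<close> with
  only edges outside: the good cover condition for one piece, counted from \<open>0\<close>.\<close>

definition core :: "(nat \<times> 'c) list \<Rightarrow> nat \<Rightarrow> nat \<Rightarrow> bool" where
  "core cs i j \<longleftrightarrow> i < j \<and> j \<le> length cs \<and>
    (\<forall>k<length cs. if i \<le> k \<and> k < j then cs ! k \<in> cubes Y else fst (cs ! k) = 1)"

text \<open>The window serves as the middle chain and the edges on its two sides as outer paths. As
  it is nonempty, its cubes place the joining vertices in \<open>Y\<close>.\<close>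

lemma core_marks:
  assumes d: "(v, cs, w) \<in> Ch X m" and c: "core cs i j"
  shows "((v, cs, w), strip (cubes Y) (take i cs)) \<in> marks m"
proof -
  let ?u = "take i cs" and ?c = "drop i (take j cs)" and ?w = "drop j cs"
  have ij: "i < j" "j \<le> length cs" using c by (auto simp: core_def)
  have cs: "cs = ?u @ ?c @ ?w"
    using ij by (metis append_assoc append_take_drop_id min.absorb1 less_imp_le take_take)
  obtain x m1 m2 where 1: "(v, ?u, x) \<in> Ch X m1" "(x, ?c @ ?w, w) \<in> Ch X m2" "m = m1 + m2"
    using Ch_appendE[OF X, of v ?u "?c @ ?w" w m] d cs by metis
  obtain y m3 m4 where 2: "(x, ?c, y) \<in> Ch X m3" "(y, ?w, w) \<in> Ch X m4" "m2 = m3 + m4"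
    using Ch_appendE[OF X 1(2)] .
  have ue: "fst z = 1" if "z \<in> set ?u" for z
    using that ij c by (auto simp: in_set_conv_nth core_def)
  have we: "fst z = 1" if "z \<in> set ?w" for z
    using that ij c by (auto simp: in_set_conv_nth core_def)
  have cY: "set ?c \<subseteq> cubes Y"
  proof
    fix z assume "z \<in> set ?c"
    then obtain t where t: "t < j - i" "z = cs ! (i + t)"
      using ij by (auto simp: in_set_conv_nth)
    then have "i + t < length cs" "i \<le> i + t \<and> i + t < j" using ij by auto
    then show "z \<in> cubes Y" using c t(2) unfolding core_def by metis
  qed
  have "m1 = 0" "m4 = 0"
    using 1(1) 2(2) ue we Ch_0_iff[of v ?u x X] Ch_0_iff[of y ?w w X] by (auto simp: Ch_iff)
  moreover have "?c \<noteq> []" using ij by simp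
  then have "x \<in> cells Y 0" using start_Y 2(1) cY by (auto simp: Ch_iff)
  ultimately have "((v, ?u @ ?c @ ?w, w), strip (cubes Y) ?u) \<in> marks m"
    using 1 2 cY by (intro marks_split) (auto simp: Ch_sub)
  then show ?thesis using cs by simp
qed

text \<open>A cube of dimension above one cannot belong to an outer path, so its position lies in
  the middle chain and determines the mark.\<close>

lemma marks_core:
  assumes "((v, cs, w), a) \<in> marks m" "0 < m"
  shows "\<exists>i j. core cs i j" and "\<And>k. k < length cs \<Longrightarrow> fst (cs ! k) \<noteq> 1 \<Longrightarrow> a = strip (cubes Y) (take k cs)"
proof -
  obtain v' qs x c y rs w' where e: "((v, cs, w), a) = ((v', qs @ c @ rs, w'), length qs)"
    "(v', qs, x) \<in> lpaths" "(x, c, y) \<in> Ch Y m" "(y, rs, w') \<in> rpaths" using assms(1) by (rule marksE)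
  have cs: "cs = qs @ c @ rs" "a = length qs" using e(1) by auto
  have f: "\<And>z. z \<in> set qs \<Longrightarrow> fst z = 1" "\<And>z. z \<in> set rs \<Longrightarrow> fst z = 1" "set c \<subseteq> cubes Y"
    "set qs \<inter> cubes Y = {}"
    using e(2-4) by (auto simp: lpaths_def rpaths_def Ch_0_iff Ch_sub)
  have "c \<noteq> []" using e(3) assms(2) by (auto simp: Ch_iff chain_dim_def)
  then have "core cs (length qs) (length qs + length c)"
    using f(1-3) unfolding core_def cs by (auto simp: nth_append)
  then show "\<exists>i j. core cs i j" by blast
  fix k assume k: "k < length cs" "fst (cs ! k) \<noteq> 1"
  have k': "length qs \<le> k" "k < length qs + length c"
    using k f(1,2) unfolding cs(1)
    by (auto simp: nth_append not_less split: if_splits)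
  have "take k cs = qs @ take (k - length qs) c" using k' by (simp add: cs)
  moreover have "set (take (k - length qs) c) \<subseteq> cubes Y" using f(3) set_take_subset by fast
  ultimately show "a = strip (cubes Y) (take k cs)"
    using strip_disjoint[OF f(4)] cs(2) by simp
qed

end

text \<open>If \<open>d\<close> has \<open>k\<close> markings for the intersection, its part of the
  short exact sequence has ranks \<open>k\<close>, \<open>1 + k\<close> and \<open>1\<close>: the
  bijection matches the \<open>k\<close> markings, and the single marking for \<open>Y1\<close> maps
  to \<open>d\<close>. The function in the bijection absorbs the edges of \<open>Y2\<close> before
  the mark.\<close>

definition good_side :: "'c precubical \<Rightarrow> 'c precubical \<Rightarrow> 'c precubical \<Rightarrow> 'c precubical \<Rightarrow> nat \<Rightarrow> 'c chain \<Rightarrow> bool" where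
  "good_side X Y1 Y2 Y12 m d \<longleftrightarrow> (\<exists>!a. (d, a) \<in> rel_cub.marks Y1 X m) \<and>
    bij_betw (\<lambda>a. strip (cubes Y2) (take a (fst (snd d))))
      {a. (d, a) \<in> rel_cub.marks Y12 X m} {a. (d, a) \<in> rel_cub.marks Y2 X m}"

locale rel_cover = R1: rel_cub Y1 X + R2: rel_cub Y2 X for X Y1 Y2 :: "'c precubical" +
  assumes union: "cells X n = cells Y1 n \<union> cells Y2 n"
begin

lemma cubes_union: "cubes X = cubes Y1 \<union> cubes Y2"
  using union by (auto simp: mem_cubes)

text \<open>If the path left both pieces, its last edge would lie in neither of them.\<close>

lemma path_in_one_start:
  assumes "(v, cs, w) \<in> Ch X 0" "v \<in> cells Y1 0" "v \<in> cells Y2 0"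
  shows "set cs \<subseteq> cubes Y1 \<or> set cs \<subseteq> cubes Y2"
proof -
  obtain s q where 1: "cs = s @ q" "set s \<subseteq> cubes Y1" "set q \<inter> cubes Y1 = {}" using R1.rel_start[OF assms(1,2)] by blast
  obtain s' q' where 2: "cs = s' @ q'" "set s' \<subseteq> cubes Y2" "set q' \<inter> cubes Y2 = {}" using R2.rel_start[OF assms(1,3)] by blast
  have "q = [] \<or> q' = []"
  proof (rule ccontr)
    assume n: "\<not> (q = [] \<or> q' = [])"
    then have "last cs \<in> set q" "last cs \<in> set q'" using 1(1) 2(1) by (metis last_appendR last_in_set)+
    moreover have "last cs \<in> cubes X"
      using assms(1) n 1(1) last_in_set[of cs] cube_chainD(3)[of X v cs w] by (auto simp: Ch_iff)
    ultimately show False using 1(3) 2(3) cubes_union by blast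
  qed
  then show ?thesis using 1 2 by auto
qed

lemma path_in_one_end:
  assumes "(v, cs, w) \<in> Ch X 0" "w \<in> cells Y1 0" "w \<in> cells Y2 0"
  shows "set cs \<subseteq> cubes Y1 \<or> set cs \<subseteq> cubes Y2"
proof -
  obtain s q where 1: "cs = q @ s" "set q \<inter> cubes Y1 = {}" "set s \<subseteq> cubes Y1" using R1.rel_end[OF assms(1,2)] by blast
  obtain s' q' where 2: "cs = q' @ s'" "set q' \<inter> cubes Y2 = {}" "set s' \<subseteq> cubes Y2" using R2.rel_end[OF assms(1,3)] by blast
  have "q = [] \<or> q' = []"
  proof (rule ccontr)
    assume n: "\<not> (q = [] \<or> q' = [])"
    then have "hd cs \<in> set q" "hd cs \<in> set q'" using 1(1) 2(1) by (metis hd_append2 hd_in_set)+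
    moreover have "hd cs \<in> cubes X"
      using assms(1) n 1(1) hd_in_set[of cs] cube_chainD(3)[of X v cs w] by (auto simp: Ch_iff)
    ultimately show False using 1(2) 2(2) cubes_union by blast
  qed
  then show ?thesis using 1 2 by auto
qed

end

locale cover = rel_cover X Y1 Y2 + R12: rel_cub Y12 X for X Y1 Y2 Y12 :: "'c precubical" +
  assumes inter: "cells Y12 n = cells Y1 n \<inter> cells Y2 n"
    and good: "(v, cs, w) \<in> Ch X m \<Longrightarrow> 0 < m \<Longrightarrow> \<exists>i j. R1.core cs i j \<or> R2.core cs i j"
begin

text \<open>The two pieces play symmetric roles; facts about the first one are transferred to the
  second by this.\<close>

lemma cover_sym: "cover X Y2 Y1 Y12"
proof (intro cover.intro rel_cover.intro rel_cover_axioms.intro cover_axioms.intro R1.rel_cub_axioms R2.rel_cub_axioms R12.rel_cub_axioms)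
  show "cells X n = cells Y2 n \<union> cells Y1 n" for n using union by blast
  show "cells Y12 n = cells Y2 n \<inter> cells Y1 n" for n using inter by blast
  show "\<exists>i j. R2.core cs i j \<or> R1.core cs i j" if "(v, cs, w) \<in> Ch X m" "0 < m" for v cs w m
    using good[OF that] by blast
qed

lemma cubes_inter: "cubes Y12 = cubes Y1 \<inter> cubes Y2"
  using inter by (auto simp: mem_cubes)

text \<open>The middle chain stays in the smaller set's supersets, but the outer paths may contain
  further edges of \<open>Y1\<close>, which have to be absorbed.\<close>

lemma marks_inter:
  assumes "((v, cs, w), a) \<in> R12.marks m"
  shows "((v, cs, w), strip (cubes Y1) (take a cs)) \<in> R1.marks m"
proof -
  obtain v' qs x c y rs w' where e: "((v, cs, w), a) = ((v', qs @ c @ rs, w'), length qs)"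
    "(v', qs, x) \<in> R12.lpaths" "(x, c, y) \<in> Ch Y12 m" "(y, rs, w') \<in> R12.rpaths" using assms by (rule R12.marksE)
  then have "(v, qs, x) \<in> Ch X 0" "(x, c, y) \<in> Ch Y1 m" "(y, rs, w) \<in> Ch X 0"
    using cubes_inter inter by (auto simp: R12.lpaths_def R12.rpaths_def R1.Ch_sub R12.Ch_sub)
  from R1.marks_split[OF this] show ?thesis using e(1) by simp
qed

text \<open>The position \<open>h\<close> of a cube of dimension above one determines every mark, so
  each of the three sets admits at most one. A marking for the second piece yields one for the
  intersection because both windows contain \<open>h\<close>.\<close>

lemma side_high:
  assumes d: "(v, cs, w) \<in> Ch X m" and m: "0 < m" and c: "R1.core cs i j"
  shows "good_side X Y1 Y2 Y12 m (v, cs, w)"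
proof -
  let ?d = "(v, cs, w)"
  have "\<not> (\<forall>c\<in>set cs. fst c = 1)" using d m Ch_0_iff[of v cs w X] by (auto simp: Ch_iff)
  then obtain h where h: "h < length cs" "fst (cs ! h) \<noteq> 1" by (auto simp: in_set_conv_nth)
  have u1: "(?d, a) \<in> R1.marks m \<Longrightarrow> a = strip (cubes Y1) (take h cs)"
    and u2: "(?d, a) \<in> R2.marks m \<Longrightarrow> a = strip (cubes Y2) (take h cs)"
    and u12: "(?d, a) \<in> R12.marks m \<Longrightarrow> a = strip (cubes Y12) (take h cs)" for a
    using R1.marks_core(2)[OF _ m h] R2.marks_core(2)[OF _ m h] R12.marks_core(2)[OF _ m h] by blast+
  have "\<exists>!a. (?d, a) \<in> R1.marks m"
    using R1.core_marks[OF d c] u1 by blast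
  moreover have "bij_betw (\<lambda>a. strip (cubes Y2) (take a cs)) {a. (?d, a) \<in> R12.marks m} {a. (?d, a) \<in> R2.marks m}"
  proof (rule bij_betw_imageI)
    show "inj_on (\<lambda>a. strip (cubes Y2) (take a cs)) {a. (?d, a) \<in> R12.marks m}"
      using u12 by (auto intro!: inj_onI)
    show "(\<lambda>a. strip (cubes Y2) (take a cs)) ` {a. (?d, a) \<in> R12.marks m} = {a. (?d, a) \<in> R2.marks m}"
    proof (intro equalityI subsetI)
      fix b assume "b \<in> {a. (?d, a) \<in> R2.marks m}"
      then have b: "(?d, b) \<in> R2.marks m" by simp
      obtain i' j' where c': "R2.core cs i' j'" using R2.marks_core(1)[OF b m] by blast
      have "i \<le> h \<and> h < j" "i' \<le> h \<and> h < j'" using c c' h unfolding R1.core_def R2.core_def by metis+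
      \<comment> \<open>The intersection of the windows contains \<open>h\<close>; a cube outside it
        is outside one of the windows and hence an edge.\<close>
      then have "R12.core cs (max i i') (min j j')"
        using c c' cubes_inter unfolding R1.core_def R2.core_def R12.core_def
        by (auto split: if_splits)
      from R12.core_marks[OF d this] have a: "(?d, strip (cubes Y12) (take (max i i') cs)) \<in> R12.marks m" (is "(?d, ?a) \<in> _") .
      have "strip (cubes Y2) (take ?a cs) = b"
        using u2[OF b] u2[OF cover.marks_inter[OF cover_sym a]] by simp
      then show "b \<in> (\<lambda>a. strip (cubes Y2) (take a cs)) ` {a. (?d, a) \<in> R12.marks m}"
        using a by blast
    next
      fix b assume "b \<in> (\<lambda>a. strip (cubes Y2) (take a cs)) ` {a. (?d, a) \<in> R12.marks m}"
      then show "b \<in> {a. (?d, a) \<in> R2.marks m}" using cover.marks_inter[OF cover_sym] by auto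
    qed
  qed
  ultimately show ?thesis by (simp add: good_side_def)
qed

lemma strip_all: "set us \<subseteq> P \<Longrightarrow> strip P us = 0"
  using strip_append[of us P "[]"] by (simp add: strip_def)

lemma path_end_Y1: "(v, us, x) \<in> Ch X 0 \<Longrightarrow> v \<in> cells Y1 0 \<Longrightarrow> set us \<subseteq> cubes Y1 \<Longrightarrow> x \<in> cells Y1 0"
  using R1.Ch_sub[of v us x 0] cube_chainD(2)[of Y1 v us x] by (auto simp: Ch_iff)

lemma path_start_Y1: "(v, us, x) \<in> Ch X 0 \<Longrightarrow> x \<in> cells Y1 0 \<Longrightarrow> set us \<subseteq> cubes Y1 \<Longrightarrow> v \<in> cells Y1 0"
  using R1.cube_chain_sub_end[of v us x] by (simp add: Ch_iff)

lemma strip_length_last: "strip P r = length r \<Longrightarrow> r = [] \<or> last r \<notin> P"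
proof (rule ccontr)
  assume l: "strip P r = length r" and n: "\<not> (r = [] \<or> last r \<notin> P)"
  then obtain ys y where r: "r = ys @ [y]" "y \<in> P" by (cases r rule: rev_cases) auto
  then show False using strip_append[of "[y]" P ys] strip_le[of P ys] l by simp
qed

text \<open>For \<open>Y1\<close> all edges are absorbed and the mark is \<open>0\<close>; along
  this path there is no difference between \<open>Y2\<close> and the intersection.\<close>

lemma side_all:
  assumes d: "(v, cs, w) \<in> Ch X 0" and v: "v \<in> cells Y1 0" and cs: "set cs \<subseteq> cubes Y1"
  shows "good_side X Y1 Y2 Y12 0 (v, cs, w)"
proof -
  let ?d = "(v, cs, w)"
  have v0: "(v, [], v) \<in> Ch X 0" using d by (auto simp: Ch_iff chain_dim_def dest: cube_chainD)
  have "(?d, a) \<in> R1.marks 0 \<longleftrightarrow> a = 0" for a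
  proof
    assume "(?d, a) \<in> R1.marks 0"
    then obtain us vs where "cs = us @ vs" "a = strip (cubes Y1) us" unfolding R1.marks_path[OF d] by blast
    then show "a = 0" using cs strip_all[of us "cubes Y1"] by simp
  next
    assume "a = 0"
    then show "(?d, a) \<in> R1.marks 0" unfolding R1.marks_path[OF d]
      using v v0 d strip_all[of "[]"] by (intro exI[of _ "[]"] exI[of _ cs] exI[of _ v]) simp
  qed
  then have "\<exists>!a. (?d, a) \<in> R1.marks 0" by simp
  moreover have s: "strip (cubes Y12) us = strip (cubes Y2) us" if "set us \<subseteq> cubes Y1" for us
  proof -
    obtain r t where rt: "us = r @ t" "set t \<subseteq> cubes Y2" "length r = strip (cubes Y2) us" by (rule stripE)
    have "strip (cubes Y12) us = strip (cubes Y12) r"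
      unfolding rt(1) by (rule strip_append) (use rt that cubes_inter in auto)
    \<comment> \<open>What remains after stripping \<open>Y2\<close> is empty or ends outside
      \<open>Y2\<close>, hence outside the intersection.\<close>
    also have "\<dots> = length r"
    proof (rule strip_id)
      have "strip (cubes Y2) r = length r" using rt(1,3) strip_append[OF rt(2), of r] by simp
      then have "r = [] \<or> last r \<notin> cubes Y2" by (rule strip_length_last)
      then show "r = [] \<or> last r \<notin> cubes Y12" using cubes_inter by blast
    qed
    finally show ?thesis using rt(3) by simp
  qed
  have eq: "(?d, a) \<in> R12.marks 0 \<longleftrightarrow> (?d, a) \<in> R2.marks 0" for a
  proof -
    have "x \<in> cells Y12 0 \<and> a = strip (cubes Y12) us \<longleftrightarrow> x \<in> cells Y2 0 \<and> a = strip (cubes Y2) us"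
      if "cs = us @ vs" "(v, us, x) \<in> Ch X 0" for us vs x
    proof -
      have us: "set us \<subseteq> cubes Y1" using that cs by auto
      then show ?thesis using s[OF us] path_end_Y1[OF that(2) v us] inter by auto
    qed
    then show ?thesis unfolding R12.marks_path[OF d] R2.marks_path[OF d] by blast
  qed
  have "strip (cubes Y2) (take a cs) = a" if "(?d, a) \<in> R2.marks 0" for a
    using R2.marks_length[OF that] by simp
  then have "bij_betw (\<lambda>a. strip (cubes Y2) (take a cs)) {a. (?d, a) \<in> R12.marks 0} {a. (?d, a) \<in> R2.marks 0}"
    unfolding eq by (intro bij_betwI[of _ _ _ id]) auto
  ultimately show ?thesis by (simp add: good_side_def)
qed

lemma split_compare:
  assumes "us @ vs = us' @ vs'"
  obtains t where "us' = us @ t" "vs = t @ vs'" | t where "us = us' @ t" "vs' = t @ vs"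
  using assms by (auto simp: append_eq_append_conv2)

text \<open>The path runs through \<open>Y1\<close> up to \<open>x\<close> and through
  \<open>Y2\<close> from there on. By the factorizations, a prefix ending at a vertex of
  \<open>Y1\<close> stays in \<open>Y1\<close> and a suffix starting at a vertex of
  \<open>Y2\<close> stays in \<open>Y2\<close>, so each of the three sets admits exactly one
  marking.\<close>

lemma side_mixed:
  assumes d: "(v, cs, w) \<in> Ch X 0" and e: "cs = us @ vs" "(v, us, x) \<in> Ch X 0" "(x, vs, w) \<in> Ch X 0" "x \<in> cells Y12 0"
    and us: "us \<noteq> []" "set us \<subseteq> cubes Y1" and vs: "vs \<noteq> []" "set vs \<subseteq> cubes Y2"
  shows "good_side X Y1 Y2 Y12 0 (v, cs, w)"
proof -
  let ?d = "(v, cs, w)"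
  have x: "x \<in> cells Y1 0" "x \<in> cells Y2 0" using e(4) inter by auto
  have v: "v \<in> cells Y1 0" by (rule path_start_Y1[OF e(2) x(1) us(2)])
  have v0: "(v, [], v) \<in> Ch X 0" using d by (auto simp: Ch_iff chain_dim_def dest: cube_chainD)
  have s1: "set us' \<subseteq> cubes Y1" if h: "cs = us' @ vs'" "(v, us', x') \<in> Ch X 0" "x' \<in> cells Y1 0" for us' vs' x'
  proof -
    obtain q s where qs: "us' = q @ s" "set q \<inter> cubes Y1 = {}" "set s \<subseteq> cubes Y1" using R1.rel_end[OF h(2,3)] by blast
    have "q = []"
    proof (rule ccontr)
      assume q: "q \<noteq> []"
      \<comment> \<open>A nonempty \<open>q\<close> would begin with the first edge of
        \<open>us\<close>, which is in \<open>Y1\<close>.\<close>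
      then have "hd q = hd us" using h(1) e(1) qs(1) us(1) by (metis append_is_Nil_conv hd_append2)
      then show False using q us qs(2) by (metis disjoint_iff hd_in_set subset_iff)
    qed
    then show ?thesis using qs by simp
  qed
  have s2: "set vs' \<subseteq> cubes Y2" if h: "cs = us' @ vs'" "(x', vs', w) \<in> Ch X 0" "x' \<in> cells Y2 0" for us' vs' x'
  proof -
    obtain s q where qs: "vs' = s @ q" "set s \<subseteq> cubes Y2" "set q \<inter> cubes Y2 = {}" using R2.rel_start[OF h(2,3)] by blast
    have "q = []"
    proof (rule ccontr)
      assume q: "q \<noteq> []"
      then have "last q = last vs" using h(1) e(1) qs(1) vs(1) by (metis append_is_Nil_conv last_appendR)
      then show False using q vs qs(3) by (metis disjoint_iff last_in_set subset_iff)
    qed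
    then show ?thesis using qs by simp
  qed
  have m1: "(?d, a) \<in> R1.marks 0 \<longleftrightarrow> a = 0" for a
  proof
    assume "(?d, a) \<in> R1.marks 0"
    then obtain us' vs' x' where "cs = us' @ vs'" "(v, us', x') \<in> Ch X 0" "x' \<in> cells Y1 0" "a = strip (cubes Y1) us'"
      unfolding R1.marks_path[OF d] by blast
    then show "a = 0" using s1 strip_all by metis
  next
    assume "a = 0"
    then show "(?d, a) \<in> R1.marks 0" unfolding R1.marks_path[OF d]
      using v v0 d strip_all[of "[]"] by (intro exI[of _ "[]"] exI[of _ cs] exI[of _ v]) simp
  qed
  have m2: "(?d, a) \<in> R2.marks 0 \<longleftrightarrow> a = strip (cubes Y2) us" for a
  proof
    assume "(?d, a) \<in> R2.marks 0"
    then obtain us' vs' x' where h: "cs = us' @ vs'" "(v, us', x') \<in> Ch X 0" "(x', vs', w) \<in> Ch X 0" "x' \<in> cells Y2 0" "a = strip (cubes Y2) us'"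
      unfolding R2.marks_path[OF d] by blast
    \<comment> \<open>Between \<open>x\<close> and any other vertex in \<open>Y2\<close> there are
      only edges of \<open>Y2\<close>, so both give the same mark.\<close>
    have "us @ vs = us' @ vs'" using h(1) e(1) by simp
    then show "a = strip (cubes Y2) us"
    proof (rule split_compare)
      fix t assume "us' = us @ t" "vs = t @ vs'"
      then show ?thesis using strip_append[of t "cubes Y2" us] vs(2) h(5) by simp
    next
      fix t assume "us = us' @ t" "vs' = t @ vs"
      then show ?thesis using strip_append[of t "cubes Y2" us'] s2[OF h(1,3,4)] h(5) by simp
    qed
  next
    assume "a = strip (cubes Y2) us"
    then show "(?d, a) \<in> R2.marks 0" unfolding R2.marks_path[OF d] using e x(2) by blast
  qed
  have m12: "(?d, a) \<in> R12.marks 0 \<longleftrightarrow> a = strip (cubes Y12) us" for a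
  proof
    assume "(?d, a) \<in> R12.marks 0"
    then obtain us' vs' x' where h: "cs = us' @ vs'" "(v, us', x') \<in> Ch X 0" "(x', vs', w) \<in> Ch X 0" "x' \<in> cells Y12 0" "a = strip (cubes Y12) us'"
      unfolding R12.marks_path[OF d] by blast
    have x': "x' \<in> cells Y1 0" "x' \<in> cells Y2 0" using h(4) inter by auto
    have "us @ vs = us' @ vs'" using h(1) e(1) by simp
    then show "a = strip (cubes Y12) us"
    proof (rule split_compare)
      fix t assume t: "us' = us @ t" "vs = t @ vs'"
      then have "set t \<subseteq> cubes Y12" using vs(2) s1[OF h(1,2) x'(1)] cubes_inter by auto
      then show ?thesis using strip_append[of t "cubes Y12" us] h(5) t by simp
    next
      fix t assume t: "us = us' @ t" "vs' = t @ vs"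
      then have "set t \<subseteq> cubes Y12" using us(2) s2[OF h(1,3) x'(2)] cubes_inter by auto
      then show ?thesis using strip_append[of t "cubes Y12" us'] h(5) t by simp
    qed
  next
    assume "a = strip (cubes Y12) us"
    then show "(?d, a) \<in> R12.marks 0" unfolding R12.marks_path[OF d] using e by blast
  qed
  have "strip (cubes Y2) (take (strip (cubes Y12) us) cs) = strip (cubes Y2) us"
    using cover.marks_inter[OF cover_sym, of v cs w "strip (cubes Y12) us" 0] m12 m2 by blast
  then show ?thesis unfolding good_side_def by (simp add: m1 m2 m12 bij_betw_def)
qed

text \<open>If the path left \<open>Y1\<close>, the vertex where it does so would be the start of an
  edge of \<open>Y2\<close>, hence a vertex of the intersection. So the path stays in
  \<open>Y1\<close>.\<close>

lemma side_disjoint: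
  assumes d: "(v, cs, w) \<in> Ch X 0" and v: "v \<in> cells Y1 0"
    and no: "\<And>us vs x. cs = us @ vs \<Longrightarrow> (v, us, x) \<in> Ch X 0 \<Longrightarrow> (x, vs, w) \<in> Ch X 0 \<Longrightarrow> x \<notin> cells Y12 0"
  shows "good_side X Y1 Y2 Y12 0 (v, cs, w)"
proof -
  obtain s q where qs: "cs = s @ q" "set s \<subseteq> cubes Y1" "set q \<inter> cubes Y1 = {}" using R1.rel_start[OF d v] by blast
  obtain x where x: "(v, s, x) \<in> Ch X 0" "(x, q, w) \<in> Ch X 0"
    using d unfolding qs(1) by (auto elim: Ch_appendE[OF R1.X])
  have xY: "x \<in> cells Y1 0" by (rule path_end_Y1[OF x(1) v qs(2)])
  have "q = []"
  proof (rule ccontr)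
    assume q: "q \<noteq> []"
    have "set q \<subseteq> cubes Y2" using x(2) qs(3) cubes_union by (auto simp: Ch_iff dest!: cube_chainD(3))
    then have "x \<in> cells Y2 0" using R2.start_Y x(2) q by (auto simp: Ch_iff)
    then show False using no[OF qs(1) x] xY inter by auto
  qed
  then show ?thesis using side_all[OF d v] qs by simp
qed

lemma side:
  assumes d: "d \<in> Ch X m"
  shows "good_side X Y1 Y2 Y12 m d \<or> good_side X Y2 Y1 Y12 m d"
proof -
  interpret sym: cover X Y2 Y1 Y12 by (rule cover_sym)
  obtain v cs w where e: "d = (v, cs, w)" by (cases d)
  show ?thesis
  proof (cases "m = 0")
    case False
    then show ?thesis using good[of v cs w m] side_high[of v cs w m] sym.side_high[of v cs w m] d e by blast
  next
    case True
    have d0: "(v, cs, w) \<in> Ch X 0" using d e True by simp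
    show ?thesis
    proof (cases "\<exists>us vs x. cs = us @ vs \<and> (v, us, x) \<in> Ch X 0 \<and> (x, vs, w) \<in> Ch X 0 \<and> x \<in> cells Y12 0")
      case False
      have "v \<in> cells Y1 0 \<or> v \<in> cells Y2 0" using d0 union by (auto simp: Ch_iff dest: cube_chainD)
      then show ?thesis using side_disjoint[OF d0] sym.side_disjoint[OF d0] False e True by blast
    next
      case True
      then obtain us vs x where h: "cs = us @ vs" "(v, us, x) \<in> Ch X 0" "(x, vs, w) \<in> Ch X 0" "x \<in> cells Y12 0" by blast
      have x: "x \<in> cells Y1 0" "x \<in> cells Y2 0" using h(4) inter by auto
      have a1: ?thesis if "set us \<subseteq> cubes Y1" "set vs \<subseteq> cubes Y1"
        using side_all[OF d0 path_start_Y1[OF h(2) x(1) that(1)]] that h(1) e \<open>m = 0\<close> by auto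
      have a2: ?thesis if "set us \<subseteq> cubes Y2" "set vs \<subseteq> cubes Y2"
        using sym.side_all[OF d0 sym.path_start_Y1[OF h(2) x(2) that(1)]] that h(1) e \<open>m = 0\<close> by auto
      have a3: ?thesis if "set us \<subseteq> cubes Y1" "set vs \<subseteq> cubes Y2" "us \<noteq> []" "vs \<noteq> []"
        using side_mixed[OF d0 h] that e \<open>m = 0\<close> by auto
      have a4: ?thesis if "set us \<subseteq> cubes Y2" "set vs \<subseteq> cubes Y1" "us \<noteq> []" "vs \<noteq> []"
        using sym.side_mixed[OF d0 h] that e \<open>m = 0\<close> by auto
      \<comment> \<open>Each half of the path has an end point in the intersection and so lies in a
        single piece; this leaves four combinations, apart from empty halves.\<close>
      show ?thesis
        using path_in_one_end[OF h(2) x] path_in_one_start[OF h(3) x] a1 a2 a3 a4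
        by (cases "us = []"; cases "vs = []") auto
    qed
  qed
qed

end

text \<open>Cycles and boundaries of a product complex are products, so the presentations combine
  componentwise.\<close>

lemma presented_sum:
  fixes E :: "nat \<Rightarrow> ('a, 'e) bimodule" and E' :: "nat \<Rightarrow> ('a, 'f) bimodule"
  assumes "presented_homology A C d l r E S" "presented_homology A C' d' l' r' E' S'"
  shows "presented_homology A (\<lambda>n. C n \<times> C' n) (\<lambda>(x, y). (d x, d' y)) (\<lambda>a (x, y). (l a x, l' a y))
    (\<lambda>(x, y) a. (r x a, r' y a)) (\<lambda>n. bimodule_sum (E n) (E' n)) (\<lambda>n (x, y). (S n x, S' n y))"
proof -
  interpret P: presented_homology A C d l r E S by fact
  interpret P': presented_homology A C' d' l' r' E' S' by fact
  interpret Q: bimod_complex A "\<lambda>n. C n \<times> C' n" "\<lambda>(x, y). (d x, d' y)" "\<lambda>a (x, y). (l a x, l' a y)"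
    "\<lambda>(x, y) a. (r x a, r' y a)"
  proof (rule bimod_complex.intro)
    show "add_subgroup (C n \<times> C' n)" for n
      using P.C_sub[of n] P'.C_sub[of n] by (auto simp: add_subgroup_def zero_prod_def)
  qed (auto simp: P.ring_A P.d_add P'.d_add P.d_closed P'.d_closed P.d_d P'.d_d P.d_0 P'.d_0
      P.l_closed P'.l_closed P.r_closed P'.r_closed P.l_add P'.l_add P.r_add P'.r_add
      P.l_add_left P'.l_add_left P.r_add_right P'.r_add_right P.l_mult P'.l_mult P.r_mult P'.r_mult
      P.l_r P'.l_r P.l_one P'.l_one P.r_one P'.r_one P.d_l P'.d_l P.d_r P'.d_r plus_prod_def zero_prod_def)
  have Z: "Q.Z n = P.Z n \<times> P'.Z n" for n
    by (auto simp: Q.Z_def P.Z_def P'.Z_def zero_prod_def)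
  have B: "Q.B n = P.B n \<times> P'.B n" for n
    by (auto simp: Q.B_def P.B_def P'.B_def)
  show ?thesis
  proof (rule presented_homology.intro[OF Q.bimod_complex_axioms presented_homology_axioms.intro], unfold Z B)
    show "(\<lambda>(x, y). (S n x, S' n y)) ` (P.Z n \<times> P'.Z n) = carrier (bimodule_sum (E n) (E' n))" for n
      by (simp add: bimodule_sum_def image_paired_Times P.S_surj P'.S_surj)
  qed (auto simp: bimodule_sum_def P.S_add P'.S_add P.S_l P'.S_l P.S_r P'.S_r P.S_ker P'.S_ker)
qed

section \<open>The maps of the short exact sequence\<close>

definition retag :: "'c precubical \<Rightarrow> 'c chain \<times> nat \<Rightarrow> 'c chain \<times> nat" where
  "retag Y = (\<lambda>((v, cs, w), a). ((v, cs, w), strip (cubes Y) (take a cs)))"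

lemma retag_simp [simp]: "retag Y ((v, cs, w), a) = ((v, cs, w), strip (cubes Y) (take a cs))"
  by (simp add: retag_def)

lemma fst_retag [simp]: "fst (retag Y k) = fst k"
  by (cases k) (auto simp: retag_def split: prod.splits)

text \<open>Corresponds on tensors to the map induced by the inclusion of the intersection into
  \<open>Y\<close>.\<close>

definition incl :: "'c precubical \<Rightarrow> ('c chain \<times> nat \<Rightarrow>\<^sub>0 'r::field) \<Rightarrow> ('c chain \<times> nat \<Rightarrow>\<^sub>0 'r)" where
  "incl Y = lin (\<lambda>k. Poly_Mapping.single (retag Y k) 1)"

text \<open>Corresponds on tensors to multiplying the three factors in R[X].\<close>

definition forget :: "('c chain \<times> nat \<Rightarrow>\<^sub>0 'r::field) \<Rightarrow> ('c chain \<Rightarrow>\<^sub>0 'r)" where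
  "forget = lin (\<lambda>k. Poly_Mapping.single (fst k) 1)"

lemma forget_incl: "forget (incl Y x) = forget x"
  by (simp add: forget_def incl_def lin_lin)

lemma forget_mark_bd: "forget (lin (mark_bd X) y) = boundary X (forget y)"
  by (simp add: forget_def lin_lin boundary_eq mark_bd_def split_beta lin_single_id)

lemma forget_lact: "forget (bil (lact Y) a y) = path_mult a (forget y)"
proof -
  have "lin (\<lambda>k. Poly_Mapping.single (fst k) 1) (bil (lact Y) a y)
    = bil cat (lin (\<lambda>k. Poly_Mapping.single k 1) a) (lin (\<lambda>k. Poly_Mapping.single (fst k) 1) y)"
    by (rule lin_bil) (auto simp: lact_def cat_def split: prod.splits)
  then show ?thesis by (simp add: forget_def path_mult_bil lin_single_id)
qed

lemma forget_ract: "forget (bil ract y a) = path_mult (forget y) a"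
proof -
  have "lin (\<lambda>k. Poly_Mapping.single (fst k) 1) (bil ract y a)
    = bil cat (lin (\<lambda>k. Poly_Mapping.single (fst k) 1) y) (lin (\<lambda>k. Poly_Mapping.single k 1) a)"
    by (rule lin_bil) (auto simp: ract_def cat_def split: prod.splits)
  then show ?thesis by (simp add: forget_def path_mult_bil lin_single_id)
qed

lemma lookup_lin_single:
  assumes "\<And>k'. k' \<in> Poly_Mapping.keys x \<Longrightarrow> \<kappa> k' = \<kappa> k \<Longrightarrow> k' = k"
  shows "Poly_Mapping.lookup (lin (\<lambda>k. Poly_Mapping.single (\<kappa> k) 1) x) (\<kappa> k) = Poly_Mapping.lookup x k"
proof -
  have "Poly_Mapping.lookup (lin (\<lambda>k. Poly_Mapping.single (\<kappa> k) 1) x) (\<kappa> k)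
    = (\<Sum>k'\<in>Poly_Mapping.keys x. if k' = k then Poly_Mapping.lookup x k else 0)"
    unfolding ext_by_def lookup_sum
    by (rule sum.cong) (use assms in \<open>auto simp: lookup_single when_def\<close>)
  also have "\<dots> = Poly_Mapping.lookup x k"
    by (simp add: in_keys_iff)
  finally show ?thesis .
qed

lemma lookup_lin_single_notin:
  assumes "y \<notin> \<kappa> ` Poly_Mapping.keys x"
  shows "Poly_Mapping.lookup (lin (\<lambda>k. Poly_Mapping.single (\<kappa> k) 1) x) y = 0"
  unfolding ext_by_def lookup_sum
  by (rule sum.neutral) (use assms in \<open>auto simp: lookup_single when_def\<close>)

context cover
begin

abbreviation "side1 \<equiv> good_side X Y1 Y2 Y12"

lemma marks_retag: "k \<in> R12.marks m \<Longrightarrow> retag Y1 k \<in> R1.marks m"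
  using marks_inter by (cases k) auto

lemma incl_span: "x \<in> span (R12.marks m) \<Longrightarrow> incl Y1 x \<in> span (R1.marks m)"
  unfolding incl_def by (erule lin_span) (intro span_single marks_retag)

lemma incl_mark_bd:
  assumes "x \<in> span (R12.marks m)"
  shows "incl Y1 (lin (mark_bd X) x) = lin (mark_bd X) (incl Y1 x :: _ \<Rightarrow>\<^sub>0 'r::field)"
proof -
  have "lin (\<lambda>k. Poly_Mapping.single (retag Y1 k) 1) (mark_bd X k) = (mark_bd X (retag Y1 k) :: _ \<Rightarrow>\<^sub>0 'r)"
    if "k \<in> R12.marks m" for k
    using that
  proof (rule R12.marksE)
    fix v qs x cs y rs w assume k: "k = ((v, qs @ cs @ rs, w), length qs)"
      "(v, qs, x) \<in> R12.lpaths" "(x, cs, y) \<in> Ch Y12 m" "(y, rs, w) \<in> R12.rpaths"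
    then have "\<And>c. c \<in> set qs \<Longrightarrow> fst c = 1" "\<And>c. c \<in> set rs \<Longrightarrow> fst c = 1"
      by (auto simp: R12.lpaths_def R12.rpaths_def Ch_0_iff)
    then have "list_bd X qs = (0 :: _ \<Rightarrow>\<^sub>0 'r)" "list_bd X rs = (0 :: _ \<Rightarrow>\<^sub>0 'r)" "list_sgn qs = (1 :: 'r)"
      by (simp_all add: list_bd_path list_sgn_path)
    then show ?thesis by (simp add: k(1) boundary_chain_eq list_bd_append lin_lin)
  qed
  then have "lin (\<lambda>k. lin (\<lambda>k. Poly_Mapping.single (retag Y1 k) 1) (mark_bd X k)) x = lin (\<lambda>k. mark_bd X (retag Y1 k)) (x :: _ \<Rightarrow>\<^sub>0 'r)"
    using assms by (intro lin_cong) (auto simp: span_def)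
  then show ?thesis by (simp add: incl_def lin_lin)
qed

lemma incl_lact:
  assumes "x \<in> span (R12.marks m)"
  shows "incl Y1 (bil (lact Y12) a x) = bil (lact Y1) a (incl Y1 x :: _ \<Rightarrow>\<^sub>0 'r::field)"
proof -
  have "lin (\<lambda>k. Poly_Mapping.single (retag Y1 k) 1) (bil (lact Y12) a x)
    = bil (lact Y1) (lin (\<lambda>k. Poly_Mapping.single k 1) a) (lin (\<lambda>k. Poly_Mapping.single (retag Y1 k) 1) x)"
  proof (rule lin_bil)
    fix p :: "'c chain" and k assume "k \<in> Poly_Mapping.keys x"
    then have km: "k \<in> R12.marks m" using assms by (auto simp: span_def)
    obtain v cs w b u ps u' where k: "k = ((v, cs, w), b)" "p = (u, ps, u')" by (cases k, cases p) auto
    have b: "b \<le> length cs" using R12.marks_length[of "(v, cs, w)" b m] km k by simp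
    have P: "cubes Y12 \<subseteq> cubes Y1" using cubes_inter by blast
    have "strip (cubes Y12) (ps @ take b cs) - length ps \<le> b"
      using strip_le[of "cubes Y12" "ps @ take b cs"] b by simp
    then have "take (strip (cubes Y12) (ps @ take b cs)) (ps @ cs) = take (strip (cubes Y12) (ps @ take b cs)) (ps @ take b cs)"
      by (simp add: min_absorb1)
    \<comment> \<open>Acting first or absorbing first, both orders end in stripping the list
      \<open>ps @ take b cs\<close>.\<close>
    then have 1: "strip (cubes Y1) (take (strip (cubes Y12) (ps @ take b cs)) (ps @ cs)) = strip (cubes Y1) (ps @ take b cs)"
      using strip_strip[OF P, of "[]" "ps @ take b cs"] by simp
    have "strip (cubes Y1) (take b cs) \<le> b" using strip_le[of "cubes Y1" "take b cs"] b by simp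
    then have "take (strip (cubes Y1) (take b cs)) cs = take (strip (cubes Y1) (take b cs)) (take b cs)"
      by (simp add: min_absorb1)
    then have 2: "strip (cubes Y1) (ps @ take (strip (cubes Y1) (take b cs)) cs) = strip (cubes Y1) (ps @ take b cs)"
      using strip_strip[OF order_refl, of "cubes Y1" ps "take b cs"] by simp
    show "lin (\<lambda>k. Poly_Mapping.single (retag Y1 k) 1) (lact Y12 p k)
      = bil (lact Y1) (Poly_Mapping.single p 1) (Poly_Mapping.single (retag Y1 k) (1::'r))"
      using 1 2 by (auto simp: k)
  qed
  then show ?thesis by (simp add: incl_def lin_single_id)
qed

lemma incl_ract:
  assumes "x \<in> span (R12.marks m)"
  shows "incl Y1 (bil ract x a) = bil ract (incl Y1 x :: _ \<Rightarrow>\<^sub>0 'r::field) a"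
proof -
  have "lin (\<lambda>k. Poly_Mapping.single (retag Y1 k) 1) (bil ract x a)
    = bil ract (lin (\<lambda>k. Poly_Mapping.single (retag Y1 k) 1) x) (lin (\<lambda>k. Poly_Mapping.single k 1) a)"
  proof (rule lin_bil)
    fix k and p :: "'c chain" assume "k \<in> Poly_Mapping.keys x"
    then have km: "k \<in> R12.marks m" using assms by (auto simp: span_def)
    obtain v cs w b u ps u' where k: "k = ((v, cs, w), b)" "p = (u, ps, u')" by (cases k, cases p) auto
    have "b \<le> length cs" using R12.marks_length[of "(v, cs, w)" b m] km k by simp
    then show "lin (\<lambda>k. Poly_Mapping.single (retag Y1 k) 1) (ract k p)
      = bil ract (Poly_Mapping.single (retag Y1 k) 1) (Poly_Mapping.single p (1::'r))"
      by (auto simp: k)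
  qed
  then show ?thesis by (simp add: incl_def lin_single_id)
qed

lemma forget_span: "y \<in> span (R1.marks m) \<Longrightarrow> forget y \<in> span (Ch X m)"
  unfolding forget_def by (erule lin_span) (intro span_single R1.marks_Ch)

lemma side1_unique: "side1 m d \<Longrightarrow> (d, a) \<in> R1.marks m \<Longrightarrow> (d, b) \<in> R1.marks m \<Longrightarrow> a = b"
  unfolding good_side_def by blast

lemma side1_ex: "side1 m d \<Longrightarrow> \<exists>k\<in>R1.marks m. fst k = d"
  unfolding good_side_def by force

lemma side1_inj:
  assumes "side1 m (fst k)" "k \<in> R12.marks m" "k' \<in> R12.marks m" "retag Y2 k' = retag Y2 k"
  shows "k' = k"
proof -
  obtain v cs w a where k: "k = ((v, cs, w), a)" by (cases k) auto
  have "fst k' = fst k" using arg_cong[OF assms(4), of fst] by simp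
  then obtain b where k': "k' = ((v, cs, w), b)" using k by (cases k') auto
  have "inj_on (\<lambda>a. strip (cubes Y2) (take a cs)) {a. ((v, cs, w), a) \<in> R12.marks m}"
    using assms(1) by (simp add: k good_side_def bij_betw_def)
  then show ?thesis using assms(2-4) unfolding k k' by (auto dest: inj_onD)
qed

lemma side1_surj:
  assumes "side1 m (fst k)" "k \<in> R2.marks m"
  shows "\<exists>k'\<in>R12.marks m. retag Y2 k' = k"
proof -
  obtain v cs w a where k: "k = ((v, cs, w), a)" by (cases k) auto
  have "(\<lambda>a. strip (cubes Y2) (take a cs)) ` {a. ((v, cs, w), a) \<in> R12.marks m} = {a. ((v, cs, w), a) \<in> R2.marks m}"
    using assms(1) by (simp add: k good_side_def bij_betw_def)
  then obtain b where "((v, cs, w), b) \<in> R12.marks m" "a = strip (cubes Y2) (take b cs)"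
    using assms(2) k by blast
  then show ?thesis by (intro bexI[of _ "((v, cs, w), b)"]) (simp_all add: k)
qed

text \<open>The coefficient at a marking of a chain is recovered from the piece whose markings of
  that chain are in bijection with those for the intersection.\<close>

lemma incl_inj:
  assumes x: "x \<in> span (R12.marks m)" and "incl Y1 x = 0" "incl Y2 x = 0"
  shows "x = 0"
proof (rule poly_mapping_eqI)
  fix k
  show "Poly_Mapping.lookup x k = Poly_Mapping.lookup 0 k"
  proof (cases "k \<in> Poly_Mapping.keys x")
    case True
    have x': "k' \<in> R12.marks m" if "k' \<in> Poly_Mapping.keys x" for k' using that x by (auto simp: span_def)
    have "fst k \<in> Ch X m" by (rule R12.marks_Ch[OF x'[OF True]])
    from side[OF this] show ?thesis
    proof
      assume s: "side1 m (fst k)"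
      have "Poly_Mapping.lookup (incl Y2 x) (retag Y2 k) = Poly_Mapping.lookup x k"
        unfolding incl_def
        by (rule lookup_lin_single, rule side1_inj[OF s x'[OF True] x'])
      then show ?thesis using assms(3) by simp
    next
      assume s: "good_side X Y2 Y1 Y12 m (fst k)"
      have "Poly_Mapping.lookup (incl Y1 x) (retag Y1 k) = Poly_Mapping.lookup x k"
        unfolding incl_def
        by (rule lookup_lin_single, rule cover.side1_inj[OF cover_sym s x'[OF True] x'])
      then show ?thesis using assms(2) by simp
    qed
  qed (simp add: in_keys_iff)
qed

lemma forget_surj:
  assumes "z \<in> span (Ch X m)"
  shows "\<exists>y1\<in>span (R1.marks m). \<exists>y2\<in>span (R2.marks m). z = forget y1 + forget (y2 :: _ \<Rightarrow>\<^sub>0 'r::field)"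
  using assms
proof (induction z rule: span_induct)
  case zero
  then show ?case using add_subgroupD(1)[OF span_sub] by (intro bexI[of _ 0]) (auto simp: forget_def)
next
  case (single d r)
  have 0: "(0 :: 'c chain \<times> nat \<Rightarrow>\<^sub>0 'r) \<in> span S" for S
    by (rule add_subgroupD(1)[OF span_sub])
  from side[OF single] show ?case
  proof
    assume "side1 m d"
    then obtain k where "k \<in> R1.marks m" "fst k = d" using side1_ex by blast
    then show ?thesis using 0
      by (intro bexI[of _ "Poly_Mapping.single k r"] bexI[of _ 0]) (auto simp: forget_def span_single)
  next
    assume "good_side X Y2 Y1 Y12 m d"
    then obtain k where "k \<in> R2.marks m" "fst k = d" using cover.side1_ex[OF cover_sym] by blast
    then show ?thesis using 0
      by (intro bexI[of _ 0] bexI[of _ "Poly_Mapping.single k r"]) (auto simp: forget_def span_single)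
  qed
next
  case (add f g)
  then obtain y1 y2 y1' y2' where y: "y1 \<in> span (R1.marks m)" "y2 \<in> span (R2.marks m)" "f = forget y1 + forget y2"
    "y1' \<in> span (R1.marks m)" "y2' \<in> span (R2.marks m)" "g = forget y1' + forget y2'" by blast
  then show ?case
    by (intro bexI[of _ "y1 + y1'"] bexI[of _ "y2 + y2'"])
      (auto simp: forget_def lin_add algebra_simps intro: add_subgroupD(2)[OF span_sub])
qed

text \<open>Together \<open>M1\<close> and \<open>M2\<close> contain exactly one marking of each
  chain of \<open>X\<close>: the one for a piece in which it is unique, with preference for the
  first piece.\<close>

definition M1 :: "nat \<Rightarrow> ('c chain \<times> nat) set" where
  "M1 m = {k \<in> R1.marks m. side1 m (fst k)}"

definition M2 :: "nat \<Rightarrow> ('c chain \<times> nat) set" where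
  "M2 m = {k \<in> R2.marks m. \<not> side1 m (fst k)}"

lemma M2_side: "k \<in> M2 m \<Longrightarrow> good_side X Y2 Y1 Y12 m (fst k)"
  using side[OF R2.marks_Ch[of k m]] by (auto simp: M2_def)

text \<open>Modulo the image of the intersection, every pair is supported in \<open>M1 \<times> M2\<close>, where
  \<^const>\<open>forget\<close> is injective.\<close>

lemma reduce1:
  assumes "y \<in> span (R1.marks m)"
  shows "\<exists>x\<in>span (R12.marks m). \<exists>n1\<in>span (M1 m). \<exists>n2\<in>span (M2 m).
    y = incl Y1 x + n1 \<and> 0 = - incl Y2 x + (n2 :: _ \<Rightarrow>\<^sub>0 'r::field)"
  using assms
proof (induction y rule: span_induct)
  case zero
  show ?case using add_subgroupD(1)[OF span_sub]
    by (intro bexI[of _ 0]) (auto simp: incl_def)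
next
  case (single k r)
  have 0: "(0 :: 'c chain \<times> nat \<Rightarrow>\<^sub>0 'r) \<in> span S" for S
    by (rule add_subgroupD(1)[OF span_sub])
  show ?case
  proof (cases "side1 m (fst k)")
    case True
    then show ?thesis using 0 single
      by (intro bexI[of _ 0] bexI[of _ "Poly_Mapping.single k r"])
        (auto simp: incl_def M1_def intro!: span_single)
  next
    case False
    then have "good_side X Y2 Y1 Y12 m (fst k)" using side[OF R1.marks_Ch[OF single]] by blast
    then obtain k' where k': "k' \<in> R12.marks m" "retag Y1 k' = k"
      using cover.side1_surj[OF cover_sym _ single] by blast
    have "fst (retag Y2 k') = fst k" using k'(2) by (metis fst_retag)
    then have "retag Y2 k' \<in> M2 m"
      using cover.marks_retag[OF cover_sym k'(1)] False by (simp add: M2_def)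
    then show ?thesis using 0 k'
      by (intro bexI[of _ "Poly_Mapping.single k' r"] bexI[of _ 0] bexI[of _ "Poly_Mapping.single (retag Y2 k') r"])
        (auto simp: incl_def intro!: span_single)
  qed
next
  case (add f g)
  then obtain x n1 n2 x' n1' n2' where x: "x \<in> span (R12.marks m)" "n1 \<in> span (M1 m)" "n2 \<in> span (M2 m)"
    "f = incl Y1 x + n1" "0 = - incl Y2 x + n2" "x' \<in> span (R12.marks m)" "n1' \<in> span (M1 m)" "n2' \<in> span (M2 m)"
    "g = incl Y1 x' + n1'" "0 = - incl Y2 x' + n2'" by blast
  have "f + g = incl Y1 (x + x') + (n1 + n1')"
    by (simp add: x(4,9) incl_def lin_add algebra_simps)
  moreover have "0 = - incl Y2 (x + x') + (n2 + n2')"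
    using x(5,10) by (simp add: incl_def lin_add algebra_simps)
  ultimately show ?case using x add_subgroupD(2)[OF span_sub] by blast
qed

lemma reduce2:
  assumes "y \<in> span (R2.marks m)"
  shows "\<exists>x\<in>span (R12.marks m). \<exists>n1\<in>span (M1 m). \<exists>n2\<in>span (M2 m).
    0 = incl Y1 x + n1 \<and> y = - incl Y2 x + (n2 :: _ \<Rightarrow>\<^sub>0 'r::field)"
  using assms
proof (induction y rule: span_induct)
  case zero
  show ?case using add_subgroupD(1)[OF span_sub]
    by (intro bexI[of _ 0]) (auto simp: incl_def)
next
  case (single k r)
  have 0: "(0 :: 'c chain \<times> nat \<Rightarrow>\<^sub>0 'r) \<in> span S" for S
    by (rule add_subgroupD(1)[OF span_sub])
  show ?case
  proof (cases "side1 m (fst k)")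
    case False
    then show ?thesis using 0 single
      by (intro bexI[of _ 0] bexI[of _ "Poly_Mapping.single k r"])
        (auto simp: incl_def M2_def intro!: span_single)
  next
    case True
    then obtain k' where k': "k' \<in> R12.marks m" "retag Y2 k' = k"
      using side1_surj[OF _ single] by blast
    have "fst (retag Y1 k') = fst k" using k'(2) by (metis fst_retag)
    then have "retag Y1 k' \<in> M1 m"
      using marks_retag[OF k'(1)] True by (simp add: M1_def)
    then have n1: "Poly_Mapping.single (retag Y1 k') r \<in> span (M1 m)" by (rule span_single)
    \<comment> \<open>The coefficient is \<open>- r\<close> because the second component of the
      inclusion carries a minus sign.\<close>
    have x: "Poly_Mapping.single k' (- r) \<in> span (R12.marks m)" using k'(1) by (rule span_single)
    have "0 = incl Y1 (Poly_Mapping.single k' (- r)) + Poly_Mapping.single (retag Y1 k') r"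
      "Poly_Mapping.single k r = - incl Y2 (Poly_Mapping.single k' (- r)) + 0"
      by (simp_all add: incl_def k'(2) single_uminus lin_minus)
    then show ?thesis using x n1 0 by blast
  qed
next
  case (add f g)
  then obtain x n1 n2 x' n1' n2' where x: "x \<in> span (R12.marks m)" "n1 \<in> span (M1 m)" "n2 \<in> span (M2 m)"
    "0 = incl Y1 x + n1" "f = - incl Y2 x + n2" "x' \<in> span (R12.marks m)" "n1' \<in> span (M1 m)" "n2' \<in> span (M2 m)"
    "0 = incl Y1 x' + n1'" "g = - incl Y2 x' + n2'" by blast
  have "f + g = - incl Y2 (x + x') + (n2 + n2')"
    by (simp add: x(5,10) incl_def lin_add algebra_simps)
  moreover have "incl Y1 (x + x') + (n1 + n1') = (incl Y1 x + n1) + (incl Y1 x' + n1')"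
    by (simp add: incl_def lin_add algebra_simps)
  then have "0 = incl Y1 (x + x') + (n1 + n1')"
    unfolding x(4)[symmetric] x(9)[symmetric] by simp
  ultimately show ?case using x add_subgroupD(2)[OF span_sub] by blast
qed

text \<open>Markings in \<open>M1\<close> and \<open>M2\<close> lie over different chains, and over
  each chain there is only one, so nothing can cancel.\<close>

lemma forget_reduced:
  assumes n: "n1 \<in> span (M1 m)" "n2 \<in> span (M2 m)" and 0: "forget n1 + forget n2 = 0"
  shows "n1 = 0 \<and> n2 = 0"
proof -
  have k1: "k \<in> M1 m" if "k \<in> Poly_Mapping.keys n1" for k using that n(1) by (auto simp: span_def)
  have k2: "k \<in> M2 m" if "k \<in> Poly_Mapping.keys n2" for k using that n(2) by (auto simp: span_def)
  have sum0: "Poly_Mapping.lookup (forget n1) d + Poly_Mapping.lookup (forget n2) d = 0" for d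
    using arg_cong[OF 0, of "\<lambda>f. Poly_Mapping.lookup f d"] by (simp add: lookup_add)
  have "Poly_Mapping.lookup n1 k = 0" for k
  proof (cases "k \<in> Poly_Mapping.keys n1")
    case True
    have "Poly_Mapping.lookup (forget n1) (fst k) = Poly_Mapping.lookup n1 k"
      unfolding forget_def
    proof (rule lookup_lin_single)
      fix k' assume "k' \<in> Poly_Mapping.keys n1" "fst k' = fst k"
      then show "k' = k" using k1[OF True] k1[of k'] side1_unique[of m "fst k" "snd k'" "snd k"]
        by (cases k, cases k') (auto simp: M1_def)
    qed
    moreover have "Poly_Mapping.lookup (forget n2) (fst k) = 0"
      unfolding forget_def
      by (rule lookup_lin_single_notin) (use k1[OF True] k2 in \<open>auto simp: M1_def M2_def\<close>)
    ultimately show ?thesis using sum0[of "fst k"] by simp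
  qed (simp add: in_keys_iff)
  moreover have "Poly_Mapping.lookup n2 k = 0" for k
  proof (cases "k \<in> Poly_Mapping.keys n2")
    case True
    have "Poly_Mapping.lookup (forget n2) (fst k) = Poly_Mapping.lookup n2 k"
      unfolding forget_def
    proof (rule lookup_lin_single)
      fix k' assume "k' \<in> Poly_Mapping.keys n2" "fst k' = fst k"
      then show "k' = k" using k2[OF True] k2[of k'] M2_side[OF k2[OF True]]
          cover.side1_unique[OF cover_sym, of m "fst k" "snd k'" "snd k"]
        by (cases k, cases k') (auto simp: M2_def)
    qed
    moreover have "Poly_Mapping.lookup (forget n1) (fst k) = 0"
      unfolding forget_def
      by (rule lookup_lin_single_notin) (use k2[OF True] k1 in \<open>auto simp: M1_def M2_def\<close>)
    ultimately show ?thesis using sum0[of "fst k"] by simp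
  qed (simp add: in_keys_iff)
  ultimately show ?thesis by (auto intro: poly_mapping_eqI)
qed

text \<open>The two components are reduced separately and the results added; the remainder has image
  zero and therefore vanishes.\<close>

lemma forget_exact:
  fixes y1 :: "'c chain \<times> nat \<Rightarrow>\<^sub>0 'r::field"
  assumes "y1 \<in> span (R1.marks m)" "y2 \<in> span (R2.marks m)" "forget y1 + forget y2 = 0"
  shows "\<exists>x\<in>span (R12.marks m). y1 = incl Y1 x \<and> y2 = - incl Y2 x"
proof -
  obtain x n1 n2 where x: "x \<in> span (R12.marks m)" "n1 \<in> span (M1 m)" "n2 \<in> span (M2 m)"
    "y1 = incl Y1 x + n1" "0 = - incl Y2 x + n2" using reduce1[OF assms(1)] by blast
  obtain x' n1' n2' where x': "x' \<in> span (R12.marks m)" "n1' \<in> span (M1 m)" "n2' \<in> span (M2 m)"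
    "0 = incl Y1 x' + n1'" "y2 = - incl Y2 x' + n2'" using reduce2[OF assms(2)] by blast
  have add: "incl Y (u + u') = incl Y u + incl Y u'" "forget (u + u') = forget u + forget u'" "forget (- u) = - forget u"
    for Y and u u' :: "'c chain \<times> nat \<Rightarrow>\<^sub>0 'r" by (simp_all add: incl_def forget_def lin_add lin_minus)
  have e: "y1 = incl Y1 (x + x') + (n1 + n1')" "y2 = - incl Y2 (x + x') + (n2 + n2')"
  proof -
    have "y1 = (incl Y1 x + n1) + (incl Y1 x' + n1')" using x(4) x'(4)[symmetric] by simp
    then show "y1 = incl Y1 (x + x') + (n1 + n1')" by (simp only: add(1) minus_add_distrib add_ac)
    have "y2 = (- incl Y2 x + n2) + (- incl Y2 x' + n2')" using x(5)[symmetric] x'(5) by simp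
    then show "y2 = - incl Y2 (x + x') + (n2 + n2')" by (simp only: add(1) minus_add_distrib add_ac)
  qed
  have "forget y1 + forget y2 = forget (n1 + n1') + forget (n2 + n2')"
    unfolding e by (simp only: add(2,3) forget_incl) simp
  then have "n1 + n1' = 0 \<and> n2 + n2' = 0"
    using assms(3) x x' by (intro forget_reduced) (auto intro: add_subgroupD(2)[OF span_sub])
  then show ?thesis using e x(1) x'(1) add_subgroupD(2)[OF span_sub] by (intro bexI[of _ "x + x'"]) auto
qed

text \<open>The sign in the first map makes the composition zero, since a marking for the
  intersection gives the same underlying chain in both pieces.\<close>

theorem short_exact_cover:
  "short_exact (path_algebra (R :: 'r::field itself) X)
    (\<lambda>n. span (R12.marks n)) (lin (mark_bd X)) (bil (lact Y12)) (bil ract) (\<lambda>n. extHM R X Y12 (Suc n)) (R12.ext_class R)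
    (\<lambda>n. span (R1.marks n) \<times> span (R2.marks n)) (\<lambda>(x, y). (lin (mark_bd X) x, lin (mark_bd X) y))
    (\<lambda>a (x, y). (bil (lact Y1) a x, bil (lact Y2) a y)) (\<lambda>(x, y) a. (bil ract x a, bil ract y a))
    (\<lambda>n. bimodule_sum (extHM R X Y1 (Suc n)) (extHM R X Y2 (Suc n))) (\<lambda>n (x, y). (R1.ext_class R n x, R2.ext_class R n y))
    (\<lambda>n. span (Ch X n)) (boundary X) path_mult path_mult (\<lambda>n. HM R X (Suc n)) (\<lambda>n. qt (R1.chains.B n))
    (\<lambda>x. (incl Y1 x, - incl Y2 x)) (\<lambda>(y1, y2). forget y1 + forget y2)"
proof (intro short_exact.intro short_exact_axioms.intro)
  show "presented_homology (path_algebra R X) (\<lambda>n. span (R12.marks n)) (lin (mark_bd X)) (bil (lact Y12)) (bil ract)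
      (\<lambda>n. extHM R X Y12 (Suc n)) (R12.ext_class R)"
    by (rule R12.presented_extHM)
  show "presented_homology (path_algebra R X) (\<lambda>n. span (R1.marks n) \<times> span (R2.marks n)) (\<lambda>(x, y). (lin (mark_bd X) x, lin (mark_bd X) y))
    (\<lambda>a (x, y). (bil (lact Y1) a x, bil (lact Y2) a y)) (\<lambda>(x, y) a. (bil ract x a, bil ract y a))
    (\<lambda>n. bimodule_sum (extHM R X Y1 (Suc n)) (extHM R X Y2 (Suc n))) (\<lambda>n (x, y). (R1.ext_class R n x, R2.ext_class R n y))"
    by (rule presented_sum[OF R1.presented_extHM R2.presented_extHM])
  show "presented_homology (path_algebra R X) (\<lambda>n. span (Ch X n)) (boundary X) path_mult path_mult
      (\<lambda>n. HM R X (Suc n)) (\<lambda>n. qt (R1.chains.B n))"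
    by (rule R1.presented_HM)
next
  fix x :: "'c chain \<times> nat \<Rightarrow>\<^sub>0 'r" and n assume x: "x \<in> span (R12.marks n)"
  show "(incl Y1 x, - incl Y2 x) \<in> span (R1.marks n) \<times> span (R2.marks n)"
    using incl_span[OF x] add_subgroupD(3)[OF span_sub cover.incl_span[OF cover_sym x]] by simp
  show "(incl Y1 (lin (mark_bd X) x), - incl Y2 (lin (mark_bd X) x))
      = (case (incl Y1 x, - incl Y2 x) of (x, y) \<Rightarrow> (lin (mark_bd X) x, lin (mark_bd X) y))"
    by (simp add: incl_mark_bd[OF x] cover.incl_mark_bd[OF cover_sym x] lin_minus)
  show "x = 0" if "(incl Y1 x, - incl Y2 x) = 0"
    using incl_inj[OF x] that by (simp add: zero_prod_def)
  show "(case (incl Y1 x, - incl Y2 x) of (y1, y2) \<Rightarrow> forget y1 + forget y2) = 0"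
  proof -
    have "forget (- incl Y2 x) = - forget (incl Y2 x)" by (simp add: forget_def lin_minus)
    then show ?thesis by (simp add: forget_incl)
  qed
  fix a :: "'c chain \<Rightarrow>\<^sub>0 'r"
  show "(incl Y1 (bil (lact Y12) a x), - incl Y2 (bil (lact Y12) a x))
      = (case (incl Y1 x, - incl Y2 x) of (x, y) \<Rightarrow> (bil (lact Y1) a x, bil (lact Y2) a y))"
    by (simp add: incl_lact[OF x] cover.incl_lact[OF cover_sym x] bil_minus_right)
  show "(incl Y1 (bil ract x a), - incl Y2 (bil ract x a))
      = (case (incl Y1 x, - incl Y2 x) of (x, y) \<Rightarrow> \<lambda>a. (bil ract x a, bil ract y a)) a"
    by (simp add: incl_ract[OF x] cover.incl_ract[OF cover_sym x] bil_minus_left)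
next
  fix y :: "('c chain \<times> nat \<Rightarrow>\<^sub>0 'r) \<times> ('c chain \<times> nat \<Rightarrow>\<^sub>0 'r)" and n
  assume y: "y \<in> span (R1.marks n) \<times> span (R2.marks n)"
  then show "(case y of (y1, y2) \<Rightarrow> forget y1 + forget y2) \<in> span (Ch X n)"
    by (auto intro: add_subgroupD(2)[OF span_sub] forget_span cover.forget_span[OF cover_sym])
  show "(case y of (y1, y2) \<Rightarrow> forget y1 + forget y2) = 0 \<Longrightarrow> \<exists>x\<in>span (R12.marks n). y = (incl Y1 x, - incl Y2 x)"
    using y forget_exact by (cases y) auto
  show "(case case y of (x, y) \<Rightarrow> (lin (mark_bd X) x, lin (mark_bd X) y) of (y1, y2) \<Rightarrow> forget y1 + forget y2)
      = boundary X (case y of (y1, y2) \<Rightarrow> forget y1 + forget y2)"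
    by (cases y) (simp add: forget_mark_bd boundary_eq lin_add)
  fix a :: "'c chain \<Rightarrow>\<^sub>0 'r"
  show "(case case y of (x, y) \<Rightarrow> (bil (lact Y1) a x, bil (lact Y2) a y) of (y1, y2) \<Rightarrow> forget y1 + forget y2)
      = path_mult a (case y of (y1, y2) \<Rightarrow> forget y1 + forget y2)"
    by (cases y) (simp add: forget_lact path_mult_bil bil_add_right)
  show "(case (case y of (x, y) \<Rightarrow> \<lambda>a. (bil ract x a, bil ract y a)) a of (y1, y2) \<Rightarrow> forget y1 + forget y2)
      = path_mult (case y of (y1, y2) \<Rightarrow> forget y1 + forget y2) a"
    by (cases y) (simp add: forget_ract path_mult_bil bil_add_left)
next
  fix z :: "'c chain \<Rightarrow>\<^sub>0 'r" and n assume "z \<in> span (Ch X n)"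
  from forget_surj[OF this] show "\<exists>y\<in>span (R1.marks n) \<times> span (R2.marks n). z = (case y of (y1, y2) \<Rightarrow> forget y1 + forget y2)"
    by force
qed (auto simp: incl_def forget_def lin_add plus_prod_def split: prod.splits)

end

section \<open>From relative pairs and good covers to factorizations of chains\<close>

lemma split_at_threshold:
  fixes cs :: "'z list"
  assumes ex: "\<exists>k<length cs. \<forall>l<length cs. (l > k \<longrightarrow> cs ! l \<notin> P) \<and> (l < k \<longrightarrow> cs ! l \<in> P)"
  shows "\<exists>s q. cs = s @ q \<and> set s \<subseteq> P \<and> set q \<inter> P = {}"
proof -
  obtain k where k: "k < length cs" "\<And>l. l < length cs \<Longrightarrow> l > k \<Longrightarrow> cs ! l \<notin> P" "\<And>l. l < length cs \<Longrightarrow> l < k \<Longrightarrow> cs ! l \<in> P"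
    using ex by blast
  \<comment> \<open>The condition leaves open on which side the entry at \<open>k\<close> lies, so
    the cut is placed before or after it.\<close>
  define n where "n = (if cs ! k \<in> P then Suc k else k)"
  have n1: "cs ! l \<in> P" if l: "l < n" "l < length cs" for l
  proof (cases "l < k")
    case True
    then show ?thesis using k(3) l(2) by blast
  next
    case False
    show ?thesis
    proof (cases "cs ! k \<in> P")
      case True
      then have "l = k" using l(1) False unfolding n_def by simp
      then show ?thesis using True by simp
    next
      case k': False
      then show ?thesis using l(1) False unfolding n_def by simp
    qed
  qed
  have n2: "cs ! l \<notin> P" if l: "n \<le> l" "l < length cs" for l
  proof (cases "k < l")
    case True
    then show ?thesis using k(2) l(2) by blast
  next
    case False
    show ?thesis
    proof (cases "cs ! k \<in> P")
      case True
      then show ?thesis using l(1) False unfolding n_def by simp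
    next
      case k': False
      then have "l = k" using l(1) False unfolding n_def by simp
      then show ?thesis using k' by simp
    qed
  qed
  have "set (take n cs) \<subseteq> P" "set (drop n cs) \<inter> P = {}"
    using n1 n2 by (auto simp: in_set_conv_nth)
  then show ?thesis by (intro exI[of _ "take n cs"] exI[of _ "drop n cs"]) simp
qed

lemma relative_pair_rel_cub:
  assumes "relative_pair X Y"
  shows "rel_cub Y X"
proof -
  note unf = assms[unfolded relative_pair_def]
  have X: "precubical X" "finite (cubes X)" and sub: "sub_precubical Y X"
    using conjunct1[OF unf] conjunct1[OF conjunct2[OF unf]] by (simp_all add: in_Cub_def)
  have "Pair 0 ` cells X 0 \<subseteq> cubes X" by (auto simp: mem_cubes)
  then have "finite (Pair (0 :: nat) ` cells X 0)" using X(2) by (rule finite_subset)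
  then have fin: "finite (cells X 0)" by (rule finite_imageD) (simp add: inj_on_def)
  have r: "(vertex X False (hd cs) \<in> cells Y 0 \<longrightarrow>
       (\<exists>k<length cs. \<forall>l<length cs. (l > k \<longrightarrow> cs ! l \<notin> cubes Y) \<and> (l < k \<longrightarrow> cs ! l \<in> cubes Y))) \<and>
     (vertex X True (last cs) \<in> cells Y 0 \<longrightarrow>
       (\<exists>k<length cs. \<forall>l<length cs. (l > k \<longrightarrow> cs ! l \<in> cubes Y) \<and> (l < k \<longrightarrow> cs ! l \<notin> cubes Y)))"
    if "(v, cs, w) \<in> Ch X 0" "cs \<noteq> []" for v cs w
    using bspec[OF conjunct2[OF conjunct2[OF unf]] that(1)] that(2) by (simp only: prod.case simp_thms)
  show ?thesis
  proof (intro rel_cub.intro sub_cub.intro fin_cub.intro rel_cub_axioms.intro X(1) sub fin)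
    fix v cs w assume d: "(v, cs, w) \<in> Ch X 0" "v \<in> cells Y 0"
    show "\<exists>s q. cs = s @ q \<and> set s \<subseteq> cubes Y \<and> set q \<inter> cubes Y = {}"
    proof (cases "cs = []")
      case False
      then have "vertex X False (hd cs) = v" using d(1) by (auto simp: Ch_iff cube_chain_def)
      then show ?thesis using r[OF d(1) False] d(2) by (intro split_at_threshold) simp
    qed simp
  next
    fix v cs w assume d: "(v, cs, w) \<in> Ch X 0" "w \<in> cells Y 0"
    show "\<exists>q s. cs = q @ s \<and> set q \<inter> cubes Y = {} \<and> set s \<subseteq> cubes Y"
    proof (cases "cs = []")
      case False
      then have "vertex X True (last cs) = w" using d(1) by (auto simp: Ch_iff cube_chain_def)
      \<comment> \<open>Passing to the complement of the cubes of \<open>Y\<close> turns the second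
        condition into the form of the first.\<close>
      then have "\<exists>s q. cs = s @ q \<and> set s \<subseteq> - cubes Y \<and> set q \<inter> - cubes Y = {}"
        using r[OF d(1) False] d(2) by (intro split_at_threshold) simp
      then obtain q s where "cs = q @ s" "set q \<subseteq> - cubes Y" "set s \<inter> - cubes Y = {}" by blast
      then have "cs = q @ s \<and> set q \<inter> cubes Y = {} \<and> set s \<subseteq> cubes Y" by blast
      then show ?thesis by blast
    qed simp
  qed
qed

context rel_cover
begin

lemma cells_X12: "cells (precubical_inter Y1 Y2) n = cells Y1 n \<inter> cells Y2 n"
  by (simp add: precubical_inter_def)

lemma sub_precubical_inter: "sub_precubical (precubical_inter Y1 Y2) X"
proof -
  have f: "face Y1 \<epsilon> n i c = face X \<epsilon> n i c" if "c \<in> cells Y1 n" "i < n" for \<epsilon> n i c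
    using R1.sub that by (simp add: sub_precubical_def)
  have f2: "face Y2 \<epsilon> n i c = face X \<epsilon> n i c" if "c \<in> cells Y2 n" "i < n" for \<epsilon> n i c
    using R2.sub that by (simp add: sub_precubical_def)
  have "precubical (precubical_inter Y1 Y2)"
    unfolding precubical_def
  proof (intro conjI allI impI)
    fix \<epsilon> n i c assume "i < n \<and> c \<in> cells (precubical_inter Y1 Y2) n"
    then have c: "i < n" "c \<in> cells Y1 n" "c \<in> cells Y2 n" by (simp_all add: cells_X12)
    have "face Y1 \<epsilon> n i c \<in> cells Y2 (n - 1)"
      using face_cells[OF R2.Y c(1,3), of \<epsilon>] f[OF c(2,1)] f2[OF c(3,1)] by simp
    then show "face (precubical_inter Y1 Y2) \<epsilon> n i c \<in> cells (precubical_inter Y1 Y2) (n - 1)"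
      using face_cells[OF R1.Y c(1,2), of \<epsilon>] by (simp add: precubical_inter_def)
  next
    fix k l n i j c assume "i < j \<and> j < n \<and> c \<in> cells (precubical_inter Y1 Y2) n"
    then have "i < j" "j < n" "c \<in> cells Y1 n" by (simp_all add: cells_X12)
    from face_face[OF R1.Y this, of k l]
    show "face (precubical_inter Y1 Y2) k (n - 1) i (face (precubical_inter Y1 Y2) l n j c)
      = face (precubical_inter Y1 Y2) l (n - 1) (j - 1) (face (precubical_inter Y1 Y2) k n i c)"
      by (simp add: precubical_inter_def)
  qed
  then show ?thesis
    unfolding sub_precubical_def using R1.cells_sub f by (auto simp: precubical_inter_def)
qed

text \<open>When the path lies in one piece, its factorization for the other piece is also one for
  the intersection.\<close>

lemma rel_cub_inter: "rel_cub (precubical_inter Y1 Y2) X"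
proof (intro rel_cub.intro sub_cub.intro rel_cub_axioms.intro R1.X sub_precubical_inter R1.fin_cub_axioms)
  have cubes: "cubes (precubical_inter Y1 Y2) = cubes Y1 \<inter> cubes Y2"
    by (auto simp: mem_cubes cells_X12)
  {
    fix v cs w assume d: "(v, cs, w) \<in> Ch X 0" "v \<in> cells (precubical_inter Y1 Y2) 0"
    then have v: "v \<in> cells Y1 0" "v \<in> cells Y2 0" by (simp_all add: cells_X12)
    obtain s q where 1: "cs = s @ q" "set s \<subseteq> cubes Y1" "set q \<inter> cubes Y1 = {}" using R1.rel_start[OF d(1) v(1)] by blast
    obtain s' q' where 2: "cs = s' @ q'" "set s' \<subseteq> cubes Y2" "set q' \<inter> cubes Y2 = {}" using R2.rel_start[OF d(1) v(2)] by blast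
    show "\<exists>s q. cs = s @ q \<and> set s \<subseteq> cubes (precubical_inter Y1 Y2) \<and> set q \<inter> cubes (precubical_inter Y1 Y2) = {}"
      using path_in_one_start[OF d(1) v]
    proof
      assume "set cs \<subseteq> cubes Y1"
      then show ?thesis using 2 unfolding cubes by (intro exI[of _ s'] exI[of _ q']) auto
    next
      assume "set cs \<subseteq> cubes Y2"
      then show ?thesis using 1 unfolding cubes by (intro exI[of _ s] exI[of _ q]) auto
    qed
  next
    fix v cs w assume d: "(v, cs, w) \<in> Ch X 0" "w \<in> cells (precubical_inter Y1 Y2) 0"
    then have w: "w \<in> cells Y1 0" "w \<in> cells Y2 0" by (simp_all add: cells_X12)
    obtain s q where 1: "cs = q @ s" "set q \<inter> cubes Y1 = {}" "set s \<subseteq> cubes Y1" using R1.rel_end[OF d(1) w(1)] by blast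
    obtain s' q' where 2: "cs = q' @ s'" "set q' \<inter> cubes Y2 = {}" "set s' \<subseteq> cubes Y2" using R2.rel_end[OF d(1) w(2)] by blast
    show "\<exists>q s. cs = q @ s \<and> set q \<inter> cubes (precubical_inter Y1 Y2) = {} \<and> set s \<subseteq> cubes (precubical_inter Y1 Y2)"
      using path_in_one_end[OF d(1) w]
    proof
      assume "set cs \<subseteq> cubes Y1"
      then show ?thesis using 2 unfolding cubes by (intro exI[of _ q'] exI[of _ s']) auto
    next
      assume "set cs \<subseteq> cubes Y2"
      then show ?thesis using 1 unfolding cubes by (intro exI[of _ q] exI[of _ s]) auto
    qed
  }
qed

end

text \<open>The positions strictly between \<open>l\<close> and \<open>m\<close>, counted from
  \<open>1\<close>, form the window from \<open>l\<close> up to but excluding \<open>m - 1\<close>,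
  counted from \<open>0\<close>.\<close>

lemma good_cover_core:
  assumes g: "good_cover X Y1 Y2" and R: "rel_cub Y1 X" "rel_cub Y2 X"
    and d: "(v, cs, w) \<in> Ch X m" "0 < m"
  shows "\<exists>i j. rel_cub.core Y1 cs i j \<or> rel_cub.core Y2 cs i j"
proof -
  have "\<exists>l m. l < m \<and> m \<le> length cs + 1 \<and>
      (\<forall>j. (1 \<le> j \<and> j \<le> l) \<or> (m \<le> j \<and> j \<le> length cs) \<longrightarrow> fst (cs ! (j - 1)) = 1) \<and>
      ((\<forall>j. l < j \<and> j < m \<longrightarrow> cs ! (j - 1) \<in> cubes Y1) \<or> (\<forall>j. l < j \<and> j < m \<longrightarrow> cs ! (j - 1) \<in> cubes Y2))"
    using bspec[OF spec[OF conjunct2[OF conjunct2[OF conjunct2[OF g[unfolded good_cover_def]]]], of m] d(1)]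
    by (simp only: prod.case)
  then obtain l n where ln: "l < n" "n \<le> length cs + 1"
    and edge: "\<And>j. (1 \<le> j \<and> j \<le> l) \<or> (n \<le> j \<and> j \<le> length cs) \<Longrightarrow> fst (cs ! (j - 1)) = 1"
    and or: "(\<forall>j. l < j \<and> j < n \<longrightarrow> cs ! (j - 1) \<in> cubes Y1) \<or> (\<forall>j. l < j \<and> j < n \<longrightarrow> cs ! (j - 1) \<in> cubes Y2)"
    by blast
  have e: "fst (cs ! k) = 1" if "k < length cs" "\<not> (l \<le> k \<and> k < n - 1)" for k
  proof -
    have "(1 \<le> Suc k \<and> Suc k \<le> l) \<or> (n \<le> Suc k \<and> Suc k \<le> length cs)" using that by linarith
    from edge[OF this] show ?thesis by simp
  qed
  \<comment> \<open>An empty window would leave only edges, contradicting the positive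
    dimension.\<close>
  have "l < n - 1"
  proof (rule ccontr)
    assume "\<not> l < n - 1"
    then have "fst (cs ! k) = 1" if "k < length cs" for k by (intro e that) linarith
    then have "\<forall>c\<in>set cs. fst c = 1" by (metis in_set_conv_nth)
    then show False using d Ch_0_iff[of v cs w X] by (auto simp: Ch_iff)
  qed
  then have ij: "l < n - 1" "n - 1 \<le> length cs" using ln(2) by simp_all
  have m: "cs ! k \<in> cubes Y" if "\<forall>j. l < j \<and> j < n \<longrightarrow> cs ! (j - 1) \<in> cubes Y" "l \<le> k \<and> k < n - 1" for k Y
  proof -
    have "l < Suc k \<and> Suc k < n" using that(2) by linarith
    with spec[OF that(1), of "Suc k"] show ?thesis by simp
  qed
  have c: "l < n - 1 \<and> n - 1 \<le> length cs \<and>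
      (\<forall>k<length cs. if l \<le> k \<and> k < n - 1 then cs ! k \<in> cubes Y else fst (cs ! k) = 1)"
    if "\<forall>j. l < j \<and> j < n \<longrightarrow> cs ! (j - 1) \<in> cubes Y" for Y
    using m[OF that] ij e by simp
  from or have "rel_cub.core Y1 cs l (n - 1) \<or> rel_cub.core Y2 cs l (n - 1)"
    unfolding rel_cub.core_def[OF R(1)] rel_cub.core_def[OF R(2)]
    by (elim disj_forward) (rule c, assumption)+
  then show ?thesis by blast
qed

theorem theorem8p25:
  fixes X X1 X2 :: "'c precubical"
    and R :: "'r::field itself"
  assumes "in_Cub X"
    and "sub_precubical X1 X" and "sub_precubical X2 X"
    and "good_cover X X1 X2"
    and "relative_pair X X1" and "relative_pair X X2"
  defines "A \<equiv> path_algebra R X"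
    and "E12 \<equiv> extHM R X (precubical_inter X1 X2)"
    and "E \<equiv> \<lambda>i. bimodule_sum (extHM R X X1 i) (extHM R X X2 i)"
    and "H \<equiv> HM R X"
  shows "\<exists>\<phi> \<psi> \<delta>.
    (\<forall>i\<ge>1. bimodule_exact A A (E12 i) (\<phi> i) (E i) (\<psi> i) (H i)) \<and>
    (\<forall>i\<ge>1. bimodule_exact A A (E (i + 1)) (\<psi> (i + 1)) (H (i + 1)) (\<delta> i) (E12 i)) \<and>
    (\<forall>i\<ge>1. bimodule_exact A A (H (i + 1)) (\<delta> i) (E12 i) (\<phi> i) (E i)) \<and>
    \<psi> 1 ` carrier (E 1) = carrier (H 1)"
proof -
  have R: "rel_cub X1 X" "rel_cub X2 X"
    using assms(5,6) by (simp_all add: relative_pair_rel_cub)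
  have union: "cells X n = cells X1 n \<union> cells X2 n" for n
    using assms(4) unfolding good_cover_def by blast
  interpret C: rel_cover X X1 X2
    by (intro rel_cover.intro rel_cover_axioms.intro R union)
  interpret C: cover X X1 X2 "precubical_inter X1 X2"
  proof (intro cover.intro cover_axioms.intro C.rel_cover_axioms C.rel_cub_inter C.cells_X12)
    show "\<exists>i j. rel_cub.core X1 cs i j \<or> rel_cub.core X2 cs i j" if "(v, cs, w) \<in> Ch X m" "0 < m" for v cs w m
      by (rule good_cover_core[OF assms(4) R that])
  qed
  have "\<exists>\<phi> \<psi> \<delta>. (\<forall>n. bimodule_exact A A (E12 (Suc n)) (\<phi> n) (E (Suc n)) (\<psi> n) (H (Suc n))) \<and>
    (\<forall>n. bimodule_exact A A (E (Suc (Suc n))) (\<psi> (Suc n)) (H (Suc (Suc n))) (\<delta> n) (E12 (Suc n))) \<and>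
    (\<forall>n. bimodule_exact A A (H (Suc (Suc n))) (\<delta> n) (E12 (Suc n)) (\<phi> n) (E (Suc n))) \<and>
    \<psi> 0 ` carrier (E (Suc 0)) = carrier (H (Suc 0))"
    unfolding A_def E12_def E_def H_def
    by (rule short_exact.long_exact_sequence[OF C.short_exact_cover[of R]])
  then obtain \<phi> \<psi> \<delta> where les: "(\<forall>n. bimodule_exact A A (E12 (Suc n)) (\<phi> n) (E (Suc n)) (\<psi> n) (H (Suc n))) \<and>
    (\<forall>n. bimodule_exact A A (E (Suc (Suc n))) (\<psi> (Suc n)) (H (Suc (Suc n))) (\<delta> n) (E12 (Suc n))) \<and>
    (\<forall>n. bimodule_exact A A (H (Suc (Suc n))) (\<delta> n) (E12 (Suc n)) (\<phi> n) (E (Suc n))) \<and>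
    \<psi> 0 ` carrier (E (Suc 0)) = carrier (H (Suc 0))"
    by (elim exE) (rule that)
  show ?thesis
  \<comment> \<open>The sequence was obtained with degrees from \<open>0\<close>; index
    \<open>i\<close> of the statement is degree \<open>i - 1\<close>.\<close>
  proof (intro exI[of _ "\<lambda>i. \<phi> (i - 1)"] exI[of _ "\<lambda>i. \<psi> (i - 1)"] exI[of _ "\<lambda>i. \<delta> (i - 1)"] conjI allI impI)
    fix i :: nat assume "1 \<le> i"
    then obtain n where i: "i = Suc n" by (cases i) auto
    show "bimodule_exact A A (E12 i) (\<phi> (i - 1)) (E i) (\<psi> (i - 1)) (H i)"
      "bimodule_exact A A (E (i + 1)) (\<psi> (i + 1 - 1)) (H (i + 1)) (\<delta> (i - 1)) (E12 i)"
      "bimodule_exact A A (H (i + 1)) (\<delta> (i - 1)) (E12 i) (\<phi> (i - 1)) (E i)"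
      using les by (simp_all add: i)
  next
    show "\<psi> (1 - 1) ` carrier (E 1) = carrier (H 1)" using les by simp
  qed
qed

end
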